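(* Let $n\ge3$, let $0<\xi_1<\pi$ and $\xi_2=\pi$, and let $(d,M)=(d(\xi_1,\pi),M(\xi_1,\pi))$ be the pair corresponding to $(\xi_1,\pi)$. Let $\Phi$ be a non-decreasing convex function on $\mathbb{R}$. If $p\in\mathcal{F}_d^M$, then for every $0<r<\infty$, $$\int_{\mathbb{S}^{n-1}}\Phi(p(ry))\,d\mathcal{H}^{n-1}y\ \le\ \int_{\mathbb{S}^{n-1}}\Phi(P(ry,d,\infty))\,d\mathcal{H}^{n-1}y .$$
   Context: Points of $\mathbb{R}^n$ are written $x=(x_1,\dots,x_n)$; $\mathbb{S}^{n-1}=\{|x|=1\}$, $\bar B(0,1)=\{|x|\le1\}$, and $\mathcal{H}^{n-1}$ is Hausdorff $(n-1)$-measure. $\mathcal{F}$ is the family of potentials $p(x)=\int_{\mathbb{S}^{n-1}}|x-y|^{2-n}\,d\mu(y)$, $x\in\mathbb{R}^n$, where $\mu$ is a positive Borel measure on $\mathbb{S}^{n-1}$ with $\mu(\mathbb{S}^{n-1})=1$ (values $+\infty$ are allowed). For $n\ge 3$ there is a one-to-one map $(\xi_1,\xi_2)\mapsto(d,M)$ from $\{0\le\xi_1<\xi_2\le\pi\}$ into $\{2^{2-n}\le d<1<M\le\infty\}$ for which there exists a potential $P(\cdot,d,M)\in\mathcal{F}$ with: (a) $P(\cdot,d,M)\equiv M$ on $E_1=\{x\in\mathbb{S}^{n-1}:\cos\xi_1\le x_1\le1\}$; (b) $P(\cdot,d,M)\equiv d$ on $E_2=\{x\in\mathbb{S}^{n-1}:-1\le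 x_1\le\cos\xi_2\}$; (c) $P(\cdot,d,M)\ge d$ in $\bar B(0,1)$ and $P(\cdot,d,M)\le M$ in $\mathbb{R}^n$; (d) $P(0,d,M)=1$ and $P(\cdot,d,M)$ is harmonic in $\mathbb{R}^n\setminus(E_1\cup E_2)$. The pair corresponding to $(\xi_1,\xi_2)$ is its image under this map. For such $d,M$, $\mathcal{F}_d^M=\{p\in\mathcal{F}: d\le p \text{ in } \bar B(0,1) \text{ and } p\le M \text{ in } \mathbb{R}^n\}$. $P(\cdot,d,\infty)$ denotes the potential satisfying (a)–(d) for the same value of $d$, with $M=\infty$ and $\xi_1$ replaced by $0$ (so that $E_1=\{e_1\}$, $e_1=(1,0,\dots,0)$) and $\xi_2$ replaced by a suitable $\xi_2'\in(0,\pi]$; it is known that for every $2^{2-n}\le d<1$ such a $\xi_2'$ and such a potential exist. *)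

theory Defs
  imports "HOL-Analysis.Analysis"
begin

text \<open>
  Points of n-space are vectors of type \<open>real^'n\<close> with n = \<open>CARD('n)\<close>; a distinguished index
  \<open>k :: 'n\<close> plays the role of the first coordinate.
\<close>

subsection \<open>Hausdorff measure\<close>

text \<open>
  The size-\<open>\<delta>\<close> approximation of m-dimensional Hausdorff measure (m at least 1), with the usual
  normalisation by the volume of the m-dimensional unit ball. Boundedness of the covering sets is
  required because \<^const>\<open>diameter\<close> is unspecified on unbounded sets.
\<close>

definition hausdorff_pre :: "nat \<Rightarrow> real \<Rightarrow> 'a::metric_space set \<Rightarrow> ennreal" where
  "hausdorff_pre m \<delta> A =
     (INF U \<in> {U :: nat \<Rightarrow> 'a set. A \<subseteq> (\<Union>i. U i) \<and> (\<forall>i. bounded (U i) \<and> diameter (U i) \<le> \<delta>)}.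
        \<Sum>i. ennreal (unit_ball_vol (real m) * (diameter (U i) / 2) ^ m))"

definition hausdorff_outer :: "nat \<Rightarrow> 'a::metric_space set \<Rightarrow> ennreal" where
  "hausdorff_outer m A = (SUP \<delta> \<in> {0<..}. hausdorff_pre m \<delta> A)"

text \<open>
  \<^const>\<open>hausdorff_outer\<close> is a metric outer measure, hence countably additive on the Borel sets,
  so \<^const>\<open>measure_of\<close> does not fall back to the null measure here.
\<close>

definition hausdorff_measure :: "nat \<Rightarrow> 'a::metric_space measure" where
  "hausdorff_measure m = measure_of UNIV (sets borel) (hausdorff_outer m)"

definition sphere_measure :: "(real^'n) measure" where
  "sphere_measure = restrict_space (hausdorff_measure (CARD('n) - 1)) (sphere 0 1)"

subsection \<open>Potentials\<close>

text \<open>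
  The kernel \<open>|x - y|\<^sup>2\<^sup>-\<^sup>n\<close> for n at least 3; since \<open>inverse 0 = \<infinity>\<close> in \<^typ>\<open>ennreal\<close>, it takes the
  value \<open>\<infinity>\<close> on the diagonal.
\<close>

definition riesz_kernel :: "real^'n \<Rightarrow> real^'n \<Rightarrow> ennreal" where
  "riesz_kernel x y = inverse (ennreal (norm (x - y) ^ (CARD('n) - 2)))"

definition potentials :: "(real^'n \<Rightarrow> ennreal) set" where
  "potentials =
     {p. \<exists>\<mu> :: (real^'n) measure.
           sets \<mu> = sets (restrict_space borel (sphere 0 1)) \<and>
           emeasure \<mu> (sphere 0 1) = 1 \<and>
           p = (\<lambda>x. \<integral>\<^sup>+ y. riesz_kernel x y \<partial>\<mu>)}"

definition bounded_potentials :: "real \<Rightarrow> ennreal \<Rightarrow> (real^'n \<Rightarrow> ennreal) set" where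
  "bounded_potentials d M =
     {p \<in> potentials. (\<forall>x\<in>cball 0 1. ennreal d \<le> p x) \<and> (\<forall>x. p x \<le> M)}"

subsection \<open>Harmonic functions\<close>

text \<open>Twice continuously differentiable (gradient \<open>g\<close>, Hessian \<open>H\<close>) with vanishing Laplacian.\<close>

definition harmonic_on :: "(real^'n) set \<Rightarrow> (real^'n \<Rightarrow> real) \<Rightarrow> bool" where
  "harmonic_on S f \<longleftrightarrow> open S \<and>
     (\<exists>(g :: real^'n \<Rightarrow> real^'n) (H :: real^'n \<Rightarrow> real^'n^'n).
        (\<forall>x\<in>S. (f has_derivative (\<lambda>v. g x \<bullet> v)) (at x)) \<and>
        (\<forall>x\<in>S. (g has_derivative (\<lambda>v. H x *v v)) (at x)) \<and>
        continuous_on S H \<and>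
        (\<forall>x\<in>S. trace (H x) = 0))"

subsection \<open>Extremal potentials\<close>

definition cap_pos :: "'n \<Rightarrow> real \<Rightarrow> (real^'n) set" where
  "cap_pos k \<xi> = {x \<in> sphere 0 1. cos \<xi> \<le> x $ k \<and> x $ k \<le> 1}"

definition cap_neg :: "'n \<Rightarrow> real \<Rightarrow> (real^'n) set" where
  "cap_neg k \<xi> = {x \<in> sphere 0 1. -1 \<le> x $ k \<and> x $ k \<le> cos \<xi>}"

definition extremal_potential ::
  "'n \<Rightarrow> real \<Rightarrow> real \<Rightarrow> real \<Rightarrow> ennreal \<Rightarrow> (real^'n \<Rightarrow> ennreal) \<Rightarrow> bool" where
  "extremal_potential k \<xi>\<^sub>1 \<xi>\<^sub>2 d M P \<longleftrightarrow>
     P \<in> potentials \<and>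
     (\<forall>x\<in>cap_pos k \<xi>\<^sub>1. P x = M) \<and>
     (\<forall>x\<in>cap_neg k \<xi>\<^sub>2. P x = ennreal d) \<and>
     (\<forall>x\<in>cball 0 1. ennreal d \<le> P x) \<and> (\<forall>x. P x \<le> M) \<and>
     P 0 = 1 \<and>
     (\<forall>x\<in>- (cap_pos k \<xi>\<^sub>1 \<union> cap_neg k \<xi>\<^sub>2). P x < \<infinity>) \<and>
     harmonic_on (- (cap_pos k \<xi>\<^sub>1 \<union> cap_neg k \<xi>\<^sub>2)) (\<lambda>x. enn2real (P x))"

text \<open>
  The graph of the map taking \<open>(\<xi>\<^sub>1, \<xi>\<^sub>2)\<close> to \<open>(d, M)\<close>: the pair is the one for which a potential with
  the required properties exists.
\<close>

definition corresponding_pair :: "'n::finite \<Rightarrow> real \<Rightarrow> real \<Rightarrow> real \<Rightarrow> ennreal \<Rightarrow> bool" where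
  "corresponding_pair k \<xi>\<^sub>1 \<xi>\<^sub>2 d M \<longleftrightarrow>
     0 \<le> \<xi>\<^sub>1 \<and> \<xi>\<^sub>1 < \<xi>\<^sub>2 \<and> \<xi>\<^sub>2 \<le> pi \<and>
     2 powr (2 - real CARD('n)) \<le> d \<and> d < 1 \<and> 1 < M \<and>
     (\<exists>P. extremal_potential k \<xi>\<^sub>1 \<xi>\<^sub>2 d M P)"

text \<open>
  \<open>P(\<cdot>, d, \<infinity>)\<close>: the upper cap degenerates to the single point with angle 0, and the angle of the
  lower cap is adapted to \<open>d\<close>.
\<close>

definition extremal_potential_inf :: "'n \<Rightarrow> real \<Rightarrow> (real^'n \<Rightarrow> ennreal) \<Rightarrow> bool" where
  "extremal_potential_inf k d P \<longleftrightarrow>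
     (\<exists>\<xi>\<^sub>2'. 0 < \<xi>\<^sub>2' \<and> \<xi>\<^sub>2' \<le> pi \<and> extremal_potential k 0 \<xi>\<^sub>2' d \<infinity> P)"

subsection \<open>Integral means\<close>

text \<open>A non-decreasing function on the reals, extended by its limit at \<open>+\<infinity>\<close>.\<close>

definition extend_top :: "(real \<Rightarrow> real) \<Rightarrow> ennreal \<Rightarrow> ereal" where
  "extend_top \<Phi> t = (if t = \<infinity> then (SUP s. ereal (\<Phi> s)) else ereal (\<Phi> (enn2real t)))"

text \<open>
  The Lebesgue integral with values in the extended reals, as the integral of the positive part
  minus that of the negative part (\<^const>\<open>e2ennreal\<close> truncates at 0). It is used below only for
  functions bounded from below on a space of finite measure, so no \<open>\<infinity> - \<infinity>\<close> occurs; the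
  integral may be \<open>+\<infinity>\<close>.
\<close>

definition ext_integral :: "'a measure \<Rightarrow> ('a \<Rightarrow> ereal) \<Rightarrow> ereal" where
  "ext_integral N f =
     enn2ereal (\<integral>\<^sup>+ x. e2ennreal (f x) \<partial>N) - enn2ereal (\<integral>\<^sup>+ x. e2ennreal (- f x) \<partial>N)"

end

theory Submission
  imports Defs "HOL-Complex_Analysis.Great_Picard" "HOL-Real_Asymp.Real_Asymp"
begin

text \<open>
  Put \<open>a = (n - 2) / 2\<close>. On the sphere of radius \<open>r\<close> the potential of \<open>\<mu>\<close> is \<open>r\<^sup>-\<^sup>a pot \<mu> t\<close> with
  \<open>t = |ln r|\<close>, where \<open>pot \<mu> t\<close> integrates the kernel \<open>(2 cosh t - 2 x \<bullet> z)\<^sup>-\<^sup>a\<close> and increases to the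
  potential on the unit sphere as \<open>t\<close> tends to \<open>0\<close>; the Poisson operators satisfy
  \<open>R s (pot \<mu> t) = pot \<mu> (s + t)\<close>. Polarization yields a rearrangement \<open>f\<close> of \<open>pot \<mu> t\<close> that increases
  in \<open>x \<bullet> e\<close> and for which convex means of \<open>R s f\<close> dominate those of \<open>R s (pot \<mu> t)\<close>. If the integral
  of \<open>f\<close> over every cap about \<open>e\<close> is at most that of \<open>P(\<cdot>, d, \<infinity>)\<close>, the theorem follows by testing the
  difference against the subgradient of \<open>\<Phi>\<close> at a multiple of \<open>R s f\<close>, which also increases in
  \<open>x \<bullet> e\<close>, and letting \<open>t\<close> tend to \<open>0\<close>.

  The caps are compared through the potential \<open>P\<^sub>0\<close> belonging to \<open>(\<xi>\<^sub>1, \<pi>)\<close>. Suppose that the integral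
  of \<open>f - P\<^sub>0\<close> over caps has a positive maximum \<open>\<kappa>\<close>. On that cap, which is strictly larger than \<open>E\<^sub>1\<close>
  because \<open>f \<le> M = P\<^sub>0\<close> there, the operator \<open>1 - R s\<close> produces at least \<open>\<kappa> (1 - exp (- a s))\<close>. But it
  produces at most \<open>V (1 - exp (- a s))\<close> for \<open>f\<close>, and for \<open>P\<^sub>0\<close> it produces this amount up to \<open>O(s\<^sup>2)\<close>,
  since the measure of \<open>P\<^sub>0\<close> lives in \<open>E\<^sub>1\<close>. In the same way \<open>P\<^sub>0\<close> is compared with \<open>P(\<cdot>, d, \<infinity>)\<close>, whose
  measure lives in \<open>e\<close> and in the set where it attains its minimum \<open>d \<le> P\<^sub>0\<close>: outside a minimising cap the
  positive part of \<open>P(\<cdot>, d, \<infinity>) - P\<^sub>0\<close> must vanish by the maximum principle.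
\<close>

subsection \<open>Hausdorff measure on the sphere\<close>

text \<open>The sphere enters as a finite nonzero Borel measure invariant under orthogonal maps. The
  facts about the Poisson kernel are drawn from this invariance: moving small rotations from one
  factor of an integral to the other gives Green's identity, hence a conserved Wronskian, and total
  masses are read off as \<open>t\<close> tends to infinity. At \<open>t = 0\<close> the kernel is
  singular and potentials may be infinite. For \<open>t > 0\<close> they are Lipschitz with a
  constant that polarization preserves, so compactness yields the rearrangement. The price is a loss
  of mass by the factor \<open>exp (- a * t)\<close>, which has the favourable sign. The second
  comparison is harder, because the measure of the unbounded potential may charge both sides of the
  critical cap. The first-order argument then leaves a boundary term containing
  \<open>poi s\<close>, whereas subharmonicity is available for \<open>kap 0 - kap s\<close>.
  Integration in \<open>s\<close> leads from one to the other, so that orders 2 and 3 in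
  \<open>t\<close> are compared there instead of orders 1 and 2.\<close>

lemma diameter_orthogonal_image:
  fixes T :: "'a::euclidean_space \<Rightarrow> 'a"
  assumes "orthogonal_transformation T"
  shows "diameter (T ` A) = diameter A"
proof -
  have *: "dist (T x) (T y) = dist x y" for x y
    by (metis assms dist_norm linear_diff orthogonal_transformation)
  have "T ` A \<times> T ` A = (\<lambda>(x, y). (T x, T y)) ` (A \<times> A)"
    by auto
  then have "(\<lambda>(x, y). dist x y) ` (T ` A \<times> T ` A) = (\<lambda>(x, y). dist x y) ` (A \<times> A)"
    by (simp add: image_image case_prod_beta *)
  then show ?thesis
    by (simp add: diameter_def)
qed

lemma hausdorff_pre_orthogonal_le:
  fixes T :: "'a::euclidean_space \<Rightarrow> 'a"
  assumes T: "orthogonal_transformation T"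
  shows "hausdorff_pre m \<delta> (T ` A) \<le> hausdorff_pre m \<delta> A"
  unfolding hausdorff_pre_def
proof (rule INF_greatest)
  fix U :: "nat \<Rightarrow> 'a set"
  assume U: "U \<in> {U. A \<subseteq> (\<Union>i. U i) \<and> (\<forall>i. bounded (U i) \<and> diameter (U i) \<le> \<delta>)}"
  have "bounded (T ` U i)" for i
    using U bounded_linear_image[of "U i" T] orthogonal_transformation_linear[OF T]
    by (simp add: linear_conv_bounded_linear[symmetric])
  then have "(\<lambda>i. T ` U i) \<in> {U. T ` A \<subseteq> (\<Union>i. U i) \<and> (\<forall>i. bounded (U i) \<and> diameter (U i) \<le> \<delta>)}"
    using U by (auto simp: diameter_orthogonal_image[OF T]) blast
  then show "(INF U\<in>{U. T ` A \<subseteq> (\<Union>i. U i) \<and> (\<forall>i. bounded (U i) \<and> diameter (U i) \<le> \<delta>)}.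
        \<Sum>i. ennreal (unit_ball_vol (real m) * (diameter (U i) / 2) ^ m))
      \<le> (\<Sum>i. ennreal (unit_ball_vol (real m) * (diameter (U i) / 2) ^ m))"
    by (rule INF_lower2) (simp add: diameter_orthogonal_image[OF T])
qed

lemma hausdorff_outer_orthogonal:
  fixes T :: "'a::euclidean_space \<Rightarrow> 'a"
  assumes T: "orthogonal_transformation T"
  shows "hausdorff_outer m (T ` A) = hausdorff_outer m A"
proof (rule antisym)
  have le: "hausdorff_outer m (S ` B) \<le> hausdorff_outer m B" if "orthogonal_transformation S"
    for S :: "'a \<Rightarrow> 'a" and B
    unfolding hausdorff_outer_def
    by (intro SUP_mono) (use hausdorff_pre_orthogonal_le[OF that] in blast)
  show "hausdorff_outer m (T ` A) \<le> hausdorff_outer m A"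
    by (rule le[OF T])
  have "inv T ` (T ` A) = A"
    using orthogonal_transformation_inj[OF T] by (simp add: image_comp inv_o_cancel)
  then show "hausdorff_outer m A \<le> hausdorff_outer m (T ` A)"
    using le[of "inv T" "T ` A"] orthogonal_transformation_inv[OF T] by simp
qed

text \<open>The \<open>i\<close>-th coordinates are bounded away from \<open>0\<close>, so the equation of the sphere controls their
  difference by that of the other coordinates. This covers the sphere by \<open>O(N\<^sup>n\<^sup>-\<^sup>1)\<close> sets of
  diameter \<open>O(1 / N)\<close>.\<close>

lemma sphere_cell_dist:
  fixes x y :: "real^'n::finite"
  assumes x: "norm x = 1" and y: "norm y = 1" and N: "0 < N"
    and xi: "\<And>j. \<bar>x $ j\<bar> \<le> \<bar>x $ i\<bar>" and yi: "\<And>j. \<bar>y $ j\<bar> \<le> \<bar>y $ i\<bar>"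
    and sg: "(0 \<le> x $ i) = (0 \<le> y $ i)"
    and near: "\<And>j. j \<noteq> i \<Longrightarrow> \<bar>x $ j - y $ j\<bar> \<le> 1 / N"
  shows "dist x y \<le> 2 * real CARD('n)^2 / N"
proof -
  let ?n = "real CARD('n)"
  have n1: "1 \<le> ?n" by (simp add: Suc_le_eq)
  have sq: "(\<Sum>j\<in>UNIV. (z $ j)^2) = 1" if "norm z = 1" for z :: "real^'n"
    using that by (simp add: norm_vec_def L2_set_def)
  have big: "1 / ?n \<le> \<bar>z $ i\<bar>" if z: "norm z = 1" and m: "\<And>j. \<bar>z $ j\<bar> \<le> \<bar>z $ i\<bar>" for z :: "real^'n"
  proof -
    have "norm z \<le> (\<Sum>j\<in>UNIV. \<bar>z $ j\<bar>)" by (rule norm_le_l1_cart)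
    also have "\<dots> \<le> (\<Sum>j\<in>(UNIV::'n set). \<bar>z $ i\<bar>)" by (intro sum_mono m)
    finally show ?thesis using z n1 by (simp add: divide_simps mult.commute)
  qed
  have le1: "\<bar>z $ j\<bar> \<le> 1" if "norm z = 1" for z :: "real^'n" and j
    using component_le_norm_cart[of z j] that by simp
  have "(x$i)^2 - (y$i)^2 = (\<Sum>j\<in>UNIV-{i}. (y$j)^2 - (x$j)^2)"
    using sq[OF x] sq[OF y] by (simp add: sum_subtractf sum.remove[of UNIV i])
  also have "\<bar>\<dots>\<bar> \<le> (\<Sum>j\<in>UNIV-{i}. \<bar>(y$j)^2 - (x$j)^2\<bar>)" by (rule sum_abs)
  also have "\<dots> \<le> (\<Sum>j\<in>UNIV-{i}. 2 / N)"
  proof (rule sum_mono)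
    fix j assume "j \<in> UNIV - {i}"
    then have "\<bar>x$j - y$j\<bar> \<le> 1/N" using near by simp
    moreover have "\<bar>y$j + x$j\<bar> \<le> 2" using le1[OF x, of j] le1[OF y, of j] by linarith
    ultimately have "\<bar>y$j + x$j\<bar> * \<bar>x$j - y$j\<bar> \<le> 2 * (1/N)" by (intro mult_mono) auto
    moreover have "\<bar>(y$j)^2 - (x$j)^2\<bar> = \<bar>y$j + x$j\<bar> * \<bar>x$j - y$j\<bar>"
      by (simp add: abs_mult[symmetric] power2_eq_square algebra_simps abs_minus_commute)
    ultimately show "\<bar>(y$j)^2 - (x$j)^2\<bar> \<le> 2 / N" by simp
  qed
  also have "\<dots> = 2 * (?n - 1) / N"
    by (simp add: card_Diff_singleton of_nat_diff Suc_le_eq)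
  finally have d2: "\<bar>(x$i)^2 - (y$i)^2\<bar> \<le> 2 * (?n - 1) / N" .
  have "\<bar>(x$i)^2 - (y$i)^2\<bar> = \<bar>x$i + y$i\<bar> * \<bar>x$i - y$i\<bar>"
    by (simp add: abs_mult[symmetric] power2_eq_square algebra_simps)
  \<comment> \<open>The signs agree, so the two coordinates add up without cancellation, and the
    factor \<open>x$i + y$i\<close> of the difference of squares can be divided out.\<close>
  moreover have "2 / ?n \<le> \<bar>x$i + y$i\<bar>"
    using big[OF x xi] big[OF y yi] sg by (auto simp: abs_if split: if_splits)
  ultimately have "2 / ?n * \<bar>x$i - y$i\<bar> \<le> 2 * (?n - 1) / N"
    using d2 mult_right_mono[of "2 / ?n" "\<bar>x$i + y$i\<bar>" "\<bar>x$i - y$i\<bar>"] by linarith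
  then have di: "\<bar>x$i - y$i\<bar> \<le> ?n * (?n - 1) / N"
    using n1 N by (simp add: field_simps)
  have "dist x y \<le> (\<Sum>j\<in>UNIV. \<bar>(x - y) $ j\<bar>)" unfolding dist_norm by (rule norm_le_l1_cart)
  also have "\<dots> = \<bar>x$i - y$i\<bar> + (\<Sum>j\<in>UNIV-{i}. \<bar>x$j - y$j\<bar>)"
    by (simp add: sum.remove[of UNIV i])
  also have "\<dots> \<le> ?n * (?n - 1) / N + (\<Sum>j\<in>(UNIV::'n set)-{i}. 1 / N)"
    by (intro add_mono di sum_mono near) auto
  also have "\<dots> = ?n * (?n - 1) / N + (?n - 1) / N"
    by (simp add: card_Diff_singleton of_nat_diff Suc_le_eq)
  also have "\<dots> \<le> 2 * ?n^2 / N"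
    unfolding add_divide_distrib[symmetric]
    by (intro divide_right_mono) (use N n1 in \<open>auto simp: power2_eq_square algebra_simps mult_le_cancel_left1\<close>)
  finally show ?thesis .
qed

text \<open>The finite family is padded to a sequence by empty sets. Their diameter is 0, and they
  cost nothing because \<open>0 < m\<close>.\<close>

lemma hausdorff_pre_finite_cover:
  assumes "finite I" "A \<subseteq> (\<Union>i\<in>I. C i)" "0 < m"
    and "\<And>i. i \<in> I \<Longrightarrow> bounded (C i) \<and> diameter (C i) \<le> \<delta>" and "0 \<le> \<delta>"
  shows "hausdorff_pre m \<delta> A \<le> ennreal (real (card I) * (unit_ball_vol (real m) * (\<delta> / 2) ^ m))"
proof -
  let ?v = "unit_ball_vol (real m)"
  obtain f where f: "bij_betw f {..<card I} I"
    using ex_bij_betw_nat_finite[OF assms(1)] by (auto simp: atLeast0LessThan)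
  define U where "U j = (if j < card I then C (f j) else {})" for j
  have cov: "A \<subseteq> (\<Union>j. U j)"
  proof
    fix x assume "x \<in> A"
    then obtain i where "i \<in> I" "x \<in> C i" using assms(2) by blast
    then obtain j where "j < card I" "f j = i" using f by (metis bij_betw_def imageE lessThan_iff)
    then show "x \<in> (\<Union>j. U j)" using \<open>x \<in> C i\<close> by (auto simp: U_def intro!: exI[of _ j])
  qed
  have fI: "f j \<in> I" if "j < card I" for j using f that by (auto simp: bij_betw_def)
  have "hausdorff_pre m \<delta> A \<le> (\<Sum>j. ennreal (?v * (diameter (U j) / 2) ^ m))"
    unfolding hausdorff_pre_def
    by (rule INF_lower) (use cov fI assms(4,5) in \<open>auto simp: U_def\<close>)
  also have "\<dots> = (\<Sum>j<card I. ennreal (?v * (diameter (U j) / 2) ^ m))"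
    by (rule suminf_finite) (use assms(3) in \<open>auto simp: U_def\<close>)
  also have "\<dots> \<le> (\<Sum>j<card I. ennreal (?v * (\<delta> / 2) ^ m))"
    using fI assms(4) by (intro sum_mono ennreal_leI mult_left_mono power_mono)
      (auto simp: U_def diameter_ge_0)
  also have "\<dots> = ennreal (real (card I) * (?v * (\<delta> / 2) ^ m))"
    using assms(5) by (simp add: ennreal_mult ennreal_of_nat_eq_real_of_nat)
  finally show ?thesis .
qed

lemma hausdorff_outer_sphere_finite:
  assumes n: "2 \<le> CARD('n::finite)"
  shows "hausdorff_outer (CARD('n) - 1) (sphere 0 1 :: (real^'n) set) < \<infinity>"
proof -
  let ?n = "real CARD('n)" and ?m = "CARD('n) - 1" and ?S = "sphere 0 1 :: (real^'n) set"
  let ?v = "unit_ball_vol (real ?m)"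
  \<comment> \<open>\<open>2 * n\<close> counts the choices of a dominant coordinate and its sign.
    Each choice has \<open>(2 * N + 1) ^ (n - 1)\<close> cells of half diameter at most
    \<open>n\<^sup>2 / N\<close>, and \<open>(2 * N + 1) / N \<le> 3\<close> makes the total
    independent of \<open>\<delta>\<close>.\<close>
  define B where "B = 2 * ?n * (?v * (3 * ?n^2) ^ ?m)"
  have "hausdorff_pre ?m \<delta> ?S \<le> ennreal B" if \<delta>: "0 < \<delta>" for \<delta>
  proof -
    obtain N :: nat where N: "2 * ?n^2 / \<delta> < real N" using reals_Archimedean2 by blast
    have N0: "0 < N" using N \<delta> by (metis divide_nonneg_pos gr0I less_le_not_le of_nat_0 of_nat_0_le_iff mult_nonneg_nonneg zero_le_numeral zero_le_power2 order_less_le_trans)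
    \<comment> \<open>A cell is described by the index of a largest coordinate, the sign of that
      coordinate and the grid positions of the others. Slot \<open>i\<close> is frozen at 0, which
      leaves \<open>n - 1\<close> free slots; adding \<open>N\<close> moves the floors into
      \<open>{0..2 * N}\<close>.\<close>
    define I where "I = (SIGMA i:(UNIV::'n set). (UNIV::bool set) \<times> PiE UNIV (\<lambda>j. if j = i then {0} else {..2*int N} \<inter> {0..}))"
    define cell :: "'n \<times> bool \<times> ('n \<Rightarrow> int) \<Rightarrow> (real^'n) set" where
      "cell = (\<lambda>(i, s, c). {x\<in>?S. (\<forall>j. \<bar>x $ j\<bar> \<le> \<bar>x $ i\<bar>) \<and> (0 \<le> x $ i) = s \<and> (\<forall>j. j \<noteq> i \<longrightarrow> \<lfloor>real N * x $ j\<rfloor> + int N = c j)})"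
    let ?\<epsilon> = "2 * ?n^2 / N"
    have eps: "?\<epsilon> \<le> \<delta>" using N \<delta> N0 by (simp add: field_simps)
    have seg: "{..2 * int N} \<inter> {0..} = {0..2 * int N}" by auto
    have finP: "finite (PiE UNIV (\<lambda>j. if j = i then {0} else {..2*int N} \<inter> {0..}))" for i :: 'n
      by (intro finite_PiE) (auto simp: seg)
    then have fin: "finite I"
      unfolding I_def by (intro finite_SigmaI finite_cartesian_product) auto
    have dist: "dist x y \<le> ?\<epsilon>" if "x \<in> cell q" "y \<in> cell q" for x y q
    proof (cases q)
      case (fields i s c)
      show ?thesis
      proof (rule sphere_cell_dist[where i=i])
        fix j assume "j \<noteq> i"
        then have "\<lfloor>real N * x $ j\<rfloor> = \<lfloor>real N * y $ j\<rfloor>" using that fields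
          by (auto simp: cell_def) (metis add_right_cancel)+
        then have "\<bar>real N * x $ j - real N * y $ j\<bar> \<le> 1" by linarith
        then have "\<bar>real N * (x $ j - y $ j)\<bar> \<le> 1" by (simp add: algebra_simps)
        then show "\<bar>x $ j - y $ j\<bar> \<le> 1 / N" using N0 by (simp add: abs_mult pos_le_divide_eq mult.commute)
      qed (use that fields N0 in \<open>auto simp: cell_def\<close>)
    qed
    have "hausdorff_pre ?m \<delta> ?S \<le> hausdorff_pre ?m ?\<epsilon> ?S"
      unfolding hausdorff_pre_def by (rule INF_superset_mono) (use eps in \<open>auto intro: order_trans\<close>)
    also have "\<dots> \<le> ennreal (real (card I) * (?v * (?\<epsilon> / 2) ^ ?m))"
    proof (rule hausdorff_pre_finite_cover[where C = cell])
      show "?S \<subseteq> (\<Union>i\<in>I. cell i)"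
      proof
        fix x assume x: "x \<in> ?S"
        have "Max (range (\<lambda>j. \<bar>x $ j\<bar>)) \<in> range (\<lambda>j. \<bar>x $ j\<bar>)" by (rule Max_in) auto
        then obtain i where "\<bar>x $ i\<bar> = Max (range (\<lambda>j. \<bar>x $ j\<bar>))" by (metis rangeE)
        then have i: "\<bar>x $ j\<bar> \<le> \<bar>x $ i\<bar>" for j by simp
        define c where "c j = (if j = i then 0 else \<lfloor>real N * x $ j\<rfloor> + int N)" for j
        have "\<bar>x $ j\<bar> \<le> 1" for j using component_le_norm_cart[of x j] x by simp
        then have a: "\<bar>real N * x $ j\<bar> \<le> real N" for j by (simp add: abs_mult mult_left_le)
        have "- int N \<le> \<lfloor>real N * x $ j\<rfloor>" for j using a[of j] by linarith
        moreover have "\<lfloor>real N * x $ j\<rfloor> \<le> int N" for j using a[of j] by linarith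
        ultimately have b: "0 \<le> \<lfloor>real N * x $ j\<rfloor> + int N \<and> \<lfloor>real N * x $ j\<rfloor> \<le> int N" for j
          by (smt (verit))
        then have "(i, 0 \<le> x $ i, c) \<in> I" by (auto simp: I_def c_def)
        moreover have "x \<in> cell (i, 0 \<le> x $ i, c)" using i x by (auto simp: cell_def c_def)
        ultimately show "x \<in> (\<Union>i\<in>I. cell i)" by blast
      qed
      fix q assume "q \<in> I"
      have "cell q \<subseteq> ?S" by (auto simp: cell_def)
      moreover have "diameter (cell q) \<le> ?\<epsilon>" by (rule diameter_le) (use dist in \<open>auto simp: dist_norm\<close>)
      ultimately show "bounded (cell q) \<and> diameter (cell q) \<le> ?\<epsilon>" using bounded_subset bounded_sphere by blast
    qed (use fin n N0 in auto)
    also have "card I = CARD('n) * (2 * (2*N+1) ^ ?m)"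
    proof -
      have "card ({..2 * int N} \<inter> {0..}) = 2*N+1"
        by (simp add: seg)
      then have c: "(\<Prod>j\<in>UNIV. card (if j = i then {0} else {..2*int N} \<inter> {0..})) = (2*N+1)^?m" for i :: 'n
        by (subst prod.remove[of UNIV i]) (auto simp: card_Diff_singleton)
      have "card I = (\<Sum>i\<in>UNIV. card ((UNIV::bool set) \<times> PiE (UNIV::'n set) (\<lambda>j. if j = i then {0} else {..2*int N} \<inter> {0..})))"
        unfolding I_def by (rule card_SigmaI) (auto intro: finite_cartesian_product[OF finite finP])
      then show ?thesis
        by (simp only: card_cartesian_product card_PiE[OF finite] c) simp
    qed
    also have "real (CARD('n) * (2 * (2*N+1) ^ ?m)) * (?v * (?\<epsilon> / 2) ^ ?m) \<le> B"
    proof -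
      have "real ((2*N+1)^?m) * (?\<epsilon> / 2)^?m = ((2*N+1) * (?n^2/N))^?m"
        by (simp add: power_mult_distrib[symmetric] del: times_divide_eq_right times_divide_eq_left)
      also have "\<dots> \<le> (3 * ?n^2)^?m"
        by (rule power_mono) (use N0 in \<open>auto simp: field_simps\<close>)
      finally have "?v * (real ((2*N+1)^?m) * (?\<epsilon> / 2)^?m) \<le> ?v * (3 * ?n^2)^?m"
        by (intro mult_left_mono) auto
      then have "2 * ?n * (?v * (real ((2*N+1)^?m) * (?\<epsilon> / 2)^?m)) \<le> B"
        unfolding B_def by (intro mult_left_mono) auto
      then show ?thesis by (simp only: of_nat_mult of_nat_numeral mult.assoc mult.left_commute mult.commute)
    qed
    finally show ?thesis by (simp add: ennreal_leI)
  qed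
  then have "hausdorff_outer ?m ?S \<le> ennreal B"
    unfolding hausdorff_outer_def by (intro SUP_least) auto
  also have "\<dots> < \<infinity>" by simp
  finally show ?thesis .
qed

lemma space_sphere_measure [simp]: "space (sphere_measure :: (real^'n) measure) = sphere 0 1"
  by (simp add: sphere_measure_def hausdorff_measure_def space_restrict_space space_measure_of_conv)

lemma sets_hausdorff_measure: "sets (hausdorff_measure m :: ('a::metric_space) measure) = sets borel"
proof -
  have "sigma_sets UNIV (sets (borel :: 'a measure)) = sets borel"
    using sets.sigma_sets_eq[of "borel :: 'a measure"] by simp
  then show ?thesis by (simp add: hausdorff_measure_def sets_measure_of_conv)
qed

lemma sets_sphere_measure:
  "sets (sphere_measure :: (real^'n) measure) = sets (restrict_space borel (sphere 0 1))"
  unfolding sphere_measure_def by (rule sets_restrict_space_cong[OF sets_hausdorff_measure])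

text \<open>\<open>measure_of\<close> either is the null measure or takes the values of the outer
  measure on Borel sets. In the second case finiteness and invariance are inherited from the outer
  measure; both outcomes are carried to the final proof.\<close>

lemma sphere_measure_cases:
  assumes n: "2 \<le> CARD('n::finite)"
  obtains "emeasure (sphere_measure :: (real^'n) measure) (sphere 0 1) = 0"
  | "emeasure (sphere_measure :: (real^'n) measure) (sphere 0 1) < \<infinity>"
    "\<And>T :: real^'n \<Rightarrow> real^'n. orthogonal_transformation T \<Longrightarrow> distr sphere_measure sphere_measure T = sphere_measure"
proof -
  let ?S = "sphere 0 1 :: (real^'n) set" and ?m = "CARD('n) - 1"
  let ?H = "hausdorff_measure ?m :: (real^'n) measure"
  have S: "?S \<in> sets borel" by (intro borel_closed) auto
  have ss: "sigma_sets UNIV (sets (borel :: (real^'n) measure)) = sets borel"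
    using sets.sigma_sets_eq[of "borel :: (real^'n) measure"] by simp
  have res: "emeasure sphere_measure A = emeasure ?H A" if "A \<subseteq> ?S" for A
    unfolding sphere_measure_def
    by (rule emeasure_restrict_space) (use that S in \<open>auto simp: sets_hausdorff_measure\<close>)
  show thesis
  proof (cases "measure_space UNIV (sigma_sets UNIV (sets borel)) (hausdorff_outer ?m :: (real^'n) set \<Rightarrow> ennreal)")
    case False
    then have "emeasure sphere_measure ?S = 0"
      unfolding res[OF order_refl] hausdorff_measure_def by (simp add: emeasure_measure_of_conv)
    then show thesis by (rule that(1))
  next
    case True
    have em: "emeasure sphere_measure A = hausdorff_outer ?m A" if "A \<in> sets borel" "A \<subseteq> ?S" for A
      unfolding res[OF that(2)] hausdorff_measure_def using True that
      by (simp add: emeasure_measure_of_conv ss)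
    show thesis
    proof (rule that(2))
      show "emeasure sphere_measure ?S < \<infinity>"
        using em[OF S] hausdorff_outer_sphere_finite[OF n] by simp
    next
      fix T :: "real^'n \<Rightarrow> real^'n" assume T: "orthogonal_transformation T"
      have nT: "norm (T x) = norm x" for x
        using T by (simp add: orthogonal_transformation_norm)
      have TS: "T ` ?S = ?S"
      proof
        show "?S \<subseteq> T ` ?S"
        proof
          fix y assume "y \<in> ?S"
          moreover obtain x where "y = T x" using orthogonal_transformation_surj[OF T] by (rule surjE)
          ultimately show "y \<in> T ` ?S" by (auto simp: nT)
        qed
      qed (auto simp: nT)
      have cT: "continuous_on A T" for A
        using orthogonal_transformation_linear[OF T]
        by (intro linear_continuous_on) (simp add: linear_conv_bounded_linear[symmetric])
      have meas: "T \<in> measurable sphere_measure sphere_measure"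
        unfolding measurable_cong_sets[OF sets_sphere_measure sets_sphere_measure]
        by (intro measurable_restrict_space3 borel_measurable_continuous_onI) (auto simp: nT cT)
      show "distr sphere_measure sphere_measure T = sphere_measure"
      proof (rule measure_eqI)
        fix A assume "A \<in> sets (distr sphere_measure sphere_measure T)"
        then have A: "A \<in> sets (sphere_measure :: (real^'n) measure)" by simp
        then have A': "A \<in> sets borel" "A \<subseteq> ?S"
          using S by (auto simp: sets_sphere_measure sets_restrict_space_iff)
        let ?B = "T -` A \<inter> ?S"
        have B: "?B \<in> sets (sphere_measure :: (real^'n) measure)"
          using measurable_sets[OF meas A] by simp
        then have B': "?B \<in> sets borel" "?B \<subseteq> ?S"
          using S by (auto simp: sets_sphere_measure sets_restrict_space_iff)
        have "T ` ?B = A"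
        proof
          show "A \<subseteq> T ` ?B"
          proof
            fix y assume "y \<in> A"
            then have "y \<in> T ` ?S" using A'(2) TS by auto
            with \<open>y \<in> A\<close> show "y \<in> T ` ?B" by blast
          qed
        qed auto
        then have "hausdorff_outer ?m ?B = hausdorff_outer ?m A"
          using hausdorff_outer_orthogonal[OF T] by metis
        then show "emeasure (distr sphere_measure sphere_measure T) A = emeasure sphere_measure A"
          using emeasure_distr[OF meas A] em[OF A'] em[OF B'] by simp
      qed simp
    qed
  qed
qed

subsection \<open>Rotation invariant measures on the sphere\<close>

text \<open>The reflection in the hyperplane orthogonal to \<open>v\<close>. For
  \<open>v = 0\<close> it is the identity, so the rules below hold for every
  \<open>v\<close>.\<close>

definition refl_along :: "'a::real_inner \<Rightarrow> 'a \<Rightarrow> 'a" where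
  "refl_along v x = x - (2 * (x \<bullet> v) / (v \<bullet> v)) *\<^sub>R v"

lemma linear_refl_along: "linear (refl_along v)"
  by (rule linearI) (auto simp: refl_along_def algebra_simps inner_add_left add_divide_distrib)

lemma inner_refl_along [simp]: "refl_along v x \<bullet> refl_along v y = x \<bullet> y"
  by (cases "v = 0") (auto simp: refl_along_def algebra_simps inner_diff_left inner_diff_right inner_commute divide_simps)

lemma orthogonal_refl_along: "orthogonal_transformation (refl_along v)"
  for v :: "'a::euclidean_space"
  by (simp add: orthogonal_transformation_def linear_refl_along)

lemma norm_refl_along [simp]: "norm (refl_along v x) = norm x"
  by (simp add: norm_eq_sqrt_inner)

lemma refl_along_refl_along [simp]: "refl_along v (refl_along v x) = x"
  by (cases "v = 0") (auto simp: refl_along_def algebra_simps inner_diff_left divide_simps)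

lemma refl_along_inner_swap: "refl_along v x \<bullet> y = x \<bullet> refl_along v y"
  by (metis inner_refl_along refl_along_refl_along)

lemma refl_along_diff: "refl_along v (x - y) = refl_along v x - refl_along v y"
  by (rule linear_diff[OF linear_refl_along])

text \<open>Reflections act transitively on each sphere. This is the form in which invariance is
  used most often: two points of equal norm are exchanged by the reflection in their bisector, which
  fixes \<open>e\<close> when both have the same height over \<open>e\<close>.\<close>

lemma refl_along_swap:
  assumes "norm x = norm y" shows "refl_along (x - y) x = y"
proof (cases "x = y")
  case False
  have "x \<bullet> x = y \<bullet> y" using assms by (simp add: norm_eq_sqrt_inner)
  then have "2 * (x \<bullet> (x - y)) = (x - y) \<bullet> (x - y)"
    by (simp add: inner_diff_left inner_diff_right inner_commute)
  then show ?thesis using False by (simp add: refl_along_def)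
qed (simp add: refl_along_def)

text \<open>For \<open>s < 1\<close> the set lies in the frontier of a convex cone. For
  \<open>s = 1\<close> it is the equality case of Cauchy-Schwarz, a ray contained in a hyperplane.
  For \<open>s > 1\<close> only the origin is left. The Fubini argument in
  \<open>ring_null_nonneg\<close> needs this.\<close>

lemma negligible_cone:
  fixes x :: "'a::euclidean_space"
  assumes x: "norm x = 1" and s: "0 \<le> s" and D: "2 \<le> DIM('a)"
  shows "negligible {v. x \<bullet> v = s * norm v}"
proof -
  have xx: "x \<bullet> x = 1" using x by (simp add: norm_eq_1)
  consider "s < 1" | "s = 1" | "s > 1" by linarith
  then show ?thesis
  proof cases
    case 1
    let ?C = "{v. s * norm v \<le> x \<bullet> v}"
    have "convex ?C"
    proof (rule convexI)
      fix u v :: 'a and a b :: real assume uv: "u \<in> ?C" "v \<in> ?C" "0 \<le> a" "0 \<le> b" "a + b = 1"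
      have "s * norm (a *\<^sub>R u + b *\<^sub>R v) \<le> s * (a * norm u + b * norm v)"
        using norm_triangle_ineq[of "a *\<^sub>R u" "b *\<^sub>R v"] uv s by (intro mult_left_mono) auto
      also have "\<dots> = a * (s * norm u) + b * (s * norm v)" by (simp add: algebra_simps)
      also have "\<dots> \<le> a * (x \<bullet> u) + b * (x \<bullet> v)" using uv by (intro add_mono mult_left_mono) auto
      finally show "a *\<^sub>R u + b *\<^sub>R v \<in> ?C" by (simp add: inner_add_right)
    qed
    moreover have "{v. x \<bullet> v = s * norm v} \<subseteq> frontier ?C"
    proof
      fix v assume "v \<in> {v. x \<bullet> v = s * norm v}"
      then have v: "x \<bullet> v = s * norm v" by simp
      have "v \<notin> interior ?C"
      proof
        assume "v \<in> interior ?C"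
        then obtain e where e: "0 < e" "cball v e \<subseteq> ?C" using mem_interior_cball by blast
        \<comment> \<open>A step of length \<open>e\<close> against \<open>x\<close> lowers
          \<open>x \<bullet> v\<close> by \<open>e\<close>, but lowers \<open>s * norm v\<close> by
          at most \<open>s * e\<close>, which is less; the point would leave the cone.\<close>
        then have "v - e *\<^sub>R x \<in> ?C" using x by (auto simp: subset_iff dist_norm)
        then have "s * norm (v - e *\<^sub>R x) \<le> s * norm v - e" using v xx by (simp add: inner_diff_right)
        moreover have "norm v - e \<le> norm (v - e *\<^sub>R x)"
          using norm_triangle_ineq2[of v "e *\<^sub>R x"] x e by simp
        then have "s * (norm v - e) \<le> s * norm (v - e *\<^sub>R x)" using s by (rule mult_left_mono)
        ultimately have "e \<le> s * e" by (simp add: algebra_simps)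
        then show False using 1 e by simp
      qed
      moreover have "v \<in> closure ?C" using v closure_subset by fastforce
      ultimately show "v \<in> frontier ?C" by (simp add: frontier_def)
    qed
    ultimately show ?thesis using negligible_convex_frontier negligible_subset by blast
  next
    case 2
    obtain w where w: "w \<noteq> 0" "orthogonal x w" using vector_in_orthogonal_basis orthogonal_to_vector_exists[OF D, of x] by metis
    have "{v. x \<bullet> v = s * norm v} \<subseteq> {v. w \<bullet> v = 0}"
    proof
      fix v assume "v \<in> {v. x \<bullet> v = s * norm v}"
      then have v: "x \<bullet> v = norm v" using 2 by simp
      have "(v - norm v *\<^sub>R x) \<bullet> (v - norm v *\<^sub>R x) = v \<bullet> v - 2 * norm v * (x \<bullet> v) + (norm v)\<^sup>2 * (x \<bullet> x)"
        by (simp add: inner_diff_left inner_diff_right inner_commute power2_eq_square algebra_simps)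
      also have "\<dots> = 0"
        using v xx by (simp add: power2_norm_eq_inner power2_eq_square[symmetric])
      finally have "(v - norm v *\<^sub>R x) \<bullet> (v - norm v *\<^sub>R x) = 0" .
      then have "v = norm v *\<^sub>R x" by (metis eq_iff_diff_eq_0 inner_eq_zero_iff)
      then have "w \<bullet> v = norm v * (w \<bullet> x)" by (metis inner_scaleR_right)
      then show "v \<in> {v. w \<bullet> v = 0}" using w by (simp add: orthogonal_def inner_commute)
    qed
    then show ?thesis using negligible_hyperplane[of w 0] w negligible_subset by blast
  next
    case 3
    have "v = 0" if "x \<bullet> v = s * norm v" for v
    proof (rule ccontr)
      assume "v \<noteq> 0"
      then have "norm v < s * norm v" using 3 by simp
      then show False using norm_cauchy_schwarz[of x v] x that by simp
    qed
    then have "{v. x \<bullet> v = s * norm v} \<subseteq> {0}" by auto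
    then show ?thesis using negligible_sing negligible_subset by blast
  qed
qed

locale sphere_space =
  fixes \<sigma> :: "(real^'n) measure"
  assumes card_n: "3 \<le> CARD('n::finite)"
    and sets_\<sigma>: "sets \<sigma> = sets (restrict_space borel (sphere 0 1))"
    and fin_\<sigma>: "emeasure \<sigma> (sphere 0 1) < \<infinity>"
    and pos_\<sigma>: "emeasure \<sigma> (sphere 0 1) \<noteq> 0"
    and invariant: "orthogonal_transformation T \<Longrightarrow> distr \<sigma> \<sigma> T = \<sigma>"
begin

abbreviation S :: "(real^'n) set" where "S \<equiv> sphere 0 1"

definition V :: real where "V = measure \<sigma> S"

lemma space_\<sigma> [simp]: "space \<sigma> = S"
  using sets_eq_imp_space_eq[OF sets_\<sigma>] by (simp add: space_restrict_space)

sublocale finite_measure \<sigma>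
  by (rule finite_measureI) (use fin_\<sigma> in auto)

lemma V_pos: "0 < V"
  using pos_\<sigma> unfolding V_def by (simp add: emeasure_eq_measure zero_less_measure_iff)

lemma S_borel [measurable]: "S \<in> sets borel"
  by (intro borel_closed) auto

lemma ident_measurable [measurable]: "(\<lambda>x. x) \<in> measurable \<sigma> borel"
  unfolding measurable_cong_sets[OF sets_\<sigma> refl] by (rule measurable_restrict_space1) simp

lemma sets_\<sigma>_iff: "A \<in> sets \<sigma> \<longleftrightarrow> A \<in> sets borel \<and> A \<subseteq> S"
  using S_borel by (auto simp: sets_\<sigma> sets_restrict_space_iff)

lemma measurable_orth:
  assumes "orthogonal_transformation T"
  shows "T \<in> measurable \<sigma> \<sigma>"
proof -
  have "continuous_on UNIV T"
    using orthogonal_transformation_linear[OF assms]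
    by (intro linear_continuous_on) (simp add: linear_conv_bounded_linear[symmetric])
  then show ?thesis
    unfolding measurable_cong_sets[OF sets_\<sigma> sets_\<sigma>] using assms
    by (intro measurable_restrict_space3 borel_measurable_continuous_onI)
       (auto simp: orthogonal_transformation_norm)
qed

lemma integral_orth:
  fixes f :: "real^'n \<Rightarrow> real"
  assumes "orthogonal_transformation T" "f \<in> borel_measurable \<sigma>"
  shows "(\<integral>x. f (T x) \<partial>\<sigma>) = (\<integral>x. f x \<partial>\<sigma>)"
  using integral_distr[OF measurable_orth[OF assms(1)] assms(2)] invariant[OF assms(1)] by simp

lemma integrable_orth:
  fixes f :: "real^'n \<Rightarrow> real"
  assumes "orthogonal_transformation T" "integrable \<sigma> f"
  shows "integrable \<sigma> (\<lambda>x. f (T x))"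
  using integrable_distr[OF measurable_orth[OF assms(1)], of f] invariant[OF assms(1)] assms(2) by simp

lemma emeasure_orth:
  assumes "orthogonal_transformation T" "A \<in> sets \<sigma>"
  shows "emeasure \<sigma> (T -` A \<inter> S) = emeasure \<sigma> A"
  using emeasure_distr[OF measurable_orth[OF assms(1)] assms(2)] invariant[OF assms(1)] by simp

lemma AE_orth:
  assumes "orthogonal_transformation T" "AE x in \<sigma>. P x"
  shows "AE x in \<sigma>. P (T x)"
  using AE_distrD[OF measurable_orth[OF assms(1)], of P] invariant[OF assms(1)] assms(2) by metis

lemma integrable_bounded:
  fixes f :: "real^'n \<Rightarrow> real"
  assumes "f \<in> borel_measurable \<sigma>" "\<And>x. x \<in> S \<Longrightarrow> \<bar>f x\<bar> \<le> B"
  shows "integrable \<sigma> f"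
  using assms by (intro integrable_const_bound[where B=B]) auto

lemma integrable_mult_bounded:
  fixes g w :: "real^'n \<Rightarrow> real"
  assumes g: "integrable \<sigma> g" and w: "w \<in> borel_measurable \<sigma>" "\<And>x. x \<in> S \<Longrightarrow> \<bar>w x\<bar> \<le> B"
  shows "integrable \<sigma> (\<lambda>x. w x * g x)"
proof (rule Bochner_Integration.integrable_bound)
  show "integrable \<sigma> (\<lambda>x. B * \<bar>g x\<bar>)" using g by simp
  show "(\<lambda>x. w x * g x) \<in> borel_measurable \<sigma>" using w(1) borel_measurable_integrable[OF g] by measurable
  show "AE x in \<sigma>. norm (w x * g x) \<le> norm (B * \<bar>g x\<bar>)"
    using w(2) by (intro AE_I2) (auto simp: abs_mult intro!: mult_right_mono order_trans[OF w(2)])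
qed

lemma integrable_if:
  fixes g :: "real^'n \<Rightarrow> real"
  assumes g: "integrable \<sigma> g" and P: "Measurable.pred \<sigma> P"
  shows "integrable \<sigma> (\<lambda>x. if P x then g x else 0)"
proof -
  have "integrable \<sigma> (\<lambda>x. (if P x then 1 else 0) * g x)"
    by (rule integrable_mult_bounded[OF g, of _ 1]) (use P in auto)
  then show ?thesis by (rule Bochner_Integration.integrable_cong[THEN iffD1, rotated -1]) auto
qed

lemma measurable_continuous_on_S:
  fixes f :: "real^'n \<Rightarrow> real"
  assumes "continuous_on S f" shows "f \<in> borel_measurable \<sigma>"
  unfolding measurable_cong_sets[OF sets_\<sigma> refl]
  by (rule borel_measurable_continuous_on_restrict[OF assms])

lemma integrable_continuous_on_S:
  fixes f :: "real^'n \<Rightarrow> real"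
  assumes "continuous_on S f" shows "integrable \<sigma> f"
proof -
  have "compact (f ` S)" by (intro compact_continuous_image assms) auto
  then obtain B where "\<And>x. x \<in> S \<Longrightarrow> \<bar>f x\<bar> \<le> B"
    using compact_imp_bounded bounded_iff by (metis imageI real_norm_def)
  then show ?thesis by (intro integrable_bounded measurable_continuous_on_S assms)
qed

text \<open>Invariance would make every ball of the same radius null as soon as one is, and by
  compactness finitely many of them cover the sphere.\<close>

lemma ball_pos:
  assumes "x0 \<in> S" "0 < e" shows "emeasure \<sigma> (S \<inter> ball x0 e) \<noteq> 0"
proof
  assume z: "emeasure \<sigma> (S \<inter> ball x0 e) = 0"
  have m: "S \<inter> ball x e \<in> sets \<sigma>" for x by (auto simp: sets_\<sigma>_iff)
  have z': "emeasure \<sigma> (S \<inter> ball x e) = 0" if "x \<in> S" for x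
  proof -
    have eq: "refl_along (x0 - x) x0 = x" using assms that by (intro refl_along_swap) auto
    have "dist x0 (refl_along (x0 - x) y) = dist x y" for y
      by (metis dist_norm eq norm_refl_along refl_along_diff refl_along_refl_along)
    then have "refl_along (x0 - x) -` (S \<inter> ball x0 e) \<inter> S = S \<inter> ball x e"
      by auto
    then show ?thesis using emeasure_orth[OF orthogonal_refl_along m, of "x0 - x" x0] z by (simp only:)
  qed
  have "S \<subseteq> (\<Union>x\<in>S. ball x e)" using assms by auto
  then obtain F where F: "F \<subseteq> S" "finite F" "S \<subseteq> (\<Union>x\<in>F. ball x e)"
    by (rule compactE_image[OF compact_sphere, rotated]) auto
  then have "S = (\<Union>x\<in>F. S \<inter> ball x e)" by auto
  then have "emeasure \<sigma> S \<le> (\<Sum>x\<in>F. emeasure \<sigma> (S \<inter> ball x e))"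
    using emeasure_subadditive_finite[OF F(2), of "\<lambda>x. S \<inter> ball x e" \<sigma>] m by auto
  also have "\<dots> = 0" using F z' by (intro sum.neutral) auto
  finally show False using pos_\<sigma> by simp
qed

lemma AE_open_nonempty:
  assumes "AE x in \<sigma>. P x" "x0 \<in> S" "0 < e"
  obtains x where "x \<in> S" "dist x0 x < e" "P x"
proof -
  have "\<exists>x\<in>S. dist x0 x < e \<and> P x"
  proof (rule ccontr)
    assume "\<not> ?thesis"
    then have "AE x in \<sigma>. x \<notin> S \<inter> ball x0 e"
      by (intro eventually_mono[OF assms(1)]) auto
    then have "emeasure \<sigma> (S \<inter> ball x0 e) = 0"
      by (subst (asm) AE_iff_measurable[OF _ refl]) (auto simp: sets_\<sigma>_iff Int_def conj_commute)
    then show False using ball_pos assms by blast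
  qed
  then show thesis using that by blast
qed

lemma ring_indep:
  assumes "norm e = 1" "norm e' = 1"
  shows "emeasure \<sigma> {x\<in>S. x \<bullet> e = s} = emeasure \<sigma> {x\<in>S. x \<bullet> e' = s}"
proof -
  have m: "{x\<in>S. x \<bullet> e = s} \<in> sets \<sigma>"
    using measurable_sets[OF ident_measurable, of "{x. x \<bullet> e = s}"]
    by (simp add: vimage_def Int_def conj_commute)
  have "refl_along (e - e') -` {x\<in>S. x \<bullet> e = s} \<inter> S = {x\<in>S. x \<bullet> e' = s}"
    using refl_along_swap[of e e'] assms by (auto simp: refl_along_inner_swap)
  then show ?thesis using emeasure_orth[OF orthogonal_refl_along m, of "e - e'"] by (simp only:)
qed

text \<open>Consider the pairs of a point \<open>x\<close> of the sphere and a vector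
  \<open>v\<close> with \<open>x \<bullet> v = s * norm v\<close>. For fixed \<open>x\<close> the
  admissible \<open>v\<close> form a null cone, so by Fubini for almost every \<open>v\<close> the
  ring around the direction of \<open>v\<close> is null. By invariance all rings of this height have
  the same measure.\<close>

lemma ring_null_nonneg:
  assumes e: "norm e = 1" and s: "0 \<le> s"
  shows "emeasure \<sigma> {x\<in>S. x \<bullet> e = s} = 0"
proof -
  interpret P: pair_sigma_finite \<sigma> "lborel :: (real^'n) measure" ..
  let ?N = "{p \<in> space (\<sigma> \<Otimes>\<^sub>M lborel). fst p \<bullet> snd p = s * norm (snd p)}"
  have N: "?N \<in> sets (\<sigma> \<Otimes>\<^sub>M (lborel :: (real^'n) measure))" by measurable
  have D: "2 \<le> DIM(real^'n)" using card_n by simp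
  have "emeasure (\<sigma> \<Otimes>\<^sub>M lborel) ?N = (\<integral>\<^sup>+x. emeasure lborel (Pair x -` ?N) \<partial>\<sigma>)"
    by (rule lborel.emeasure_pair_measure_alt[OF N])
  also have "\<dots> = (\<integral>\<^sup>+x. 0 \<partial>\<sigma>)"
  proof (rule nn_integral_cong)
    fix x assume "x \<in> space \<sigma>"
    then have x: "x \<in> S" by simp
    have "Pair x -` ?N = {v. x \<bullet> v = s * norm v}" using x by (auto simp: space_pair_measure)
    moreover have "emeasure lebesgue {v. x \<bullet> v = s * norm v} = 0"
      using negligible_cone[OF _ s D, of x] x by (simp add: negligible_iff_emeasure0 negligible_iff_null_sets null_setsD1)
    moreover have "{v. x \<bullet> v = s * norm v} \<in> sets lborel" by measurable
    ultimately show "emeasure lborel (Pair x -` ?N) = 0" by (simp add: emeasure_completion)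
  qed
  finally have "emeasure (\<sigma> \<Otimes>\<^sub>M lborel) ?N = 0" by simp
  then have "(\<integral>\<^sup>+v. emeasure \<sigma> ((\<lambda>x. (x, v)) -` ?N) \<partial>lborel) = 0"
    using P.emeasure_pair_measure_alt2[OF N] by simp
  moreover have "(\<lambda>v. emeasure \<sigma> ((\<lambda>x. (x, v)) -` ?N)) \<in> borel_measurable lborel"
    by (rule P.measurable_emeasure_Pair2[OF N])
  ultimately have "AE v in lborel. emeasure \<sigma> ((\<lambda>x. (x, v)) -` ?N) = 0"
    by (simp add: nn_integral_0_iff_AE)
  moreover have "AE v in lborel. v \<noteq> (0 :: real^'n)"
    by (rule AE_lborel_singleton)
  ultimately have "AE v in (lborel :: (real^'n) measure). emeasure \<sigma> ((\<lambda>x. (x, v)) -` ?N) = 0 \<and> v \<noteq> 0"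
    by eventually_elim simp
  moreover have "ae_filter (lborel :: (real^'n) measure) \<noteq> bot"
    by (simp add: ae_filter_eq_bot_iff)
  ultimately obtain v where v: "emeasure \<sigma> ((\<lambda>x. (x, v)) -` ?N) = 0" "v \<noteq> 0"
    using eventually_happens' by blast
  have "(\<lambda>x. (x, v)) -` ?N = {x\<in>S. x \<bullet> (v /\<^sub>R norm v) = s}"
    using v(2) by (auto simp: space_pair_measure field_simps)
  then show ?thesis using v ring_indep[OF e, of "v /\<^sub>R norm v" s] by simp
qed

lemma ring_null:
  assumes e: "norm e = 1"
  shows "emeasure \<sigma> {x\<in>S. x \<bullet> e = s} = 0"
proof (cases "0 \<le> s")
  case False
  have "{x\<in>S. x \<bullet> e = s} = {x\<in>S. x \<bullet> (- e) = - s}" by auto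
  then show ?thesis using ring_null_nonneg[of "- e" "- s"] e False by simp
qed (use ring_null_nonneg[OF e] in auto)

lemma AE_ring:
  assumes "norm e = 1"
  shows "AE x in \<sigma>. x \<bullet> e \<noteq> s"
  by (rule AE_I[OF _ ring_null[OF assms, of s]]) (auto simp: sets_\<sigma>_iff)

lemma AE_neq_point:
  assumes "norm e = 1"
  shows "AE x in \<sigma>. x \<noteq> e"
  using AE_ring[OF assms, of 1] by eventually_elim (use assms in \<open>auto simp: norm_eq_1\<close>)

end

section \<open>Second differences, coordinate rotations and differentiation under the
  integral\<close>

lemma second_difference_taylor:
  fixes g :: "real \<Rightarrow> real"
  assumes "0 < \<theta>" and g1: "\<And>t. \<bar>t\<bar> \<le> \<theta> \<Longrightarrow> (g has_real_derivative g' t) (at t)"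
    and g2: "\<And>t. \<bar>t\<bar> \<le> \<theta> \<Longrightarrow> (g' has_real_derivative g'' t) (at t)"
  obtains \<xi> where "0 < \<xi>" "\<xi> < \<theta>" "g \<theta> + g (- \<theta>) - 2 * g 0 = (g'' \<xi> + g'' (- \<xi>)) / 2 * \<theta>\<^sup>2"
proof -
  \<comment> \<open>The symmetric second difference vanishes at 0 together with its first
    derivative, so Maclaurin's formula of order 2 consists of the remainder alone.\<close>
  define h where "h t = g t + g (- t) - 2 * g 0" for t
  define d where "d m = (if m = 0 then h else if m = 1 then (\<lambda>t. g' t - g' (- t)) else (\<lambda>t. g'' t + g'' (- t)))" for m :: nat
  have "\<exists>t. 0 < t \<and> t < \<theta> \<and> h \<theta> = (\<Sum>m<2. d m 0 / fact m * \<theta> ^ m) + d 2 t / fact 2 * \<theta> ^ 2"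
  proof (rule Maclaurin[OF \<open>0 < \<theta>\<close>])
    have "DERIV (d m) t :> d (Suc m) t" if "m < 2" "0 \<le> t" "t \<le> \<theta>" for m t
    proof -
      have n1: "((\<lambda>t. g (- t)) has_real_derivative - g' (- t)) (at t)"
        using DERIV_mirror[of g "g' (-t)" t] g1[of "- t"] that by simp
      have n2: "((\<lambda>t. g' (- t)) has_real_derivative - g'' (- t)) (at t)"
        using DERIV_mirror[of g' "g'' (-t)" t] g2[of "- t"] that by simp
      consider "m = 0" | "m = 1" using \<open>m < 2\<close> by linarith
      then show ?thesis
      proof cases
        case 1
        then show ?thesis unfolding d_def h_def
          using g1[of t] n1 that by (auto intro!: derivative_eq_intros)
      next
        case 2
        then show ?thesis unfolding d_def
          using g2[of t] n2 that by (auto intro!: derivative_eq_intros)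
      qed
    qed
    then show "\<forall>m t. m < 2 \<and> 0 \<le> t \<and> t \<le> \<theta> \<longrightarrow> DERIV (d m) t :> d (Suc m) t" by blast
  qed (auto simp: d_def)
  then obtain t where t: "0 < t" "t < \<theta>" "h \<theta> = (\<Sum>m<2. d m 0 / fact m * \<theta> ^ m) + d 2 t / fact 2 * \<theta> ^ 2" by blast
  have "(\<Sum>m<2. d m 0 / fact m * \<theta> ^ m) = 0"
    by (simp add: d_def h_def numeral_2_eq_2)
  then show thesis using that[of t] t by (simp add: h_def d_def)
qed

text \<open>The rotation by \<open>\<theta>\<close> in the plane of the coordinates \<open>i\<close>
  and \<open>j\<close>, written as a perturbation of the identity. It is orthogonal for
  \<open>i \<noteq> j\<close>.\<close>

definition rot :: "'n \<Rightarrow> 'n \<Rightarrow> real \<Rightarrow> real^'n \<Rightarrow> real^'n::finite" where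
  "rot i j \<theta> y = y + ((cos \<theta> - 1) * y $ i - sin \<theta> * y $ j) *\<^sub>R axis i 1
      + (sin \<theta> * y $ i + (cos \<theta> - 1) * y $ j) *\<^sub>R axis j 1"

lemma inner_rot:
  "x \<bullet> rot i j \<theta> y = x \<bullet> y + (cos \<theta> - 1) * (x $ i * y $ i + x $ j * y $ j) + sin \<theta> * (x $ j * y $ i - x $ i * y $ j)"
  by (simp add: rot_def inner_add_right inner_axis algebra_simps)

lemma rot_component:
  "rot i j \<theta> y $ l = y $ l + ((cos \<theta> - 1) * y $ i - sin \<theta> * y $ j) * (if l = i then 1 else 0)
     + (sin \<theta> * y $ i + (cos \<theta> - 1) * y $ j) * (if l = j then 1 else 0)"
  by (simp add: rot_def axis_def)

lemma orthogonal_rot: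
  assumes "i \<noteq> j" shows "orthogonal_transformation (rot i j \<theta>)"
proof -
  have "linear (rot i j \<theta>)"
    by (rule linearI) (auto simp: rot_def algebra_simps)
  moreover have "rot i j \<theta> x \<bullet> rot i j \<theta> y = x \<bullet> y" for x y
  proof -
    have "cos \<theta> * cos \<theta> = 1 - sin \<theta> * sin \<theta>"
      using sin_cos_squared_add[of \<theta>] by (simp add: power2_eq_square)
    then have c: "cos \<theta> * (cos \<theta> * z) = z - sin \<theta> * (sin \<theta> * z)" for z
      by (metis mult.assoc left_diff_distrib mult_1)
    show ?thesis using assms
      unfolding inner_rot by (simp add: inner_commute[of "rot i j \<theta> x"] inner_rot rot_component algebra_simps c inner_commute[of y x])
  qed
  ultimately show ?thesis by (simp add: orthogonal_transformation_def)
qed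

lemma rot_inverse:
  assumes "i \<noteq> j" shows "rot i j (- \<theta>) (rot i j \<theta> y) = y"
proof -
  have "w \<bullet> rot i j (- \<theta>) (rot i j \<theta> y) = w \<bullet> y" for w
  proof -
    have "cos \<theta> * cos \<theta> = 1 - sin \<theta> * sin \<theta>"
      using sin_cos_squared_add[of \<theta>] by (simp add: power2_eq_square)
    then have c: "cos \<theta> * (cos \<theta> * z) = z - sin \<theta> * (sin \<theta> * z)" for z
      by (metis mult.assoc left_diff_distrib mult_1)
    show ?thesis using assms
      unfolding inner_rot by (simp add: rot_component algebra_simps c)
  qed
  then show ?thesis by (metis vector_eq_rdot inner_commute)
qed

lemma deriv_integral_dominated:
  fixes f f' :: "real \<Rightarrow> 'a \<Rightarrow> real"
  assumes int: "\<And>t. t \<in> {c..d} \<Longrightarrow> integrable M (f t)"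
    and m': "f' t \<in> borel_measurable M"
    and d: "\<And>t y. t \<in> {c..d} \<Longrightarrow> y \<in> space M \<Longrightarrow> ((\<lambda>t. f t y) has_real_derivative f' t y) (at t)"
    and B: "\<And>t y. t \<in> {c..d} \<Longrightarrow> y \<in> space M \<Longrightarrow> \<bar>f' t y\<bar> \<le> w y" "integrable M w"
    and t: "c < t" "t < d"
  shows "((\<lambda>t. \<integral>y. f t y \<partial>M) has_real_derivative (\<integral>y. f' t y \<partial>M)) (at t)"
proof -
  have "((\<lambda>s. ((\<integral>y. f s y \<partial>M) - (\<integral>y. f t y \<partial>M)) / (s - t)) \<longlongrightarrow> (\<integral>y. f' t y \<partial>M)) (at t within {c..d})"
  proof (unfold tendsto_at_iff_sequentially, intro allI impI)
    fix X assume X: "\<forall>i. X i \<in> {c..d} - {t}" "X \<longlonglongrightarrow> t"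
    let ?g = "\<lambda>i y. (f (X i) y - f t y) / (X i - t)"
    have tc: "t \<in> {c..d}" using t by auto
    have "(\<lambda>i. \<integral>y. ?g i y \<partial>M) \<longlonglongrightarrow> (\<integral>y. f' t y \<partial>M)"
    proof (rule integral_dominated_convergence[where w = w])
      show "?g i \<in> borel_measurable M" for i
        using int[of "X i"] int[OF tc] X by simp
      show "AE y in M. (\<lambda>i. ?g i y) \<longlonglongrightarrow> f' t y"
      proof (rule AE_I2)
        fix y assume "y \<in> space M"
        then have "((\<lambda>s. (f s y - f t y) / (s - t)) \<longlongrightarrow> f' t y) (at t)"
          using d[OF tc, of y] by (simp add: has_field_derivative_iff)
        then show "(\<lambda>i. ?g i y) \<longlonglongrightarrow> f' t y"
          using X unfolding tendsto_at_iff_sequentially by (auto simp: o_def)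
      qed
      show "AE y in M. norm (?g i y) \<le> w y" for i
      proof (rule AE_I2)
        fix y assume y: "y \<in> space M"
        have "norm (f (X i) y - f t y) \<le> w y * norm (X i - t)"
          by (rule field_differentiable_bound[of "{c..d}" "\<lambda>t. f t y" "\<lambda>t. f' t y"])
             (use X tc B y d in \<open>auto intro: has_field_derivative_at_within\<close>)
        then show "norm (?g i y) \<le> w y"
          using X by (simp add: divide_simps abs_divide)
      qed
    qed (use m' B in auto)
    then show "((\<lambda>s. ((\<integral>y. f s y \<partial>M) - (\<integral>y. f t y \<partial>M)) / (s - t)) \<circ> X) \<longlonglongrightarrow> (\<integral>y. f' t y \<partial>M)"
      using int X int[OF tc] by (simp add: o_def)
  qed
  moreover have "at t within {c..d} = at t"
    using t by (intro at_within_interior) auto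
  ultimately show ?thesis by (simp add: has_field_derivative_iff)
qed

context sphere_space
begin

subsection \<open>The kernels\<close>

definition a :: real where "a = (real CARD('n) - 2) / 2"

lemma a_pos: "0 < a" using card_n by (simp add: a_def)

text \<open>For unit vectors, \<open>|r x - z|\<^sup>2\<^sup>-\<^sup>n = r\<^sup>-\<^sup>a kap (ln r) (x \<bullet> z)\<close>. The kernel \<open>poi t\<close> is, up to the
  normalising factor \<open>1 / V\<close> and a power of \<open>exp t\<close>, the Poisson kernel of the unit ball at radius
  \<open>exp (- t)\<close>; it is also \<open>- 1 / a\<close> times the derivative of \<open>kap t\<close> in \<open>t\<close>.\<close>

definition kap :: "real \<Rightarrow> real \<Rightarrow> real" where
  "kap t u = (2 * cosh t - 2 * u) powr (- a)"

definition poi :: "real \<Rightarrow> real \<Rightarrow> real" where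
  "poi t u = 2 * sinh t * (2 * cosh t - 2 * u) powr (- a - 1)"

definition kap_tt :: "real \<Rightarrow> real \<Rightarrow> real" where
  "kap_tt t u = 4 * a * (a + 1) * (sinh t)\<^sup>2 * (2 * cosh t - 2 * u) powr (- a - 2)
      - 2 * a * cosh t * (2 * cosh t - 2 * u) powr (- a - 1)"

definition kap_u :: "real \<Rightarrow> real \<Rightarrow> real" where
  "kap_u t u = 2 * a * (2 * cosh t - 2 * u) powr (- a - 1)"

definition kap_uu :: "real \<Rightarrow> real \<Rightarrow> real" where
  "kap_uu t u = 4 * a * (a + 1) * (2 * cosh t - 2 * u) powr (- a - 2)"

lemma cosh_gt_1: "t \<noteq> 0 \<Longrightarrow> 1 < cosh (t::real)"
  using cosh_real_nonneg_less_iff[of 0 "\<bar>t\<bar>"] by simp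

lemma gap_pos: "t \<noteq> 0 \<Longrightarrow> u \<le> 1 \<Longrightarrow> 0 < 2 * cosh t - 2 * (u::real)"
  using cosh_gt_1[of t] by simp

lemma kap_deriv_t:
  assumes "t \<noteq> 0" "u \<le> 1"
  shows "((\<lambda>t. kap t u) has_real_derivative - a * poi t u) (at t)"
  unfolding kap_def poi_def using gap_pos[OF assms]
  by (auto intro!: derivative_eq_intros DERIV_fun_powr simp: algebra_simps)

lemma kap_deriv_tt:
  assumes "t \<noteq> 0" "u \<le> 1"
  shows "((\<lambda>t. - a * poi t u) has_real_derivative kap_tt t u) (at t)"
  unfolding kap_tt_def poi_def using gap_pos[OF assms]
  by (auto intro!: derivative_eq_intros DERIV_fun_powr simp: algebra_simps power2_eq_square)

lemma kap_deriv_u: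
  assumes "0 < 2 * cosh t - 2 * u"
  shows "((\<lambda>u. kap t u) has_real_derivative kap_u t u) (at u)"
  unfolding kap_def kap_u_def using assms
  by (auto intro!: derivative_eq_intros DERIV_fun_powr simp: algebra_simps)

lemma kap_deriv_uu:
  assumes "0 < 2 * cosh t - 2 * u"
  shows "((\<lambda>u. kap_u t u) has_real_derivative kap_uu t u) (at u)"
  unfolding kap_u_def kap_uu_def using assms
  by (auto intro!: derivative_eq_intros DERIV_fun_powr simp: algebra_simps)

text \<open>Laplace's equation for the Riesz kernel. With \<open>t = ln r\<close> and the factor
  \<open>r powr (- a)\<close> removed, the Laplacian of n-space becomes, up to a factor, the second
  derivative in \<open>t\<close> minus \<open>a\<^sup>2\<close> plus the Laplacian of the sphere;
  the latter acts on functions of \<open>u\<close> as the left side, because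
  \<open>2 * a + 1 = n - 1\<close>.\<close>

lemma wave_equation:
  assumes "0 < 2 * cosh t - 2 * u"
  shows "(1 - u\<^sup>2) * kap_uu t u - (2 * a + 1) * u * kap_u t u = a\<^sup>2 * kap t u - kap_tt t u"
proof -
  let ?D = "2 * cosh t - 2 * u"
  have p1: "?D powr (- a - 1) = ?D * ?D powr (- a - 2)"
  proof -
    have "?D powr (1 + (- a - 2)) = ?D * ?D powr (- a - 2)"
      using assms by (subst powr_add) simp
    moreover have "1 + (- a - 2) = - a - 1" by simp
    ultimately show ?thesis by metis
  qed
  have p0: "?D powr (- a) = ?D * (?D * ?D powr (- a - 2))"
  proof -
    have "?D powr (1 + (- a - 1)) = ?D * ?D powr (- a - 1)"
      using assms by (subst powr_add) simp
    moreover have "1 + (- a - 1) = - a" by simp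
    ultimately show ?thesis using p1 by metis
  qed
  have s: "(sinh t)\<^sup>2 = (cosh t)\<^sup>2 - 1" using cosh_square_eq[of t] by simp
  show ?thesis
    unfolding kap_def kap_u_def kap_uu_def kap_tt_def p0 p1 s
    by (simp add: algebra_simps power2_eq_square)
qed

lemma gap_pos_prod:
  assumes "0 < c" "p \<in> {c..} \<times> {..1}"
  shows "2 * cosh (fst p) - 2 * snd p \<noteq> (0::real)"
proof -
  have "fst p \<noteq> 0" "snd p \<le> 1" using assms by auto
  from gap_pos[OF this] show ?thesis by simp
qed

lemma kap_cont: "continuous_on ({c..} \<times> {..1}) (\<lambda>(t, u). kap t u)" if "0 < c" for c
  unfolding kap_def case_prod_beta
  by (intro continuous_intros ballI gap_pos_prod[OF that])

lemma poi_cont: "continuous_on ({c..} \<times> {..1}) (\<lambda>(t, u). poi t u)" if "0 < c" for c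
  unfolding poi_def case_prod_beta
  by (intro continuous_intros ballI gap_pos_prod[OF that])

lemma kap_tt_cont: "continuous_on ({c..} \<times> {..1}) (\<lambda>(t, u). kap_tt t u)" if "0 < c" for c
  unfolding kap_tt_def case_prod_beta
  by (intro continuous_intros ballI gap_pos_prod[OF that])

lemma inner_le_1: "x \<in> S \<Longrightarrow> y \<in> S \<Longrightarrow> x \<bullet> y \<le> 1"
  using norm_cauchy_schwarz[of x y] by simp

lemma abs_inner_le_1: "x \<in> S \<Longrightarrow> y \<in> S \<Longrightarrow> \<bar>x \<bullet> y\<bar> \<le> 1"
  using Cauchy_Schwarz_ineq2[of x y] by simp

lemma deriv_integral:
  fixes f f' :: "real \<Rightarrow> real^'n \<Rightarrow> real"
  assumes c: "continuous_on ({c..d} \<times> S) (\<lambda>(t, y). f t y)"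
    and c': "continuous_on ({c..d} \<times> S) (\<lambda>(t, y). f' t y)"
    and d: "\<And>t y. t \<in> {c..d} \<Longrightarrow> y \<in> S \<Longrightarrow> ((\<lambda>t. f t y) has_real_derivative f' t y) (at t)"
    and t: "c < t" "t < d"
  shows "((\<lambda>t. \<integral>y. f t y \<partial>\<sigma>) has_real_derivative (\<integral>y. f' t y \<partial>\<sigma>)) (at t)"
proof -
  have "compact ((\<lambda>(t, y). f' t y) ` ({c..d} \<times> S))"
    by (intro compact_continuous_image c' compact_Times) auto
  then obtain B where B: "\<And>t y. t \<in> {c..d} \<Longrightarrow> y \<in> S \<Longrightarrow> \<bar>f' t y\<bar> \<le> B"
    using compact_imp_bounded bounded_iff by (metis (mono_tags, lifting) SigmaI case_prod_conv imageI real_norm_def)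
  have slice: "continuous_on S (\<lambda>y. g t y)" if "continuous_on ({c..d} \<times> S) (\<lambda>(t, y). g t y)" "t \<in> {c..d}" for g :: "real \<Rightarrow> real^'n \<Rightarrow> real" and t
  proof -
    have "continuous_on S ((\<lambda>(t, y). g t y) \<circ> (\<lambda>y. (t, y)))"
      by (intro continuous_on_compose continuous_intros continuous_on_subset[OF that(1)]) (use that(2) in auto)
    then show ?thesis by (simp add: o_def)
  qed
  show ?thesis
  proof (rule deriv_integral_dominated[where c = c and d = d and w = "\<lambda>_. B"])
    show "f' t \<in> borel_measurable \<sigma>"
      using t by (intro measurable_continuous_on_S slice[OF c']) auto
  qed (use c slice d B t integrable_continuous_on_S in auto)
qed

end

subsection \<open>Green's identity by second differences along rotations\<close>

text \<open>As a function of \<open>\<theta>\<close>, \<open>x \<bullet> rot i j \<theta> y\<close>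
  has at 0 the first derivative \<open>rot_B\<close> and the second derivative
  \<open>- rot_A\<close>; see \<open>inner_rot'\<close>.\<close>

definition rot_A :: "real^'n \<Rightarrow> real^'n \<Rightarrow> 'n \<Rightarrow> 'n \<Rightarrow> real" where
  "rot_A x y i j = x $ i * y $ i + x $ j * y $ j"

definition rot_B :: "real^'n \<Rightarrow> real^'n \<Rightarrow> 'n \<Rightarrow> 'n \<Rightarrow> real" where
  "rot_B x y i j = x $ j * y $ i - x $ i * y $ j"

lemma inner_rot':
  "x \<bullet> rot i j \<theta> y = x \<bullet> y + (cos \<theta> - 1) * rot_A x y i j + sin \<theta> * rot_B x y i j"
  by (simp add: inner_rot rot_A_def rot_B_def)

text \<open>Lagrange's identity. Pairs are ordered, so every plane is counted twice, which explains
  the factor 2 here and in \<open>sum_rot_A\<close>.\<close>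

lemma sum_rot_B:
  fixes x y :: "real^'n::finite"
  shows "(\<Sum>(i, j)\<in>{(i, j). i \<noteq> j}. (rot_B x y i j)\<^sup>2) = 2 * ((x \<bullet> x) * (y \<bullet> y) - (x \<bullet> y)\<^sup>2)"
proof -
  have "(\<Sum>(i, j)\<in>{(i, j). i \<noteq> j}. (rot_B x y i j)\<^sup>2) = (\<Sum>(i, j)\<in>UNIV. (rot_B x y i j)\<^sup>2)"
    by (rule sum.mono_neutral_left) (auto simp: rot_B_def)
  also have "\<dots> = (\<Sum>i\<in>UNIV. \<Sum>j\<in>UNIV. (rot_B x y i j)\<^sup>2)"
    by (simp add: sum.cartesian_product UNIV_Times_UNIV)
  also have "\<dots> = (\<Sum>i\<in>UNIV. \<Sum>j\<in>UNIV. (x$j * x$j) * (y$i * y$i)) + (\<Sum>i\<in>UNIV. \<Sum>j\<in>UNIV. (x$i * x$i) * (y$j * y$j))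
      - 2 * (\<Sum>i\<in>UNIV. \<Sum>j\<in>UNIV. (x$i * y$i) * (x$j * y$j))"
    by (simp add: rot_B_def power2_eq_square algebra_simps sum.distrib sum_subtractf sum_distrib_left)
  also have "(\<Sum>i\<in>UNIV. \<Sum>j\<in>UNIV. (x$i * x$i) * (y$j * y$j)) = (x \<bullet> x) * (y \<bullet> y)"
    by (simp add: inner_vec_def sum_product)
  also have "(\<Sum>i\<in>UNIV. \<Sum>j\<in>UNIV. (x$j * x$j) * (y$i * y$i)) = (x \<bullet> x) * (y \<bullet> y)"
    by (subst sum.swap) (simp add: inner_vec_def sum_product)
  also have "(\<Sum>i\<in>UNIV. \<Sum>j\<in>UNIV. (x$i * y$i) * (x$j * y$j)) = (x \<bullet> y)\<^sup>2"
    by (simp add: inner_vec_def sum_product power2_eq_square)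
  finally show ?thesis by simp
qed

lemma sum_rot_A:
  fixes x y :: "real^'n::finite"
  shows "(\<Sum>(i, j)\<in>{(i, j). i \<noteq> j}. rot_A x y i j) = 2 * (real CARD('n) - 1) * (x \<bullet> y)"
proof -
  have split: "UNIV = {(i, j). i \<noteq> j} \<union> (\<lambda>i. (i, i)) ` (UNIV :: 'n set)" by auto
  have "(\<Sum>(i, j)\<in>UNIV. rot_A x y i j) = (\<Sum>(i, j)\<in>{(i, j). i \<noteq> j}. rot_A x y i j) + (\<Sum>(i, j)\<in>(\<lambda>i. (i, i)) ` (UNIV :: 'n set). rot_A x y i j)"
    unfolding split by (rule sum.union_disjoint) auto
  moreover have "(\<Sum>(i, j)\<in>(\<lambda>i. (i, i)) ` (UNIV :: 'n set). rot_A x y i j) = 2 * (x \<bullet> y)"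
    by (subst sum.reindex) (auto simp: inj_on_def rot_A_def inner_vec_def sum_distrib_left)
  moreover have "(\<Sum>(i, j)\<in>UNIV. rot_A x y i j) = (\<Sum>i\<in>UNIV. \<Sum>j\<in>UNIV. rot_A x y i j)"
    by (simp add: sum.cartesian_product UNIV_Times_UNIV)
  moreover have "\<dots> = 2 * real CARD('n) * (x \<bullet> y)"
    by (simp add: rot_A_def inner_vec_def sum.distrib sum_distrib_left mult_ac)
  ultimately show ?thesis by (simp add: algebra_simps)
qed

lemma rot_zero: "rot i j 0 y = y"
  by (simp add: rot_def)

lemma second_difference_rot:
  fixes x y :: "real^'n::finite"
  assumes x: "norm x = 1" and y: "norm y = 1" and "0 < \<theta>"
    and m: "\<And>t. \<bar>t\<bar> \<le> \<theta> \<Longrightarrow> x \<bullet> rot i j t y \<in> U"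
    and d1: "\<And>u. u \<in> U \<Longrightarrow> (\<phi> has_real_derivative \<phi>' u) (at u)"
    and d2: "\<And>u. u \<in> U \<Longrightarrow> (\<phi>' has_real_derivative \<phi>'' u) (at u)"
  obtains \<xi> where "0 < \<xi>" "\<xi> < \<theta>"
    "\<phi> (x \<bullet> rot i j \<theta> y) + \<phi> (x \<bullet> rot i j (- \<theta>) y) - 2 * \<phi> (x \<bullet> y) =
     ((\<phi>'' (x \<bullet> rot i j \<xi> y) * (- sin \<xi> * rot_A x y i j + cos \<xi> * rot_B x y i j)\<^sup>2
        + \<phi>' (x \<bullet> rot i j \<xi> y) * (- cos \<xi> * rot_A x y i j - sin \<xi> * rot_B x y i j))
     + (\<phi>'' (x \<bullet> rot i j (- \<xi>) y) * (sin \<xi> * rot_A x y i j + cos \<xi> * rot_B x y i j)\<^sup>2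
        + \<phi>' (x \<bullet> rot i j (- \<xi>) y) * (- cos \<xi> * rot_A x y i j + sin \<xi> * rot_B x y i j))) / 2 * \<theta>\<^sup>2"
proof -
  let ?A = "rot_A x y i j" and ?B = "rot_B x y i j"
  let ?u = "\<lambda>t. x \<bullet> rot i j t y"
  let ?g = "\<lambda>t. \<phi> (?u t)"
  let ?g' = "\<lambda>t. \<phi>' (?u t) * (- sin t * ?A + cos t * ?B)"
  let ?g'' = "\<lambda>t. \<phi>'' (?u t) * (- sin t * ?A + cos t * ?B)\<^sup>2 + \<phi>' (?u t) * (- cos t * ?A - sin t * ?B)"
  have u: "(?u has_real_derivative - sin t * ?A + cos t * ?B) (at t)" for t
    unfolding inner_rot' by (auto intro!: derivative_eq_intros)
  have g: "(?g has_real_derivative ?g' t) (at t)" if "\<bar>t\<bar> \<le> \<theta>" for t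
    using DERIV_chain2[OF d1[OF m[OF that]] u] by simp
  have gp: "((\<lambda>t. \<phi>' (?u t)) has_real_derivative \<phi>'' (?u t) * (- sin t * ?A + cos t * ?B)) (at t)" if "\<bar>t\<bar> \<le> \<theta>" for t
    using DERIV_chain2[OF d2[OF m[OF that]] u] by simp
  have g': "(?g' has_real_derivative ?g'' t) (at t)" if "\<bar>t\<bar> \<le> \<theta>" for t
  proof -
    have v: "((\<lambda>t. - sin t * ?A + cos t * ?B) has_real_derivative (- cos t * ?A - sin t * ?B)) (at t)"
      by (auto intro!: derivative_eq_intros)
    show ?thesis using DERIV_mult[OF gp[OF that] v] by (simp add: power2_eq_square algebra_simps)
  qed
  obtain \<xi> where xi: "0 < \<xi>" "\<xi> < \<theta>" "?g \<theta> + ?g (- \<theta>) - 2 * ?g 0 = (?g'' \<xi> + ?g'' (- \<xi>)) / 2 * \<theta>\<^sup>2"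
    by (rule second_difference_taylor[OF \<open>0 < \<theta>\<close> g g'])
  show thesis
    by (rule that[OF xi(1,2)]) (use xi(3) in \<open>simp add: rot_zero\<close>)
qed

lemma abs_rot_A: "norm x = 1 \<Longrightarrow> norm y = 1 \<Longrightarrow> \<bar>rot_A x y i j\<bar> \<le> 2"
  for x y :: "real^'n::finite"
proof -
  assume "norm x = 1" "norm y = 1"
  then have c: "\<bar>x $ k\<bar> \<le> 1" "\<bar>y $ k\<bar> \<le> 1" for k
    using component_le_norm_cart[of x k] component_le_norm_cart[of y k] by auto
  have "\<bar>x $ k * y $ k\<bar> \<le> 1 * 1" for k unfolding abs_mult by (intro mult_mono c) auto
  from this[of i] this[of j] show ?thesis unfolding rot_A_def by linarith
qed

lemma abs_rot_B: "norm x = 1 \<Longrightarrow> norm y = 1 \<Longrightarrow> \<bar>rot_B x y i j\<bar> \<le> 2"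
  for x y :: "real^'n::finite"
proof -
  assume "norm x = 1" "norm y = 1"
  then have c: "\<bar>x $ k\<bar> \<le> 1" "\<bar>y $ k\<bar> \<le> 1" for k
    using component_le_norm_cart[of x k] component_le_norm_cart[of y k] by auto
  have "\<bar>x $ k * y $ l\<bar> \<le> 1 * 1" for k l unfolding abs_mult by (intro mult_mono c) auto
  from this[of j i] this[of i j] show ?thesis unfolding rot_B_def by linarith
qed

definition sdiff :: "'n \<Rightarrow> 'n \<Rightarrow> (real \<Rightarrow> real) \<Rightarrow> real \<Rightarrow> real^'n \<Rightarrow> real^'n::finite \<Rightarrow> real" where
  "sdiff i j \<phi> \<theta> x y = (\<phi> (x \<bullet> rot i j \<theta> y) + \<phi> (x \<bullet> rot i j (- \<theta>) y) - 2 * \<phi> (x \<bullet> y)) / \<theta>\<^sup>2"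

text \<open>The constant is \<open>4\<^sup>2 + 4\<close>: since \<open>rot_A\<close> and
  \<open>rot_B\<close> are at most 2, both the first and the second derivative of the angle function
  are at most 4, the first of them entering squared. The two intermediate points are
  averaged.\<close>

lemma sdiff_bound:
  fixes x y :: "real^'n::finite"
  assumes x: "norm x = 1" and y: "norm y = 1" and th: "0 < \<theta>"
    and m: "\<And>t. \<bar>t\<bar> \<le> \<theta> \<Longrightarrow> x \<bullet> rot i j t y \<in> U"
    and d1: "\<And>u. u \<in> U \<Longrightarrow> (\<phi> has_real_derivative \<phi>' u) (at u)"
    and d2: "\<And>u. u \<in> U \<Longrightarrow> (\<phi>' has_real_derivative \<phi>'' u) (at u)"
    and b: "\<And>u. u \<in> U \<Longrightarrow> \<bar>\<phi>' u\<bar> \<le> C" "\<And>u. u \<in> U \<Longrightarrow> \<bar>\<phi>'' u\<bar> \<le> C"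
  shows "\<bar>sdiff i j \<phi> \<theta> x y\<bar> \<le> 20 * C"
proof -
  let ?A = "rot_A x y i j" and ?B = "rot_B x y i j"
  obtain \<xi> where xi: "0 < \<xi>" "\<xi> < \<theta>" and eq:
    "\<phi> (x \<bullet> rot i j \<theta> y) + \<phi> (x \<bullet> rot i j (- \<theta>) y) - 2 * \<phi> (x \<bullet> y) =
     ((\<phi>'' (x \<bullet> rot i j \<xi> y) * (- sin \<xi> * ?A + cos \<xi> * ?B)\<^sup>2
        + \<phi>' (x \<bullet> rot i j \<xi> y) * (- cos \<xi> * ?A - sin \<xi> * ?B))
     + (\<phi>'' (x \<bullet> rot i j (- \<xi>) y) * (sin \<xi> * ?A + cos \<xi> * ?B)\<^sup>2
        + \<phi>' (x \<bullet> rot i j (- \<xi>) y) * (- cos \<xi> * ?A + sin \<xi> * ?B))) / 2 * \<theta>\<^sup>2"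
    by (rule second_difference_rot[OF x y th m d1 d2])
  have b4: "\<bar>p * ?A + q * ?B\<bar> \<le> 4" if "\<bar>p\<bar> \<le> 1" "\<bar>q\<bar> \<le> 1" for p q
  proof -
    have "\<bar>p * ?A\<bar> \<le> 1 * 2" "\<bar>q * ?B\<bar> \<le> 1 * 2"
      unfolding abs_mult by (intro mult_mono that abs_rot_A abs_rot_B x y; simp)+
    then show ?thesis by linarith
  qed
  have C: "0 \<le> C" using b(1)[OF m[of 0]] th by (smt (verit))
  have e: "\<bar>\<phi>'' u * w\<^sup>2 + \<phi>' u * v\<bar> \<le> 20 * C" if "u \<in> U" "\<bar>w\<bar> \<le> 4" "\<bar>v\<bar> \<le> 4" for u w v
  proof -
    have "\<bar>w\<bar> * \<bar>w\<bar> \<le> 4 * 4" using that by (intro mult_mono) auto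
    then have "\<bar>\<phi>'' u\<bar> * (\<bar>w\<bar> * \<bar>w\<bar>) \<le> C * 16" by (intro mult_mono b that) (auto simp: C)
    moreover have "\<bar>\<phi>' u\<bar> * \<bar>v\<bar> \<le> C * 4" by (intro mult_mono b that) (auto simp: C)
    moreover have "\<bar>\<phi>'' u * w\<^sup>2 + \<phi>' u * v\<bar> \<le> \<bar>\<phi>'' u\<bar> * (\<bar>w\<bar> * \<bar>w\<bar>) + \<bar>\<phi>' u\<bar> * \<bar>v\<bar>"
      by (rule order_trans[OF abs_triangle_ineq]) (simp add: abs_mult power2_eq_square)
    ultimately show ?thesis by linarith
  qed
  have u: "x \<bullet> rot i j \<xi> y \<in> U" "x \<bullet> rot i j (- \<xi>) y \<in> U" using m xi by auto
  have s1: "\<bar>- sin \<xi> * ?A + cos \<xi> * ?B\<bar> \<le> 4" using b4[of "- sin \<xi>" "cos \<xi>"] by simp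
  have s2: "\<bar>- cos \<xi> * ?A - sin \<xi> * ?B\<bar> \<le> 4" using b4[of "- cos \<xi>" "- sin \<xi>"] by simp
  have s3: "\<bar>sin \<xi> * ?A + cos \<xi> * ?B\<bar> \<le> 4" using b4[of "sin \<xi>" "cos \<xi>"] by simp
  have s4: "\<bar>- cos \<xi> * ?A + sin \<xi> * ?B\<bar> \<le> 4" using b4[of "- cos \<xi>" "sin \<xi>"] by simp
  show ?thesis
    unfolding sdiff_def eq using th e[OF u(1) s1 s2] e[OF u(2) s3 s4] by simp
qed

lemma sdiff_limit:
  fixes x y :: "real^'n::finite"
  assumes x: "norm x = 1" and y: "norm y = 1" and del: "0 < \<delta>"
    and m: "\<And>t. \<bar>t\<bar> \<le> \<delta> \<Longrightarrow> x \<bullet> rot i j t y \<in> U"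
    and d1: "\<And>u. u \<in> U \<Longrightarrow> (\<phi> has_real_derivative \<phi>' u) (at u)"
    and d2: "\<And>u. u \<in> U \<Longrightarrow> (\<phi>' has_real_derivative \<phi>'' u) (at u)"
    and c: "\<And>u. u \<in> U \<Longrightarrow> isCont \<phi>'' u"
    and X: "\<And>n. 0 < X n" "X \<longlonglongrightarrow> 0"
  shows "(\<lambda>n. sdiff i j \<phi> (X n) x y) \<longlonglongrightarrow> \<phi>'' (x \<bullet> y) * (rot_B x y i j)\<^sup>2 - \<phi>' (x \<bullet> y) * rot_A x y i j"
proof -
  let ?A = "rot_A x y i j" and ?B = "rot_B x y i j"
  define G where "G t = \<phi>'' (x \<bullet> rot i j t y) * (- sin t * ?A + cos t * ?B)\<^sup>2
        + \<phi>' (x \<bullet> rot i j t y) * (- cos t * ?A - sin t * ?B)" for t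
  have ev: "eventually (\<lambda>n. X n \<le> \<delta>) sequentially"
    using order_tendstoD(2)[OF X(2) del] by eventually_elim simp
  have "\<exists>\<xi>. 0 < \<xi> \<and> \<xi> < X n \<and> sdiff i j \<phi> (X n) x y = (G \<xi> + G (- \<xi>)) / 2" if hn: "X n \<le> \<delta>" for n
  proof -
    obtain \<xi> where xi: "0 < \<xi>" "\<xi> < X n" and eq:
      "\<phi> (x \<bullet> rot i j (X n) y) + \<phi> (x \<bullet> rot i j (- X n) y) - 2 * \<phi> (x \<bullet> y) =
       ((\<phi>'' (x \<bullet> rot i j \<xi> y) * (- sin \<xi> * ?A + cos \<xi> * ?B)\<^sup>2
          + \<phi>' (x \<bullet> rot i j \<xi> y) * (- cos \<xi> * ?A - sin \<xi> * ?B))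
       + (\<phi>'' (x \<bullet> rot i j (- \<xi>) y) * (sin \<xi> * ?A + cos \<xi> * ?B)\<^sup>2
          + \<phi>' (x \<bullet> rot i j (- \<xi>) y) * (- cos \<xi> * ?A + sin \<xi> * ?B))) / 2 * (X n)\<^sup>2"
      by (rule second_difference_rot[OF x y X(1) m[OF order_trans[OF _ hn]] d1 d2])
    show ?thesis
      by (intro exI[of _ \<xi>]) (use X(1)[of n] xi in \<open>simp add: sdiff_def eq G_def\<close>)
  qed
  then obtain \<xi> where xi: "\<And>n. X n \<le> \<delta> \<Longrightarrow> 0 < \<xi> n \<and> \<xi> n < X n \<and> sdiff i j \<phi> (X n) x y = (G (\<xi> n) + G (- \<xi> n)) / 2"
    by metis
  have xi0: "\<xi> \<longlonglongrightarrow> 0"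
    by (rule tendsto_sandwich[OF _ _ tendsto_const X(2)]) (use ev xi in \<open>auto elim!: eventually_mono intro: less_imp_le\<close>)
  have cu: "isCont (\<lambda>t. x \<bullet> rot i j t y) 0"
    unfolding inner_rot' by (intro continuous_intros)
  have U0: "x \<bullet> rot i j 0 y \<in> U" using m[of 0] del by simp
  have G0: "G 0 = \<phi>'' (x \<bullet> y) * ?B\<^sup>2 - \<phi>' (x \<bullet> y) * ?A"
    by (simp add: G_def rot_zero)
  have "isCont G 0"
    unfolding G_def
    by (intro continuous_intros isCont_o2[OF cu] c[OF U0] DERIV_isCont[OF d2[OF U0]])
  then have "(\<lambda>n. G (\<xi> n)) \<longlonglongrightarrow> G 0" "(\<lambda>n. G (- \<xi> n)) \<longlonglongrightarrow> G 0"
    using isCont_tendsto_compose[of 0 G \<xi>] isCont_tendsto_compose[of 0 G "\<lambda>n. - \<xi> n"] xi0 tendsto_minus[OF xi0]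
    by simp_all
  then have "(\<lambda>n. (G (\<xi> n) + G (- \<xi> n)) / 2) \<longlonglongrightarrow> (G 0 + G 0) / 2"
    by (intro tendsto_divide tendsto_add tendsto_const) auto
  then have "(\<lambda>n. (G (\<xi> n) + G (- \<xi> n)) / 2) \<longlonglongrightarrow> \<phi>'' (x \<bullet> y) * ?B\<^sup>2 - \<phi>' (x \<bullet> y) * ?A"
    unfolding G0[symmetric] by simp
  moreover have "eventually (\<lambda>n. (G (\<xi> n) + G (- \<xi> n)) / 2 = sdiff i j \<phi> (X n) x y) sequentially"
    using ev by eventually_elim (use xi in auto)
  ultimately show ?thesis by (rule Lim_transform_eventually)
qed

context sphere_space
begin

text \<open>The Laplace--Beltrami operator of the sphere on functions of \<open>u = x \<bullet> y\<close>.\<close>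

definition lap :: "(real \<Rightarrow> real) \<Rightarrow> (real \<Rightarrow> real) \<Rightarrow> real \<Rightarrow> real" where
  "lap \<phi>' \<phi>'' u = (1 - u\<^sup>2) * \<phi>'' u - (2 * a + 1) * u * \<phi>' u"

text \<open>The Laplace-Beltrami operator is the sum of the squared infinitesimal rotations over all
  coordinate planes; ordered pairs give it twice.\<close>

lemma sum_sdiff_limit:
  assumes "x \<in> S" "y \<in> S"
  shows "(\<Sum>(i, j)\<in>{(i, j). i \<noteq> j}. \<phi>'' (x \<bullet> y) * (rot_B x y i j)\<^sup>2 - \<phi>' (x \<bullet> y) * rot_A x y i j) = 2 * lap \<phi>' \<phi>'' (x \<bullet> y)"
proof -
  have "(\<Sum>(i, j)\<in>{(i, j). i \<noteq> j}. \<phi>'' (x \<bullet> y) * (rot_B x y i j)\<^sup>2 - \<phi>' (x \<bullet> y) * rot_A x y i j)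
    = \<phi>'' (x \<bullet> y) * (\<Sum>(i, j)\<in>{(i, j). i \<noteq> j}. (rot_B x y i j)\<^sup>2) - \<phi>' (x \<bullet> y) * (\<Sum>(i, j)\<in>{(i, j). i \<noteq> j}. rot_A x y i j)"
    by (simp add: sum_subtractf sum_distrib_left case_prod_beta)
  also have "\<dots> = 2 * lap \<phi>' \<phi>'' (x \<bullet> y)"
    unfolding sum_rot_A sum_rot_B using assms
    by (simp add: lap_def a_def norm_eq_1 algebra_simps add_divide_distrib diff_divide_distrib)
  finally show ?thesis .
qed

lemma continuous_on_inner_S:
  assumes "\<And>u. \<bar>u\<bar> \<le> 1 \<Longrightarrow> isCont \<phi> u" "x \<in> S"
  shows "continuous_on S (\<lambda>y. \<phi> (x \<bullet> y))"
proof -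
  have "continuous_on {-1..1} \<phi>"
    by (rule continuous_at_imp_continuous_on) (use assms(1) in auto)
  moreover have "continuous_on S (\<lambda>y. x \<bullet> y)" by (intro continuous_intros)
  moreover have "(\<lambda>y. x \<bullet> y) ` S \<subseteq> {-1..1}" using abs_inner_le_1[OF assms(2)] by (force simp: abs_le_iff)
  ultimately show ?thesis using continuous_on_compose2 by blast
qed

lemma rot_in_S: "i \<noteq> j \<Longrightarrow> y \<in> S \<Longrightarrow> rot i j \<theta> y \<in> S"
  using orthogonal_rot[of i j \<theta>] by (simp add: orthogonal_transformation_norm)

text \<open>Rotations preserve \<open>\<sigma>\<close>, so a symmetric second difference in one
  factor can be moved to the other. Dominated convergence turns the second differences into second
  derivatives along rotations, and the sum over all planes gives the symmetry of the Laplacian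
  without charts or integration by parts.\<close>

lemma green_identity:
  assumes x: "x \<in> S" and z: "z \<in> S"
    and d: "\<And>u. \<bar>u\<bar> \<le> 1 \<Longrightarrow> (\<phi> has_real_derivative \<phi>' u) (at u)"
      "\<And>u. \<bar>u\<bar> \<le> 1 \<Longrightarrow> (\<phi>' has_real_derivative \<phi>'' u) (at u)"
      "\<And>u. \<bar>u\<bar> \<le> 1 \<Longrightarrow> isCont \<phi>'' u"
    and e: "\<And>u. \<bar>u\<bar> \<le> 1 \<Longrightarrow> (\<psi> has_real_derivative \<psi>' u) (at u)"
      "\<And>u. \<bar>u\<bar> \<le> 1 \<Longrightarrow> (\<psi>' has_real_derivative \<psi>'' u) (at u)"
      "\<And>u. \<bar>u\<bar> \<le> 1 \<Longrightarrow> isCont \<psi>'' u"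
  shows "(\<integral>y. lap \<phi>' \<phi>'' (x \<bullet> y) * \<psi> (z \<bullet> y) \<partial>\<sigma>) = (\<integral>y. \<phi> (x \<bullet> y) * lap \<psi>' \<psi>'' (z \<bullet> y) \<partial>\<sigma>)"
proof -
  define X where "X n = 1 / real (Suc n)" for n
  have X: "0 < X n" for n by (simp add: X_def)
  have X0: "X \<longlonglongrightarrow> 0" unfolding X_def by (rule LIMSEQ_Suc[OF lim_1_over_n])
  have key: "(\<lambda>n. \<integral>y. sdiff i j f (X n) w y * g (v \<bullet> y) \<partial>\<sigma>) \<longlonglongrightarrow>
        (\<integral>y. (f'' (w \<bullet> y) * (rot_B w y i j)\<^sup>2 - f' (w \<bullet> y) * rot_A w y i j) * g (v \<bullet> y) \<partial>\<sigma>)" (is "?L")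
    and int: "integrable \<sigma> (\<lambda>y. (f'' (w \<bullet> y) * (rot_B w y i j)\<^sup>2 - f' (w \<bullet> y) * rot_A w y i j) * g (v \<bullet> y))" (is "?I")
    if ij: "i \<noteq> j" and w: "w \<in> S" and v: "v \<in> S"
      and f: "\<And>u. \<bar>u\<bar> \<le> 1 \<Longrightarrow> (f has_real_derivative f' u) (at u)"
      "\<And>u. \<bar>u\<bar> \<le> 1 \<Longrightarrow> (f' has_real_derivative f'' u) (at u)"
      "\<And>u. \<bar>u\<bar> \<le> 1 \<Longrightarrow> isCont f'' u"
      and g: "\<And>u. \<bar>u\<bar> \<le> 1 \<Longrightarrow> isCont g u" for i j and f f' f'' g :: "real \<Rightarrow> real" and w v
  proof -
    have cf: "\<And>u. \<bar>u\<bar> \<le> 1 \<Longrightarrow> isCont f u" "\<And>u. \<bar>u\<bar> \<le> 1 \<Longrightarrow> isCont f' u"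
      using f DERIV_isCont by blast+
    have bd: "\<exists>B. \<forall>u. \<bar>u\<bar> \<le> 1 \<longrightarrow> \<bar>q u\<bar> \<le> B" if "\<And>u. \<bar>u\<bar> \<le> 1 \<Longrightarrow> isCont q u" for q :: "real \<Rightarrow> real"
    proof -
      have "continuous_on {-1..1} q"
        by (rule continuous_at_imp_continuous_on) (use that in auto)
      then have "bounded (q ` {-1..1})" by (intro compact_imp_bounded compact_continuous_image) auto
      then obtain B where B: "\<And>s. s \<in> q ` {-1..1} \<Longrightarrow> norm s \<le> B" unfolding bounded_iff by blast
      have "\<bar>q u\<bar> \<le> B" if "\<bar>u\<bar> \<le> 1" for u using B[of "q u"] that by (simp add: abs_le_iff)
      then show ?thesis by blast
    qed
    obtain B1 B2 B3 where B: "\<And>u. \<bar>u\<bar> \<le> 1 \<Longrightarrow> \<bar>f' u\<bar> \<le> B1" "\<And>u. \<bar>u\<bar> \<le> 1 \<Longrightarrow> \<bar>f'' u\<bar> \<le> B2" "\<And>u. \<bar>u\<bar> \<le> 1 \<Longrightarrow> \<bar>g u\<bar> \<le> B3"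
      using bd[of f'] bd[of f''] bd[of g] cf f g by metis
    define C where "C = max B1 B2"
    have mem: "w \<bullet> rot i j t y \<in> {u. \<bar>u\<bar> \<le> 1}" if "y \<in> S" for t y
      using abs_inner_le_1[OF w rot_in_S[OF ij that]] by simp
    have c2: "continuous_on S (\<lambda>y. g (v \<bullet> y))" by (rule continuous_on_inner_S[OF g v])
    have rc: "continuous_on S (\<lambda>y. rot i j t y)" for t unfolding rot_def by (intro continuous_intros)
    have c1: "continuous_on S (\<lambda>y. f (w \<bullet> rot i j t y))" for t
      using continuous_on_compose2[OF continuous_on_inner_S[OF cf(1) w] rc] rot_in_S[OF ij] by blast
    have c0: "continuous_on S (\<lambda>y. sdiff i j f t w y * g (v \<bullet> y))" if "t \<noteq> 0" for t
      unfolding sdiff_def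
      using that by (intro continuous_intros c1 c2 continuous_on_inner_S[OF cf(1) w]) auto
    show ?I
      unfolding rot_A_def rot_B_def
      by (intro integrable_continuous_on_S continuous_intros c2 continuous_on_inner_S[OF cf(2) w] continuous_on_inner_S[OF f(3) w])
    show ?L
    proof (rule integral_dominated_convergence[where w = "\<lambda>_. 20 * C * B3"])
      show "(\<lambda>y. (f'' (w \<bullet> y) * (rot_B w y i j)\<^sup>2 - f' (w \<bullet> y) * rot_A w y i j) * g (v \<bullet> y)) \<in> borel_measurable \<sigma>"
        using \<open>?I\<close> by simp
      show "(\<lambda>y. sdiff i j f (X n) w y * g (v \<bullet> y)) \<in> borel_measurable \<sigma>" for n
        using X[of n] by (intro measurable_continuous_on_S c0) simp
      show "AE y in \<sigma>. (\<lambda>n. sdiff i j f (X n) w y * g (v \<bullet> y)) \<longlonglongrightarrow> (f'' (w \<bullet> y) * (rot_B w y i j)\<^sup>2 - f' (w \<bullet> y) * rot_A w y i j) * g (v \<bullet> y)"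
      proof (rule AE_I2)
        fix y assume "y \<in> space \<sigma>"
        then have y: "y \<in> S" by simp
        show "(\<lambda>n. sdiff i j f (X n) w y * g (v \<bullet> y)) \<longlonglongrightarrow> (f'' (w \<bullet> y) * (rot_B w y i j)\<^sup>2 - f' (w \<bullet> y) * rot_A w y i j) * g (v \<bullet> y)"
          by (intro tendsto_mult tendsto_const sdiff_limit[where \<delta> = 1 and U = "{u. \<bar>u\<bar> \<le> 1}" and X = X])
             (use mem[OF y] w y f X X0 in auto)
      qed
      show "AE y in \<sigma>. norm (sdiff i j f (X n) w y * g (v \<bullet> y)) \<le> 20 * C * B3" for n
      proof (rule AE_I2)
        fix y assume "y \<in> space \<sigma>"
        then have y: "y \<in> S" by simp
        have "\<bar>sdiff i j f (X n) w y\<bar> \<le> 20 * C"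
          by (rule sdiff_bound[where U = "{u. \<bar>u\<bar> \<le> 1}" and \<phi>' = f' and \<phi>'' = f''])
             (use mem[OF y] w y f X B in \<open>auto simp: C_def le_max_iff_disj\<close>)
        moreover have "\<bar>g (v \<bullet> y)\<bar> \<le> B3" using B(3) abs_inner_le_1[OF v y] by blast
        ultimately show "norm (sdiff i j f (X n) w y * g (v \<bullet> y)) \<le> 20 * C * B3"
          by (simp add: abs_mult) (intro mult_mono, auto intro: order_trans[OF abs_ge_zero])
      qed
    qed auto
  qed
  let ?P = "{(i :: 'n, j). i \<noteq> j}"
  have cphi: "\<And>u. \<bar>u\<bar> \<le> 1 \<Longrightarrow> isCont \<phi> u" and cpsi: "\<And>u. \<bar>u\<bar> \<le> 1 \<Longrightarrow> isCont \<psi> u"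
    using d e DERIV_isCont by blast+
  have pair: "(\<integral>y. (\<phi>'' (x \<bullet> y) * (rot_B x y i j)\<^sup>2 - \<phi>' (x \<bullet> y) * rot_A x y i j) * \<psi> (z \<bullet> y) \<partial>\<sigma>)
     = (\<integral>y. (\<psi>'' (z \<bullet> y) * (rot_B z y i j)\<^sup>2 - \<psi>' (z \<bullet> y) * rot_A z y i j) * \<phi> (x \<bullet> y) \<partial>\<sigma>)" if ij: "i \<noteq> j" for i j
  proof -
    have rc: "continuous_on S (\<lambda>y. rot i j t y)" for t unfolding rot_def by (intro continuous_intros)
    have c1: "continuous_on S (\<lambda>y. \<phi> (x \<bullet> rot i j t y))" for t
      using continuous_on_compose2[OF continuous_on_inner_S[OF cphi x] rc] rot_in_S[OF ij] by blast
    have c2: "continuous_on S (\<lambda>y. \<psi> (z \<bullet> rot i j t y))" for t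
      using continuous_on_compose2[OF continuous_on_inner_S[OF cpsi z] rc] rot_in_S[OF ij] by blast
    \<comment> \<open>The rotation reappears in the other factor with the opposite angle, which a
      symmetric second difference does not notice.\<close>
    have sw: "(\<integral>y. \<phi> (x \<bullet> rot i j t y) * \<psi> (z \<bullet> y) \<partial>\<sigma>) = (\<integral>y. \<psi> (z \<bullet> rot i j (- t) y) * \<phi> (x \<bullet> y) \<partial>\<sigma>)" for t
    proof -
      have "(\<lambda>y. \<psi> (z \<bullet> rot i j (- t) y) * \<phi> (x \<bullet> y)) \<in> borel_measurable \<sigma>"
        by (intro measurable_continuous_on_S continuous_intros c2 continuous_on_inner_S[OF cphi x])
      from integral_orth[OF orthogonal_rot[OF ij] this, of t]
      show ?thesis by (simp add: rot_inverse[OF ij] mult.commute)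
    qed
    have e1: "(\<integral>y. sdiff i j \<phi> t x y * \<psi> (z \<bullet> y) \<partial>\<sigma>) = (\<integral>y. sdiff i j \<psi> t z y * \<phi> (x \<bullet> y) \<partial>\<sigma>)" for t
    proof -
      have "(\<integral>y. sdiff i j \<phi> t x y * \<psi> (z \<bullet> y) \<partial>\<sigma>) = ((\<integral>y. \<phi> (x \<bullet> rot i j t y) * \<psi> (z \<bullet> y) \<partial>\<sigma>) + (\<integral>y. \<phi> (x \<bullet> rot i j (- t) y) * \<psi> (z \<bullet> y) \<partial>\<sigma>) - 2 * (\<integral>y. \<phi> (x \<bullet> y) * \<psi> (z \<bullet> y) \<partial>\<sigma>)) / t\<^sup>2"
        using c1 continuous_on_inner_S[OF cpsi z] continuous_on_inner_S[OF cphi x]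
        by (simp add: sdiff_def algebra_simps add_divide_distrib diff_divide_distrib
            integrable_continuous_on_S continuous_on_mult integral_diff integral_add)
      moreover have "(\<integral>y. sdiff i j \<psi> t z y * \<phi> (x \<bullet> y) \<partial>\<sigma>) = ((\<integral>y. \<psi> (z \<bullet> rot i j t y) * \<phi> (x \<bullet> y) \<partial>\<sigma>) + (\<integral>y. \<psi> (z \<bullet> rot i j (- t) y) * \<phi> (x \<bullet> y) \<partial>\<sigma>) - 2 * (\<integral>y. \<psi> (z \<bullet> y) * \<phi> (x \<bullet> y) \<partial>\<sigma>)) / t\<^sup>2"
        using c2 continuous_on_inner_S[OF cpsi z] continuous_on_inner_S[OF cphi x]
        by (simp add: sdiff_def algebra_simps add_divide_distrib diff_divide_distrib
            integrable_continuous_on_S continuous_on_mult integral_diff integral_add)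
      ultimately show ?thesis using sw[of t] sw[of "- t"] by (simp add: mult.commute)
    qed
    have l1: "(\<lambda>n. \<integral>y. sdiff i j \<phi> (X n) x y * \<psi> (z \<bullet> y) \<partial>\<sigma>) \<longlonglongrightarrow>
        (\<integral>y. (\<phi>'' (x \<bullet> y) * (rot_B x y i j)\<^sup>2 - \<phi>' (x \<bullet> y) * rot_A x y i j) * \<psi> (z \<bullet> y) \<partial>\<sigma>)"
      by (rule key[OF ij x z d cpsi])
    have l2: "(\<lambda>n. \<integral>y. sdiff i j \<psi> (X n) z y * \<phi> (x \<bullet> y) \<partial>\<sigma>) \<longlonglongrightarrow>
        (\<integral>y. (\<psi>'' (z \<bullet> y) * (rot_B z y i j)\<^sup>2 - \<psi>' (z \<bullet> y) * rot_A z y i j) * \<phi> (x \<bullet> y) \<partial>\<sigma>)"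
      by (rule key[OF ij z x e cphi])
    show ?thesis using LIMSEQ_unique[OF l1] l2 e1 by simp
  qed
  have tot: "(\<integral>y. 2 * lap f' f'' (w \<bullet> y) * g (v \<bullet> y) \<partial>\<sigma>) = (\<Sum>(i, j)\<in>?P. \<integral>y. (f'' (w \<bullet> y) * (rot_B w y i j)\<^sup>2 - f' (w \<bullet> y) * rot_A w y i j) * g (v \<bullet> y) \<partial>\<sigma>)"
    if w: "w \<in> S" and v: "v \<in> S"
      and f: "\<And>u. \<bar>u\<bar> \<le> 1 \<Longrightarrow> (f has_real_derivative f' u) (at u)"
      "\<And>u. \<bar>u\<bar> \<le> 1 \<Longrightarrow> (f' has_real_derivative f'' u) (at u)"
      "\<And>u. \<bar>u\<bar> \<le> 1 \<Longrightarrow> isCont f'' u"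
      and g: "\<And>u. \<bar>u\<bar> \<le> 1 \<Longrightarrow> isCont g u" for f f' f'' g :: "real \<Rightarrow> real" and w v
  proof -
    have "(\<integral>y. 2 * lap f' f'' (w \<bullet> y) * g (v \<bullet> y) \<partial>\<sigma>) = (\<integral>y. (\<Sum>(i, j)\<in>?P. (f'' (w \<bullet> y) * (rot_B w y i j)\<^sup>2 - f' (w \<bullet> y) * rot_A w y i j) * g (v \<bullet> y)) \<partial>\<sigma>)"
      by (rule Bochner_Integration.integral_cong) (simp_all add: sum_sdiff_limit[OF w, symmetric] sum_distrib_right case_prod_beta)
    also have "\<dots> = (\<Sum>p\<in>?P. \<integral>y. (case p of (i, j) \<Rightarrow> (f'' (w \<bullet> y) * (rot_B w y i j)\<^sup>2 - f' (w \<bullet> y) * rot_A w y i j) * g (v \<bullet> y)) \<partial>\<sigma>)"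
      by (rule Bochner_Integration.integral_sum) (use int[OF _ w v f g] in auto)
    finally show ?thesis by (simp add: case_prod_beta)
  qed
  have "(\<integral>y. 2 * lap \<phi>' \<phi>'' (x \<bullet> y) * \<psi> (z \<bullet> y) \<partial>\<sigma>)
    = (\<Sum>(i, j)\<in>?P. \<integral>y. (\<phi>'' (x \<bullet> y) * (rot_B x y i j)\<^sup>2 - \<phi>' (x \<bullet> y) * rot_A x y i j) * \<psi> (z \<bullet> y) \<partial>\<sigma>)"
    by (rule tot[OF x z d cpsi])
  also have "\<dots> = (\<Sum>(i, j)\<in>?P. \<integral>y. (\<psi>'' (z \<bullet> y) * (rot_B z y i j)\<^sup>2 - \<psi>' (z \<bullet> y) * rot_A z y i j) * \<phi> (x \<bullet> y) \<partial>\<sigma>)"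
    by (rule sum.cong) (use pair in auto)
  also have "\<dots> = (\<integral>y. 2 * lap \<psi>' \<psi>'' (z \<bullet> y) * \<phi> (x \<bullet> y) \<partial>\<sigma>)"
    by (rule tot[OF z x e cphi, symmetric])
  finally show ?thesis
    by (simp only: mult.assoc integral_mult_right_zero) (simp add: mult.commute)
qed


subsection \<open>The Poisson semigroup\<close>

lemma kap_pos: "t \<noteq> 0 \<Longrightarrow> u \<le> 1 \<Longrightarrow> 0 < kap t u"
  using gap_pos[of t u] by (simp add: kap_def)

lemma poi_pos: "0 < t \<Longrightarrow> u \<le> 1 \<Longrightarrow> 0 < poi t u"
  using gap_pos[of t u] by (simp add: poi_def)

lemma poi_nonneg: "0 < t \<Longrightarrow> x \<in> S \<Longrightarrow> y \<in> S \<Longrightarrow> 0 \<le> poi t (x \<bullet> y)"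
  using poi_pos[of t "x \<bullet> y"] inner_le_1 by fastforce

lemma poi_mono: "0 < t \<Longrightarrow> u \<le> v \<Longrightarrow> v \<le> 1 \<Longrightarrow> poi t u \<le> poi t v"
  unfolding poi_def using gap_pos[of t v] a_pos
  by (intro mult_left_mono powr_mono2') auto

lemma kap_isCont_u: "t \<noteq> 0 \<Longrightarrow> \<bar>u\<bar> \<le> 1 \<Longrightarrow> isCont (kap t) u"
  using DERIV_isCont[OF kap_deriv_u] gap_pos by auto

lemma poi_isCont_u: "t \<noteq> 0 \<Longrightarrow> \<bar>u\<bar> \<le> 1 \<Longrightarrow> isCont (poi t) u"
  unfolding poi_def using gap_pos[of t u] by (intro continuous_intros) auto

lemma kap_tt_isCont_u: "t \<noteq> 0 \<Longrightarrow> \<bar>u\<bar> \<le> 1 \<Longrightarrow> isCont (kap_tt t) u"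
  unfolding kap_tt_def using gap_pos[of t u] by (intro continuous_intros) auto

lemma kap_uu_isCont_u: "t \<noteq> 0 \<Longrightarrow> \<bar>u\<bar> \<le> 1 \<Longrightarrow> isCont (kap_uu t) u"
  unfolding kap_uu_def using gap_pos[of t u] by (intro continuous_intros) auto

text \<open>By the wave equation \<open>kap_tt\<close> is \<open>a\<^sup>2 * kap\<close> minus the
  spherical Laplacian of \<open>kap\<close>. The first part is symmetric as it stands, the second by
  Green's identity.\<close>

lemma kap_tt_symmetric:
  assumes s: "0 < s" and b: "0 < b" and x: "x \<in> S" and z: "z \<in> S"
  shows "(\<integral>y. kap_tt s (x \<bullet> y) * kap b (z \<bullet> y) \<partial>\<sigma>) = (\<integral>y. kap s (x \<bullet> y) * kap_tt b (z \<bullet> y) \<partial>\<sigma>)"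
proof -
  have nz: "s \<noteq> 0" "b \<noteq> 0" using s b by auto
  have w: "kap_tt t u = a\<^sup>2 * kap t u - lap (kap_u t) (kap_uu t) u" if "t \<noteq> 0" "\<bar>u\<bar> \<le> 1" for t u
    using wave_equation[of t u] gap_pos[OF that(1), of u] that by (simp add: lap_def)
  have g: "(\<integral>y. lap (kap_u s) (kap_uu s) (x \<bullet> y) * kap b (z \<bullet> y) \<partial>\<sigma>) = (\<integral>y. kap s (x \<bullet> y) * lap (kap_u b) (kap_uu b) (z \<bullet> y) \<partial>\<sigma>)"
    by (rule green_identity[OF x z]) (use nz gap_pos in \<open>auto intro!: kap_deriv_u kap_deriv_uu kap_uu_isCont_u\<close>)
  have cl: "continuous_on S (\<lambda>y. lap (kap_u t) (kap_uu t) (v \<bullet> y))" if "t \<noteq> 0" "v \<in> S" for t v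
  proof -
    have "continuous_on S (\<lambda>y. a\<^sup>2 * kap t (v \<bullet> y) - kap_tt t (v \<bullet> y))"
      using that by (intro continuous_intros continuous_on_inner_S[OF kap_isCont_u] continuous_on_inner_S[OF kap_tt_isCont_u])
    then show ?thesis
      by (rule continuous_on_eq) (use w[OF that(1)] abs_inner_le_1[OF that(2)] in simp)
  qed
  have ck: "continuous_on S (\<lambda>y. kap t (v \<bullet> y))" if "t \<noteq> 0" "v \<in> S" for t v
    using that by (intro continuous_on_inner_S[OF kap_isCont_u])
  note int = integrable_continuous_on_S[OF continuous_on_mult[OF cl ck]] integrable_continuous_on_S[OF continuous_on_mult[OF ck cl]]
     integrable_continuous_on_S[OF continuous_on_mult[OF ck ck]]
  have "(\<integral>y. kap_tt s (x \<bullet> y) * kap b (z \<bullet> y) \<partial>\<sigma>) = (\<integral>y. a\<^sup>2 * (kap s (x \<bullet> y) * kap b (z \<bullet> y)) - lap (kap_u s) (kap_uu s) (x \<bullet> y) * kap b (z \<bullet> y) \<partial>\<sigma>)"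
    by (rule Bochner_Integration.integral_cong) (simp_all add: w[OF nz(1) abs_inner_le_1[OF x]] algebra_simps)
  also have "\<dots> = a\<^sup>2 * (\<integral>y. kap s (x \<bullet> y) * kap b (z \<bullet> y) \<partial>\<sigma>) - (\<integral>y. lap (kap_u s) (kap_uu s) (x \<bullet> y) * kap b (z \<bullet> y) \<partial>\<sigma>)"
    using int nz x z by simp
  also have "\<dots> = a\<^sup>2 * (\<integral>y. kap s (x \<bullet> y) * kap b (z \<bullet> y) \<partial>\<sigma>) - (\<integral>y. kap s (x \<bullet> y) * lap (kap_u b) (kap_uu b) (z \<bullet> y) \<partial>\<sigma>)"
    unfolding g ..
  also have "\<dots> = (\<integral>y. a\<^sup>2 * (kap s (x \<bullet> y) * kap b (z \<bullet> y)) - kap s (x \<bullet> y) * lap (kap_u b) (kap_uu b) (z \<bullet> y) \<partial>\<sigma>)"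
    using int nz x z by simp
  also have "\<dots> = (\<integral>y. kap s (x \<bullet> y) * kap_tt b (z \<bullet> y) \<partial>\<sigma>)"
    by (rule Bochner_Integration.integral_cong) (simp_all add: w[OF nz(2) abs_inner_le_1[OF z]] algebra_simps)
  finally show ?thesis .
qed

lemma cont_kernel_shift:
  assumes "continuous_on ({m..} \<times> {..1}) (\<lambda>(t, u). k t u :: real)" "x \<in> S"
    and "continuous_on {c..d} g" "\<And>t. t \<in> {c..d} \<Longrightarrow> m \<le> g t"
  shows "continuous_on ({c..d} \<times> S) (\<lambda>p. k (g (fst p)) (x \<bullet> snd p))"
proof -
  have "continuous_on ({c..d} \<times> S) ((\<lambda>(t, u). k t u) \<circ> (\<lambda>p. (g (fst p), x \<bullet> snd p)))"
    by (intro continuous_on_compose continuous_intros continuous_on_subset[OF assms(1)]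
        continuous_on_compose2[OF assms(3)])
       (use assms(2,4) inner_le_1 in auto)
  then show ?thesis by (simp add: o_def case_prod_beta)
qed

text \<open>With \<open>q = exp (- b)\<close> the gap \<open>2 * cosh b - 2 * u\<close> equals
  \<open>exp b\<close> times \<open>1 - 2 * u * q + q\<^sup>2\<close>, which lies between the
  squares of \<open>1 - q\<close> and \<open>1 + q\<close>. Both bounds tend to 1 as
  \<open>b\<close> tends to infinity, uniformly in \<open>u\<close>; this determines all total
  masses below.\<close>

lemma exp_kap_bounds:
  assumes "0 < b" "\<bar>u\<bar> \<le> 1"
  shows "(1 + exp (- b)) powr (- 2 * a) \<le> exp (a * b) * kap b u"
    "exp (a * b) * kap b u \<le> (1 - exp (- b)) powr (- 2 * a)"
proof -
  let ?e = "exp (- b)"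
  have e: "0 < ?e" "?e < 1" using assms by auto
  have D: "2 * cosh b - 2 * u = exp b * (1 + ?e\<^sup>2 - 2 * u * ?e)"
  proof -
    have Ee: "exp b * ?e = 1" by (simp flip: exp_add)
    have "exp b * (1 + ?e\<^sup>2 - 2 * u * ?e) = exp b + (exp b * ?e) * ?e - 2 * u * (exp b * ?e)"
      by (simp add: power2_eq_square algebra_simps)
    also have "\<dots> = 2 * cosh b - 2 * u"
      unfolding Ee by (simp add: cosh_field_def)
    finally show ?thesis ..
  qed
  have up: "1 + ?e\<^sup>2 - 2 * u * ?e \<le> (1 + ?e)\<^sup>2"
    using mult_nonneg_nonneg[of "1 + u" ?e] e assms(2) by (simp add: power2_eq_square algebra_simps abs_le_iff)
  have lo: "(1 - ?e)\<^sup>2 \<le> 1 + ?e\<^sup>2 - 2 * u * ?e"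
    using mult_nonneg_nonneg[of "1 - u" ?e] e assms(2) by (simp add: power2_eq_square algebra_simps abs_le_iff)
  have lo0: "0 < (1 - ?e)\<^sup>2" using e by simp
  have "kap b u = exp b powr (- a) * (1 + ?e\<^sup>2 - 2 * u * ?e) powr (- a)"
    unfolding kap_def D by (rule powr_mult)
  then have eq: "exp (a * b) * kap b u = (1 + ?e\<^sup>2 - 2 * u * ?e) powr (- a)"
    by (simp add: powr_def exp_minus algebra_simps)
  have sq: "q\<^sup>2 powr (- a) = q powr (- 2 * a)" if "0 < q" for q :: real
    using that by (simp add: powr_powr flip: powr_numeral)
  show "(1 + ?e) powr (- 2 * a) \<le> exp (a * b) * kap b u"
    using powr_mono2'[of "- a" "1 + ?e\<^sup>2 - 2 * u * ?e" "(1 + ?e)\<^sup>2"] sq[of "1 + ?e"] e up lo lo0 a_pos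
    unfolding eq by linarith
  show "exp (a * b) * kap b u \<le> (1 - ?e) powr (- 2 * a)"
    using powr_mono2'[of "- a" "(1 - ?e)\<^sup>2" "1 + ?e\<^sup>2 - 2 * u * ?e"] sq[of "1 - ?e"] e lo lo0 a_pos
    unfolding eq by linarith
qed

lemma kap_bound: "0 < b \<Longrightarrow> \<bar>u\<bar> \<le> 1 \<Longrightarrow> kap b u \<le> (1 - exp (- b)) powr (- 2 * a) * exp (- a * b)"
  using exp_kap_bounds(2)[of b u] by (simp add: exp_minus field_simps)

lemma exp_poi_eq:
  assumes "0 < b" "\<bar>u\<bar> \<le> 1"
  shows "poi b u = 2 * sinh b * (kap b u powr ((a + 1) / a))"
proof -
  have "((2 * cosh b - 2 * u) powr (- a)) powr ((a + 1) / a) = (2 * cosh b - 2 * u) powr (- a - 1)"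
  proof -
    have "- a * ((a + 1) / a) = - a - 1" using a_pos by (simp add: field_simps)
    then show ?thesis by (simp only: powr_powr)
  qed
  then show ?thesis by (simp add: poi_def kap_def)
qed

lemma exp_poi_bounds:
  assumes "0 < b" "\<bar>u\<bar> \<le> 1"
  shows "(1 - exp (- 2 * b)) * (1 + exp (- b)) powr (- 2 * (a + 1)) \<le> exp (a * b) * poi b u"
    "exp (a * b) * poi b u \<le> (1 - exp (- 2 * b)) * (1 - exp (- b)) powr (- 2 * (a + 1))"
proof -
  let ?q = "(a + 1) / a"
  have q: "0 \<le> ?q" using a_pos by simp
  have k: "0 < kap b u" using assms by (intro kap_pos) auto
  have s: "2 * sinh b = exp b * (1 - exp (- 2 * b))"
  proof -
    have "exp b * exp (- 2 * b) = exp (- b)" by (simp flip: exp_add)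
    then show ?thesis by (simp add: sinh_field_def right_diff_distrib)
  qed
  have "(exp (a * b) * kap b u) powr ?q = exp (a * b) powr ?q * kap b u powr ?q"
    by (rule powr_mult)
  also have "exp (a * b) powr ?q = exp (a * b + b)"
    using a_pos by (simp add: powr_def field_simps)
  finally have eq: "exp (a * b) * poi b u = (1 - exp (- 2 * b)) * (exp (a * b) * kap b u) powr ?q"
    unfolding exp_poi_eq[OF assms] s by (simp add: exp_add algebra_simps)
  have pq: "(w powr (- 2 * a)) powr ?q = w powr (- 2 * (a + 1))" for w :: real
  proof -
    have "- 2 * a * ((a + 1) / a) = - 2 * (a + 1)" using a_pos by (simp add: field_simps)
    then show ?thesis by (simp only: powr_powr)
  qed
  have nn: "0 \<le> 1 - exp (- 2 * b)" using assms by simp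
  show "(1 - exp (- 2 * b)) * (1 + exp (- b)) powr (- 2 * (a + 1)) \<le> exp (a * b) * poi b u"
    unfolding eq pq[symmetric] by (intro mult_left_mono nn powr_mono2 q exp_kap_bounds(1) assms) auto
  show "exp (a * b) * poi b u \<le> (1 - exp (- 2 * b)) * (1 - exp (- b)) powr (- 2 * (a + 1))"
    unfolding eq pq[symmetric] using k by (intro mult_left_mono nn powr_mono2 q exp_kap_bounds(2) assms) auto
qed

lemma poi_bound: "0 < b \<Longrightarrow> \<bar>u\<bar> \<le> 1 \<Longrightarrow> poi b u \<le> (1 - exp (- 2 * b)) * (1 - exp (- b)) powr (- 2 * (a + 1)) * exp (- a * b)"
  using exp_poi_bounds(2)[of b u] by (simp add: exp_minus field_simps)

text \<open>The Wronskian of the two kernels is constant by the wave equation, and it tends to \<open>0\<close>.\<close>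

lemma poi_kap_symmetric:
  assumes s: "0 < s" and b: "0 < b" and x: "x \<in> S" and z: "z \<in> S"
  shows "(\<integral>y. poi s (x \<bullet> y) * kap b (z \<bullet> y) \<partial>\<sigma>) = (\<integral>y. kap s (x \<bullet> y) * poi b (z \<bullet> y) \<partial>\<sigma>)"
proof -
  \<comment> \<open>Leaves room to the left of \<open>t = 0\<close>, so that two-sided derivatives
    exist there while both kernel arguments stay positive.\<close>
  define m where "m = min s b / 2"
  have m: "0 < m" "m < s" "m < b" using s b by (auto simp: m_def)
  define F where "F t y = poi (s + t) (x \<bullet> y) * kap (b + t) (z \<bullet> y) - kap (s + t) (x \<bullet> y) * poi (b + t) (z \<bullet> y)" for t y
  define F' where "F' t y = (- 1 / a) * (kap_tt (s + t) (x \<bullet> y) * kap (b + t) (z \<bullet> y) - kap (s + t) (x \<bullet> y) * kap_tt (b + t) (z \<bullet> y))" for t y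
  define Z where "Z t = (\<integral>y. F t y \<partial>\<sigma>)" for t
  have cs: "continuous_on ({- m..d} \<times> S) (\<lambda>p. kap (s + fst p) (x \<bullet> snd p))"
    "continuous_on ({- m..d} \<times> S) (\<lambda>p. poi (s + fst p) (x \<bullet> snd p))"
    "continuous_on ({- m..d} \<times> S) (\<lambda>p. kap_tt (s + fst p) (x \<bullet> snd p))"
    "continuous_on ({- m..d} \<times> S) (\<lambda>p. kap (b + fst p) (z \<bullet> snd p))"
    "continuous_on ({- m..d} \<times> S) (\<lambda>p. poi (b + fst p) (z \<bullet> snd p))"
    "continuous_on ({- m..d} \<times> S) (\<lambda>p. kap_tt (b + fst p) (z \<bullet> snd p))" for d
    by (intro cont_kernel_shift[OF kap_cont[of "s - m"] x] cont_kernel_shift[OF poi_cont[of "s - m"] x] cont_kernel_shift[OF kap_tt_cont[of "s - m"] x]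
      cont_kernel_shift[OF kap_cont[of "b - m"] z] cont_kernel_shift[OF poi_cont[of "b - m"] z] cont_kernel_shift[OF kap_tt_cont[of "b - m"] z]
      continuous_intros; use m in simp)+
  have sh: "(g has_real_derivative g') (at (c + t)) \<Longrightarrow> ((\<lambda>t. g (c + t)) has_real_derivative g') (at t)" for g g' and c t :: real
    using DERIV_shift[of g g' t c] by (simp add: add.commute)
  have dF: "((\<lambda>t. F t y) has_real_derivative F' t y) (at t)" if t: "- m \<le> t" and y: "y \<in> S" for t y
  proof -
    have nz: "s + t \<noteq> 0" "b + t \<noteq> 0" using t m by auto
    have xy: "x \<bullet> y \<le> 1" "z \<bullet> y \<le> 1" using inner_le_1 x z y by auto
    have ds: "((\<lambda>t. kap (s + t) (x \<bullet> y)) has_real_derivative - a * poi (s + t) (x \<bullet> y)) (at t)"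
      by (rule sh[OF kap_deriv_t[OF nz(1) xy(1)]])
    have db: "((\<lambda>t. kap (b + t) (z \<bullet> y)) has_real_derivative - a * poi (b + t) (z \<bullet> y)) (at t)"
      by (rule sh[OF kap_deriv_t[OF nz(2) xy(2)]])
    have ds2: "((\<lambda>t. - a * poi (s + t) (x \<bullet> y)) has_real_derivative kap_tt (s + t) (x \<bullet> y)) (at t)"
      by (rule sh[OF kap_deriv_tt[OF nz(1) xy(1)]])
    have db2: "((\<lambda>t. - a * poi (b + t) (z \<bullet> y)) has_real_derivative kap_tt (b + t) (z \<bullet> y)) (at t)"
      by (rule sh[OF kap_deriv_tt[OF nz(2) xy(2)]])
    have "((\<lambda>t. (- 1 / a) * ((- a * poi (s + t) (x \<bullet> y)) * kap (b + t) (z \<bullet> y) - kap (s + t) (x \<bullet> y) * (- a * poi (b + t) (z \<bullet> y)))) has_real_derivative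
       (- 1 / a) * ((kap_tt (s + t) (x \<bullet> y) * kap (b + t) (z \<bullet> y) + (- a * poi (b + t) (z \<bullet> y)) * (- a * poi (s + t) (x \<bullet> y)))
         - ((- a * poi (s + t) (x \<bullet> y)) * (- a * poi (b + t) (z \<bullet> y)) + kap_tt (b + t) (z \<bullet> y) * kap (s + t) (x \<bullet> y)))) (at t)"
      by (intro DERIV_cmult DERIV_diff DERIV_mult ds db ds2 db2)
    then show ?thesis unfolding F_def F'_def using a_pos by (simp add: algebra_simps)
  qed
  have dZ: "(Z has_real_derivative 0) (at t)" if "0 \<le> t" for t
  proof -
    have "(Z has_real_derivative (\<integral>y. F' t y \<partial>\<sigma>)) (at t)"
      unfolding Z_def
    proof (rule deriv_integral[where c = "- m" and d = "t + 1"])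
      show "continuous_on ({- m..t + 1} \<times> S) (\<lambda>(t, y). F t y)"
        unfolding F_def case_prod_beta by (intro continuous_intros cs)
      show "continuous_on ({- m..t + 1} \<times> S) (\<lambda>(t, y). F' t y)"
        unfolding F'_def case_prod_beta by (intro continuous_intros cs)
    qed (use that m dF in auto)
    moreover have "(\<integral>y. F' t y \<partial>\<sigma>) = 0"
    proof -
      have p: "0 < s + t" "0 < b + t" using that s b by auto
      have "integrable \<sigma> (\<lambda>y. kap_tt (s + t) (x \<bullet> y) * kap (b + t) (z \<bullet> y))"
        "integrable \<sigma> (\<lambda>y. kap (s + t) (x \<bullet> y) * kap_tt (b + t) (z \<bullet> y))"
        using p x z by (intro integrable_continuous_on_S continuous_intros
            continuous_on_inner_S[OF kap_isCont_u] continuous_on_inner_S[OF kap_tt_isCont_u]; simp)+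
      then show ?thesis
        unfolding F'_def using kap_tt_symmetric[OF p x z] by simp
    qed
    ultimately show ?thesis by simp
  qed
  have const: "Z t = Z 0" if "0 \<le> t" for t
  proof -
    have "\<exists>c. \<forall>t\<in>{0..}. Z t = c"
      by (rule has_field_derivative_zero_constant) (use dZ in \<open>auto intro: has_field_derivative_at_within\<close>)
    then show ?thesis using that by auto
  qed
  have bound: "\<bar>Z t\<bar> \<le> 2 * V * ((1 - exp (- m)) powr (- 2 * a) * (1 - exp (- m)) powr (- 2 * (a + 1)) * exp (- a * t))" if t: "0 \<le> t" for t
  proof -
    let ?C = "(1 - exp (- m)) powr (- 2 * a)" and ?C' = "(1 - exp (- m)) powr (- 2 * (a + 1))"
    have kb: "\<bar>kap (c + t) u\<bar> \<le> ?C * exp (- a * t)" if "m < c" "\<bar>u\<bar> \<le> 1" for c u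
    proof -
      have p: "0 < c + t" using that m t by auto
      have "kap (c + t) u \<le> (1 - exp (- (c + t))) powr (- 2 * a) * exp (- a * (c + t))"
        by (rule kap_bound[OF p that(2)])
      also have "\<dots> \<le> ?C * exp (- a * t)"
        using that m t a_pos by (intro mult_mono powr_mono2') (auto simp: algebra_simps)
      finally show ?thesis using kap_pos[of "c + t" u] p abs_le_D1[OF that(2)] by simp
    qed
    have pb: "\<bar>poi (c + t) u\<bar> \<le> ?C'" if "m < c" "\<bar>u\<bar> \<le> 1" for c u
    proof -
      have p: "0 < c + t" using that m t by auto
      have ex: "exp (- a * (c + t)) \<le> 1"
        using mult_nonpos_nonneg[of "- a" "c + t"] p a_pos by (simp del: mult_minus_left)
      have "poi (c + t) u \<le> (1 - exp (- 2 * (c + t))) * (1 - exp (- (c + t))) powr (- 2 * (a + 1)) * exp (- a * (c + t))"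
        by (rule poi_bound[OF p that(2)])
      also have "\<dots> \<le> 1 * ?C' * 1"
        using that m t a_pos p by (intro mult_mono powr_mono2' ex) auto
      finally show ?thesis using poi_pos[of "c + t" u] p abs_le_D1[OF that(2)] by simp
    qed
    have Fb: "\<bar>F t y\<bar> \<le> 2 * (?C * ?C' * exp (- a * t))" if "y \<in> S" for y
    proof -
      have u: "\<bar>x \<bullet> y\<bar> \<le> 1" "\<bar>z \<bullet> y\<bar> \<le> 1" using abs_inner_le_1 x z that by auto
      have "\<bar>poi (s + t) (x \<bullet> y) * kap (b + t) (z \<bullet> y)\<bar> \<le> ?C' * (?C * exp (- a * t))"
        unfolding abs_mult by (intro mult_mono pb kb m u) auto
      moreover have "\<bar>kap (s + t) (x \<bullet> y) * poi (b + t) (z \<bullet> y)\<bar> \<le> (?C * exp (- a * t)) * ?C'"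
        unfolding abs_mult by (intro mult_mono pb kb m u) auto
      ultimately show ?thesis unfolding F_def by (simp add: algebra_simps abs_le_iff)
    qed
    have p: "s + t \<noteq> 0" "b + t \<noteq> 0" using t s b by auto
    have "integrable \<sigma> (F t)"
      unfolding F_def using p x z by (intro integrable_continuous_on_S continuous_intros
            continuous_on_inner_S[OF kap_isCont_u] continuous_on_inner_S[OF poi_isCont_u])
    then have "\<bar>Z t\<bar> \<le> (\<integral>y. 2 * (?C * ?C' * exp (- a * t)) \<partial>\<sigma>)"
      unfolding Z_def by (intro order_trans[OF integral_abs_bound] integral_mono) (use Fb in auto)
    then show ?thesis by (simp add: V_def mult_ac)
  qed
  have lim: "((\<lambda>t. 2 * V * ((1 - exp (- m)) powr (- 2 * a) * (1 - exp (- m)) powr (- 2 * (a + 1)) * exp (- a * t))) \<longlongrightarrow> 0) at_top"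
    using a_pos by real_asymp
  have "((\<lambda>t::real. \<bar>Z 0\<bar>) \<longlongrightarrow> 0) at_top"
  proof (rule tendsto_sandwich[OF _ _ tendsto_const lim])
    show "\<forall>\<^sub>F t in at_top. \<bar>Z 0\<bar> \<le> 2 * V * ((1 - exp (- m)) powr (- 2 * a) * (1 - exp (- m)) powr (- 2 * (a + 1)) * exp (- a * t))"
      by (rule eventually_at_top_linorderI[of 0]) (use bound const in metis)
  qed auto
  then have "Z 0 = 0" by (simp add: tendsto_const_iff)
  moreover have "integrable \<sigma> (\<lambda>y. poi s (x \<bullet> y) * kap b (z \<bullet> y))" "integrable \<sigma> (\<lambda>y. kap s (x \<bullet> y) * poi b (z \<bullet> y))"
    using s b x z by (intro integrable_continuous_on_S continuous_intros
            continuous_on_inner_S[OF kap_isCont_u] continuous_on_inner_S[OF poi_isCont_u]; simp)+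
  ultimately show ?thesis by (simp add: Z_def F_def)
qed


lemma integrable_kap_kap:
  "s \<noteq> 0 \<Longrightarrow> b \<noteq> 0 \<Longrightarrow> x \<in> S \<Longrightarrow> z \<in> S \<Longrightarrow> integrable \<sigma> (\<lambda>y. kap s (x \<bullet> y) * kap b (z \<bullet> y))"
  by (intro integrable_continuous_on_S continuous_intros continuous_on_inner_S[OF kap_isCont_u])

lemma integrable_poi_kap:
  "s \<noteq> 0 \<Longrightarrow> b \<noteq> 0 \<Longrightarrow> x \<in> S \<Longrightarrow> z \<in> S \<Longrightarrow> integrable \<sigma> (\<lambda>y. poi s (x \<bullet> y) * kap b (z \<bullet> y))"
  by (intro integrable_continuous_on_S continuous_intros continuous_on_inner_S[OF kap_isCont_u] continuous_on_inner_S[OF poi_isCont_u])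

lemma integrable_kap_poi:
  "s \<noteq> 0 \<Longrightarrow> b \<noteq> 0 \<Longrightarrow> x \<in> S \<Longrightarrow> z \<in> S \<Longrightarrow> integrable \<sigma> (\<lambda>y. kap s (x \<bullet> y) * poi b (z \<bullet> y))"
  by (intro integrable_continuous_on_S continuous_intros continuous_on_inner_S[OF kap_isCont_u] continuous_on_inner_S[OF poi_isCont_u])

text \<open>The slope \<open>e\<close> serves two purposes: \<open>e = -1\<close> moves along
  \<open>s + b\<close> constant, and \<open>e = 0\<close> differentiates in the first argument
  only.\<close>

lemma deriv_kap_kap:
  assumes "0 < s" "0 < b" "x \<in> S" "z \<in> S" "\<bar>e\<bar> \<le> 1"
  shows "((\<lambda>t. \<integral>y. kap (s + t) (x \<bullet> y) * kap (b + e * t) (z \<bullet> y) \<partial>\<sigma>) has_real_derivative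
     - a * (\<integral>y. poi s (x \<bullet> y) * kap b (z \<bullet> y) \<partial>\<sigma>) - a * e * (\<integral>y. kap s (x \<bullet> y) * poi b (z \<bullet> y) \<partial>\<sigma>)) (at 0)"
proof -
  define m where "m = min s b / 2"
  have m: "0 < m" "m < s" "m < b" using assms by (auto simp: m_def)
  define F where "F t y = kap (s + t) (x \<bullet> y) * kap (b + e * t) (z \<bullet> y)" for t y
  define F' where "F' t y = - a * (poi (s + t) (x \<bullet> y) * kap (b + e * t) (z \<bullet> y)) - a * e * (kap (s + t) (x \<bullet> y) * poi (b + e * t) (z \<bullet> y))" for t y
  have et: "\<bar>e * t\<bar> \<le> m" if "\<bar>t\<bar> \<le> m" for t
    using mult_mono[of "\<bar>e\<bar>" 1 "\<bar>t\<bar>" m] that assms(5) m by (simp add: abs_mult)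
  have ran: "s - m \<le> s + t" "b - m \<le> b + e * t" if "t \<in> {- m..m}" for t
    using et[of t] that by (auto simp: abs_le_iff)
  have cs: "continuous_on ({- m..m} \<times> S) (\<lambda>p. kap (s + fst p) (x \<bullet> snd p))"
    "continuous_on ({- m..m} \<times> S) (\<lambda>p. poi (s + fst p) (x \<bullet> snd p))"
    "continuous_on ({- m..m} \<times> S) (\<lambda>p. kap (b + e * fst p) (z \<bullet> snd p))"
    "continuous_on ({- m..m} \<times> S) (\<lambda>p. poi (b + e * fst p) (z \<bullet> snd p))"
    by (intro cont_kernel_shift[OF kap_cont[of "s - m"] assms(3)] cont_kernel_shift[OF poi_cont[of "s - m"] assms(3)]
      cont_kernel_shift[OF kap_cont[of "b - m"] assms(4)] cont_kernel_shift[OF poi_cont[of "b - m"] assms(4)]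
      continuous_intros ran; use m in simp)+
  have "((\<lambda>t. \<integral>y. F t y \<partial>\<sigma>) has_real_derivative (\<integral>y. F' 0 y \<partial>\<sigma>)) (at 0)"
  proof (rule deriv_integral[where c = "- m" and d = m])
    show "continuous_on ({- m..m} \<times> S) (\<lambda>(t, y). F t y)"
      unfolding F_def case_prod_beta by (intro continuous_intros cs)
    show "continuous_on ({- m..m} \<times> S) (\<lambda>(t, y). F' t y)"
      unfolding F'_def case_prod_beta by (intro continuous_intros cs)
    show "((\<lambda>t. F t y) has_real_derivative F' t y) (at t)" if t: "t \<in> {- m..m}" and y: "y \<in> S" for t y
    proof -
      have nz: "s + t \<noteq> 0" "b + e * t \<noteq> 0" using ran[OF t] m by auto
      have xy: "x \<bullet> y \<le> 1" "z \<bullet> y \<le> 1" using inner_le_1 assms y by auto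
      have l1: "((\<lambda>t. s + t) has_real_derivative 1) (at t)" "((\<lambda>t. b + e * t) has_real_derivative e) (at t)"
        by (auto intro!: derivative_eq_intros)
      have "((\<lambda>t. kap (s + t) (x \<bullet> y)) has_real_derivative - a * poi (s + t) (x \<bullet> y) * 1) (at t)"
        by (rule DERIV_chain2[OF kap_deriv_t[OF nz(1) xy(1)] l1(1)])
      moreover have "((\<lambda>t. kap (b + e * t) (z \<bullet> y)) has_real_derivative - a * poi (b + e * t) (z \<bullet> y) * e) (at t)"
        by (rule DERIV_chain2[OF kap_deriv_t[OF nz(2) xy(2)] l1(2)])
      ultimately show ?thesis
        unfolding F_def F'_def using DERIV_mult by (fastforce simp: algebra_simps)
    qed
  qed (use m in auto)
  moreover have "(\<integral>y. F' 0 y \<partial>\<sigma>) = - a * (\<integral>y. poi s (x \<bullet> y) * kap b (z \<bullet> y) \<partial>\<sigma>) - a * e * (\<integral>y. kap s (x \<bullet> y) * poi b (z \<bullet> y) \<partial>\<sigma>)"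
    unfolding F'_def using integrable_poi_kap[of s b x z] integrable_kap_poi[of s b x z] assms by simp
  ultimately show ?thesis by (simp add: F_def)
qed

text \<open>Along \<open>s + b\<close> constant the derivative is \<open>- a\<close> times the
  difference of the two sides of \<open>poi_kap_symmetric\<close>, hence zero.\<close>

lemma kap_kap_shift:
  assumes "0 < s" "0 < b" "0 < s'" "0 < b'" "s + b = s' + b'" and x: "x \<in> S" and z: "z \<in> S"
  shows "(\<integral>y. kap s (x \<bullet> y) * kap b (z \<bullet> y) \<partial>\<sigma>) = (\<integral>y. kap s' (x \<bullet> y) * kap b' (z \<bullet> y) \<partial>\<sigma>)"
proof -
  define q where "q t = (\<integral>y. kap t (x \<bullet> y) * kap (s + b - t) (z \<bullet> y) \<partial>\<sigma>)" for t
  have "(q has_real_derivative 0) (at t)" if t: "t \<in> {0<..<s + b}" for t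
  proof -
    have p: "0 < t" "0 < s + b - t" using t by auto
    have "((\<lambda>h. \<integral>y. kap (t + h) (x \<bullet> y) * kap (s + b - t + - 1 * h) (z \<bullet> y) \<partial>\<sigma>) has_real_derivative 0) (at 0)"
      using deriv_kap_kap[OF p x z, of "- 1"] poi_kap_symmetric[OF p x z] by simp
    then have "((\<lambda>h. q (h + t)) has_real_derivative 0) (at 0)"
      by (simp add: q_def algebra_simps)
    then show ?thesis using DERIV_shift[of q 0 0 t] by simp
  qed
  then have "\<exists>c. \<forall>t\<in>{0<..<s + b}. q t = c"
    by (intro has_field_derivative_zero_constant) (auto intro: has_field_derivative_at_within)
  then have "q s = q s'" using assms by auto
  moreover have "s + b - s = b" "s + b - s' = b'" using assms by auto
  ultimately show ?thesis by (simp add: q_def)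
qed

text \<open>Increasing both first arguments in \<open>kap_kap_shift\<close> by the same small
  \<open>t\<close> keeps the sums equal; the derivatives at \<open>t = 0\<close> must then
  agree.\<close>

lemma poi_kap_shift:
  assumes "0 < s" "0 < b" "0 < s'" "0 < b'" "s + b = s' + b'" and x: "x \<in> S" and z: "z \<in> S"
  shows "(\<integral>y. poi s (x \<bullet> y) * kap b (z \<bullet> y) \<partial>\<sigma>) = (\<integral>y. poi s' (x \<bullet> y) * kap b' (z \<bullet> y) \<partial>\<sigma>)"
proof -
  have d: "((\<lambda>t. \<integral>y. kap (s + t) (x \<bullet> y) * kap b (z \<bullet> y) \<partial>\<sigma>) has_real_derivative
     - a * (\<integral>y. poi s (x \<bullet> y) * kap b (z \<bullet> y) \<partial>\<sigma>)) (at 0)"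
    using deriv_kap_kap[OF assms(1,2) x z, of 0] by simp
  have d': "((\<lambda>t. \<integral>y. kap (s' + t) (x \<bullet> y) * kap b' (z \<bullet> y) \<partial>\<sigma>) has_real_derivative
     - a * (\<integral>y. poi s' (x \<bullet> y) * kap b' (z \<bullet> y) \<partial>\<sigma>)) (at 0)"
    using deriv_kap_kap[OF assms(3,4) x z, of 0] by simp
  have "((\<lambda>t. \<integral>y. kap (s' + t) (x \<bullet> y) * kap b' (z \<bullet> y) \<partial>\<sigma>) has_real_derivative
     - a * (\<integral>y. poi s (x \<bullet> y) * kap b (z \<bullet> y) \<partial>\<sigma>)) (at 0)"
    by (rule DERIV_cong_ev[THEN iffD1, OF refl _ refl d])
       (use assms in \<open>auto intro!: eventually_nhds_in_open[of "{- min s s'<..}" 0, THEN eventually_mono] kap_kap_shift\<close>)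
  from DERIV_unique[OF d' this] show ?thesis using a_pos by simp
qed

lemma integrable_poi: "s \<noteq> 0 \<Longrightarrow> x \<in> S \<Longrightarrow> integrable \<sigma> (\<lambda>y. poi s (x \<bullet> y))"
  by (intro integrable_continuous_on_S continuous_on_inner_S[OF poi_isCont_u])

lemma integrable_kap: "s \<noteq> 0 \<Longrightarrow> x \<in> S \<Longrightarrow> integrable \<sigma> (\<lambda>y. kap s (x \<bullet> y))"
  by (intro integrable_continuous_on_S continuous_on_inner_S[OF kap_isCont_u])

lemma poi_kap_limit:
  assumes s: "0 < s" and x: "x \<in> S"
  shows "((\<lambda>b. exp (a * b) * (\<integral>y. poi s (x \<bullet> y) * kap b (x \<bullet> y) \<partial>\<sigma>)) \<longlongrightarrow> (\<integral>y. poi s (x \<bullet> y) \<partial>\<sigma>)) at_top"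
proof (rule tendsto_sandwich)
  let ?N = "\<integral>y. poi s (x \<bullet> y) \<partial>\<sigma>"
  have u: "\<bar>x \<bullet> y\<bar> \<le> 1" if "y \<in> S" for y using abs_inner_le_1[OF x that] .
  show "\<forall>\<^sub>F b in at_top. (1 + exp (- b)) powr (- 2 * a) * ?N \<le> exp (a * b) * (\<integral>y. poi s (x \<bullet> y) * kap b (x \<bullet> y) \<partial>\<sigma>)"
  proof (rule eventually_mono[OF eventually_gt_at_top[of 0]])
    fix b :: real assume b: "0 < b"
    have "(\<integral>y. (1 + exp (- b)) powr (- 2 * a) * poi s (x \<bullet> y) \<partial>\<sigma>) \<le> (\<integral>y. exp (a * b) * (poi s (x \<bullet> y) * kap b (x \<bullet> y)) \<partial>\<sigma>)"
    proof (intro integral_mono)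
      fix y assume "y \<in> space \<sigma>"
      then have y: "y \<in> S" by simp
      from mult_right_mono[OF exp_kap_bounds(1)[OF b u[OF y]] poi_nonneg[OF s x y]]
      show "(1 + exp (- b)) powr (- 2 * a) * poi s (x \<bullet> y) \<le> exp (a * b) * (poi s (x \<bullet> y) * kap b (x \<bullet> y))" by (simp add: mult_ac)
    qed (use s b x integrable_poi integrable_poi_kap in auto)
    then show "(1 + exp (- b)) powr (- 2 * a) * ?N \<le> exp (a * b) * (\<integral>y. poi s (x \<bullet> y) * kap b (x \<bullet> y) \<partial>\<sigma>)" by simp
  qed
  show "\<forall>\<^sub>F b in at_top. exp (a * b) * (\<integral>y. poi s (x \<bullet> y) * kap b (x \<bullet> y) \<partial>\<sigma>) \<le> (1 - exp (- b)) powr (- 2 * a) * ?N"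
  proof (rule eventually_mono[OF eventually_gt_at_top[of 0]])
    fix b :: real assume b: "0 < b"
    have "(\<integral>y. exp (a * b) * (poi s (x \<bullet> y) * kap b (x \<bullet> y)) \<partial>\<sigma>) \<le> (\<integral>y. (1 - exp (- b)) powr (- 2 * a) * poi s (x \<bullet> y) \<partial>\<sigma>)"
    proof (intro integral_mono)
      fix y assume "y \<in> space \<sigma>"
      then have y: "y \<in> S" by simp
      from mult_right_mono[OF exp_kap_bounds(2)[OF b u[OF y]] poi_nonneg[OF s x y]]
      show "exp (a * b) * (poi s (x \<bullet> y) * kap b (x \<bullet> y)) \<le> (1 - exp (- b)) powr (- 2 * a) * poi s (x \<bullet> y)" by (simp add: mult_ac)
    qed (use s b x integrable_poi integrable_poi_kap in auto)
    then show "exp (a * b) * (\<integral>y. poi s (x \<bullet> y) * kap b (x \<bullet> y) \<partial>\<sigma>) \<le> (1 - exp (- b)) powr (- 2 * a) * ?N" by simp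
  qed
  have "((\<lambda>b::real. (1 + exp (- b)) powr (- 2 * a)) \<longlongrightarrow> 1) at_top" "((\<lambda>b::real. (1 - exp (- b)) powr (- 2 * a)) \<longlongrightarrow> 1) at_top"
    by real_asymp+
  from tendsto_mult_right[OF this(1), of ?N] tendsto_mult_right[OF this(2), of ?N]
  show "((\<lambda>b. (1 + exp (- b)) powr (- 2 * a) * ?N) \<longlongrightarrow> ?N) at_top" "((\<lambda>b. (1 - exp (- b)) powr (- 2 * a) * ?N) \<longlongrightarrow> ?N) at_top"
    by simp_all
qed

text \<open>\<open>poi_kap_shift\<close> equates the pairings at \<open>(s, b)\<close> and at
  \<open>(s', b + s - s')\<close>. As \<open>b\<close> tends to infinity, \<open>kap\<close>
  normalised by \<open>exp (a * b)\<close> becomes the constant 1 and only the masses of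
  \<open>poi\<close> remain.\<close>

lemma integral_poi_exp_const:
  assumes s: "0 < s" and s': "0 < s'" and x: "x \<in> S"
  shows "exp (a * s) * (\<integral>y. poi s (x \<bullet> y) \<partial>\<sigma>) = exp (a * s') * (\<integral>y. poi s' (x \<bullet> y) \<partial>\<sigma>)"
proof -
  let ?A = "\<lambda>s b. \<integral>y. poi s (x \<bullet> y) * kap b (x \<bullet> y) \<partial>\<sigma>"
  have l1: "((\<lambda>b. exp (a * s) * (exp (a * b) * ?A s b)) \<longlongrightarrow> exp (a * s) * (\<integral>y. poi s (x \<bullet> y) \<partial>\<sigma>)) at_top"
    by (intro tendsto_intros poi_kap_limit s x)
  have sh: "filterlim (\<lambda>b. (s - s') + b) at_top at_top"
    by (rule filterlim_tendsto_add_at_top[OF tendsto_const filterlim_ident])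
  have l2: "((\<lambda>b. exp (a * s') * (exp (a * ((s - s') + b)) * ?A s' ((s - s') + b))) \<longlongrightarrow> exp (a * s') * (\<integral>y. poi s' (x \<bullet> y) \<partial>\<sigma>)) at_top"
    by (intro tendsto_mult tendsto_const filterlim_compose[OF poi_kap_limit[OF s' x] sh])
  have "\<forall>\<^sub>F b in at_top. exp (a * s') * (exp (a * ((s - s') + b)) * ?A s' ((s - s') + b)) = exp (a * s) * (exp (a * b) * ?A s b)"
  proof (rule eventually_mono[OF eventually_gt_at_top[of "max 0 (s' - s)"]])
    fix b assume b: "max 0 (s' - s) < b"
    have "?A s' ((s - s') + b) = ?A s b"
      by (rule poi_kap_shift) (use b s s' x in auto)
    then show "exp (a * s') * (exp (a * ((s - s') + b)) * ?A s' ((s - s') + b)) = exp (a * s) * (exp (a * b) * ?A s b)"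
      by (simp add: algebra_simps flip: exp_add)
  qed
  from Lim_transform_eventually[OF l2 this] show ?thesis
    by (intro tendsto_unique[OF _ l1]) auto
qed

text \<open>The quantity \<open>exp (a * s)\<close> times the mass does not depend on
  \<open>s\<close>, and for large \<open>s\<close> the kernel normalised in this way tends to 1
  uniformly; the constant is therefore \<open>V\<close>.\<close>

lemma integral_poi:
  assumes s: "0 < s" and x: "x \<in> S"
  shows "(\<integral>y. poi s (x \<bullet> y) \<partial>\<sigma>) = V * exp (- a * s)"
proof -
  let ?F = "\<lambda>t. exp (a * t) * (\<integral>y. poi t (x \<bullet> y) \<partial>\<sigma>)"
  have u: "\<bar>x \<bullet> y\<bar> \<le> 1" if "y \<in> S" for y using abs_inner_le_1[OF x that] .
  have "(?F \<longlongrightarrow> V) at_top"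
  proof (rule tendsto_sandwich)
    show "\<forall>\<^sub>F b in at_top. V * ((1 - exp (- 2 * b)) * (1 + exp (- b)) powr (- 2 * (a + 1))) \<le> ?F b"
    proof (rule eventually_mono[OF eventually_gt_at_top[of 0]])
      fix b :: real assume b: "0 < b"
      have "(\<integral>y. (1 - exp (- 2 * b)) * (1 + exp (- b)) powr (- 2 * (a + 1)) \<partial>\<sigma>) \<le> (\<integral>y. exp (a * b) * poi b (x \<bullet> y) \<partial>\<sigma>)"
        by (intro integral_mono exp_poi_bounds(1) b) (use b x u integrable_poi in auto)
      then show "V * ((1 - exp (- 2 * b)) * (1 + exp (- b)) powr (- 2 * (a + 1))) \<le> ?F b"
        by (simp add: V_def)
    qed
    show "\<forall>\<^sub>F b in at_top. ?F b \<le> V * ((1 - exp (- 2 * b)) * (1 - exp (- b)) powr (- 2 * (a + 1)))"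
    proof (rule eventually_mono[OF eventually_gt_at_top[of 0]])
      fix b :: real assume b: "0 < b"
      have "(\<integral>y. exp (a * b) * poi b (x \<bullet> y) \<partial>\<sigma>) \<le> (\<integral>y. (1 - exp (- 2 * b)) * (1 - exp (- b)) powr (- 2 * (a + 1)) \<partial>\<sigma>)"
        by (intro integral_mono exp_poi_bounds(2) b) (use b x u integrable_poi in auto)
      then show "?F b \<le> V * ((1 - exp (- 2 * b)) * (1 - exp (- b)) powr (- 2 * (a + 1)))"
        by (simp add: V_def)
    qed
    have "((\<lambda>b::real. (1 - exp (- 2 * b)) * (1 + exp (- b)) powr (- 2 * (a + 1))) \<longlongrightarrow> 1) at_top"
      "((\<lambda>b::real. (1 - exp (- 2 * b)) * (1 - exp (- b)) powr (- 2 * (a + 1))) \<longlongrightarrow> 1) at_top"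
      by real_asymp+
    from tendsto_mult_left[OF this(1), of V] tendsto_mult_left[OF this(2), of V]
    show "((\<lambda>b. V * ((1 - exp (- 2 * b)) * (1 + exp (- b)) powr (- 2 * (a + 1)))) \<longlongrightarrow> V) at_top"
      "((\<lambda>b. V * ((1 - exp (- 2 * b)) * (1 - exp (- b)) powr (- 2 * (a + 1)))) \<longlongrightarrow> V) at_top"
      by simp_all
  qed
  moreover have "\<forall>\<^sub>F b in at_top. ?F b = ?F s"
    by (rule eventually_mono[OF eventually_gt_at_top[of 0]]) (use integral_poi_exp_const[OF _ s x] in blast)
  ultimately have "((\<lambda>b::real. ?F s) \<longlongrightarrow> V) at_top" by (rule Lim_transform_eventually)
  then have "?F s = V" by (simp add: tendsto_const_iff)
  then show ?thesis by (simp add: exp_minus field_simps)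
qed

lemma dist_sq: "x \<in> S \<Longrightarrow> y \<in> S \<Longrightarrow> (norm (x - y))\<^sup>2 = 2 - 2 * (x \<bullet> y)"
  unfolding power2_norm_eq_inner by (simp add: inner_diff_left inner_diff_right inner_commute norm_eq_1)

lemma poi_far:
  assumes "0 < h" "x \<in> S" "y \<in> S" "\<delta> \<le> norm (x - y)" "0 < \<delta>"
  shows "poi h (x \<bullet> y) \<le> 2 * sinh h * (\<delta>\<^sup>2) powr (- a - 1)"
proof -
  have "\<delta>\<^sup>2 \<le> (norm (x - y))\<^sup>2" using assms by (intro power_mono) auto
  then have "\<delta>\<^sup>2 \<le> 2 * cosh h - 2 * (x \<bullet> y)" using dist_sq[OF assms(2,3)] cosh_real_ge_1[of h] by linarith
  then show ?thesis
    unfolding poi_def using assms a_pos by (intro mult_left_mono powr_mono2') auto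
qed

text \<open>The function \<open>y \<mapsto> kap b (z \<bullet> y)\<close> is, up to a factor, the restriction to the unit
  sphere of a harmonic function on a larger ball, and \<open>poi s\<close> is the Poisson kernel of the unit
  ball for the radius \<open>exp (- s)\<close>.\<close>

lemma poi_kap_conv:
  assumes s: "0 < s" and b: "0 < b" and x: "x \<in> S" and z: "z \<in> S"
  shows "(\<integral>y. poi s (x \<bullet> y) * kap b (z \<bullet> y) \<partial>\<sigma>) = V * kap (s + b) (x \<bullet> z)"
proof -
  define T where "T = s + b"
  have T: "0 < T" using s b by (simp add: T_def)
  define A where "A = (\<integral>y. poi s (x \<bullet> y) * kap b (z \<bullet> y) \<partial>\<sigma>)"
  define g where "g = 2 * cosh (T/2) - 2"
  have g: "0 < g" using gap_pos[of "T/2" 1] T by (simp add: g_def)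
  have D: "g \<le> 2 * cosh t - 2 * u" if "T/2 \<le> t" "u \<le> 1" for t u
    using cosh_real_nonneg_le_iff[of "T/2" t] that T unfolding g_def by linarith
  \<comment> \<open>The two summands bound the derivative of \<open>kap\<close> in \<open>u\<close>
    at time \<open>T\<close> and its derivative in \<open>t\<close> on \<open>{T/2..T}\<close>,
    where the gap is at least \<open>g\<close>.\<close>
  define L where "L = (2 * a + 2 * a * sinh T) * g powr (- a - 1)"
  have L: "0 \<le> L" using T a_pos by (simp add: L_def)
  have lip: "\<bar>kap (T - h) u - kap T v\<bar> \<le> L * (h + \<bar>u - v\<bar>)" if h: "0 < h" "h \<le> T/2" and uv: "\<bar>u\<bar> \<le> 1" "\<bar>v\<bar> \<le> 1" for h u v
  proof -
    have "norm (kap (T - h) u - kap T u) \<le> (2 * a * sinh T * g powr (- a - 1)) * norm (T - h - T)"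
    proof (rule field_differentiable_bound[of "{T/2..T}" "\<lambda>t. kap t u" "\<lambda>t. - a * poi t u"])
      fix t assume t: "t \<in> {T/2..T}"
      show "((\<lambda>t. kap t u) has_field_derivative - a * poi t u) (at t within {T/2..T})"
        using kap_deriv_t[of t u] t T uv by (auto intro: has_field_derivative_at_within)
      have "poi t u \<le> 2 * sinh T * g powr (- a - 1)"
        unfolding poi_def using t T a_pos g D[of t u] uv by (intro mult_mono powr_mono2') auto
      then show "norm (- a * poi t u) \<le> 2 * a * sinh T * g powr (- a - 1)"
        using poi_pos[of t u] t T abs_le_D1[OF uv(1)] a_pos mult_left_mono[of "poi t u" "2 * sinh T * g powr (- a - 1)" a]
        by (simp add: abs_mult)
    qed (use h T in auto)
    moreover have "norm (kap T u - kap T v) \<le> (2 * a * g powr (- a - 1)) * norm (u - v)"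
    proof (rule field_differentiable_bound[of "{-1..1}" "kap T" "kap_u T"])
      fix w :: real assume w: "w \<in> {-1..1}"
      then have Dw: "g \<le> 2 * cosh T - 2 * w" using D[of T w] T by auto
      show "(kap T has_field_derivative kap_u T w) (at w within {-1..1})"
        by (rule has_field_derivative_at_within[OF kap_deriv_u]) (use Dw g in linarith)
      show "norm (kap_u T w) \<le> 2 * a * g powr (- a - 1)"
        unfolding kap_u_def real_norm_def abs_mult using a_pos g Dw
        by (intro mult_mono) (auto intro!: powr_mono2')
    qed (use uv in auto)
    ultimately have "\<bar>kap (T - h) u - kap T v\<bar> \<le> 2 * a * sinh T * g powr (- a - 1) * h + 2 * a * g powr (- a - 1) * \<bar>u - v\<bar>"
      using h by (simp add: abs_le_iff)
    also have "\<dots> \<le> L * h + L * \<bar>u - v\<bar>"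
      unfolding L_def using h T a_pos by (intro add_mono mult_right_mono) (auto simp: algebra_simps)
    finally show ?thesis by (simp add: algebra_simps)
  qed
  \<comment> \<open>By \<open>poi_kap_shift\<close>, \<open>A\<close> may be computed with a small
    first parameter \<open>h\<close>, where \<open>poi h\<close> is an approximate identity at
    \<open>x\<close>. Within distance \<open>\<delta>\<close> of \<open>x\<close> the Lipschitz
    bound applies; outside, the kernel is of size \<open>sinh h\<close>. Afterwards \<open>h\<close>
    and then \<open>\<delta>\<close> tend to 0.\<close>
  have main: "\<bar>A - V * exp (- a * h) * kap T (x \<bullet> z)\<bar> \<le> L * V * h + (L * V * \<delta> + 4 * L * V * sinh h * (\<delta>\<^sup>2) powr (- a - 1))"
    if h: "0 < h" "h \<le> T/2" and \<delta>: "0 < \<delta>" for h \<delta>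
  proof -
    have Th: "0 < T - h" using h T by linarith
    have "A = (\<integral>y. poi h (x \<bullet> y) * kap (T - h) (z \<bullet> y) \<partial>\<sigma>)"
      unfolding A_def by (rule poi_kap_shift) (use s b h Th x z in \<open>auto simp: T_def\<close>)
    moreover have "V * exp (- a * h) * kap T (x \<bullet> z) = (\<integral>y. poi h (x \<bullet> y) * kap T (x \<bullet> z) \<partial>\<sigma>)"
      using integral_poi[OF h(1) x] by simp
    ultimately have e1: "A - V * exp (- a * h) * kap T (x \<bullet> z) = (\<integral>y. poi h (x \<bullet> y) * (kap (T - h) (z \<bullet> y) - kap T (x \<bullet> z)) \<partial>\<sigma>)"
      using integrable_poi_kap[of h "T - h" x z] integrable_poi[of h x] h Th x z
      by (simp add: right_diff_distrib)
    have b2: "\<bar>\<integral>y. poi h (x \<bullet> y) * (kap (T - h) (z \<bullet> y) - kap T (x \<bullet> z)) \<partial>\<sigma>\<bar> \<le> (\<integral>y. L * h * poi h (x \<bullet> y) + (L * \<delta> * poi h (x \<bullet> y) + L * (4 * sinh h * (\<delta>\<^sup>2) powr (- a - 1))) \<partial>\<sigma>)"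
    proof (rule order_trans[OF integral_abs_bound], rule integral_mono)
      show "integrable \<sigma> (\<lambda>y. \<bar>poi h (x \<bullet> y) * (kap (T - h) (z \<bullet> y) - kap T (x \<bullet> z))\<bar>)"
        using integrable_poi_kap[of h "T - h" x z] integrable_poi[of h x] h Th x z
        by (simp add: right_diff_distrib)
      show "integrable \<sigma> (\<lambda>y. L * h * poi h (x \<bullet> y) + (L * \<delta> * poi h (x \<bullet> y) + L * (4 * sinh h * (\<delta>\<^sup>2) powr (- a - 1))))"
        using integrable_poi[of h x] h x by simp
      fix y assume "y \<in> space \<sigma>"
      then have y: "y \<in> S" by simp
      have pn: "0 \<le> poi h (x \<bullet> y)" by (rule poi_nonneg[OF h(1) x y])
      have "\<bar>z \<bullet> y - x \<bullet> z\<bar> = \<bar>z \<bullet> (y - x)\<bar>" by (simp add: inner_diff_right inner_commute)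
      also have "\<dots> \<le> norm (x - y)" using Cauchy_Schwarz_ineq2[of z "y - x"] z by (simp add: norm_minus_commute)
      finally have zd: "\<bar>z \<bullet> y - x \<bullet> z\<bar> \<le> norm (x - y)" .
      have bnd: "poi h (x \<bullet> y) * norm (x - y) \<le> \<delta> * poi h (x \<bullet> y) + 4 * sinh h * (\<delta>\<^sup>2) powr (- a - 1)"
      proof (cases "norm (x - y) \<le> \<delta>")
        case True
        then have "poi h (x \<bullet> y) * norm (x - y) \<le> poi h (x \<bullet> y) * \<delta>" using pn by (intro mult_left_mono)
        moreover have "0 \<le> 4 * sinh h * (\<delta>\<^sup>2) powr (- a - 1)" using h by simp
        ultimately show ?thesis by (simp add: mult.commute)
      next
        case False
        have "norm (x - y) \<le> 2" using norm_triangle_ineq4[of x y] x y by simp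
        then have "poi h (x \<bullet> y) * norm (x - y) \<le> (2 * sinh h * (\<delta>\<^sup>2) powr (- a - 1)) * 2"
          using poi_far[OF h(1) x y _ \<delta>] False pn h by (intro mult_mono) auto
        then show ?thesis using pn \<delta> by (simp add: add_increasing)
      qed
      have "\<bar>kap (T - h) (z \<bullet> y) - kap T (x \<bullet> z)\<bar> \<le> L * (h + \<bar>z \<bullet> y - x \<bullet> z\<bar>)"
        by (rule lip[OF h]) (use abs_inner_le_1 x y z in auto)
      also have "\<dots> \<le> L * (h + norm (x - y))" using zd L by (intro mult_left_mono) auto
      finally have "\<bar>poi h (x \<bullet> y) * (kap (T - h) (z \<bullet> y) - kap T (x \<bullet> z))\<bar> \<le> poi h (x \<bullet> y) * (L * (h + norm (x - y)))"
        using pn by (simp add: abs_mult mult_left_mono)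
      also have "\<dots> = L * h * poi h (x \<bullet> y) + L * (poi h (x \<bullet> y) * norm (x - y))" by (simp add: algebra_simps)
      also have "\<dots> \<le> L * h * poi h (x \<bullet> y) + L * (\<delta> * poi h (x \<bullet> y) + 4 * sinh h * (\<delta>\<^sup>2) powr (- a - 1))"
        by (intro add_left_mono mult_left_mono bnd L)
      finally show "\<bar>poi h (x \<bullet> y) * (kap (T - h) (z \<bullet> y) - kap T (x \<bullet> z))\<bar>
        \<le> L * h * poi h (x \<bullet> y) + (L * \<delta> * poi h (x \<bullet> y) + L * (4 * sinh h * (\<delta>\<^sup>2) powr (- a - 1)))"
        by (simp add: algebra_simps)
    qed
    have e3: "(\<integral>y. L * h * poi h (x \<bullet> y) + (L * \<delta> * poi h (x \<bullet> y) + L * (4 * sinh h * (\<delta>\<^sup>2) powr (- a - 1))) \<partial>\<sigma>) = L * h * (V * exp (- a * h)) + (L * \<delta> * (V * exp (- a * h)) + 4 * L * V * sinh h * (\<delta>\<^sup>2) powr (- a - 1))"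
    proof -
      have ip: "integrable \<sigma> (\<lambda>y. poi h (x \<bullet> y))" using integrable_poi[of h x] h(1) x by simp
      have "(\<integral>y. c1 * poi h (x \<bullet> y) + (c2 * poi h (x \<bullet> y) + c3) \<partial>\<sigma>) = c1 * (V * exp (- a * h)) + (c2 * (V * exp (- a * h)) + V * c3)" for c1 c2 c3
        unfolding integral_poi[OF h(1) x, symmetric] using ip by (simp add: V_def)
      then show ?thesis by (simp only:) (simp only: mult_ac)
    qed
    have b4: "L * h * (V * exp (- a * h)) + (L * \<delta> * (V * exp (- a * h)) + 4 * L * V * sinh h * (\<delta>\<^sup>2) powr (- a - 1)) \<le> L * h * V + (L * \<delta> * V + 4 * L * V * sinh h * (\<delta>\<^sup>2) powr (- a - 1))"
    proof -
      have "exp (- a * h) \<le> 1" using a_pos h by (simp add: mult_nonneg_nonneg)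
      then have "V * exp (- a * h) \<le> V" using V_pos by (simp add: mult_left_le)
      then show ?thesis using L h \<delta> by (intro add_mono mult_left_mono order_refl) auto
    qed
    show ?thesis unfolding e1 using b2 b4 unfolding e3 by (simp add: mult_ac)
  qed
  have le: "\<bar>A - V * kap T (x \<bullet> z)\<bar> \<le> L * V * \<delta>" if \<delta>: "0 < \<delta>" for \<delta>
  proof (rule tendsto_le[OF trivial_limit_at_right_real])
    have "((\<lambda>h. L * V * h + (L * V * \<delta> + 4 * L * V * sinh h * (\<delta>\<^sup>2) powr (- a - 1))) \<longlongrightarrow> L * V * 0 + (L * V * \<delta> + 4 * L * V * sinh 0 * (\<delta>\<^sup>2) powr (- a - 1))) (at_right 0)"
      by (intro tendsto_intros)
    then show "((\<lambda>h. L * V * h + (L * V * \<delta> + 4 * L * V * sinh h * (\<delta>\<^sup>2) powr (- a - 1))) \<longlongrightarrow> L * V * \<delta>) (at_right 0)" by simp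
    have "((\<lambda>h. \<bar>A - V * exp (- a * h) * kap T (x \<bullet> z)\<bar>) \<longlongrightarrow> \<bar>A - V * exp (- a * 0) * kap T (x \<bullet> z)\<bar>) (at_right 0)"
      by (intro tendsto_intros)
    then show "((\<lambda>h. \<bar>A - V * exp (- a * h) * kap T (x \<bullet> z)\<bar>) \<longlongrightarrow> \<bar>A - V * kap T (x \<bullet> z)\<bar>) (at_right 0)" by simp
    show "\<forall>\<^sub>F h in at_right 0. \<bar>A - V * exp (- a * h) * kap T (x \<bullet> z)\<bar> \<le> L * V * h + (L * V * \<delta> + 4 * L * V * sinh h * (\<delta>\<^sup>2) powr (- a - 1))"
      using eventually_at_right_real[OF half_gt_zero[OF T]]
      by eventually_elim (use main[OF _ _ \<delta>] in auto)
  qed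
  have "\<bar>A - V * kap T (x \<bullet> z)\<bar> \<le> 0"
  proof (rule tendsto_le[OF trivial_limit_at_right_real])
    show "((\<lambda>\<delta>. L * V * \<delta>) \<longlongrightarrow> 0) (at_right 0)" by (auto intro!: tendsto_eq_intros)
    show "((\<lambda>\<delta>::real. \<bar>A - V * kap T (x \<bullet> z)\<bar>) \<longlongrightarrow> \<bar>A - V * kap T (x \<bullet> z)\<bar>) (at_right 0)" by simp
    show "\<forall>\<^sub>F \<delta> in at_right 0. \<bar>A - V * kap T (x \<bullet> z)\<bar> \<le> L * V * \<delta>"
      using eventually_at_right_less[of 0] by eventually_elim (rule le)
  qed
  then show ?thesis by (simp add: A_def T_def)
qed


section \<open>The Riesz kernel as an increasing limit of bounded kernels\<close>

lemma kap_abs: "kap \<bar>t\<bar> u = kap t u"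
  by (simp add: kap_def)

lemma kap_antimono: "0 \<le> s \<Longrightarrow> s \<le> t \<Longrightarrow> 0 < 2 * cosh s - 2 * u \<Longrightarrow> kap t u \<le> kap s u"
  unfolding kap_def using cosh_real_nonneg_le_iff[of s t] a_pos by (intro powr_mono2') auto

lemma kap_measurable [measurable]: "kap t \<in> borel_measurable borel"
  unfolding kap_def by measurable

lemma poi_measurable [measurable]: "poi t \<in> borel_measurable borel"
  unfolding poi_def by measurable

lemma riesz_kernel_eq:
  assumes x: "x \<in> S" and z: "z \<in> S" and r: "0 < r" and ne: "r *\<^sub>R x \<noteq> z"
  shows "riesz_kernel (r *\<^sub>R x) z = ennreal (r powr (- a) * kap (ln r) (x \<bullet> z))"
proof -
  have n: "0 < norm (r *\<^sub>R x - z)" using ne by simp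
  have sq: "(norm (r *\<^sub>R x - z))\<^sup>2 = r * (2 * cosh (ln r) - 2 * (x \<bullet> z))"
    unfolding power2_norm_eq_inner using x z r
    by (simp add: cosh_ln_real inner_diff_left inner_diff_right inner_commute norm_eq_1 algebra_simps)
  have "norm (r *\<^sub>R x - z) ^ (CARD('n) - 2) = norm (r *\<^sub>R x - z) powr (2 * a)"
  proof -
    have "2 * a = real (CARD('n) - 2)" using card_n by (simp add: a_def of_nat_diff)
    then show ?thesis using n by (simp add: powr_realpow)
  qed
  also have "\<dots> = (norm (r *\<^sub>R x - z))\<^sup>2 powr a"
    using n by (simp add: powr_powr flip: powr_numeral)
  also have "inverse \<dots> = r powr (- a) * kap (ln r) (x \<bullet> z)"
    unfolding sq kap_def by (simp add: powr_mult powr_minus inverse_mult_distrib)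
  finally show ?thesis
    unfolding riesz_kernel_def using n by (simp add: inverse_ennreal)
qed

lemma riesz_kernel_eq_S:
  assumes "x \<in> S" "z \<in> S" "x \<noteq> z"
  shows "riesz_kernel x z = ennreal (kap 0 (x \<bullet> z))"
  using riesz_kernel_eq[of x z 1] assms by simp

lemma riesz_kernel_diag: "riesz_kernel x x = (\<infinity>::ennreal)" for x :: "real^'n"
  using card_n by (simp add: riesz_kernel_def)

lemma inner_less_1: "x \<in> S \<Longrightarrow> z \<in> S \<Longrightarrow> x \<noteq> z \<Longrightarrow> x \<bullet> z < 1"
  using dist_sq[of x z] by (smt (verit) norm_eq_zero right_minus_eq zero_less_power2)

lemma kap_le_kap_0: "0 \<le> t \<Longrightarrow> x \<in> S \<Longrightarrow> z \<in> S \<Longrightarrow> x \<noteq> z \<Longrightarrow> kap t (x \<bullet> z) \<le> kap 0 (x \<bullet> z)"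
  by (rule kap_antimono) (use inner_less_1 in auto)

lemma kap_le_riesz:
  assumes "0 < t" "x \<in> S" "z \<in> S"
  shows "ennreal (kap t (x \<bullet> z)) \<le> riesz_kernel x z"
proof (cases "x = z")
  case False
  then show ?thesis using kap_le_kap_0[of t x z] assms by (simp add: riesz_kernel_eq_S ennreal_leI)
qed (simp add: riesz_kernel_diag)

definition tau :: "nat \<Rightarrow> real" where "tau n = 1 / real (Suc n)"

lemma tau_pos: "0 < tau n" by (simp add: tau_def)

lemma tau_lim: "tau \<longlonglongrightarrow> 0" unfolding tau_def by (rule LIMSEQ_Suc[OF lim_1_over_n])

lemma tau_antimono: "m \<le> n \<Longrightarrow> tau n \<le> tau m"
  by (simp add: tau_def frac_le)

lemma kap_tau_lim:
  assumes "x \<in> S" "z \<in> S"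
  shows "(\<lambda>n. ennreal (kap (tau n) (x \<bullet> z))) \<longlonglongrightarrow> riesz_kernel x z"
proof (cases "x = z")
  case False
  have "isCont (\<lambda>t. kap t (x \<bullet> z)) 0"
    unfolding kap_def using inner_less_1[OF assms False] by (intro continuous_intros) auto
  then have "(\<lambda>n. kap (tau n) (x \<bullet> z)) \<longlonglongrightarrow> kap 0 (x \<bullet> z)"
    using tau_lim isCont_tendsto_compose by blast
  then show ?thesis using False assms by (simp add: riesz_kernel_eq_S tendsto_ennrealI)
next
  case True
  have l0: "(\<lambda>n. 2 * cosh (tau n) - 2) \<longlonglongrightarrow> 2 * cosh 0 - 2"
    by (intro tendsto_intros tau_lim)
  have pos: "0 < 2 * cosh (tau n) - 2" for n using gap_pos[of "tau n" 1] tau_pos[of n] by simp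
  have "filterlim (\<lambda>n. 2 * cosh (tau n) - 2) (at_right 0) sequentially"
    using l0 pos by (intro filterlim_atI tendsto_imp_filterlim_at_right) (auto simp: eventually_sequentially)
  moreover have "filterlim (\<lambda>w::real. w powr (- a)) at_top (at_right 0)"
    using a_pos by real_asymp
  ultimately have "filterlim (\<lambda>n. (2 * cosh (tau n) - 2) powr (- a)) at_top sequentially"
    by (rule filterlim_compose[rotated])
  then have "filterlim (\<lambda>n. kap (tau n) (x \<bullet> z)) at_top sequentially"
    using True assms by (simp add: kap_def norm_eq_1)
  then have "(\<lambda>n. ennreal (kap (tau n) (x \<bullet> z))) \<longlonglongrightarrow> top"
    by (simp add: ennreal_tendsto_top_eq_at_top)
  then show ?thesis using True by (simp add: riesz_kernel_diag)
qed

lemma kap_tau_incseq: "x \<in> S \<Longrightarrow> z \<in> S \<Longrightarrow> incseq (\<lambda>n. ennreal (kap (tau n + t) (x \<bullet> z)))" if "0 \<le> t"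
  unfolding incseq_def using tau_antimono that gap_pos inner_le_1
  by (auto intro!: ennreal_leI kap_antimono add_nonneg_nonneg simp: less_imp_le[OF tau_pos])
     (metis add_pos_nonneg gap_pos less_irrefl tau_pos inner_le_1 diff_gt_0_iff_gt mult_less_cancel_left_pos zero_less_numeral mem_sphere_0)

subsection \<open>Unit masses and their potentials\<close>

definition mass :: "(real^'n) measure \<Rightarrow> bool" where
  "mass \<mu> \<longleftrightarrow> sets \<mu> = sets (restrict_space borel S) \<and> emeasure \<mu> S = 1"

definition pot :: "(real^'n) measure \<Rightarrow> real \<Rightarrow> real^'n \<Rightarrow> real" where
  "pot \<mu> t x = (\<integral>z. kap t (x \<bullet> z) \<partial>\<mu>)"

definition npot :: "(real^'n) measure \<Rightarrow> real^'n \<Rightarrow> ennreal" where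
  "npot \<mu> x = (\<integral>\<^sup>+z. riesz_kernel x z \<partial>\<mu>)"

text \<open>Where the potential is infinite this takes the value 0; by \<open>npot_finite_AE\<close>
  that happens only on a null set.\<close>

definition rpot :: "(real^'n) measure \<Rightarrow> real^'n \<Rightarrow> real" where
  "rpot \<mu> x = enn2real (npot \<mu> x)"

lemma mass_space: "mass \<mu> \<Longrightarrow> space \<mu> = S"
  using sets_eq_imp_space_eq[of \<mu> "restrict_space borel S"] by (simp add: mass_def space_restrict_space)

lemma mass_finite: "mass \<mu> \<Longrightarrow> finite_measure \<mu>"
  by (rule finite_measureI) (simp add: mass_space, simp add: mass_def)

lemma mass_measure: "mass \<mu> \<Longrightarrow> measure \<mu> S = 1"
  by (simp add: mass_def measure_def)

lemma mass_ident [measurable (raw)]: "mass \<mu> \<Longrightarrow> (\<lambda>x. x) \<in> measurable \<mu> borel"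
  unfolding mass_def using measurable_cong_sets[of \<mu> "restrict_space borel S" borel borel]
  by (auto intro!: measurable_restrict_space1)

lemma mass_sets_eq: "mass \<mu> \<Longrightarrow> sets \<mu> = sets \<sigma>"
  by (simp add: mass_def sets_\<sigma>)

lemma mass_measurable: "mass \<mu> \<Longrightarrow> f \<in> borel_measurable \<sigma> \<Longrightarrow> f \<in> borel_measurable \<mu>"
  using measurable_cong_sets[OF mass_sets_eq refl] by blast

lemma mass_pair: "mass \<mu> \<Longrightarrow> pair_sigma_finite \<sigma> \<mu>"
  by (intro pair_sigma_finite.intro sigma_finite_measure_axioms finite_measure.axioms(1) mass_finite)

lemma mass_integrable_bounded:
  fixes f :: "real^'n \<Rightarrow> real"
  assumes "mass \<mu>" "f \<in> borel_measurable \<mu>" "\<And>x. x \<in> S \<Longrightarrow> \<bar>f x\<bar> \<le> B"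
  shows "integrable \<mu> f"
  using assms mass_finite[OF assms(1)] mass_space[OF assms(1)]
  by (intro finite_measure.integrable_const_bound[where B=B]) auto

lemma mass_swap:
  fixes f :: "real^'n \<Rightarrow> real^'n \<Rightarrow> real"
  assumes m: "mass \<mu>" and f: "case_prod f \<in> borel_measurable (\<sigma> \<Otimes>\<^sub>M \<mu>)"
    and B: "\<And>x z. x \<in> S \<Longrightarrow> z \<in> S \<Longrightarrow> \<bar>f x z\<bar> \<le> B"
  shows "(\<integral>x. \<integral>z. f x z \<partial>\<mu> \<partial>\<sigma>) = (\<integral>z. \<integral>x. f x z \<partial>\<sigma> \<partial>\<mu>)"
proof -
  interpret pair_sigma_finite \<sigma> \<mu> by (rule mass_pair[OF m])
  interpret M: finite_measure \<mu> by (rule mass_finite[OF m])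
  interpret P: finite_measure "\<sigma> \<Otimes>\<^sub>M \<mu>"
    by (rule finite_measure_pair_measure) (rule finite_measure_axioms M.finite_measure_axioms)+
  have "integrable (\<sigma> \<Otimes>\<^sub>M \<mu>) (case_prod f)"
    by (intro P.integrable_const_bound[where B = B] f AE_I2)
       (auto simp: space_pair_measure mass_space[OF m] B)
  from Fubini_integral[OF this] show ?thesis by simp
qed

lemma mass_swap_integrable:
  fixes f :: "real^'n \<Rightarrow> real^'n \<Rightarrow> real"
  assumes m: "mass \<mu>" and f: "case_prod f \<in> borel_measurable (\<sigma> \<Otimes>\<^sub>M \<mu>)"
    and B: "\<And>x z. x \<in> S \<Longrightarrow> z \<in> S \<Longrightarrow> \<bar>f x z\<bar> \<le> B"
  shows "integrable \<mu> (\<lambda>z. \<integral>x. f x z \<partial>\<sigma>)" "integrable \<sigma> (\<lambda>x. \<integral>z. f x z \<partial>\<mu>)"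
proof -
  interpret pair_sigma_finite \<sigma> \<mu> by (rule mass_pair[OF m])
  interpret M: finite_measure \<mu> by (rule mass_finite[OF m])
  interpret P: finite_measure "\<sigma> \<Otimes>\<^sub>M \<mu>"
    by (rule finite_measure_pair_measure) (rule finite_measure_axioms M.finite_measure_axioms)+
  have i: "integrable (\<sigma> \<Otimes>\<^sub>M \<mu>) (case_prod f)"
    by (intro P.integrable_const_bound[where B = B] f AE_I2)
       (auto simp: space_pair_measure mass_space[OF m] B)
  show "integrable \<mu> (\<lambda>z. \<integral>x. f x z \<partial>\<sigma>)" by (rule integrable_snd[OF i])
  show "integrable \<sigma> (\<lambda>x. \<integral>z. f x z \<partial>\<mu>)" using integrable_fst[OF i] by simp
qed

lemma kap_bounded:
  assumes "0 < t"
  obtains B where "\<And>s u. t \<le> s \<Longrightarrow> \<bar>u\<bar> \<le> 1 \<Longrightarrow> \<bar>kap s u\<bar> \<le> B"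
proof
  fix s u :: real assume s: "t \<le> s" and u: "\<bar>u\<bar> \<le> 1"
  have D: "0 < 2 * cosh t - 2" using gap_pos[of t 1] assms by simp
  have "2 * cosh t - 2 \<le> 2 * cosh s - 2 * u" using cosh_real_nonneg_le_iff[of t s] s u assms by auto
  then have "kap s u \<le> (2 * cosh t - 2) powr (- a)"
    unfolding kap_def using D a_pos by (intro powr_mono2') auto
  moreover have "0 \<le> kap s u" by (simp add: kap_def)
  ultimately show "\<bar>kap s u\<bar> \<le> (2 * cosh t - 2) powr (- a)" by simp
qed

lemma poi_bounded:
  assumes "0 < t"
  obtains B where "\<And>u. \<bar>u\<bar> \<le> 1 \<Longrightarrow> \<bar>poi t u\<bar> \<le> B"
proof
  fix u :: real assume u: "\<bar>u\<bar> \<le> 1"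
  have "poi t u \<le> poi t 1" using assms u by (intro poi_mono) auto
  then show "\<bar>poi t u\<bar> \<le> poi t 1" using poi_pos[of t u] assms abs_le_D1[OF u] by simp
qed

lemma pot_integrable:
  assumes m: "mass \<mu>" and t: "0 < t" and x: "x \<in> S"
  shows "integrable \<mu> (\<lambda>z. kap t (x \<bullet> z))"
proof -
  obtain B where B: "\<And>s u. t \<le> s \<Longrightarrow> \<bar>u\<bar> \<le> 1 \<Longrightarrow> \<bar>kap s u\<bar> \<le> B"
    using kap_bounded[OF t] by blast
  note [measurable] = mass_ident[OF m]
  show ?thesis
    by (rule mass_integrable_bounded[OF m, where B = B]) (measurable, intro B abs_inner_le_1 x order_refl)
qed

lemma pot_nonneg: "0 \<le> pot \<mu> t x"
  unfolding pot_def by (intro integral_nonneg_AE) (auto simp: kap_def)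

lemma pot_ennreal: "mass \<mu> \<Longrightarrow> 0 < t \<Longrightarrow> x \<in> S \<Longrightarrow> ennreal (pot \<mu> t x) = (\<integral>\<^sup>+z. ennreal (kap t (x \<bullet> z)) \<partial>\<mu>)"
  unfolding pot_def by (subst nn_integral_eq_integral[OF pot_integrable]) (auto simp: kap_def)

lemma kap_lipschitz:
  assumes "0 < t"
  obtains L where "0 \<le> L" "\<And>u v. \<bar>u\<bar> \<le> 1 \<Longrightarrow> \<bar>v\<bar> \<le> 1 \<Longrightarrow> \<bar>kap t u - kap t v\<bar> \<le> L * \<bar>u - v\<bar>"
proof
  define g where "g = 2 * cosh t - 2"
  have g: "0 < g" using gap_pos[of t 1] assms by (simp add: g_def)
  show "0 \<le> 2 * a * g powr (- a - 1)" using a_pos by simp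
  fix u v :: real assume uv: "\<bar>u\<bar> \<le> 1" "\<bar>v\<bar> \<le> 1"
  have "norm (kap t u - kap t v) \<le> (2 * a * g powr (- a - 1)) * norm (u - v)"
  proof (rule field_differentiable_bound[of "{-1..1}" "kap t" "kap_u t"])
    fix w :: real assume w: "w \<in> {-1..1}"
    then have Dw: "g \<le> 2 * cosh t - 2 * w" by (simp add: g_def)
    show "(kap t has_field_derivative kap_u t w) (at w within {-1..1})"
      by (rule has_field_derivative_at_within[OF kap_deriv_u]) (use Dw g in linarith)
    show "norm (kap_u t w) \<le> 2 * a * g powr (- a - 1)"
      unfolding kap_u_def real_norm_def abs_mult using a_pos g Dw
      by (intro mult_mono) (auto intro!: powr_mono2')
  qed (use uv in auto)
  then show "\<bar>kap t u - kap t v\<bar> \<le> (2 * a * g powr (- a - 1)) * \<bar>u - v\<bar>" by simp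
qed

lemma pot_lipschitz:
  assumes m: "mass \<mu>" and t: "0 < t"
  obtains L where "0 \<le> L" "\<And>x y. x \<in> S \<Longrightarrow> y \<in> S \<Longrightarrow> \<bar>pot \<mu> t x - pot \<mu> t y\<bar> \<le> L * norm (x - y)"
proof -
  obtain L where L: "0 \<le> L" "\<And>u v. \<bar>u\<bar> \<le> 1 \<Longrightarrow> \<bar>v\<bar> \<le> 1 \<Longrightarrow> \<bar>kap t u - kap t v\<bar> \<le> L * \<bar>u - v\<bar>"
    using kap_lipschitz[OF t] by blast
  have "\<bar>pot \<mu> t x - pot \<mu> t y\<bar> \<le> L * norm (x - y)" if x: "x \<in> S" and y: "y \<in> S" for x y
  proof -
    have "pot \<mu> t x - pot \<mu> t y = (\<integral>z. kap t (x \<bullet> z) - kap t (y \<bullet> z) \<partial>\<mu>)"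
      unfolding pot_def using pot_integrable[OF m t] x y by simp
    also have "\<bar>\<dots>\<bar> \<le> (\<integral>z. L * norm (x - y) \<partial>\<mu>)"
    proof (rule order_trans[OF integral_abs_bound], rule integral_mono)
      fix z assume "z \<in> space \<mu>"
      then have z: "z \<in> S" using mass_space[OF m] by simp
      have "\<bar>kap t (x \<bullet> z) - kap t (y \<bullet> z)\<bar> \<le> L * \<bar>x \<bullet> z - y \<bullet> z\<bar>"
        by (intro L(2) abs_inner_le_1 x y z)
      also have "\<bar>x \<bullet> z - y \<bullet> z\<bar> \<le> norm (x - y)"
        using Cauchy_Schwarz_ineq2[of "x - y" z] z by (simp add: inner_diff_left)
      finally show "\<bar>kap t (x \<bullet> z) - kap t (y \<bullet> z)\<bar> \<le> L * norm (x - y)" using L(1) by (simp add: mult_left_mono)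
    qed (use pot_integrable[OF m t] x y finite_measure.integrable_const[OF mass_finite[OF m]] in auto)
    also have "\<dots> = L * norm (x - y)" using mass_measure[OF m] mass_space[OF m] by simp
    finally show ?thesis .
  qed
  then show thesis using that L(1) by blast
qed

lemma pot_continuous:
  assumes "mass \<mu>" "0 < t" shows "continuous_on S (pot \<mu> t)"
proof -
  obtain L where L: "0 \<le> L" "\<And>x y. x \<in> S \<Longrightarrow> y \<in> S \<Longrightarrow> \<bar>pot \<mu> t x - pot \<mu> t y\<bar> \<le> L * norm (x - y)"
    using pot_lipschitz[OF assms] by blast
  have "L-lipschitz_on S (pot \<mu> t)"
    using L by (intro lipschitz_onI) (auto simp: dist_norm)
  then show ?thesis by (rule lipschitz_on_continuous_on)
qed

lemma pot_poi_conv: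
  assumes m: "mass \<mu>" and s: "0 < s" and b: "0 < b" and x: "x \<in> S"
  shows "(\<integral>y. poi s (x \<bullet> y) * pot \<mu> b y \<partial>\<sigma>) = V * pot \<mu> (s + b) x"
proof -
  obtain B1 where B1: "\<And>s u. b \<le> s \<Longrightarrow> \<bar>u\<bar> \<le> 1 \<Longrightarrow> \<bar>kap s u\<bar> \<le> B1" using kap_bounded[OF b] by blast
  obtain B2 where B2: "\<And>u. \<bar>u\<bar> \<le> 1 \<Longrightarrow> \<bar>poi s u\<bar> \<le> B2" using poi_bounded[OF s] by blast
  note [measurable] = mass_ident[OF m]
  have "(\<integral>y. poi s (x \<bullet> y) * pot \<mu> b y \<partial>\<sigma>) = (\<integral>y. \<integral>z. poi s (x \<bullet> y) * kap b (y \<bullet> z) \<partial>\<mu> \<partial>\<sigma>)"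
    by (simp add: pot_def)
  also have "\<dots> = (\<integral>z. \<integral>y. poi s (x \<bullet> y) * kap b (y \<bullet> z) \<partial>\<sigma> \<partial>\<mu>)"
  proof (rule mass_swap[OF m, where B = "B2 * B1"])
    show "\<bar>poi s (x \<bullet> y) * kap b (y \<bullet> z)\<bar> \<le> B2 * B1" if "y \<in> S" "z \<in> S" for y z
      unfolding abs_mult using that x
      by (intro mult_mono B1 B2 abs_inner_le_1 order_refl order_trans[OF abs_ge_zero B2[of 0]]) auto
  qed measurable
  also have "\<dots> = (\<integral>z. V * kap (s + b) (x \<bullet> z) \<partial>\<mu>)"
    by (rule Bochner_Integration.integral_cong[OF refl])
       (use poi_kap_conv[OF s b x] mass_space[OF m] in \<open>simp add: inner_commute\<close>)
  also have "\<dots> = V * pot \<mu> (s + b) x" by (simp add: pot_def)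
  finally show ?thesis .
qed

text \<open>Integrating \<open>poi_kap_conv\<close> over \<open>x\<close> and inserting the mass of
  \<open>poi\<close> shows that \<open>exp (a * t)\<close> times the integral of
  \<open>kap t\<close> is constant in \<open>t\<close>. Its limit at infinity is
  \<open>V\<close>.\<close>

lemma integral_kap:
  assumes b: "0 < b" and z: "z \<in> S"
  shows "(\<integral>x. kap b (x \<bullet> z) \<partial>\<sigma>) = V * exp (- a * b)"
proof -
  let ?m = "\<lambda>b. \<integral>x. kap b (z \<bullet> x) \<partial>\<sigma>"
  let ?F = "\<lambda>t. exp (a * t) * ?m t"
  have sh: "?m (s + b) = exp (- a * s) * ?m b" if s: "0 < s" for s
  proof -
    obtain B1 where B1: "\<And>s u. b \<le> s \<Longrightarrow> \<bar>u\<bar> \<le> 1 \<Longrightarrow> \<bar>kap s u\<bar> \<le> B1" using kap_bounded[OF b] by blast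
    obtain B2 where B2: "\<And>u. \<bar>u\<bar> \<le> 1 \<Longrightarrow> \<bar>poi s u\<bar> \<le> B2" using poi_bounded[OF s] by blast
    interpret pp: pair_sigma_finite \<sigma> \<sigma> ..
    interpret P: finite_measure "\<sigma> \<Otimes>\<^sub>M \<sigma>"
      by (rule finite_measure_pair_measure) (rule finite_measure_axioms)+
    have i: "integrable (\<sigma> \<Otimes>\<^sub>M \<sigma>) (\<lambda>(x, y). poi s (x \<bullet> y) * kap b (z \<bullet> y))"
    proof (intro P.integrable_const_bound[where B = "B2 * B1"] AE_I2)
      fix p assume "p \<in> space (\<sigma> \<Otimes>\<^sub>M \<sigma>)"
      then have "fst p \<in> S" "snd p \<in> S" by (auto simp: space_pair_measure)
      then show "norm (case p of (x, y) \<Rightarrow> poi s (x \<bullet> y) * kap b (z \<bullet> y)) \<le> B2 * B1"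
        unfolding case_prod_beta real_norm_def abs_mult using z
        by (intro mult_mono B1 B2 abs_inner_le_1 order_refl order_trans[OF abs_ge_zero B2[of 0]]) auto
    qed measurable
    have "V * ?m (s + b) = (\<integral>x. V * kap (s + b) (x \<bullet> z) \<partial>\<sigma>)" by (simp add: inner_commute)
    also have "\<dots> = (\<integral>x. \<integral>y. poi s (x \<bullet> y) * kap b (z \<bullet> y) \<partial>\<sigma> \<partial>\<sigma>)"
      by (rule Bochner_Integration.integral_cong[OF refl]) (use poi_kap_conv[OF s b _ z] in simp)
    also have "\<dots> = (\<integral>y. \<integral>x. poi s (x \<bullet> y) * kap b (z \<bullet> y) \<partial>\<sigma> \<partial>\<sigma>)"
      using pp.Fubini_integral[OF i] by simp
    also have "\<dots> = (\<integral>y. (V * exp (- a * s)) * kap b (z \<bullet> y) \<partial>\<sigma>)"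
      by (rule Bochner_Integration.integral_cong[OF refl]) (use integral_poi[OF s] in \<open>simp add: inner_commute\<close>)
    also have "\<dots> = V * (exp (- a * s) * ?m b)" by simp
    finally show ?thesis using V_pos by simp
  qed
  have u: "\<bar>z \<bullet> y\<bar> \<le> 1" if "y \<in> S" for y using abs_inner_le_1[OF z that] .
  have "(?F \<longlongrightarrow> V) at_top"
  proof (rule tendsto_sandwich)
    show "\<forall>\<^sub>F b in at_top. V * (1 + exp (- b)) powr (- 2 * a) \<le> ?F b"
    proof (rule eventually_mono[OF eventually_gt_at_top[of 0]])
      fix b :: real assume b: "0 < b"
      have "(\<integral>y. (1 + exp (- b)) powr (- 2 * a) \<partial>\<sigma>) \<le> (\<integral>y. exp (a * b) * kap b (z \<bullet> y) \<partial>\<sigma>)"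
        by (intro integral_mono exp_kap_bounds(1) b) (use b z u integrable_kap in auto)
      then show "V * (1 + exp (- b)) powr (- 2 * a) \<le> ?F b" by (simp add: V_def)
    qed
    show "\<forall>\<^sub>F b in at_top. ?F b \<le> V * (1 - exp (- b)) powr (- 2 * a)"
    proof (rule eventually_mono[OF eventually_gt_at_top[of 0]])
      fix b :: real assume b: "0 < b"
      have "(\<integral>y. exp (a * b) * kap b (z \<bullet> y) \<partial>\<sigma>) \<le> (\<integral>y. (1 - exp (- b)) powr (- 2 * a) \<partial>\<sigma>)"
        by (intro integral_mono exp_kap_bounds(2) b) (use b z u integrable_kap in auto)
      then show "?F b \<le> V * (1 - exp (- b)) powr (- 2 * a)" by (simp add: V_def)
    qed
    have "((\<lambda>b::real. (1 + exp (- b)) powr (- 2 * a)) \<longlongrightarrow> 1) at_top" "((\<lambda>b::real. (1 - exp (- b)) powr (- 2 * a)) \<longlongrightarrow> 1) at_top"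
      by real_asymp+
    from tendsto_mult_left[OF this(1), of V] tendsto_mult_left[OF this(2), of V]
    show "((\<lambda>b. V * (1 + exp (- b)) powr (- 2 * a)) \<longlongrightarrow> V) at_top" "((\<lambda>b. V * (1 - exp (- b)) powr (- 2 * a)) \<longlongrightarrow> V) at_top"
      by simp_all
  qed
  moreover have "\<forall>\<^sub>F t in at_top. ?F t = ?F b"
  proof (rule eventually_mono[OF eventually_gt_at_top[of b]])
    fix t assume "b < t"
    then show "?F t = ?F b" using sh[of "t - b"] by (simp add: algebra_simps flip: exp_add)
  qed
  ultimately have "((\<lambda>t::real. ?F b) \<longlongrightarrow> V) at_top" by (rule Lim_transform_eventually)
  then have "?F b = V" by (simp add: tendsto_const_iff)
  then show ?thesis by (simp add: exp_minus field_simps inner_commute)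
qed

lemma integral_pot:
  assumes m: "mass \<mu>" and t: "0 < t"
  shows "(\<integral>x. pot \<mu> t x \<partial>\<sigma>) = V * exp (- a * t)"
proof -
  obtain B1 where B1: "\<And>s u. t \<le> s \<Longrightarrow> \<bar>u\<bar> \<le> 1 \<Longrightarrow> \<bar>kap s u\<bar> \<le> B1" using kap_bounded[OF t] by blast
  note [measurable] = mass_ident[OF m]
  have "(\<integral>x. pot \<mu> t x \<partial>\<sigma>) = (\<integral>z. \<integral>x. kap t (x \<bullet> z) \<partial>\<sigma> \<partial>\<mu>)"
    unfolding pot_def by (rule mass_swap[OF m, where B = B1]) (measurable, use B1 abs_inner_le_1 in auto)
  also have "\<dots> = (\<integral>z. V * exp (- a * t) \<partial>\<mu>)"
    by (rule Bochner_Integration.integral_cong[OF refl]) (use integral_kap[OF t] mass_space[OF m] in simp)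
  also have "\<dots> = V * exp (- a * t)" using mass_measure[OF m] mass_space[OF m] by simp
  finally show ?thesis .
qed

lemma npot_lim:
  assumes m: "mass \<mu>" and x: "x \<in> S"
  shows "(\<lambda>n. ennreal (pot \<mu> (tau n) x)) \<longlonglongrightarrow> npot \<mu> x" "incseq (\<lambda>n. ennreal (pot \<mu> (tau n) x))"
proof -
  note [measurable] = mass_ident[OF m]
  have inc: "incseq (\<lambda>n z. if z \<in> S then ennreal (kap (tau n) (x \<bullet> z)) else 0)"
    using kap_tau_incseq[of 0 x] x by (auto simp: incseq_def le_fun_def)
  have eq: "ennreal (pot \<mu> (tau n) x) = (\<integral>\<^sup>+z. (if z \<in> S then ennreal (kap (tau n) (x \<bullet> z)) else 0) \<partial>\<mu>)" for n
    unfolding pot_ennreal[OF m tau_pos x] by (rule nn_integral_cong) (use mass_space[OF m] in simp)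
  show inc2: "incseq (\<lambda>n. ennreal (pot \<mu> (tau n) x))"
    unfolding eq using inc by (auto simp: incseq_def le_fun_def intro!: nn_integral_mono)
  have SUP: "(SUP n. if z \<in> S then ennreal (kap (tau n) (x \<bullet> z)) else 0) = riesz_kernel x z" if "z \<in> S" for z
    using LIMSEQ_unique[OF LIMSEQ_SUP kap_tau_lim[OF x that]] kap_tau_incseq[of 0 x z] x that by simp
  have "(SUP n. ennreal (pot \<mu> (tau n) x)) = (\<integral>\<^sup>+z. (SUP n. if z \<in> S then ennreal (kap (tau n) (x \<bullet> z)) else 0) \<partial>\<mu>)"
    unfolding eq by (rule nn_integral_monotone_convergence_SUP[OF inc, symmetric]) measurable
  also have "\<dots> = npot \<mu> x"
    unfolding npot_def by (rule nn_integral_cong) (use SUP mass_space[OF m] in simp)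
  finally show "(\<lambda>n. ennreal (pot \<mu> (tau n) x)) \<longlonglongrightarrow> npot \<mu> x"
    using LIMSEQ_SUP[OF inc2] by simp
qed

lemma pot_le_npot:
  assumes m: "mass \<mu>" and x: "x \<in> S" and t: "0 < t"
  shows "ennreal (pot \<mu> t x) \<le> npot \<mu> x"
  unfolding pot_ennreal[OF m t x] npot_def
  by (rule nn_integral_mono) (use kap_le_riesz[OF t x] mass_space[OF m] in simp)

lemma npot_scaled:
  assumes m: "mass \<mu>" and x: "x \<in> S" and r: "0 < r" "r \<noteq> 1"
  shows "npot \<mu> (r *\<^sub>R x) = ennreal (r powr (- a) * pot \<mu> \<bar>ln r\<bar> x)"
proof -
  note [measurable] = mass_ident[OF m]
  have l: "0 < \<bar>ln r\<bar>" using r by simp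
  have ne: "r *\<^sub>R x \<noteq> z" if "z \<in> S" for z using x r that by auto
  have "npot \<mu> (r *\<^sub>R x) = (\<integral>\<^sup>+z. ennreal (r powr (- a)) * ennreal (kap \<bar>ln r\<bar> (x \<bullet> z)) \<partial>\<mu>)"
    unfolding npot_def
    by (rule nn_integral_cong)
       (use mass_space[OF m] riesz_kernel_eq[OF x _ r(1) ne] in \<open>simp add: kap_abs ennreal_mult kap_def\<close>)
  also have "\<dots> = ennreal (r powr (- a)) * ennreal (pot \<mu> \<bar>ln r\<bar> x)"
    unfolding pot_ennreal[OF m l x] by (rule nn_integral_cmult) measurable
  finally show ?thesis by (simp add: ennreal_mult pot_nonneg)
qed

lemma npot_measurable [measurable (raw)]:
  assumes "mass \<mu>" shows "npot \<mu> \<in> borel_measurable \<sigma>"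
proof -
  interpret M: finite_measure \<mu> by (rule mass_finite[OF assms])
  note [measurable] = mass_ident[OF assms]
  have "case_prod riesz_kernel \<in> borel_measurable (\<sigma> \<Otimes>\<^sub>M \<mu>)"
    unfolding riesz_kernel_def by measurable
  then show ?thesis unfolding npot_def by (rule M.borel_measurable_nn_integral)
qed

text \<open>The masses \<open>V * exp (- a * tau n)\<close> increase to \<open>V\<close>. In
  particular every potential is finite almost everywhere, also if its measure has atoms.\<close>

lemma nn_integral_npot:
  assumes m: "mass \<mu>" shows "(\<integral>\<^sup>+x. npot \<mu> x \<partial>\<sigma>) = ennreal V"
proof -
  have meas: "(\<lambda>x. ennreal (pot \<mu> (tau n) x)) \<in> borel_measurable \<sigma>" for n
    using measurable_continuous_on_S[OF pot_continuous[OF m tau_pos]] by measurable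
  have e: "(\<integral>\<^sup>+x. ennreal (pot \<mu> (tau n) x) \<partial>\<sigma>) = ennreal (V * exp (- a * tau n))" for n
    by (subst nn_integral_eq_integral)
       (auto intro!: integrable_continuous_on_S pot_continuous m tau_pos pot_nonneg simp: integral_pot[OF m tau_pos])
  have inc: "ennreal (pot \<mu> (tau i) x) \<le> ennreal (pot \<mu> (tau (Suc i)) x)" if "x \<in> S" for i x
    using npot_lim(2)[OF m that] by (simp add: incseq_Suc_iff)
  have SUP: "(SUP i. ennreal (pot \<mu> (tau i) x)) = npot \<mu> x" if "x \<in> S" for x
    using LIMSEQ_unique[OF LIMSEQ_SUP npot_lim(1)[OF m that]] npot_lim(2)[OF m that] by simp
  have "(\<integral>\<^sup>+x. npot \<mu> x \<partial>\<sigma>) = (\<integral>\<^sup>+x. (SUP i. ennreal (pot \<mu> (tau i) x)) \<partial>\<sigma>)"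
    by (rule nn_integral_cong) (use SUP in simp)
  also have "\<dots> = (SUP i. \<integral>\<^sup>+x. ennreal (pot \<mu> (tau i) x) \<partial>\<sigma>)"
    by (rule nn_integral_monotone_convergence_SUP_AE) (use inc meas in auto)
  also have "\<dots> = (SUP i. ennreal (V * exp (- a * tau i)))" by (simp only: e)
  also have "\<dots> = ennreal V"
  proof (rule LIMSEQ_unique[OF LIMSEQ_SUP])
    show "incseq (\<lambda>i. ennreal (V * exp (- a * tau i)))"
      unfolding incseq_def using tau_antimono a_pos V_pos by (auto intro!: ennreal_leI)
    have "(\<lambda>i. V * exp (- a * tau i)) \<longlonglongrightarrow> V * exp (- a * 0)"
      by (intro tendsto_intros tau_lim)
    then show "(\<lambda>i. ennreal (V * exp (- a * tau i))) \<longlonglongrightarrow> ennreal V"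
      by (intro tendsto_ennrealI) simp
  qed
  finally show ?thesis .
qed

end

text \<open>Since \<open>(1 - x + x\<^sup>2) * (1 + x)\<close> is 1 plus the cube of
  \<open>x\<close>, the claim follows from \<open>1 + x \<le> exp x\<close>. It supplies the
  second-order bounds for \<open>cosh\<close> and for \<open>1 - exp (- a * s)\<close>
  below.\<close>

lemma exp_minus_quadratic: "0 \<le> x \<Longrightarrow> exp (- x) \<le> 1 - x + x\<^sup>2" for x :: real
proof -
  assume x: "0 \<le> x"
  have "0 \<le> 1 - x + x\<^sup>2" using zero_le_power2[of "x - 1"] x by (simp add: power2_eq_square algebra_simps)
  moreover have "1 + x \<le> exp x" by (rule exp_ge_add_one_self)
  ultimately have "(1 - x + x\<^sup>2) * (1 + x) \<le> (1 - x + x\<^sup>2) * exp x" by (rule mult_left_mono[rotated])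
  moreover have "1 \<le> (1 - x + x\<^sup>2) * (1 + x)"
    using x mult_nonneg_nonneg[of x "x\<^sup>2"] by (simp add: algebra_simps power2_eq_square)
  ultimately show ?thesis by (simp add: exp_minus field_simps)
qed

context sphere_space
begin

section \<open>Potentials on the unit sphere itself\<close>

lemma AE_neq_S: "z \<in> S \<Longrightarrow> AE x in \<sigma>. x \<noteq> z"
  by (rule AE_neq_point) simp

lemma riesz_measurable:
  assumes "mass \<mu>" shows "(\<lambda>z. riesz_kernel x z) \<in> borel_measurable \<mu>"
proof -
  note [measurable] = mass_ident[OF assms]
  show ?thesis unfolding riesz_kernel_def by measurable
qed

lemma rpot_nonneg: "0 \<le> rpot \<mu> x"
  by (simp add: rpot_def)

lemma npot_finite_AE: "mass \<mu> \<Longrightarrow> AE x in \<sigma>. npot \<mu> x < \<infinity>"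
  using nn_integral_PInf_AE[OF npot_measurable, of \<mu>] nn_integral_npot[of \<mu>]
  by (auto elim!: eventually_mono simp: less_top)

lemma rpot_ennreal: "npot \<mu> x < \<infinity> \<Longrightarrow> ennreal (rpot \<mu> x) = npot \<mu> x"
  by (simp add: rpot_def)

lemma rpot_measurable [measurable (raw)]: "mass \<mu> \<Longrightarrow> rpot \<mu> \<in> borel_measurable \<sigma>"
  unfolding rpot_def by measurable

lemma nn_integral_rpot:
  assumes m: "mass \<mu>" shows "(\<integral>\<^sup>+x. ennreal (rpot \<mu> x) \<partial>\<sigma>) = ennreal V"
proof -
  have "(\<integral>\<^sup>+x. ennreal (rpot \<mu> x) \<partial>\<sigma>) = (\<integral>\<^sup>+x. npot \<mu> x \<partial>\<sigma>)"
    by (rule nn_integral_cong_AE) (use npot_finite_AE[OF m] in \<open>auto elim!: eventually_mono simp: rpot_ennreal\<close>)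
  then show ?thesis using nn_integral_npot[OF m] by simp
qed

lemma rpot_integrable: "mass \<mu> \<Longrightarrow> integrable \<sigma> (rpot \<mu>)"
  using nn_integral_rpot[of \<mu>] by (intro integrableI_nonneg) (auto simp: rpot_nonneg)

lemma integral_rpot: "mass \<mu> \<Longrightarrow> (\<integral>x. rpot \<mu> x \<partial>\<sigma>) = V"
  using nn_integral_rpot[of \<mu>] V_pos
  by (subst integral_eq_nn_integral) (auto simp: rpot_nonneg)

lemma pot_le_rpot: "mass \<mu> \<Longrightarrow> x \<in> S \<Longrightarrow> 0 < t \<Longrightarrow> npot \<mu> x < \<infinity> \<Longrightarrow> pot \<mu> t x \<le> rpot \<mu> x"
  using pot_le_npot[of \<mu> x t] by (simp add: rpot_ennreal[symmetric] rpot_nonneg)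

lemma pot_le_rpot_AE:
  assumes "mass \<mu>" "0 < t" shows "AE x in \<sigma>. pot \<mu> t x \<le> rpot \<mu> x"
  using npot_finite_AE[OF assms(1)] AE_space[of \<sigma>]
  by eventually_elim (use pot_le_rpot assms in auto)

lemma pot_tau_lim:
  assumes m: "mass \<mu>" and x: "x \<in> S" and s: "0 < s"
  shows "(\<lambda>n. pot \<mu> (s + tau n) x) \<longlonglongrightarrow> pot \<mu> s x"
proof -
  obtain B where B: "\<And>t u. s \<le> t \<Longrightarrow> \<bar>u\<bar> \<le> 1 \<Longrightarrow> \<bar>kap t u\<bar> \<le> B" using kap_bounded[OF s] by blast
  note [measurable] = mass_ident[OF m]
  show ?thesis
    unfolding pot_def
  proof (rule integral_dominated_convergence[where w = "\<lambda>_. B"])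
    show "integrable \<mu> (\<lambda>_. B)" using finite_measure.integrable_const[OF mass_finite[OF m]] .
    show "AE z in \<mu>. (\<lambda>n. kap (s + tau n) (x \<bullet> z)) \<longlonglongrightarrow> kap s (x \<bullet> z)"
    proof (rule AE_I2)
      fix z assume "z \<in> space \<mu>"
      then have z: "z \<in> S" using mass_space[OF m] by simp
      have "isCont (\<lambda>t. kap t (x \<bullet> z)) s"
        using DERIV_isCont[OF kap_deriv_t[of s "x \<bullet> z"]] s inner_le_1[OF x z] by simp
      moreover have "(\<lambda>n. s + tau n) \<longlonglongrightarrow> s" using tendsto_add[OF tendsto_const tau_lim, of s] by simp
      ultimately show "(\<lambda>n. kap (s + tau n) (x \<bullet> z)) \<longlonglongrightarrow> kap s (x \<bullet> z)"
        using isCont_tendsto_compose by blast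
    qed
    show "AE z in \<mu>. norm (kap (s + tau n) (x \<bullet> z)) \<le> B" for n
      by (rule AE_I2) (use mass_space[OF m] B abs_inner_le_1[OF x] tau_pos[of n] in auto)
  qed measurable
qed

lemma rpot_poi_conv:
  assumes m: "mass \<mu>" and s: "0 < s" and x: "x \<in> S"
  shows "integrable \<sigma> (\<lambda>y. poi s (x \<bullet> y) * rpot \<mu> y)"
    "(\<integral>y. poi s (x \<bullet> y) * rpot \<mu> y \<partial>\<sigma>) = V * pot \<mu> s x"
proof -
  have meas: "(\<lambda>y. ennreal (poi s (x \<bullet> y) * pot \<mu> (tau i) y)) \<in> borel_measurable \<sigma>" for i
    using measurable_continuous_on_S[OF pot_continuous[OF m tau_pos]] by measurable
  have inc: "ennreal (poi s (x \<bullet> y) * pot \<mu> (tau i) y) \<le> ennreal (poi s (x \<bullet> y) * pot \<mu> (tau (Suc i)) y)" if "y \<in> S" for i y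
    using npot_lim(2)[OF m that] poi_nonneg[OF s x that]
    by (intro ennreal_leI mult_left_mono) (auto simp: incseq_Suc_iff ennreal_le_iff pot_nonneg)
  have SUP: "(SUP i. ennreal (poi s (x \<bullet> y) * pot \<mu> (tau i) y)) = ennreal (poi s (x \<bullet> y) * rpot \<mu> y)" if y: "y \<in> S" and f: "npot \<mu> y < \<infinity>" for y
  proof -
    have "(SUP i. ennreal (poi s (x \<bullet> y)) * ennreal (pot \<mu> (tau i) y)) = ennreal (poi s (x \<bullet> y)) * (SUP i. ennreal (pot \<mu> (tau i) y))"
      by (rule SUP_mult_left_ennreal[symmetric])
    moreover have "(SUP i. ennreal (pot \<mu> (tau i) y)) = npot \<mu> y"
      using LIMSEQ_unique[OF LIMSEQ_SUP npot_lim(1)[OF m y]] npot_lim(2)[OF m y] by simp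
    ultimately show ?thesis
      using f poi_nonneg[OF s x y] by (simp add: rpot_ennreal[symmetric] ennreal_mult pot_nonneg rpot_nonneg)
  qed
  have e: "(\<integral>\<^sup>+y. ennreal (poi s (x \<bullet> y) * pot \<mu> (tau i) y) \<partial>\<sigma>) = ennreal (V * pot \<mu> (s + tau i) x)" for i
  proof (subst nn_integral_eq_integral)
    show "integrable \<sigma> (\<lambda>y. poi s (x \<bullet> y) * pot \<mu> (tau i) y)"
      using s x by (intro integrable_continuous_on_S continuous_on_mult pot_continuous m tau_pos
         continuous_on_inner_S[OF poi_isCont_u]) auto
    show "AE y in \<sigma>. 0 \<le> poi s (x \<bullet> y) * pot \<mu> (tau i) y"
      by (rule AE_I2) (use poi_nonneg[OF s x] pot_nonneg in simp)
  qed (simp add: pot_poi_conv[OF m s tau_pos x])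
  have "(\<integral>\<^sup>+y. ennreal (poi s (x \<bullet> y) * rpot \<mu> y) \<partial>\<sigma>) = (\<integral>\<^sup>+y. (SUP i. ennreal (poi s (x \<bullet> y) * pot \<mu> (tau i) y)) \<partial>\<sigma>)"
    by (rule nn_integral_cong_AE) (use npot_finite_AE[OF m] AE_space[of \<sigma>] SUP in \<open>auto elim!: eventually_elim2\<close>)
  also have "\<dots> = (SUP i. \<integral>\<^sup>+y. ennreal (poi s (x \<bullet> y) * pot \<mu> (tau i) y) \<partial>\<sigma>)"
    by (rule nn_integral_monotone_convergence_SUP_AE) (use inc meas in auto)
  also have "\<dots> = (SUP i. ennreal (V * pot \<mu> (s + tau i) x))" by (simp only: e)
  also have "\<dots> = ennreal (V * pot \<mu> s x)"
  proof (rule LIMSEQ_unique[OF LIMSEQ_SUP])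
    show "incseq (\<lambda>i. ennreal (V * pot \<mu> (s + tau i) x))"
      unfolding e[symmetric] incseq_Suc_iff by (intro allI nn_integral_mono) (use inc in auto)
    show "(\<lambda>i. ennreal (V * pot \<mu> (s + tau i) x)) \<longlonglongrightarrow> ennreal (V * pot \<mu> s x)"
      by (intro tendsto_ennrealI tendsto_mult_left pot_tau_lim m x s)
  qed
  finally have eq: "(\<integral>\<^sup>+y. ennreal (poi s (x \<bullet> y) * rpot \<mu> y) \<partial>\<sigma>) = ennreal (V * pot \<mu> s x)" .
  have nn: "AE y in \<sigma>. 0 \<le> poi s (x \<bullet> y) * rpot \<mu> y"
    by (rule AE_I2) (use poi_nonneg[OF s x] rpot_nonneg in simp)
  have mm: "(\<lambda>y. poi s (x \<bullet> y) * rpot \<mu> y) \<in> borel_measurable \<sigma>" using m by measurable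
  show "integrable \<sigma> (\<lambda>y. poi s (x \<bullet> y) * rpot \<mu> y)"
    by (rule integrableI_nonneg[OF mm nn]) (simp add: eq)
  show "(\<integral>y. poi s (x \<bullet> y) * rpot \<mu> y \<partial>\<sigma>) = V * pot \<mu> s x"
    using V_pos by (subst integral_eq_nn_integral[OF mm nn]) (simp add: eq pot_nonneg)
qed

definition dirac :: "real^'n \<Rightarrow> (real^'n) measure" where
  "dirac z = distr (count_space {z}) (restrict_space borel S) (\<lambda>_. z)"

lemma dirac_mass: "z \<in> S \<Longrightarrow> mass (dirac z)"
  by (auto simp: mass_def dirac_def sets_restrict_space_iff emeasure_distr space_restrict_space)

lemma npot_dirac:
  assumes z: "z \<in> S" shows "npot (dirac z) x = riesz_kernel x z"
proof -
  have "(\<lambda>y. riesz_kernel x y) \<in> borel_measurable (restrict_space borel S)"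
    unfolding riesz_kernel_def by (rule measurable_restrict_space1) measurable
  then show ?thesis unfolding npot_def dirac_def
    by (subst nn_integral_distr) (use z in \<open>auto simp: space_restrict_space nn_integral_count_space_finite\<close>)
qed

text \<open>Off the diagonal \<open>kap 0\<close> is the potential of a unit point mass, so
  integrability and total integral are instances of the facts on \<open>rpot\<close>.\<close>

lemma kap_0_integrable:
  assumes z: "z \<in> S"
  shows "integrable \<sigma> (\<lambda>x. kap 0 (x \<bullet> z))" "(\<integral>x. kap 0 (x \<bullet> z) \<partial>\<sigma>) = V"
proof -
  have eq: "AE x in \<sigma>. rpot (dirac z) x = kap 0 (x \<bullet> z)"
    using AE_neq_S[OF z] AE_space[of \<sigma>]
    by eventually_elim (use z in \<open>simp_all add: rpot_def npot_dirac[OF z] riesz_kernel_eq_S kap_def\<close>)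
  show "integrable \<sigma> (\<lambda>x. kap 0 (x \<bullet> z))"
    by (rule integrable_cong_AE_imp[OF rpot_integrable[OF dirac_mass[OF z]]]) (measurable, use eq in auto)
  have "(\<integral>x. rpot (dirac z) x \<partial>\<sigma>) = (\<integral>x. kap 0 (x \<bullet> z) \<partial>\<sigma>)"
    by (rule integral_cong_AE[OF _ _ eq]) (use rpot_measurable[OF dirac_mass[OF z]] in measurable)
  then show "(\<integral>x. kap 0 (x \<bullet> z) \<partial>\<sigma>) = V" using integral_rpot[OF dirac_mass[OF z]] by simp
qed

lemma kap_nonneg: "0 \<le> kap t u"
  by (simp add: kap_def)

text \<open>\<open>kap 0\<close> is unbounded near the diagonal, so the integrals are exchanged by
  Tonelli's theorem for nonnegative functions. This is why the weight has a sign here, in contrast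
  to \<open>weighted_kap\<close>.\<close>

lemma weighted_kap_0:
  fixes w :: "real^'n \<Rightarrow> real"
  assumes m: "mass \<mu>" and w: "w \<in> borel_measurable \<sigma>" "\<And>x. x \<in> S \<Longrightarrow> 0 \<le> w x" "\<And>x. x \<in> S \<Longrightarrow> w x \<le> B"
  shows "integrable \<sigma> (\<lambda>x. w x * rpot \<mu> x)"
    "integrable \<mu> (\<lambda>z. \<integral>x. w x * kap 0 (x \<bullet> z) \<partial>\<sigma>)"
    "(\<integral>x. w x * rpot \<mu> x \<partial>\<sigma>) = (\<integral>z. \<integral>x. w x * kap 0 (x \<bullet> z) \<partial>\<sigma> \<partial>\<mu>)"
proof -
  interpret pair_sigma_finite \<sigma> \<mu> by (rule mass_pair[OF m])
  note [measurable] = mass_ident[OF m] w(1)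
  have wb: "\<bar>w x\<bar> \<le> B" if "x \<in> S" for x using w(2,3)[OF that] by simp
  have wi: "integrable \<sigma> (\<lambda>x. w x * kap 0 (x \<bullet> z))" if z: "z \<in> S" for z
    by (rule integrable_mult_bounded[OF kap_0_integrable(1)[OF z] w(1) wb])
  have winn: "0 \<le> (\<integral>x. w x * kap 0 (x \<bullet> z) \<partial>\<sigma>)" for z
    by (rule integral_nonneg_AE) (rule AE_I2, use w kap_nonneg in auto)
  show i1: "integrable \<sigma> (\<lambda>x. w x * rpot \<mu> x)"
    by (rule integrable_mult_bounded[OF rpot_integrable[OF m] w(1) wb])
  have mr: "(\<lambda>(x, z). ennreal (w x) * riesz_kernel x z) \<in> borel_measurable (\<sigma> \<Otimes>\<^sub>M \<mu>)"
    unfolding riesz_kernel_def by measurable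
  have "(\<integral>\<^sup>+x. ennreal (w x * rpot \<mu> x) \<partial>\<sigma>) = (\<integral>\<^sup>+x. ennreal (w x) * npot \<mu> x \<partial>\<sigma>)"
    by (rule nn_integral_cong_AE)
       (use npot_finite_AE[OF m] AE_space[of \<sigma>] w in \<open>auto elim!: eventually_elim2 simp: rpot_ennreal ennreal_mult rpot_nonneg\<close>)
  also have "\<dots> = (\<integral>\<^sup>+x. \<integral>\<^sup>+z. ennreal (w x) * riesz_kernel x z \<partial>\<mu> \<partial>\<sigma>)"
    unfolding npot_def
    by (intro nn_integral_cong nn_integral_cmult[symmetric]) (use riesz_measurable[OF m] in simp)
  also have "\<dots> = (\<integral>\<^sup>+z. \<integral>\<^sup>+x. ennreal (w x) * riesz_kernel x z \<partial>\<sigma> \<partial>\<mu>)"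
    by (rule Fubini'[symmetric]) (use mr in simp)
  also have "\<dots> = (\<integral>\<^sup>+z. ennreal (\<integral>x. w x * kap 0 (x \<bullet> z) \<partial>\<sigma>) \<partial>\<mu>)"
  proof (rule nn_integral_cong)
    fix z assume "z \<in> space \<mu>"
    then have z: "z \<in> S" using mass_space[OF m] by simp
    have "(\<integral>\<^sup>+x. ennreal (w x) * riesz_kernel x z \<partial>\<sigma>) = (\<integral>\<^sup>+x. ennreal (w x * kap 0 (x \<bullet> z)) \<partial>\<sigma>)"
      by (rule nn_integral_cong_AE)
         (use AE_neq_S[OF z] AE_space[of \<sigma>] z w in \<open>auto elim!: eventually_elim2 simp: riesz_kernel_eq_S ennreal_mult kap_nonneg\<close>)
    also have "\<dots> = ennreal (\<integral>x. w x * kap 0 (x \<bullet> z) \<partial>\<sigma>)"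
      by (rule nn_integral_eq_integral[OF wi[OF z]]) (rule AE_I2, use w kap_nonneg in auto)
    finally show "(\<integral>\<^sup>+x. ennreal (w x) * riesz_kernel x z \<partial>\<sigma>) = ennreal (\<integral>x. w x * kap 0 (x \<bullet> z) \<partial>\<sigma>)" .
  qed
  finally have eq: "(\<integral>\<^sup>+z. ennreal (\<integral>x. w x * kap 0 (x \<bullet> z) \<partial>\<sigma>) \<partial>\<mu>) = (\<integral>\<^sup>+x. ennreal (w x * rpot \<mu> x) \<partial>\<sigma>)" ..
  have nn: "AE x in \<sigma>. 0 \<le> w x * rpot \<mu> x" by (rule AE_I2) (use w rpot_nonneg in auto)
  have fin: "(\<integral>\<^sup>+x. ennreal (w x * rpot \<mu> x) \<partial>\<sigma>) = ennreal (\<integral>x. w x * rpot \<mu> x \<partial>\<sigma>)"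
    by (rule nn_integral_eq_integral[OF i1 nn])
  have mz: "(\<lambda>z. \<integral>x. w x * kap 0 (x \<bullet> z) \<partial>\<sigma>) \<in> borel_measurable \<mu>"
    by measurable
  show "integrable \<mu> (\<lambda>z. \<integral>x. w x * kap 0 (x \<bullet> z) \<partial>\<sigma>)"
    by (rule integrableI_nonneg[OF mz]) (use winn eq fin in auto)
  show "(\<integral>x. w x * rpot \<mu> x \<partial>\<sigma>) = (\<integral>z. \<integral>x. w x * kap 0 (x \<bullet> z) \<partial>\<sigma> \<partial>\<mu>)"
  proof -
    have "(\<integral>z. \<integral>x. w x * kap 0 (x \<bullet> z) \<partial>\<sigma> \<partial>\<mu>) = enn2real (\<integral>\<^sup>+z. ennreal (\<integral>x. w x * kap 0 (x \<bullet> z) \<partial>\<sigma>) \<partial>\<mu>)"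
      by (rule integral_eq_nn_integral[OF mz]) (use winn in auto)
    also have "\<dots> = (\<integral>x. w x * rpot \<mu> x \<partial>\<sigma>)"
      unfolding eq fin using integral_nonneg_AE[OF nn] by simp
    finally show ?thesis ..
  qed
qed

lemma weighted_kap:
  fixes w :: "real^'n \<Rightarrow> real"
  assumes m: "mass \<mu>" and t: "0 < t" and w: "w \<in> borel_measurable \<sigma>" "\<And>x. x \<in> S \<Longrightarrow> \<bar>w x\<bar> \<le> B"
  shows "integrable \<sigma> (\<lambda>x. w x * pot \<mu> t x)"
    "integrable \<mu> (\<lambda>z. \<integral>x. w x * kap t (x \<bullet> z) \<partial>\<sigma>)"
    "(\<integral>x. w x * pot \<mu> t x \<partial>\<sigma>) = (\<integral>z. \<integral>x. w x * kap t (x \<bullet> z) \<partial>\<sigma> \<partial>\<mu>)"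
proof -
  obtain B1 where B1: "\<And>s u. t \<le> s \<Longrightarrow> \<bar>u\<bar> \<le> 1 \<Longrightarrow> \<bar>kap s u\<bar> \<le> B1" using kap_bounded[OF t] by blast
  note [measurable] = mass_ident[OF m] w(1)
  have b: "\<bar>w x * kap t (x \<bullet> z)\<bar> \<le> B * B1" if "x \<in> S" "z \<in> S" for x z
    unfolding abs_mult using that
    by (intro mult_mono w B1 abs_inner_le_1 order_refl order_trans[OF abs_ge_zero w(2)[OF that(1)]]) auto
  have me: "case_prod (\<lambda>x z. w x * kap t (x \<bullet> z)) \<in> borel_measurable (\<sigma> \<Otimes>\<^sub>M \<mu>)" by measurable
  have e: "(\<lambda>x. w x * pot \<mu> t x) = (\<lambda>x. \<integral>z. w x * kap t (x \<bullet> z) \<partial>\<mu>)" by (simp add: pot_def)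
  show "integrable \<mu> (\<lambda>z. \<integral>x. w x * kap t (x \<bullet> z) \<partial>\<sigma>)" by (rule mass_swap_integrable(1)[OF m me b])
  show "integrable \<sigma> (\<lambda>x. w x * pot \<mu> t x)" unfolding e by (rule mass_swap_integrable(2)[OF m me b])
  show "(\<integral>x. w x * pot \<mu> t x \<partial>\<sigma>) = (\<integral>z. \<integral>x. w x * kap t (x \<bullet> z) \<partial>\<sigma> \<partial>\<mu>)"
    unfolding e by (rule mass_swap[OF m me b])
qed

section \<open>Weights tested against a potential minus its Poisson shift\<close>

definition far_const :: "real \<Rightarrow> real" where
  "far_const \<delta> = 2 * a * (2 * \<delta>) powr (- a - 1)"

lemma far_const_nonneg: "0 \<le> far_const \<delta>"
  using a_pos by (simp add: far_const_def)

text \<open>\<open>kap\<close> depends on \<open>s\<close> through \<open>cosh s\<close> and is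
  smooth away from the pole, so its change from time 0 is quadratic:
  \<open>2 * cosh s - 2 \<le> 2 * s\<^sup>2\<close>, and the mean value theorem for the power
  function is applied where the gap is at least \<open>2 * \<delta>\<close>.\<close>

lemma kap_far:
  assumes d: "0 < \<delta>" and s: "0 \<le> s" "s \<le> 1" and u: "u \<le> 1 - \<delta>"
  shows "kap 0 u - kap s u \<le> far_const \<delta> * s\<^sup>2"
proof -
  define q where "q = 2 * cosh s - 2"
  have q0: "0 \<le> q" using cosh_real_ge_1[of s] by (simp add: q_def)
  have q1: "q \<le> 2 * s\<^sup>2"
  proof -
    have e: "exp s \<le> 1 + s + s\<^sup>2" by (rule exp_bound[OF s])
    moreover have "exp (- s) \<le> 1 - s + s\<^sup>2" by (rule exp_minus_quadratic[OF s(1)])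
    moreover have "2 * cosh s = exp s + exp (- s)" by (simp add: cosh_field_def)
    ultimately show ?thesis using e unfolding q_def by linarith
  qed
  have D: "2 * \<delta> \<le> 2 - 2 * u" using u by simp
  have "norm ((2 - 2 * u + q) powr (- a) - (2 - 2 * u) powr (- a)) \<le> (a * (2 * \<delta>) powr (- a - 1)) * norm ((2 - 2 * u + q) - (2 - 2 * u))"
  proof (rule field_differentiable_bound[of "{2 * \<delta>..}" "\<lambda>w. w powr (- a)" "\<lambda>w. - a * w powr (- a - 1)"])
    fix w assume w: "w \<in> {2 * \<delta>..}"
    then have "0 < w" using d by simp
    from has_real_derivative_powr[OF this, of "- a"]
    show "((\<lambda>w. w powr (- a)) has_field_derivative - a * w powr (- a - 1)) (at w within {2 * \<delta>..})"
      by (rule has_field_derivative_at_within)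
    have "w powr (- a - 1) \<le> (2 * \<delta>) powr (- a - 1)" using w d a_pos by (intro powr_mono2') auto
    then show "norm (- a * w powr (- a - 1)) \<le> a * (2 * \<delta>) powr (- a - 1)" using a_pos by (simp add: abs_mult)
  qed (use D q0 in auto)
  then have "(2 - 2 * u) powr (- a) - (2 - 2 * u + q) powr (- a) \<le> a * (2 * \<delta>) powr (- a - 1) * q"
    using q0 by (simp add: abs_le_iff)
  also have "\<dots> \<le> a * (2 * \<delta>) powr (- a - 1) * (2 * s\<^sup>2)"
    using q1 a_pos by (intro mult_left_mono) auto
  finally show ?thesis
    by (simp add: far_const_def kap_def q_def algebra_simps)
qed

text \<open>The dual form of \<open>1 - R s\<close>: by \<open>weighted_kd\<close>, testing
  \<open>rpot \<mu> - pot \<mu> s\<close> against \<open>w\<close> equals integrating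
  \<open>kd s w\<close> against \<open>\<mu>\<close>. Thus the position of \<open>\<mu>\<close>
  relative to \<open>w\<close> decides whether the result is of first or of second order in
  \<open>s\<close>.\<close>

definition kd :: "real \<Rightarrow> (real^'n \<Rightarrow> real) \<Rightarrow> real^'n \<Rightarrow> real" where
  "kd s w z = (\<integral>x. w x * (kap 0 (x \<bullet> z) - kap s (x \<bullet> z)) \<partial>\<sigma>)"

lemma kd_integrable:
  assumes s: "0 < s" and z: "z \<in> S" and w: "w \<in> borel_measurable \<sigma>" "\<And>x. x \<in> S \<Longrightarrow> 0 \<le> w x" "\<And>x. x \<in> S \<Longrightarrow> w x \<le> B"
  shows "integrable \<sigma> (\<lambda>x. w x * kap 0 (x \<bullet> z))" "integrable \<sigma> (\<lambda>x. w x * kap s (x \<bullet> z))"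
    "integrable \<sigma> (\<lambda>x. w x * (kap 0 (x \<bullet> z) - kap s (x \<bullet> z)))"
    "kd s w z = (\<integral>x. w x * kap 0 (x \<bullet> z) \<partial>\<sigma>) - (\<integral>x. w x * kap s (x \<bullet> z) \<partial>\<sigma>)"
proof -
  have *: "integrable \<sigma> (\<lambda>x. w x * h x)" if "integrable \<sigma> h" for h
    by (rule integrable_mult_bounded[OF that w(1), of B]) (use w(2,3) in fastforce)
  show i0: "integrable \<sigma> (\<lambda>x. w x * kap 0 (x \<bullet> z))" by (rule *[OF kap_0_integrable(1)[OF z]])
  show isv: "integrable \<sigma> (\<lambda>x. w x * kap s (x \<bullet> z))"
    using integrable_kap[of s z] s z by (intro *) (simp add: inner_commute)
  show "integrable \<sigma> (\<lambda>x. w x * (kap 0 (x \<bullet> z) - kap s (x \<bullet> z)))" unfolding right_diff_distrib using i0 isv by simp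
  show "kd s w z = (\<integral>x. w x * kap 0 (x \<bullet> z) \<partial>\<sigma>) - (\<integral>x. w x * kap s (x \<bullet> z) \<partial>\<sigma>)"
    unfolding kd_def right_diff_distrib using i0 isv by simp
qed

lemma kd_mono:
  assumes s: "0 < s" and z: "z \<in> S" and w: "integrable \<sigma> (\<lambda>x. w x * (kap 0 (x \<bullet> z) - kap s (x \<bullet> z)))"
    and w': "integrable \<sigma> (\<lambda>x. w' x * (kap 0 (x \<bullet> z) - kap s (x \<bullet> z)))"
    and le: "AE x in \<sigma>. w x \<le> w' x"
  shows "kd s w z \<le> kd s w' z"
  unfolding kd_def
proof (rule integral_mono_AE[OF w w'])
  show "AE x in \<sigma>. w x * (kap 0 (x \<bullet> z) - kap s (x \<bullet> z)) \<le> w' x * (kap 0 (x \<bullet> z) - kap s (x \<bullet> z))"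
    using le AE_neq_S[OF z] AE_space
  proof eventually_elim
    case (elim x)
    then have "0 \<le> kap 0 (x \<bullet> z) - kap s (x \<bullet> z)" using kap_le_kap_0[of s x z] s z by simp
    then show ?case using elim by (simp add: mult_right_mono)
  qed
qed

lemma kd_one: "0 < s \<Longrightarrow> z \<in> S \<Longrightarrow> kd s (\<lambda>_. 1) z = V * (1 - exp (- a * s))"
  using kd_integrable(4)[of s z "\<lambda>_. 1" 1] kap_0_integrable(2)[of z] integral_kap[of s z] by (simp add: algebra_simps)

lemma kd_nonneg: "0 < s \<Longrightarrow> z \<in> S \<Longrightarrow> (\<And>x. x \<in> S \<Longrightarrow> 0 \<le> w x) \<Longrightarrow> 0 \<le> kd s w z"
  unfolding kd_def
proof (rule integral_nonneg_AE)
  assume *: "0 < s" "z \<in> S" "\<And>x. x \<in> S \<Longrightarrow> 0 \<le> w x"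
  show "AE x in \<sigma>. 0 \<le> w x * (kap 0 (x \<bullet> z) - kap s (x \<bullet> z))"
    using AE_neq_S[OF *(2)] AE_space by eventually_elim (use * kap_le_kap_0[of s _ z] in auto)
qed

lemma kd_le_V:
  assumes s: "0 < s" and z: "z \<in> S" and w: "w \<in> borel_measurable \<sigma>" "\<And>x. x \<in> S \<Longrightarrow> 0 \<le> w x" "\<And>x. x \<in> S \<Longrightarrow> w x \<le> 1"
  shows "kd s w z \<le> V"
proof -
  have "kd s w z \<le> kd s (\<lambda>_. 1) z"
    by (rule kd_mono[OF s z kd_integrable(3)[OF s z w] kd_integrable(3)[OF s z, of _ 1]]) (use w in auto)
  also have "\<dots> \<le> V" unfolding kd_one[OF s z] using V_pos by simp
  finally show ?thesis .
qed

lemma weighted_kd: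
  assumes m: "mass \<mu>" and s: "0 < s" and w: "w \<in> borel_measurable \<sigma>" "\<And>x. x \<in> S \<Longrightarrow> 0 \<le> w x" "\<And>x. x \<in> S \<Longrightarrow> w x \<le> 1"
  shows "(\<integral>x. w x * (rpot \<mu> x - pot \<mu> s x) \<partial>\<sigma>) = (\<integral>z. kd s w z \<partial>\<mu>)" "integrable \<mu> (kd s w)"
proof -
  have wa: "\<bar>w x\<bar> \<le> 1" if "x \<in> S" for x using w(2,3)[OF that] by simp
  note k0 = weighted_kap_0[OF m w] and ks = weighted_kap[OF m s w(1) wa]
  have e: "kd s w z = (\<integral>x. w x * kap 0 (x \<bullet> z) \<partial>\<sigma>) - (\<integral>x. w x * kap s (x \<bullet> z) \<partial>\<sigma>)" if "z \<in> space \<mu>" for z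
    using kd_integrable(4)[OF s _ w] that mass_space[OF m] by simp
  have "(\<integral>x. w x * (rpot \<mu> x - pot \<mu> s x) \<partial>\<sigma>) = (\<integral>z. (\<integral>x. w x * kap 0 (x \<bullet> z) \<partial>\<sigma>) - (\<integral>x. w x * kap s (x \<bullet> z) \<partial>\<sigma>) \<partial>\<mu>)"
    unfolding right_diff_distrib using k0 ks by simp
  also have "\<dots> = (\<integral>z. kd s w z \<partial>\<mu>)"
    by (rule Bochner_Integration.integral_cong[OF refl]) (use e in simp)
  finally show "(\<integral>x. w x * (rpot \<mu> x - pot \<mu> s x) \<partial>\<sigma>) = (\<integral>z. kd s w z \<partial>\<mu>)" .
  have "integrable \<mu> (\<lambda>z. (\<integral>x. w x * kap 0 (x \<bullet> z) \<partial>\<sigma>) - (\<integral>x. w x * kap s (x \<bullet> z) \<partial>\<sigma>))" using k0 ks by simp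
  then show "integrable \<mu> (kd s w)"
    by (rule Bochner_Integration.integrable_cong[THEN iffD1, rotated -1]) (use e in auto)
qed

lemma kd_far:
  assumes \<delta>: "0 < \<delta>" and s: "0 < s" "s \<le> 1" and z: "z \<in> S"
    and w: "w \<in> borel_measurable \<sigma>" "\<And>x. x \<in> S \<Longrightarrow> 0 \<le> w x" "\<And>x. x \<in> S \<Longrightarrow> w x \<le> 1"
    and far: "\<And>x. x \<in> S \<Longrightarrow> w x \<noteq> 0 \<Longrightarrow> x \<bullet> z \<le> 1 - \<delta>"
  shows "kd s w z \<le> V * far_const \<delta> * s\<^sup>2"
proof -
  have "kd s w z \<le> (\<integral>x. far_const \<delta> * s\<^sup>2 \<partial>\<sigma>)"
    unfolding kd_def
  proof (rule integral_mono[OF kd_integrable(3)[OF s(1) z w]])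
    fix x assume "x \<in> space \<sigma>"
    then have x: "x \<in> S" by simp
    have C: "0 \<le> far_const \<delta> * s\<^sup>2" using far_const_nonneg by simp
    show "w x * (kap 0 (x \<bullet> z) - kap s (x \<bullet> z)) \<le> far_const \<delta> * s\<^sup>2"
    proof (cases "w x = 0")
      case False
      have "w x * (kap 0 (x \<bullet> z) - kap s (x \<bullet> z)) \<le> w x * (far_const \<delta> * s\<^sup>2)"
        using kap_far[OF \<delta> _ s(2) far[OF x False]] s w(2)[OF x] by (intro mult_left_mono) auto
      also have "\<dots> \<le> far_const \<delta> * s\<^sup>2" using w(2,3)[OF x] C by (intro mult_left_le_one_le) auto
      finally show ?thesis .
    qed (use C in simp)
  qed simp_all
  then show ?thesis by (simp add: V_def mult_ac)
qed

lemma integrable_rpot_pot: "mass \<mu> \<Longrightarrow> 0 < s \<Longrightarrow> integrable \<sigma> (\<lambda>x. rpot \<mu> x - pot \<mu> s x)"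
  using rpot_integrable[of \<mu>] integrable_continuous_on_S[OF pot_continuous[of \<mu> s]] by simp

text \<open>By \<open>poi_kap_conv\<close> the pairing, as a function of the first time, falls at
  the rate \<open>a * V * kap (t + c)\<close>, and this rate is largest at
  \<open>t = b\<close>.\<close>

lemma kap_diff_kap_bound:
  assumes b: "0 < b" and c: "0 < c" and s: "0 \<le> s" and x: "x \<in> S" and z: "z \<in> S"
  shows "(\<integral>y. (kap b (x \<bullet> y) - kap (b + s) (x \<bullet> y)) * kap c (z \<bullet> y) \<partial>\<sigma>) \<le> a * V * s * kap (b + c) (x \<bullet> z)"
proof -
  define Q where "Q t = (\<integral>y. kap t (x \<bullet> y) * kap c (z \<bullet> y) \<partial>\<sigma>)" for t
  have dQ: "(Q has_real_derivative - a * (V * kap (t + c) (x \<bullet> z))) (at t)" if "0 < t" for t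
  proof -
    have "((\<lambda>h. \<integral>y. kap (t + h) (x \<bullet> y) * kap (c + 0 * h) (z \<bullet> y) \<partial>\<sigma>) has_real_derivative - a * (V * kap (t + c) (x \<bullet> z))) (at 0)"
      using deriv_kap_kap[OF that c x z, of 0] poi_kap_conv[OF that c x z] by simp
    then have "((\<lambda>h. Q (h + t)) has_real_derivative - a * (V * kap (t + c) (x \<bullet> z))) (at 0)"
      by (simp add: Q_def add.commute)
    then show ?thesis using DERIV_shift[of Q "- a * (V * kap (t + c) (x \<bullet> z))" 0 t] by simp
  qed
  have "norm (Q (b + s) - Q b) \<le> (a * V * kap (b + c) (x \<bullet> z)) * norm (b + s - b)"
  proof (rule field_differentiable_bound[of "{b..}" Q "\<lambda>t. - a * (V * kap (t + c) (x \<bullet> z))"])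
    fix t assume t: "t \<in> {b..}"
    then show "(Q has_field_derivative - a * (V * kap (t + c) (x \<bullet> z))) (at t within {b..})"
      by (intro has_field_derivative_at_within[OF dQ]) (use b in auto)
    have "kap (t + c) (x \<bullet> z) \<le> kap (b + c) (x \<bullet> z)"
      using t b c gap_pos[of "b + c" "x \<bullet> z"] inner_le_1[OF x z] by (intro kap_antimono) auto
    then show "norm (- a * (V * kap (t + c) (x \<bullet> z))) \<le> a * V * kap (b + c) (x \<bullet> z)"
      using a_pos V_pos kap_nonneg[of "t + c" "x \<bullet> z"] by (simp add: abs_mult mult_left_mono)
  qed (use s in auto)
  moreover have "(\<integral>y. (kap b (x \<bullet> y) - kap (b + s) (x \<bullet> y)) * kap c (z \<bullet> y) \<partial>\<sigma>) = Q b - Q (b + s)"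
    unfolding Q_def left_diff_distrib
    using integrable_kap_kap[of b c x z] integrable_kap_kap[of "b + s" c x z] b c s x z by simp
  ultimately show ?thesis using s by (simp add: abs_le_iff algebra_simps)
qed

text \<open>\<open>kap_diff_kap_bound\<close> is applied with both times equal to
  \<open>tau n\<close>, where the kernels are bounded; Fatou's lemma then reaches the singular
  kernels.\<close>

lemma kap_diff_riesz_bound:
  assumes s: "0 < s" and x: "x \<in> S" and z: "z \<in> S"
  shows "(\<integral>\<^sup>+y. ennreal (kap 0 (x \<bullet> y) - kap s (x \<bullet> y)) * riesz_kernel y z \<partial>\<sigma>) \<le> ennreal (a * V * s) * riesz_kernel x z"
proof -
  define f where "f n y = ennreal ((kap (tau n) (x \<bullet> y) - kap (tau n + s) (x \<bullet> y)) * kap (tau n) (z \<bullet> y))" for n y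
  have mf: "f n \<in> borel_measurable \<sigma>" for n unfolding f_def by measurable
  have lim: "(\<lambda>n. f n y) \<longlonglongrightarrow> ennreal (kap 0 (x \<bullet> y) - kap s (x \<bullet> y)) * riesz_kernel y z"
    if y: "y \<in> S" "y \<noteq> x" "y \<noteq> z" for y
  proof -
    have c0: "isCont (\<lambda>t. kap t u) 0" if "u < 1" for u
      unfolding kap_def using that by (intro continuous_intros) auto
    have u1: "x \<bullet> y < 1" "z \<bullet> y < 1" using inner_less_1 x y z by auto
    have l1: "(\<lambda>n. kap (tau n) (x \<bullet> y)) \<longlonglongrightarrow> kap 0 (x \<bullet> y)" by (rule isCont_tendsto_compose[OF c0[OF u1(1)] tau_lim])
    have l2: "(\<lambda>n. kap (tau n) (z \<bullet> y)) \<longlonglongrightarrow> kap 0 (z \<bullet> y)" by (rule isCont_tendsto_compose[OF c0[OF u1(2)] tau_lim])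
    have "isCont (\<lambda>t. kap t (x \<bullet> y)) s" using DERIV_isCont[OF kap_deriv_t] s u1 by fastforce
    moreover have "(\<lambda>n. tau n + s) \<longlonglongrightarrow> s" using tendsto_add[OF tau_lim tendsto_const, of s] by simp
    ultimately have l3: "(\<lambda>n. kap (tau n + s) (x \<bullet> y)) \<longlonglongrightarrow> kap s (x \<bullet> y)" by (rule isCont_tendsto_compose)
    have "(\<lambda>n. f n y) \<longlonglongrightarrow> ennreal ((kap 0 (x \<bullet> y) - kap s (x \<bullet> y)) * kap 0 (z \<bullet> y))"
      unfolding f_def by (intro tendsto_ennrealI tendsto_intros l1 l2 l3)
    also have "ennreal ((kap 0 (x \<bullet> y) - kap s (x \<bullet> y)) * kap 0 (z \<bullet> y)) = ennreal (kap 0 (x \<bullet> y) - kap s (x \<bullet> y)) * riesz_kernel y z"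
      using riesz_kernel_eq_S[OF y(1) z y(3)] kap_le_kap_0[of s x y] x y s
      by (simp add: ennreal_mult kap_nonneg inner_commute)
    finally show ?thesis .
  qed
  have "(\<integral>\<^sup>+y. ennreal (kap 0 (x \<bullet> y) - kap s (x \<bullet> y)) * riesz_kernel y z \<partial>\<sigma>) = (\<integral>\<^sup>+y. liminf (\<lambda>n. f n y) \<partial>\<sigma>)"
  proof (rule nn_integral_cong_AE)
    show "AE y in \<sigma>. ennreal (kap 0 (x \<bullet> y) - kap s (x \<bullet> y)) * riesz_kernel y z = liminf (\<lambda>n. f n y)"
      using AE_neq_S[OF x] AE_neq_S[OF z] AE_space[of \<sigma>]
      by eventually_elim (use x z lim in \<open>auto intro!: lim_imp_Liminf[symmetric]\<close>)
  qed
  also have "\<dots> \<le> liminf (\<lambda>n. \<integral>\<^sup>+y. f n y \<partial>\<sigma>)"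
    by (rule nn_integral_liminf) (rule mf)
  also have "\<dots> \<le> liminf (\<lambda>n. ennreal (a * V * s) * riesz_kernel x z)"
  proof (rule Liminf_mono, rule always_eventually, rule allI)
    fix n
    have t: "0 < tau n" by (rule tau_pos)
    have nn: "0 \<le> (kap (tau n) (x \<bullet> y) - kap (tau n + s) (x \<bullet> y)) * kap (tau n) (z \<bullet> y)" if "y \<in> S" for y
      using kap_antimono[of "tau n" "tau n + s" "x \<bullet> y"] t s gap_pos[of "tau n" "x \<bullet> y"] inner_le_1[OF x that] kap_nonneg
      by (intro mult_nonneg_nonneg) auto
    have int: "integrable \<sigma> (\<lambda>y. (kap (tau n) (x \<bullet> y) - kap (tau n + s) (x \<bullet> y)) * kap (tau n) (z \<bullet> y))"
      unfolding left_diff_distrib using integrable_kap_kap[of "tau n" "tau n" x z] integrable_kap_kap[of "tau n + s" "tau n" x z] t s x z by auto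
    have "(\<integral>\<^sup>+y. f n y \<partial>\<sigma>) = ennreal (\<integral>y. (kap (tau n) (x \<bullet> y) - kap (tau n + s) (x \<bullet> y)) * kap (tau n) (z \<bullet> y) \<partial>\<sigma>)"
      unfolding f_def by (rule nn_integral_eq_integral[OF int]) (rule AE_I2, use nn in auto)
    also have "\<dots> \<le> ennreal (a * V * s * kap (tau n + tau n) (x \<bullet> z))"
      by (rule ennreal_leI[OF kap_diff_kap_bound]) (use t s x z in auto)
    also have "\<dots> = ennreal (a * V * s) * ennreal (kap (tau n + tau n) (x \<bullet> z))"
      using a_pos V_pos s by (simp add: ennreal_mult kap_nonneg)
    also have "\<dots> \<le> ennreal (a * V * s) * riesz_kernel x z"
      by (intro mult_left_mono kap_le_riesz) (use t x z in auto)
    finally show "(\<integral>\<^sup>+y. f n y \<partial>\<sigma>) \<le> ennreal (a * V * s) * riesz_kernel x z" .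
  qed
  also have "\<dots> = ennreal (a * V * s) * riesz_kernel x z" by (simp add: Liminf_const)
  finally show ?thesis .
qed

text \<open>A constant potential would give \<open>V * (1 - exp (- a * s))\<close> times the
  constant on the left, so the bound is sharp to first order in \<open>s\<close>.
  \<open>contact_estimate\<close> depends on this.\<close>

lemma kap_diff_npot_bound:
  assumes m: "mass \<mu>" and s: "0 < s" and x: "x \<in> S"
  shows "(\<integral>\<^sup>+y. ennreal (kap 0 (x \<bullet> y) - kap s (x \<bullet> y)) * npot \<mu> y \<partial>\<sigma>) \<le> ennreal (a * V * s) * npot \<mu> x"
proof -
  interpret pair_sigma_finite \<sigma> \<mu> by (rule mass_pair[OF m])
  note [measurable] = mass_ident[OF m]
  have mr: "(\<lambda>(y, z). ennreal (kap 0 (x \<bullet> y) - kap s (x \<bullet> y)) * riesz_kernel y z) \<in> borel_measurable (\<sigma> \<Otimes>\<^sub>M \<mu>)"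
    unfolding riesz_kernel_def by measurable
  have "(\<integral>\<^sup>+y. ennreal (kap 0 (x \<bullet> y) - kap s (x \<bullet> y)) * npot \<mu> y \<partial>\<sigma>) = (\<integral>\<^sup>+y. \<integral>\<^sup>+z. ennreal (kap 0 (x \<bullet> y) - kap s (x \<bullet> y)) * riesz_kernel y z \<partial>\<mu> \<partial>\<sigma>)"
    unfolding npot_def
    by (intro nn_integral_cong nn_integral_cmult[symmetric]) (use riesz_measurable[OF m] in simp)
  also have "\<dots> = (\<integral>\<^sup>+z. \<integral>\<^sup>+y. ennreal (kap 0 (x \<bullet> y) - kap s (x \<bullet> y)) * riesz_kernel y z \<partial>\<sigma> \<partial>\<mu>)"
    by (rule Fubini'[symmetric]) (use mr in simp)
  also have "\<dots> \<le> (\<integral>\<^sup>+z. ennreal (a * V * s) * riesz_kernel x z \<partial>\<mu>)"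
    by (intro nn_integral_mono kap_diff_riesz_bound s x) (use mass_space[OF m] in simp)
  also have "\<dots> = ennreal (a * V * s) * npot \<mu> x"
    unfolding npot_def by (rule nn_integral_cmult) (use riesz_measurable[OF m] in simp)
  finally show ?thesis .
qed


subsection \<open>Testing against functions that increase towards a pole\<close>

text \<open>The layer-cake formula in the form of Riemann sums: \<open>w\<close> is replaced by a
  multiple of a sum of indicators of \<open>m\<close> level sets, each of which is controlled by the
  hypothesis, and the error is \<open>B / m\<close> times the \<open>L1\<close> norm of
  \<open>g\<close>.\<close>

lemma layer_cake_le:
  fixes g w :: "real^'n \<Rightarrow> real"
  assumes g: "integrable \<sigma> g" and w: "w \<in> borel_measurable \<sigma>" and B: "0 < B"
    and wB: "\<And>x. x \<in> S \<Longrightarrow> 0 \<le> w x" "\<And>x. x \<in> S \<Longrightarrow> w x \<le> B"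
    and lev: "\<And>\<tau>. 0 \<le> \<tau> \<Longrightarrow> (\<integral>x. (if \<tau> < w x then g x else 0) \<partial>\<sigma>) \<le> \<kappa>"
  shows "(\<integral>x. w x * g x \<partial>\<sigma>) \<le> B * \<kappa>"
proof -
  note [measurable] = w borel_measurable_integrable[OF g]
  have li: "integrable \<sigma> (\<lambda>x. if \<tau> < w x then g x else 0)" for \<tau>
    by (rule integrable_if[OF g]) measurable
  have wg: "integrable \<sigma> (\<lambda>x. w x * g x)"
    by (rule integrable_mult_bounded[OF g w, of B]) (use wB in fastforce)
  have approx: "(\<integral>x. w x * g x \<partial>\<sigma>) \<le> B * \<kappa> + B / m * (\<integral>x. \<bar>g x\<bar> \<partial>\<sigma>)" if m: "0 < m" for m :: nat
  proof -
    \<comment> \<open>This rounds \<open>w x\<close> up to the next multiple of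
      \<open>B / m\<close>.\<close>
    define W where "W x = B / m * (\<Sum>i<m. if real i * B / m < w x then 1 else (0::real))" for x
    have W: "\<bar>w x - W x\<bar> \<le> B / m" if x: "x \<in> S" for x
    proof -
      define v where "v = w x * m / B"
      have v: "0 \<le> v" "v \<le> m" using wB[OF x] m B by (auto simp: v_def field_simps)
      have "(real i * B / m < w x) = (i < nat \<lceil>v\<rceil>)" for i
      proof -
        have "(real i * B / m < w x) = (real i < v)" using m B by (simp add: v_def field_simps)
        also have "\<dots> = (int i < \<lceil>v\<rceil>)" by (simp add: less_ceiling_iff)
        finally show ?thesis by linarith
      qed
      then have "(\<Sum>i<m. if real i * B / m < w x then 1 else (0::real)) = (\<Sum>i\<in>{..<m} \<inter> {i. i < nat \<lceil>v\<rceil>}. 1)"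
        by (simp add: sum.If_cases)
      moreover have le: "nat \<lceil>v\<rceil> \<le> m" using v by (simp add: ceiling_le_iff)
      have "{..<m} \<inter> {i. i < nat \<lceil>v\<rceil>} = {..<nat \<lceil>v\<rceil>}"
        using order_less_le_trans[OF _ le] by blast
      ultimately have "W x = B / m * real (nat \<lceil>v\<rceil>)" by (simp add: W_def)
      moreover have "w x = B / m * v" using m B by (simp add: v_def)
      ultimately have "w x - W x = B / m * (v - real (nat \<lceil>v\<rceil>))" by (simp add: algebra_simps)
      moreover have "\<bar>v - real (nat \<lceil>v\<rceil>)\<bar> \<le> 1" using v(1) by linarith
      ultimately show ?thesis using B m
        by (auto simp: abs_mult intro!: divide_right_mono mult_left_le)
    qed
    have Wm [measurable]: "W \<in> borel_measurable \<sigma>" unfolding W_def by measurable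
    have Wg: "W x * g x = B / m * (\<Sum>i<m. if real i * B / m < w x then g x else 0)" for x
      unfolding W_def mult.assoc sum_distrib_right
      by (rule arg_cong[where f = "\<lambda>q. B / m * q"], rule sum.cong) auto
    have iW: "integrable \<sigma> (\<lambda>x. W x * g x)"
      unfolding Wg by (intro integrable_mult_right Bochner_Integration.integrable_sum li)
    have "(\<integral>x. W x * g x \<partial>\<sigma>) = B / m * (\<Sum>i<m. \<integral>x. (if real i * B / m < w x then g x else 0) \<partial>\<sigma>)"
      unfolding Wg by (simp add: Bochner_Integration.integral_sum[OF li])
    also have "\<dots> \<le> B / m * (\<Sum>i<m. \<kappa>)"
      using B by (intro mult_left_mono sum_mono lev) auto
    finally have 1: "(\<integral>x. W x * g x \<partial>\<sigma>) \<le> B * \<kappa>" using m by simp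
    have "(\<integral>x. w x * g x \<partial>\<sigma>) - (\<integral>x. W x * g x \<partial>\<sigma>) = (\<integral>x. (w x - W x) * g x \<partial>\<sigma>)"
      using wg iW by (simp add: left_diff_distrib)
    also have "\<dots> \<le> (\<integral>x. B / m * \<bar>g x\<bar> \<partial>\<sigma>)"
    proof (rule integral_mono)
      show "integrable \<sigma> (\<lambda>x. (w x - W x) * g x)" using wg iW by (simp add: left_diff_distrib)
      show "integrable \<sigma> (\<lambda>x. B / m * \<bar>g x\<bar>)" using g by simp
      fix x assume "x \<in> space \<sigma>"
      then have "\<bar>w x - W x\<bar> * \<bar>g x\<bar> \<le> B / m * \<bar>g x\<bar>" by (intro mult_right_mono W) auto
      then show "(w x - W x) * g x \<le> B / m * \<bar>g x\<bar>"
        using abs_ge_self[of "(w x - W x) * g x"] by (simp add: abs_mult)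
    qed
    finally show ?thesis using 1 by simp
  qed
  have "(\<lambda>m. B * \<kappa> + B / real m * (\<integral>x. \<bar>g x\<bar> \<partial>\<sigma>)) \<longlonglongrightarrow> B * \<kappa> + 0 * (\<integral>x. \<bar>g x\<bar> \<partial>\<sigma>)"
    by (intro tendsto_intros lim_const_over_n)
  then show ?thesis
    by (intro LIMSEQ_le_const[where X = "\<lambda>m. B * \<kappa> + B / real m * (\<integral>x. \<bar>g x\<bar> \<partial>\<sigma>)"] exI[of _ 1])
       (use approx in auto)
qed

text \<open>The premise is not strict, so two points of equal height are compared in both
  directions: such a function depends on \<open>x \<bullet> e\<close> alone.\<close>

definition zdec :: "real^'n \<Rightarrow> (real^'n \<Rightarrow> real) \<Rightarrow> bool" where
  "zdec e f \<longleftrightarrow> (\<forall>x\<in>S. \<forall>y\<in>S. x \<bullet> e \<le> y \<bullet> e \<longrightarrow> f x \<le> f y)"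

lemma zdecD: "zdec e f \<Longrightarrow> x \<in> S \<Longrightarrow> y \<in> S \<Longrightarrow> x \<bullet> e \<le> y \<bullet> e \<Longrightarrow> f x \<le> f y"
  by (simp add: zdec_def)

lemma AE_ring_S: "e \<in> S \<Longrightarrow> AE x in \<sigma>. x \<bullet> e \<noteq> s"
  by (rule AE_ring) simp

text \<open>Upper level sets are caps with or without their boundary ring, and rings are
  null.\<close>

lemma zdec_level:
  assumes e: "e \<in> S" and z: "zdec e w"
  obtains s where "AE x in \<sigma>. (\<tau> < w x) = (s < x \<bullet> e)"
proof -
  define A where "A = {x \<in> S. \<tau> < w x}"
  have le1: "\<bar>x \<bullet> e\<bar> \<le> 1" if "x \<in> S" for x using abs_inner_le_1[OF that e] .
  show thesis
  proof (cases "A = {}")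
    case True
    have "AE x in \<sigma>. (\<tau> < w x) = (1 < x \<bullet> e)"
      by (rule AE_I2) (use True le1 in \<open>fastforce simp: A_def abs_le_iff\<close>)
    then show thesis by (rule that)
  next
    case False
    define s where "s = (INF x\<in>A. x \<bullet> e)"
    have bd: "bdd_below ((\<lambda>x. x \<bullet> e) ` A)"
      by (rule bdd_belowI2[of _ "- 1"]) (use le1 in \<open>fastforce simp: A_def abs_le_iff\<close>)
    have "AE x in \<sigma>. (\<tau> < w x) = (s < x \<bullet> e)"
      using AE_ring_S[OF e, of s] AE_space
    proof eventually_elim
      case (elim x)
      then have x: "x \<in> S" by simp
      show ?case
      proof
        assume "\<tau> < w x"
        then have "s \<le> x \<bullet> e" unfolding s_def by (intro cINF_lower bd) (use x in \<open>auto simp: A_def\<close>)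
        then show "s < x \<bullet> e" using elim by simp
      next
        assume "s < x \<bullet> e"
        then obtain y where "y \<in> A" "y \<bullet> e < x \<bullet> e" using cINF_less_iff[OF False bd] by (auto simp: s_def)
        then show "\<tau> < w x" using zdecD[OF z, of y x] x by (auto simp: A_def)
      qed
    qed
    then show thesis by (rule that)
  qed
qed

text \<open>Sets of \<open>\<sigma>\<close> are Borel sets, so the description almost everywhere
  from \<open>zdec_level\<close> is too weak; each level set is empty or exactly an open or a closed
  cap, depending on whether the infimum of heights is attained.\<close>

lemma zdec_measurable:
  assumes e: "e \<in> S" and z: "zdec e w"
  shows "w \<in> borel_measurable \<sigma>"
proof (rule borel_measurableI_greater)
  fix \<tau>
  have "{x \<in> S. \<tau> < w x} \<in> sets \<sigma>"
  proof -
    define A where "A = {x \<in> S. \<tau> < w x}"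
    define s where "s = (INF x\<in>A. x \<bullet> e)"
    have "A = {} \<or> A = {x \<in> S. s < x \<bullet> e} \<or> A = {x \<in> S. s \<le> x \<bullet> e}"
    proof (cases "A = {}")
      case False
      have bd: "bdd_below ((\<lambda>x. x \<bullet> e) ` A)"
        by (rule bdd_belowI2[of _ "- 1"]) (use abs_inner_le_1[OF _ e] in \<open>fastforce simp: A_def abs_le_iff\<close>)
      have 1: "s \<le> x \<bullet> e" if "x \<in> A" for x unfolding s_def by (intro cINF_lower bd that)
      have 2: "x \<in> A" if x: "x \<in> S" "s < x \<bullet> e" for x
      proof -
        obtain y where "y \<in> A" "y \<bullet> e < x \<bullet> e" using cINF_less_iff[OF False bd] x by (auto simp: s_def)
        then show ?thesis using zdecD[OF z, of y x] x by (auto simp: A_def)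
      qed
      show ?thesis
      proof (cases "\<exists>x\<in>A. x \<bullet> e = s")
        case True
        then obtain y where y: "y \<in> A" "y \<bullet> e = s" by blast
        then have "x \<in> A" if "x \<in> S" "s \<le> x \<bullet> e" for x
          using zdecD[OF z, of y x] that by (auto simp: A_def)
        then show ?thesis using 1 by (auto simp: A_def)
      next
        case False
        then show ?thesis using 1 2 by (auto simp: A_def) (metis less_eq_real_def)+
      qed
    qed simp
    moreover have "{x \<in> space \<sigma>. s < x \<bullet> e} \<in> sets \<sigma>" "{x \<in> space \<sigma>. s \<le> x \<bullet> e} \<in> sets \<sigma>" by measurable
    ultimately show ?thesis unfolding A_def[symmetric] by auto
  qed
  then show "{x \<in> space \<sigma>. \<tau> < w x} \<in> sets \<sigma>" by simp
qed

lemma zdec_test: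
  fixes g w :: "real^'n \<Rightarrow> real"
  assumes e: "e \<in> S" and g: "integrable \<sigma> g" and z: "zdec e w" and B: "0 < B"
    and wB: "\<And>x. x \<in> S \<Longrightarrow> 0 \<le> w x" "\<And>x. x \<in> S \<Longrightarrow> w x \<le> B"
    and lev: "\<And>s. (\<integral>x. (if s < x \<bullet> e then g x else 0) \<partial>\<sigma>) \<le> \<kappa>"
  shows "(\<integral>x. w x * g x \<partial>\<sigma>) \<le> B * \<kappa>"
proof (rule layer_cake_le[OF g zdec_measurable[OF e z] B wB])
  fix \<tau> :: real
  obtain s where s: "AE x in \<sigma>. (\<tau> < w x) = (s < x \<bullet> e)" by (rule zdec_level[OF e z])
  note [measurable] = zdec_measurable[OF e z] borel_measurable_integrable[OF g]
  have "(\<integral>x. (if \<tau> < w x then g x else 0) \<partial>\<sigma>) = (\<integral>x. (if s < x \<bullet> e then g x else 0) \<partial>\<sigma>)"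
    by (rule integral_cong_AE) (measurable, use s in \<open>auto elim!: eventually_mono\<close>)
  then show "(\<integral>x. (if \<tau> < w x then g x else 0) \<partial>\<sigma>) \<le> \<kappa>" using lev by simp
qed auto

text \<open>This is \<open>exp (- a * s)\<close> times the harmonic extension of \<open>f\<close>
  evaluated at radius \<open>exp (- s)\<close>. With this factor the operators form a semigroup on
  potentials, and constants are contracted rather than preserved.\<close>

definition R :: "real \<Rightarrow> (real^'n \<Rightarrow> real) \<Rightarrow> real^'n \<Rightarrow> real" where
  "R s f x = (\<integral>y. poi s (x \<bullet> y) * f y \<partial>\<sigma>) / V"

lemma integrable_poi_mult:
  assumes s: "0 < s" and x: "x \<in> S" and f: "integrable \<sigma> f"
  shows "integrable \<sigma> (\<lambda>y. poi s (x \<bullet> y) * f y)"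
proof -
  obtain B where B: "\<And>u. \<bar>u\<bar> \<le> 1 \<Longrightarrow> \<bar>poi s u\<bar> \<le> B" using poi_bounded[OF s] by blast
  note [measurable] = borel_measurable_integrable[OF f]
  show ?thesis
    by (rule integrable_mult_bounded[OF f _ B]) (measurable, use abs_inner_le_1[OF x] in auto)
qed

lemma R_measurable [measurable (raw)]:
  assumes "f \<in> borel_measurable \<sigma>" shows "R s f \<in> borel_measurable \<sigma>"
proof -
  note [measurable] = assms
  show ?thesis unfolding R_def by measurable
qed

lemma R_rpot: "mass \<mu> \<Longrightarrow> 0 < s \<Longrightarrow> x \<in> S \<Longrightarrow> R s (rpot \<mu>) x = pot \<mu> s x"
  using rpot_poi_conv(2)[of \<mu> s x] V_pos by (simp add: R_def)

lemma R_pot: "mass \<mu> \<Longrightarrow> 0 < s \<Longrightarrow> 0 < b \<Longrightarrow> x \<in> S \<Longrightarrow> R s (pot \<mu> b) x = pot \<mu> (s + b) x"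
  using pot_poi_conv[of \<mu> s b x] V_pos by (simp add: R_def)

lemma R_const: "0 < s \<Longrightarrow> x \<in> S \<Longrightarrow> R s (\<lambda>_. c) x = c * exp (- a * s)"
  using integral_poi[of s x] V_pos by (simp add: R_def)

lemma R_diff: "0 < s \<Longrightarrow> x \<in> S \<Longrightarrow> integrable \<sigma> f \<Longrightarrow> integrable \<sigma> g \<Longrightarrow> R s (\<lambda>y. f y - g y) x = R s f x - R s g x"
  using integrable_poi_mult[of s x f] integrable_poi_mult[of s x g]
  by (simp add: R_def right_diff_distrib diff_divide_distrib)

lemma R_add: "0 < s \<Longrightarrow> x \<in> S \<Longrightarrow> integrable \<sigma> f \<Longrightarrow> integrable \<sigma> g \<Longrightarrow> R s (\<lambda>y. f y + g y) x = R s f x + R s g x"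
  using integrable_poi_mult[of s x f] integrable_poi_mult[of s x g]
  by (simp add: R_def distrib_left add_divide_distrib)

lemma R_mono:
  assumes s: "0 < s" and x: "x \<in> S" and f: "integrable \<sigma> f" "integrable \<sigma> g" and le: "AE y in \<sigma>. f y \<le> g y"
  shows "R s f x \<le> R s g x"
proof -
  have "(\<integral>y. poi s (x \<bullet> y) * f y \<partial>\<sigma>) \<le> (\<integral>y. poi s (x \<bullet> y) * g y \<partial>\<sigma>)"
  proof (rule integral_mono_AE)
    show "AE y in \<sigma>. poi s (x \<bullet> y) * f y \<le> poi s (x \<bullet> y) * g y"
      using le AE_space by eventually_elim (use poi_nonneg[OF s x] in \<open>auto intro!: mult_left_mono\<close>)
  qed (intro integrable_poi_mult s x f)+
  then show ?thesis unfolding R_def using V_pos by (simp add: divide_right_mono)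
qed

lemma R_nonneg: "0 < s \<Longrightarrow> x \<in> S \<Longrightarrow> (\<And>y. y \<in> S \<Longrightarrow> 0 \<le> f y) \<Longrightarrow> 0 \<le> R s f x"
  unfolding R_def using V_pos poi_nonneg by (intro divide_nonneg_pos integral_nonneg_AE AE_I2) auto

lemma R_le_const:
  assumes s: "0 < s" and x: "x \<in> S" and f: "integrable \<sigma> f" and le: "\<And>y. y \<in> S \<Longrightarrow> f y \<le> c"
  shows "R s f x \<le> c * exp (- a * s)"
proof -
  have "AE y in \<sigma>. f y \<le> c" by (rule AE_I2) (use le in simp)
  from R_mono[OF s x f _ this] R_const[OF s x, of c] show ?thesis by simp
qed

lemma integrable_product_R:
  fixes f g :: "real^'n \<Rightarrow> real"
  assumes s: "0 < s" and f: "integrable \<sigma> f" and g: "g \<in> borel_measurable \<sigma>" "\<And>x. x \<in> S \<Longrightarrow> \<bar>g x\<bar> \<le> B"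
  shows "integrable (\<sigma> \<Otimes>\<^sub>M \<sigma>) (\<lambda>(x, y). g x * poi s (x \<bullet> y) * f y)"
proof -
  interpret pp: pair_sigma_finite \<sigma> \<sigma> ..
  obtain C where C: "\<And>u. \<bar>u\<bar> \<le> 1 \<Longrightarrow> \<bar>poi s u\<bar> \<le> C" using poi_bounded[OF s] by blast
  have C0: "0 \<le> C" using C[of 0] by simp
  obtain x0 where "x0 \<in> S" using pos_\<sigma> by (metis emeasure_empty equals0I)
  then have B0: "0 \<le> B" using g(2)[of x0] by simp
  note [measurable] = g(1) borel_measurable_integrable[OF f]
  have bd: "\<bar>g x * poi s (x \<bullet> y) * f y\<bar> \<le> B * C * \<bar>f y\<bar>" if "x \<in> S" "y \<in> S" for x y
    unfolding abs_mult using that g(2) C abs_inner_le_1 B0 C0 by (intro mult_right_mono mult_mono) auto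
  have i: "integrable \<sigma> (\<lambda>y. g x * poi s (x \<bullet> y) * f y)" if x: "x \<in> S" for x
    using integrable_mult_right[OF integrable_poi_mult[OF s x f], of "g x"] by (simp add: mult.assoc)
  show ?thesis
  proof (rule pp.Fubini_integrable)
    show "(\<lambda>(x, y). g x * poi s (x \<bullet> y) * f y) \<in> borel_measurable (\<sigma> \<Otimes>\<^sub>M \<sigma>)" by measurable
    show "integrable \<sigma> (\<lambda>x. \<integral>y. norm (case (x, y) of (x, y) \<Rightarrow> g x * poi s (x \<bullet> y) * f y) \<partial>\<sigma>)"
    proof (rule integrable_bounded[where B = "\<integral>y. B * C * \<bar>f y\<bar> \<partial>\<sigma>"])
      show "(\<lambda>x. \<integral>y. norm (case (x, y) of (x, y) \<Rightarrow> g x * poi s (x \<bullet> y) * f y) \<partial>\<sigma>) \<in> borel_measurable \<sigma>" by measurable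
      fix x assume x: "x \<in> S"
      have "(\<integral>y. norm (g x * poi s (x \<bullet> y) * f y) \<partial>\<sigma>) \<le> (\<integral>y. B * C * \<bar>f y\<bar> \<partial>\<sigma>)"
        by (rule integral_mono) (use i[OF x] f bd[OF x] in auto)
      then show "\<bar>\<integral>y. norm (case (x, y) of (x, y) \<Rightarrow> g x * poi s (x \<bullet> y) * f y) \<partial>\<sigma>\<bar> \<le> (\<integral>y. B * C * \<bar>f y\<bar> \<partial>\<sigma>)"
        by simp
    qed
    show "AE x in \<sigma>. integrable \<sigma> (\<lambda>y. case (x, y) of (x, y) \<Rightarrow> g x * poi s (x \<bullet> y) * f y)"
      by (rule AE_I2) (use i in simp)
  qed
qed

lemma R_swap:
  fixes f g :: "real^'n \<Rightarrow> real"
  assumes s: "0 < s" and f: "integrable \<sigma> f" and g: "g \<in> borel_measurable \<sigma>" "\<And>x. x \<in> S \<Longrightarrow> \<bar>g x\<bar> \<le> B"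
  shows "(\<integral>x. g x * R s f x \<partial>\<sigma>) = (\<integral>x. R s g x * f x \<partial>\<sigma>)" "integrable \<sigma> (\<lambda>x. g x * R s f x)" "integrable \<sigma> (\<lambda>x. R s g x * f x)"
proof -
  interpret pp: pair_sigma_finite \<sigma> \<sigma> ..
  note i = integrable_product_R[OF s f g]
  have e1: "(\<lambda>x. g x * R s f x) = (\<lambda>x. (\<integral>y. g x * poi s (x \<bullet> y) * f y \<partial>\<sigma>) / V)"
    by (simp add: R_def mult.assoc fun_eq_iff)
  have e2: "(\<lambda>y. R s g y * f y) = (\<lambda>y. (\<integral>x. g x * poi s (x \<bullet> y) * f y \<partial>\<sigma>) / V)"
    by (simp add: R_def fun_eq_iff inner_commute mult.commute[of "poi s _"])
  show "(\<integral>x. g x * R s f x \<partial>\<sigma>) = (\<integral>x. R s g x * f x \<partial>\<sigma>)"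
    unfolding e1 e2 using pp.Fubini_integral[OF i] by simp
  show "integrable \<sigma> (\<lambda>x. g x * R s f x)" unfolding e1 using pp.integrable_fst[OF i] by simp
  show "integrable \<sigma> (\<lambda>x. R s g x * f x)" unfolding e2 using pp.integrable_snd[OF i] by simp
qed

lemma integral_refl_sum:
  fixes f :: "real^'n \<Rightarrow> real"
  assumes "integrable \<sigma> f"
  shows "(\<integral>x. f x \<partial>\<sigma>) = (\<integral>x. f x + f (refl_along v x) \<partial>\<sigma>) / 2"
  using integral_orth[OF orthogonal_refl_along, of f v] integrable_orth[OF orthogonal_refl_along assms, of v] assms
  by simp

lemma refl_along_S: "x \<in> S \<Longrightarrow> refl_along v x \<in> S"
  by simp

lemma inner_refl_self: "v \<bullet> refl_along v x = - (v \<bullet> x)"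
  by (cases "v = 0") (auto simp: refl_along_def inner_diff_right inner_commute)

lemma R_refl_diff:
  assumes s: "0 < s" and x: "x \<in> S" and f: "integrable \<sigma> f"
  shows "R s f x - R s f (refl_along v x) = (\<integral>y. (poi s (x \<bullet> y) - poi s (refl_along v x \<bullet> y)) * (f y - f (refl_along v y)) \<partial>\<sigma>) / (2 * V)"
proof -
  have x': "refl_along v x \<in> S" using x by simp
  let ?h = "\<lambda>y. (poi s (x \<bullet> y) - poi s (refl_along v x \<bullet> y)) * f y"
  have i: "integrable \<sigma> ?h"
    unfolding left_diff_distrib using integrable_poi_mult[OF s x f] integrable_poi_mult[OF s x' f] by simp
  have "R s f x - R s f (refl_along v x) = (\<integral>y. ?h y \<partial>\<sigma>) / V"
    unfolding R_def left_diff_distrib using integrable_poi_mult[OF s x f] integrable_poi_mult[OF s x' f]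
    by (simp add: diff_divide_distrib)
  also have "(\<integral>y. ?h y \<partial>\<sigma>) = (\<integral>y. ?h y + ?h (refl_along v y) \<partial>\<sigma>) / 2" by (rule integral_refl_sum[OF i])
  also have "(\<lambda>y. ?h y + ?h (refl_along v y)) = (\<lambda>y. (poi s (x \<bullet> y) - poi s (refl_along v x \<bullet> y)) * (f y - f (refl_along v y)))"
    by (rule ext) (simp add: refl_along_inner_swap[of v x] algebra_simps)
  finally show ?thesis by simp
qed

lemma poi_refl_sign:
  assumes s: "0 < s" and x: "x \<in> S" and y: "y \<in> S"
  shows "0 \<le> (v \<bullet> x) * (v \<bullet> y) \<Longrightarrow> poi s (refl_along v x \<bullet> y) \<le> poi s (x \<bullet> y)"
    "(v \<bullet> x) * (v \<bullet> y) \<le> 0 \<Longrightarrow> poi s (x \<bullet> y) \<le> poi s (refl_along v x \<bullet> y)"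
proof -
  have e: "refl_along v x \<bullet> y = x \<bullet> y - 2 * ((v \<bullet> x) * (v \<bullet> y)) / (v \<bullet> v)"
    by (simp add: refl_along_def inner_diff_left inner_commute[of x v])
  have le: "x \<bullet> y \<le> 1" "refl_along v x \<bullet> y \<le> 1" using inner_le_1 x y by auto
  show "poi s (refl_along v x \<bullet> y) \<le> poi s (x \<bullet> y)" if "0 \<le> (v \<bullet> x) * (v \<bullet> y)"
    using that le s by (intro poi_mono) (auto simp: e)
  show "poi s (x \<bullet> y) \<le> poi s (refl_along v x \<bullet> y)" if "(v \<bullet> x) * (v \<bullet> y) \<le> 0"
  proof (rule poi_mono[OF s _ le(2)])
    have "2 * ((v \<bullet> x) * (v \<bullet> y)) / (v \<bullet> v) \<le> 0" using that by (intro divide_nonpos_nonneg) auto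
    then show "x \<bullet> y \<le> refl_along v x \<bullet> y" unfolding e by linarith
  qed
qed

text \<open>Two points are compared through the reflection in their bisector. On the side of the
  higher point both the Poisson kernel centred there and \<open>f\<close> are larger than at the
  mirror image, so the integrand of \<open>R_refl_diff\<close> is nonnegative on both sides.\<close>

lemma R_zdec:
  assumes e: "e \<in> S" and s: "0 < s" and f: "integrable \<sigma> f" and z: "zdec e f"
  shows "zdec e (R s f)"
  unfolding zdec_def
proof (intro ballI impI)
  fix x y assume x: "x \<in> S" and y: "y \<in> S" and le: "x \<bullet> e \<le> y \<bullet> e"
  define v where "v = y - x"
  have ve: "0 \<le> v \<bullet> e" using le by (simp add: v_def inner_diff_left)
  have ryx: "refl_along v y = x" unfolding v_def by (rule refl_along_swap) (use x y in simp)
  have vy: "0 \<le> v \<bullet> y" using inner_le_1[OF x y] y by (simp add: v_def inner_diff_left norm_eq_1)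
  have "0 \<le> R s f y - R s f (refl_along v y)"
    unfolding R_refl_diff[OF s y f]
  proof (intro divide_nonneg_pos integral_nonneg_AE AE_I2)
    fix w assume "w \<in> space \<sigma>"
    then have w: "w \<in> S" by simp
    have we: "w \<bullet> e - refl_along v w \<bullet> e = 2 * (v \<bullet> w) * (v \<bullet> e) / (v \<bullet> v)"
      by (simp add: refl_along_def inner_diff_left inner_commute[of w v])
    show "0 \<le> (poi s (y \<bullet> w) - poi s (refl_along v y \<bullet> w)) * (f w - f (refl_along v w))"
    proof (cases "0 \<le> v \<bullet> w")
      case True
      then have "0 \<le> w \<bullet> e - refl_along v w \<bullet> e" unfolding we using ve by (intro divide_nonneg_nonneg mult_nonneg_nonneg) auto
      then have "f (refl_along v w) \<le> f w" using zdecD[OF z refl_along_S[OF w] w] by simp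
      moreover have "poi s (refl_along v y \<bullet> w) \<le> poi s (y \<bullet> w)" by (rule poi_refl_sign(1)[OF s y w]) (use True vy in simp)
      ultimately show ?thesis by simp
    next
      case False
      then have "w \<bullet> e - refl_along v w \<bullet> e \<le> 0" unfolding we using ve
        by (intro divide_nonpos_nonneg) (auto intro: mult_nonpos_nonneg mult_nonneg_nonpos)
      then have "f w \<le> f (refl_along v w)" using zdecD[OF z w refl_along_S[OF w]] by simp
      moreover have "poi s (y \<bullet> w) \<le> poi s (refl_along v y \<bullet> w)" by (rule poi_refl_sign(2)[OF s y w]) (use False vy in \<open>simp add: mult_nonneg_nonpos\<close>)
      ultimately show ?thesis by (simp add: mult_nonpos_nonpos)
    qed
  qed (use V_pos in simp)
  then show "R s f x \<le> R s f y" unfolding ryx by simp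
qed

end

subsection \<open>Polarization\<close>

definition pol :: "'a::real_inner \<Rightarrow> ('a \<Rightarrow> real) \<Rightarrow> 'a \<Rightarrow> real" where
  "pol v f x = (if 0 \<le> v \<bullet> x then max (f x) (f (refl_along v x)) else min (f x) (f (refl_along v x)))"

text \<open>Equal sum and smaller spread make \<open>p\<close> and \<open>q\<close> convex
  combinations of \<open>p'\<close> and \<open>q'\<close> with interchanged weights \<open>t\<close>
  and \<open>1 - t\<close>; the two convexity inequalities are added.\<close>

lemma convex_majorize:
  fixes \<Phi> :: "real \<Rightarrow> real"
  assumes c: "convex_on UNIV \<Phi>" and s: "p + q = p' + q'" and d: "\<bar>p - q\<bar> \<le> \<bar>p' - q'\<bar>"
  shows "\<Phi> p + \<Phi> q \<le> \<Phi> p' + \<Phi> q'"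
proof -
  have *: "\<Phi> p + \<Phi> q \<le> \<Phi> p' + \<Phi> q'" if s: "p + q = p' + q'" and le: "q \<le> p" "p \<le> p'" "q' \<le> q" for p q p' q'
  proof (cases "q' = p'")
    case False
    define t where "t = (p - q') / (p' - q')"
    have pos: "0 < p' - q'" using le False by linarith
    have t: "0 \<le> t" "t \<le> 1" using le pos by (auto simp: t_def)
    have "t * (p' - q') = p - q'" using pos by (simp add: t_def)
    then have p: "p = t * p' + (1 - t) * q'" by (simp add: algebra_simps)
    then have q: "q = (1 - t) * p' + t * q'" using s by (simp add: algebra_simps)
    have "\<Phi> p \<le> t * \<Phi> p' + (1 - t) * \<Phi> q'"
      unfolding p using convex_onD[OF c, of "1 - t" p' q'] t by simp
    moreover have "\<Phi> q \<le> (1 - t) * \<Phi> p' + t * \<Phi> q'"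
      unfolding q using convex_onD[OF c, of t p' q'] t by simp
    ultimately show ?thesis by (simp add: algebra_simps)
  next
    case True
    then have "p = p'" "q = q'" using le s by auto
    then show ?thesis by simp
  qed
  show ?thesis
  proof (cases "q \<le> p"; cases "q' \<le> p'")
    assume "q \<le> p" "q' \<le> p'" then show ?thesis using *[of p q p' q'] s d by simp
  next
    assume "q \<le> p" "\<not> q' \<le> p'" then show ?thesis using *[of p q q' p'] s d by simp
  next
    assume "\<not> q \<le> p" "q' \<le> p'" then show ?thesis using *[of q p p' q'] s d by simp
  next
    assume "\<not> q \<le> p" "\<not> q' \<le> p'" then show ?thesis using *[of q p q' p'] s d by simp
  qed
qed

context sphere_space
begin

lemma pol_pair: "h (pol v f x) + h (pol v f (refl_along v x)) = h (f x) + h (f (refl_along v x))" for h :: "real \<Rightarrow> real"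
proof (cases "v \<bullet> x = 0")
  case True
  then have "refl_along v x = x" by (simp add: refl_along_def inner_commute)
  then show ?thesis by (simp add: pol_def True)
qed (auto simp: pol_def inner_refl_self max_def min_def)

lemma pol_sum: "pol v f x + pol v f (refl_along v x) = f x + f (refl_along v x)"
  by (rule pol_pair[where h = "\<lambda>x. x"])

lemma pol_diff: "pol v f x - pol v f (refl_along v x) = (if 0 \<le> v \<bullet> x then \<bar>f x - f (refl_along v x)\<bar> else - \<bar>f x - f (refl_along v x)\<bar>)"
proof (cases "v \<bullet> x = 0")
  case True
  then have "refl_along v x = x" by (simp add: refl_along_def inner_commute)
  then show ?thesis by (simp add: pol_def True)
qed (auto simp: pol_def inner_refl_self max_def min_def)

definition lips :: "real \<Rightarrow> (real^'n \<Rightarrow> real) \<Rightarrow> bool" where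
  "lips L f \<longleftrightarrow> (\<forall>x\<in>S. \<forall>y\<in>S. \<bar>f x - f y\<bar> \<le> L * norm (x - y))"

lemma lips_continuous: "lips L f \<Longrightarrow> continuous_on S f"
proof -
  assume "lips L f"
  then have "\<bar>L\<bar>-lipschitz_on S f"
    by (intro lipschitz_onI) (fastforce simp: lips_def dist_norm intro: order_trans[OF _ mult_right_mono[OF abs_ge_self]])+
  then show ?thesis by (rule lipschitz_on_continuous_on)
qed

lemma norm_refl_diff: "norm (refl_along v x - refl_along v y) = norm (x - y)"
  by (metis norm_refl_along refl_along_diff)

lemma norm_refl_diff_swap: "norm (refl_along v x - y) = norm (x - refl_along v y)"
  by (metis norm_refl_along refl_along_diff refl_along_refl_along)

lemma norm_refl_closer:
  assumes "0 \<le> v \<bullet> x" "v \<bullet> y \<le> 0" shows "norm (x - refl_along v y) \<le> norm (x - y)"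
proof -
  have e: "x \<bullet> refl_along v y = x \<bullet> y - 2 * ((v \<bullet> x) * (v \<bullet> y)) / (v \<bullet> v)"
    by (simp add: refl_along_def inner_diff_right inner_commute[of y v] inner_commute[of x v])
  have "2 * ((v \<bullet> x) * (v \<bullet> y)) / (v \<bullet> v) \<le> 0"
    using assms by (intro divide_nonpos_nonneg) (auto simp: mult_nonneg_nonpos)
  then have "x \<bullet> y \<le> x \<bullet> refl_along v y" unfolding e by linarith
  then have "(norm (x - refl_along v y))\<^sup>2 \<le> (norm (x - y))\<^sup>2"
    unfolding power2_norm_eq_inner by (simp add: inner_diff_left inner_diff_right inner_commute)
  then show ?thesis by (simp add: power2_le_iff_abs_le)
qed

text \<open>Points on opposite sides of the hyperplane come closer when one of them is reflected, so
  crosswise differences of values satisfy the same bound as direct ones. That the constant is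
  unchanged keeps iterated polarizations equicontinuous.\<close>

lemma pol_lips:
  assumes f: "lips L f" and L: "0 \<le> L"
  shows "lips L (pol v f)"
  unfolding lips_def
proof (intro ballI)
  have F: "\<bar>f x - f y\<bar> \<le> L * norm (x - y)" if "x \<in> S" "y \<in> S" for x y using f that by (simp add: lips_def)
  have *: "\<bar>pol v f x - pol v f y\<bar> \<le> L * norm (x - y)" if x: "x \<in> S" and y: "y \<in> S" and vx: "0 \<le> v \<bullet> x" for x y
  proof -
    let ?x = "refl_along v x" and ?y = "refl_along v y"
    have x': "?x \<in> S" and y': "?y \<in> S" using x y by auto
    have 1: "\<bar>f x - f y\<bar> \<le> L * norm (x - y)" "\<bar>f ?x - f ?y\<bar> \<le> L * norm (x - y)"
      using F[OF x y] F[OF x' y'] by (auto simp: norm_refl_diff)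
    show ?thesis
    proof (cases "0 \<le> v \<bullet> y")
      case True
      then show ?thesis using 1 vx by (auto simp: pol_def max_def abs_le_iff)
    next
      case False
      have n: "L * norm (x - ?y) \<le> L * norm (x - y)" using norm_refl_closer[of v x y] vx False L by (intro mult_left_mono) auto
      have 2: "\<bar>f x - f ?y\<bar> \<le> L * norm (x - y)" "\<bar>f ?x - f y\<bar> \<le> L * norm (x - y)"
        using F[OF x y'] F[OF x' y] n by (auto simp: norm_refl_diff_swap)
      show ?thesis using 1 2 vx False by (auto simp: pol_def max_def min_def abs_le_iff)
    qed
  qed
  fix x y assume x: "x \<in> S" and y: "y \<in> S"
  consider "0 \<le> v \<bullet> x" | "0 \<le> v \<bullet> y" | "v \<bullet> x < 0" "v \<bullet> y < 0" by linarith
  then show "\<bar>pol v f x - pol v f y\<bar> \<le> L * norm (x - y)"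
  proof cases
    case 1 then show ?thesis using *[OF x y] by simp
  next
    case 2 then show ?thesis using *[OF y x] by (simp add: abs_minus_commute norm_minus_commute)
  next
    case 3
    let ?x = "refl_along v x" and ?y = "refl_along v y"
    have x': "?x \<in> S" and y': "?y \<in> S" using x y by auto
    have "\<bar>f x - f y\<bar> \<le> L * norm (x - y)" "\<bar>f ?x - f ?y\<bar> \<le> L * norm (x - y)"
      using F[OF x y] F[OF x' y'] by (auto simp: norm_refl_diff)
    then show ?thesis using 3 by (auto simp: pol_def min_def abs_le_iff)
  qed
qed

lemma pol_bounded: "(\<And>x. x \<in> S \<Longrightarrow> \<bar>f x\<bar> \<le> M) \<Longrightarrow> x \<in> S \<Longrightarrow> \<bar>pol v f x\<bar> \<le> M"
  using refl_along_S[of x v] by (auto simp: pol_def max_def min_def)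

lemma pol_equimeasurable:
  fixes h :: "real \<Rightarrow> real"
  assumes "integrable \<sigma> (\<lambda>x. h (f x))" "integrable \<sigma> (\<lambda>x. h (pol v f x))"
  shows "(\<integral>x. h (pol v f x) \<partial>\<sigma>) = (\<integral>x. h (f x) \<partial>\<sigma>)"
  unfolding integral_refl_sum[OF assms(1), of v] integral_refl_sum[OF assms(2), of v] pol_pair ..

text \<open>Polarization keeps the part of \<open>f\<close> that is even under the reflection. In
  the odd part, the kernel difference and the polarized difference change sign at the same
  hyperplane, so no cancellation is left and the spread of \<open>R s\<close> at mirror points can
  only grow. This is the input of \<open>convex_majorize\<close>.\<close>

lemma R_pol_pair:
  assumes s: "0 < s" and x: "x \<in> S" and f: "integrable \<sigma> f" and pf: "integrable \<sigma> (pol v f)"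
  shows "R s f x + R s f (refl_along v x) = R s (pol v f) x + R s (pol v f) (refl_along v x)"
    "\<bar>R s f x - R s f (refl_along v x)\<bar> \<le> \<bar>R s (pol v f) x - R s (pol v f) (refl_along v x)\<bar>"
proof -
  have x': "refl_along v x \<in> S" using x by simp
  let ?K = "\<lambda>y. poi s (x \<bullet> y) + poi s (refl_along v x \<bullet> y)"
  let ?D = "\<lambda>y. poi s (x \<bullet> y) - poi s (refl_along v x \<bullet> y)"
  have sum: "R s g x + R s g (refl_along v x) = (\<integral>y. ?K y * (g y + g (refl_along v y)) \<partial>\<sigma>) / (2 * V)" if g: "integrable \<sigma> g" for g
  proof -
    have i: "integrable \<sigma> (\<lambda>y. ?K y * g y)"
      unfolding distrib_right using integrable_poi_mult[OF s x g] integrable_poi_mult[OF s x' g] by simp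
    have "R s g x + R s g (refl_along v x) = (\<integral>y. ?K y * g y \<partial>\<sigma>) / V"
      unfolding R_def distrib_right using integrable_poi_mult[OF s x g] integrable_poi_mult[OF s x' g]
      by (simp add: add_divide_distrib)
    also have "(\<integral>y. ?K y * g y \<partial>\<sigma>) = (\<integral>y. ?K y * g y + ?K (refl_along v y) * g (refl_along v y) \<partial>\<sigma>) / 2" by (rule integral_refl_sum[OF i])
    also have "(\<lambda>y. ?K y * g y + ?K (refl_along v y) * g (refl_along v y)) = (\<lambda>y. ?K y * (g y + g (refl_along v y)))"
      by (rule ext) (simp add: refl_along_inner_swap[of v x] algebra_simps)
    finally show ?thesis by simp
  qed
  show "R s f x + R s f (refl_along v x) = R s (pol v f) x + R s (pol v f) (refl_along v x)"
    unfolding sum[OF f] sum[OF pf] pol_sum ..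
  let ?I = "\<integral>y. ?D y * (f y - f (refl_along v y)) \<partial>\<sigma>" and ?J = "\<integral>y. ?D y * (pol v f y - pol v f (refl_along v y)) \<partial>\<sigma>"
  have pw: "\<bar>?D y * (f y - f (refl_along v y))\<bar> = (if 0 \<le> v \<bullet> x then 1 else - 1) * (?D y * (pol v f y - pol v f (refl_along v y)))" if y: "y \<in> S" for y
  proof -
    have p: "0 \<le> ?D y" if "0 \<le> (v \<bullet> x) * (v \<bullet> y)" using poi_refl_sign(1)[OF s x y that] by simp
    have q: "?D y \<le> 0" if "(v \<bullet> x) * (v \<bullet> y) \<le> 0" using poi_refl_sign(2)[OF s x y that] by simp
    have "\<bar>?D y\<bar> = (if 0 \<le> v \<bullet> x then 1 else - 1) * (?D y * (if 0 \<le> v \<bullet> y then 1 else - 1))"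
      using p q by (cases "0 \<le> v \<bullet> x"; cases "0 \<le> v \<bullet> y")
        (simp_all add: mult_nonneg_nonpos mult_nonpos_nonneg mult_nonpos_nonpos)
    then have "\<bar>?D y\<bar> * \<bar>f y - f (refl_along v y)\<bar> = (if 0 \<le> v \<bullet> x then 1 else - 1) * (?D y * ((if 0 \<le> v \<bullet> y then 1 else - 1) * \<bar>f y - f (refl_along v y)\<bar>))"
      by (simp only: mult.assoc)
    then show ?thesis
      unfolding pol_diff abs_mult by (cases "0 \<le> v \<bullet> y") simp_all
  qed
  have "\<bar>?I\<bar> \<le> (\<integral>y. \<bar>?D y * (f y - f (refl_along v y))\<bar> \<partial>\<sigma>)" by (rule integral_abs_bound)
  also have "\<dots> = (\<integral>y. (if 0 \<le> v \<bullet> x then 1 else - 1) * (?D y * (pol v f y - pol v f (refl_along v y))) \<partial>\<sigma>)"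
    by (rule Bochner_Integration.integral_cong[OF refl]) (use pw in simp)
  also have "\<dots> = (if 0 \<le> v \<bullet> x then 1 else - 1) * ?J" by simp
  also have "\<dots> \<le> \<bar>?J\<bar>" using abs_ge_self[of ?J] abs_ge_minus_self[of ?J] by (simp only: mult_1 mult_minus1 split: if_split) simp
  finally have "\<bar>?I\<bar> \<le> \<bar>?J\<bar>" .
  then show "\<bar>R s f x - R s f (refl_along v x)\<bar> \<le> \<bar>R s (pol v f) x - R s (pol v f) (refl_along v x)\<bar>"
    unfolding R_refl_diff[OF s x f] R_refl_diff[OF s x pf] using V_pos by (simp add: abs_divide divide_right_mono)
qed

lemma convex_isCont: "convex_on UNIV \<Phi> \<Longrightarrow> continuous_on UNIV \<Phi>" for \<Phi> :: "real \<Rightarrow> real"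
  using convex_on_continuous[of UNIV \<Phi>] by simp

lemma integrable_cont_comp:
  fixes \<Phi> :: "real \<Rightarrow> real"
  assumes c: "continuous_on UNIV \<Phi>" and f: "f \<in> borel_measurable \<sigma>" "\<And>x. x \<in> S \<Longrightarrow> \<bar>f x\<bar> \<le> M"
  shows "integrable \<sigma> (\<lambda>x. \<Phi> (f x))"
proof -
  have "compact (\<Phi> ` {- M..M})" by (intro compact_continuous_image continuous_on_subset[OF c]) auto
  then have "bounded (\<Phi> ` {- M..M})" by (rule compact_imp_bounded)
  then obtain B where B: "\<And>u. u \<in> \<Phi> ` {- M..M} \<Longrightarrow> norm u \<le> B" unfolding bounded_iff by blast
  have "\<bar>\<Phi> (f x)\<bar> \<le> B" if "x \<in> S" for x
    using B[of "\<Phi> (f x)"] f(2)[OF that] by (auto simp: abs_le_iff)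
  moreover have "(\<lambda>x. \<Phi> (f x)) \<in> borel_measurable \<sigma>"
    using borel_measurable_continuous_onI[OF c] f(1) by (rule measurable_compose_rev)
  ultimately show ?thesis by (intro integrable_bounded)
qed

lemma R_abs_bound:
  assumes s: "0 < s" and x: "x \<in> S" and f: "f \<in> borel_measurable \<sigma>" "\<And>x. x \<in> S \<Longrightarrow> \<bar>f x\<bar> \<le> M"
  shows "\<bar>R s f x\<bar> \<le> M"
proof -
  have fi: "integrable \<sigma> f" by (rule integrable_bounded[OF f])
  have M: "0 \<le> M" using f(2)[OF x] by simp
  have ex: "exp (- a * s) \<le> 1" using a_pos s by simp
  have u: "R s f x \<le> M * exp (- a * s)"
    by (rule R_le_const[OF s x fi]) (use f(2) in \<open>auto simp: abs_le_iff\<close>)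
  have "R s (\<lambda>_. - M) x \<le> R s f x"
  proof (rule R_mono[OF s x _ fi])
    have "- M \<le> f y" if "y \<in> S" for y using f(2)[OF that] by linarith
    then show "AE y in \<sigma>. - M \<le> f y" by (intro AE_I2) simp
  qed simp
  then have l: "- M * exp (- a * s) \<le> R s f x" using R_const[OF s x, of "- M"] by simp
  have "M * exp (- a * s) \<le> M" using M ex by (rule mult_left_le[rotated])
  then show ?thesis using u l by (simp add: abs_le_iff)
qed

lemma R_pol_convex:
  assumes s: "0 < s" and f: "continuous_on S f" and pf: "continuous_on S (pol v f)" and c: "convex_on UNIV \<Phi>"
    and M: "\<And>x. x \<in> S \<Longrightarrow> \<bar>f x\<bar> \<le> M"
  shows "(\<integral>x. \<Phi> (R s f x) \<partial>\<sigma>) \<le> (\<integral>x. \<Phi> (R s (pol v f) x) \<partial>\<sigma>)"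
proof -
  note fm = measurable_continuous_on_S[OF f] and pm = measurable_continuous_on_S[OF pf]
  have fi: "integrable \<sigma> f" "integrable \<sigma> (pol v f)" using f pf integrable_continuous_on_S by auto
  have i1: "integrable \<sigma> (\<lambda>x. \<Phi> (R s f x))"
    by (rule integrable_cont_comp[OF convex_isCont[OF c] R_measurable[OF fm], where M = M]) (rule R_abs_bound[OF s _ fm M])
  have i2: "integrable \<sigma> (\<lambda>x. \<Phi> (R s (pol v f) x))"
    by (rule integrable_cont_comp[OF convex_isCont[OF c] R_measurable[OF pm], where M = M])
       (rule R_abs_bound[OF s _ pm pol_bounded[of f M, OF M]])
  have "(\<integral>x. \<Phi> (R s f x) + \<Phi> (R s f (refl_along v x)) \<partial>\<sigma>) \<le> (\<integral>x. \<Phi> (R s (pol v f) x) + \<Phi> (R s (pol v f) (refl_along v x)) \<partial>\<sigma>)"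
  proof (rule integral_mono)
    show "integrable \<sigma> (\<lambda>x. \<Phi> (R s f x) + \<Phi> (R s f (refl_along v x)))"
      using i1 integrable_orth[OF orthogonal_refl_along i1] by simp
    show "integrable \<sigma> (\<lambda>x. \<Phi> (R s (pol v f) x) + \<Phi> (R s (pol v f) (refl_along v x)))"
      using i2 integrable_orth[OF orthogonal_refl_along i2] by simp
    fix x assume "x \<in> space \<sigma>"
    then have x: "x \<in> S" by simp
    show "\<Phi> (R s f x) + \<Phi> (R s f (refl_along v x)) \<le> \<Phi> (R s (pol v f) x) + \<Phi> (R s (pol v f) (refl_along v x))"
      by (rule convex_majorize[OF c R_pol_pair[OF s x fi]])
  qed
  then show ?thesis
    unfolding integral_refl_sum[OF i1, of v] integral_refl_sum[OF i2, of v] by simp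
qed

lemma continuous_nonneg_zero:
  assumes f: "continuous_on S f" "\<And>x. x \<in> S \<Longrightarrow> 0 \<le> f x" and I: "(\<integral>x. f x \<partial>\<sigma>) \<le> 0" and x: "x \<in> S"
  shows "f x = (0::real)"
proof (rule ccontr)
  assume "f x \<noteq> 0"
  then have px: "0 < f x" using f(2)[OF x] by simp
  have fi: "integrable \<sigma> f" by (rule integrable_continuous_on_S[OF f(1)])
  have nn: "AE x in \<sigma>. 0 \<le> f x" by (rule AE_I2) (use f(2) in simp)
  have "(\<integral>x. f x \<partial>\<sigma>) = 0" using I integral_nonneg_AE[OF nn] by linarith
  then have ae: "AE x in \<sigma>. f x = 0"
    using integral_nonneg_eq_0_iff_AE[OF fi nn] by simp
  obtain d where d: "0 < d" "\<And>y. y \<in> S \<Longrightarrow> dist y x < d \<Longrightarrow> dist (f y) (f x) < f x"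
    using f(1) x px unfolding continuous_on_iff by blast
  obtain y where "y \<in> S" "dist x y < d" "f y = 0" by (rule AE_open_nonempty[OF ae x d(1)])
  then show False using d(2)[of y] px by (simp add: dist_commute dist_real_def)
qed

text \<open>Among the functions that arise from \<open>p\<close> by polarizations and uniform limits, one that
  maximises the integral against \<open>x \<bullet> e\<close> is unchanged by every polarization towards \<open>e\<close>.\<close>

definition dominates :: "(real^'n \<Rightarrow> real) \<Rightarrow> (real^'n \<Rightarrow> real) \<Rightarrow> bool" where
  "dominates p f \<longleftrightarrow> (\<forall>h :: real \<Rightarrow> real. continuous_on UNIV h \<longrightarrow> (\<integral>x. h (f x) \<partial>\<sigma>) = (\<integral>x. h (p x) \<partial>\<sigma>)) \<and>
     (\<forall>s. \<forall>\<Phi> :: real \<Rightarrow> real. 0 < s \<longrightarrow> convex_on UNIV \<Phi> \<longrightarrow> (\<integral>x. \<Phi> (R s p x) \<partial>\<sigma>) \<le> (\<integral>x. \<Phi> (R s f x) \<partial>\<sigma>))"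

lemma rearrangement_exists:
  assumes e: "e \<in> S" and p: "lips L p" and L: "0 \<le> L" and M: "\<And>x. x \<in> S \<Longrightarrow> \<bar>p x\<bar> \<le> M"
  obtains f where "lips L f" "\<And>x. x \<in> S \<Longrightarrow> \<bar>f x\<bar> \<le> M" "zdec e f" "dominates p f"
proof -
  define \<O> where "\<O> = {f. lips L f \<and> (\<forall>x\<in>S. \<bar>f x\<bar> \<le> M) \<and> dominates p f}"
  define \<Xi> where "\<Xi> f = (\<integral>x. f x * (x \<bullet> e) \<partial>\<sigma>)" for f
  have M0: "0 \<le> M" using M[OF e] by simp
  have O: "continuous_on S f" "lips L f" "\<And>x. x \<in> S \<Longrightarrow> \<bar>f x\<bar> \<le> M" "dominates p f" if "f \<in> \<O>" for f
    using that lips_continuous by (auto simp: \<O>_def)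
  have ie: "integrable \<sigma> (\<lambda>x. f x * (x \<bullet> e))" if "continuous_on S f" for f
    by (intro integrable_continuous_on_S continuous_intros that)
  have pO: "p \<in> \<O>" using p M by (simp add: \<O>_def dominates_def)
  have polO: "pol v f \<in> \<O>" if f: "f \<in> \<O>" for v f
  proof -
    have l: "lips L (pol v f)" by (rule pol_lips[OF O(2)[OF f] L])
    have b: "\<bar>pol v f x\<bar> \<le> M" if "x \<in> S" for x by (rule pol_bounded[of f M, OF O(3)[OF f] that])
    have pc: "continuous_on S (pol v f)" by (rule lips_continuous[OF l])
    have "dominates p (pol v f)"
      unfolding dominates_def
    proof (intro conjI allI impI)
      fix h :: "real \<Rightarrow> real" assume h: "continuous_on UNIV h"
      have "(\<integral>x. h (pol v f x) \<partial>\<sigma>) = (\<integral>x. h (f x) \<partial>\<sigma>)"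
        by (rule pol_equimeasurable) (rule integrable_cont_comp[OF h measurable_continuous_on_S[OF O(1)[OF f]] O(3)[OF f]]
            integrable_cont_comp[OF h measurable_continuous_on_S[OF pc] b], assumption)+
      then show "(\<integral>x. h (pol v f x) \<partial>\<sigma>) = (\<integral>x. h (p x) \<partial>\<sigma>)" using O(4)[OF f] h by (simp add: dominates_def)
    next
      fix s \<Phi> assume s: "0 < (s::real)" and c: "convex_on UNIV (\<Phi>::real \<Rightarrow> real)"
      have "(\<integral>x. \<Phi> (R s p x) \<partial>\<sigma>) \<le> (\<integral>x. \<Phi> (R s f x) \<partial>\<sigma>)" using O(4)[OF f] s c by (simp add: dominates_def)
      also have "\<dots> \<le> (\<integral>x. \<Phi> (R s (pol v f) x) \<partial>\<sigma>)"
        by (rule R_pol_convex[OF s O(1)[OF f] pc c O(3)[OF f]])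
      finally show "(\<integral>x. \<Phi> (R s p x) \<partial>\<sigma>) \<le> (\<integral>x. \<Phi> (R s (pol v f) x) \<partial>\<sigma>)" .
    qed
    then show ?thesis using l b by (simp add: \<O>_def)
  qed
  have Xb: "\<Xi> f \<le> M * V" if f: "f \<in> \<O>" for f
  proof -
    have "\<Xi> f \<le> (\<integral>x. M \<partial>\<sigma>)"
      unfolding \<Xi>_def
    proof (rule integral_mono[OF ie[OF O(1)[OF f]]])
      fix x assume "x \<in> space \<sigma>"
      then have x: "x \<in> S" by simp
      have "\<bar>f x * (x \<bullet> e)\<bar> \<le> M * 1" unfolding abs_mult
        by (intro mult_mono O(3)[OF f x] abs_inner_le_1[OF x e]) (use M0 in auto)
      then show "f x * (x \<bullet> e) \<le> M" by (simp add: abs_le_iff)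
    qed simp
    then show ?thesis by (simp add: V_def mult.commute)
  qed
  define m where "m = (SUP f\<in>\<O>. \<Xi> f)"
  have bdd: "bdd_above (\<Xi> ` \<O>)" by (rule bdd_aboveI2[OF Xb])
  have "\<exists>f. f \<in> \<O> \<and> m - 1 / real (Suc n) < \<Xi> f" for n
  proof -
    have "m - 1 / real (Suc n) < (SUP f\<in>\<O>. \<Xi> f)" unfolding m_def by simp
    then show ?thesis using less_cSUP_iff[of \<O> \<Xi>] bdd pO by (metis empty_iff)
  qed
  then obtain F where F: "\<And>n. F n \<in> \<O>" "\<And>n. m - 1 / real (Suc n) < \<Xi> (F n)" by metis
  have bnd: "norm (F n x) \<le> M" if "x \<in> S" for n x using O(3)[OF F(1) that] by simp
  have eqc: "\<exists>d. 0 < d \<and> (\<forall>n y. y \<in> S \<and> norm (x - y) < d \<longrightarrow> norm (F n x - F n y) < \<epsilon>)" if "x \<in> S" "0 < \<epsilon>" for x \<epsilon>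
  proof (intro exI conjI allI impI)
    show "0 < \<epsilon> / (L + 1)" using that L by simp
    fix n y assume y: "y \<in> S \<and> norm (x - y) < \<epsilon> / (L + 1)"
    have "\<bar>F n x - F n y\<bar> \<le> L * norm (x - y)" using O(2)[OF F(1)] that y by (simp add: lips_def)
    also have "\<dots> \<le> (L + 1) * norm (x - y)" using L by (intro mult_right_mono) auto
    also have "\<dots> < \<epsilon>" using y L by (simp add: field_simps)
    finally show "norm (F n x - F n y) < \<epsilon>" by simp
  qed
  \<comment> \<open>All members share \<open>L\<close> and \<open>M\<close>, so a maximising
    sequence is bounded and equicontinuous and has a uniformly convergent subsequence.\<close>
  obtain g r where g: "continuous_on S g" "strict_mono (r :: nat \<Rightarrow> nat)"
    "\<And>\<epsilon>. 0 < \<epsilon> \<Longrightarrow> \<exists>N. \<forall>n x. n \<ge> N \<and> x \<in> S \<longrightarrow> norm (F (r n) x - g x) < \<epsilon>"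
    using Arzela_Ascoli[of S F M, OF compact_sphere bnd eqc] by blast
  have pt: "(\<lambda>n. F (r n) x) \<longlonglongrightarrow> g x" if "x \<in> S" for x
    unfolding LIMSEQ_iff using g(3) that by meson
  have gl: "lips L g"
    unfolding lips_def
  proof (intro ballI)
    fix x y assume x: "x \<in> S" and y: "y \<in> S"
    have "(\<lambda>n. \<bar>F (r n) x - F (r n) y\<bar>) \<longlonglongrightarrow> \<bar>g x - g y\<bar>" by (intro tendsto_intros pt x y)
    then show "\<bar>g x - g y\<bar> \<le> L * norm (x - y)"
      by (rule LIMSEQ_le_const2) (use O(2)[OF F(1)] x y in \<open>auto simp: lips_def\<close>)
  qed
  have gb: "\<bar>g x\<bar> \<le> M" if x: "x \<in> S" for x
  proof -
    have "(\<lambda>n. \<bar>F (r n) x\<bar>) \<longlonglongrightarrow> \<bar>g x\<bar>" by (intro tendsto_intros pt x)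
    then show ?thesis by (rule LIMSEQ_le_const2) (use O(3)[OF F(1) x] in auto)
  qed
  note Fm = measurable_continuous_on_S[OF O(1)[OF F(1)]] and gm = measurable_continuous_on_S[OF g(1)]
  have hlim: "(\<lambda>n. \<integral>x. h (G n x) \<partial>\<sigma>) \<longlonglongrightarrow> (\<integral>x. h (H x) \<partial>\<sigma>)"
    if h: "continuous_on UNIV h" and G: "\<And>n. G n \<in> borel_measurable \<sigma>" "\<And>n x. x \<in> S \<Longrightarrow> \<bar>G n x\<bar> \<le> M"
      and H: "H \<in> borel_measurable \<sigma>" "\<And>x. x \<in> S \<Longrightarrow> (\<lambda>n. G n x) \<longlonglongrightarrow> H x"
    for h :: "real \<Rightarrow> real" and G H
  proof -
    have "compact (h ` {- M..M})" by (intro compact_continuous_image continuous_on_subset[OF h]) auto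
    then have "bounded (h ` {- M..M})" by (rule compact_imp_bounded)
    then obtain B where B: "\<And>u. u \<in> h ` {- M..M} \<Longrightarrow> norm u \<le> B" unfolding bounded_iff by blast
    have hm: "h \<in> borel_measurable borel" by (rule borel_measurable_continuous_onI[OF h])
    show ?thesis
    proof (rule integral_dominated_convergence[where w = "\<lambda>_. B"])
      show "(\<lambda>x. h (H x)) \<in> borel_measurable \<sigma>" by (rule measurable_compose[OF H(1) hm])
      show "(\<lambda>x. h (G n x)) \<in> borel_measurable \<sigma>" for n by (rule measurable_compose[OF G(1) hm])
      show "AE x in \<sigma>. (\<lambda>n. h (G n x)) \<longlonglongrightarrow> h (H x)"
        by (rule AE_I2) (use h H(2) in \<open>auto intro!: isCont_tendsto_compose[of _ h] simp: continuous_on_eq_continuous_at\<close>)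
      show "AE x in \<sigma>. norm (h (G n x)) \<le> B" for n
      proof (rule AE_I2, rule B, rule imageI)
        fix x assume "x \<in> space \<sigma>"
        then show "G n x \<in> {- M..M}" using G(2)[of x n] by (simp add: abs_le_iff minus_le_iff)
      qed
    qed simp
  qed
  have Rlim: "(\<lambda>n. R s (F (r n)) x) \<longlonglongrightarrow> R s g x" if s: "0 < s" and x: "x \<in> S" for s x
  proof -
    obtain B where B: "\<And>u. \<bar>u\<bar> \<le> 1 \<Longrightarrow> \<bar>poi s u\<bar> \<le> B" using poi_bounded[OF s] by blast
    have "(\<lambda>n. \<integral>y. poi s (x \<bullet> y) * F (r n) y \<partial>\<sigma>) \<longlonglongrightarrow> (\<integral>y. poi s (x \<bullet> y) * g y \<partial>\<sigma>)"
    proof (rule integral_dominated_convergence[where w = "\<lambda>_. B * M"])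
      show "AE y in \<sigma>. (\<lambda>n. poi s (x \<bullet> y) * F (r n) y) \<longlonglongrightarrow> poi s (x \<bullet> y) * g y"
        by (rule AE_I2) (auto intro!: tendsto_mult_left pt)
      show "AE y in \<sigma>. norm (poi s (x \<bullet> y) * F (r n) y) \<le> B * M" for n
        by (rule AE_I2, unfold real_norm_def abs_mult)
           (use B abs_inner_le_1[OF x] O(3)[OF F(1)] order_trans[OF abs_ge_zero B[of 0]] in \<open>auto intro!: mult_mono\<close>)
      have [measurable]: "(\<lambda>y. poi s (x \<bullet> y)) \<in> borel_measurable \<sigma>" by measurable
      show "(\<lambda>y. poi s (x \<bullet> y) * g y) \<in> borel_measurable \<sigma>" by (intro borel_measurable_times gm) measurable
      show "(\<lambda>y. poi s (x \<bullet> y) * F (r n) y) \<in> borel_measurable \<sigma>" for n by (intro borel_measurable_times Fm) measurable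
    qed simp
    then show ?thesis unfolding R_def using V_pos by (intro tendsto_divide tendsto_const) auto
  qed
  have "dominates p g"
    unfolding dominates_def
  proof (intro conjI allI impI)
    fix h :: "real \<Rightarrow> real" assume h: "continuous_on UNIV h"
    have "(\<lambda>n. \<integral>x. h (F (r n) x) \<partial>\<sigma>) \<longlonglongrightarrow> (\<integral>x. h (g x) \<partial>\<sigma>)"
      by (rule hlim[OF h Fm O(3)[OF F(1)] gm pt])
    moreover have "(\<integral>x. h (F (r n) x) \<partial>\<sigma>) = (\<integral>x. h (p x) \<partial>\<sigma>)" for n
      using O(4)[OF F(1)] h by (simp add: dominates_def)
    ultimately show "(\<integral>x. h (g x) \<partial>\<sigma>) = (\<integral>x. h (p x) \<partial>\<sigma>)" using LIMSEQ_unique[OF _ tendsto_const] by force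
  next
    fix s \<Phi> assume s: "0 < (s::real)" and c: "convex_on UNIV (\<Phi>::real \<Rightarrow> real)"
    have "(\<lambda>n. \<integral>x. \<Phi> (R s (F (r n)) x) \<partial>\<sigma>) \<longlonglongrightarrow> (\<integral>x. \<Phi> (R s g x) \<partial>\<sigma>)"
      by (rule hlim[OF convex_isCont[OF c] R_measurable[OF Fm] R_abs_bound[OF s _ Fm O(3)[OF F(1)]] R_measurable[OF gm] Rlim[OF s]])
    then show "(\<integral>x. \<Phi> (R s p x) \<partial>\<sigma>) \<le> (\<integral>x. \<Phi> (R s g x) \<partial>\<sigma>)"
      by (rule LIMSEQ_le_const) (use O(4)[OF F(1)] s c in \<open>auto simp: dominates_def\<close>)
  qed
  then have gO: "g \<in> \<O>" using gl gb by (simp add: \<O>_def)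
  have "(\<lambda>n. \<Xi> (F (r n))) \<longlonglongrightarrow> \<Xi> g"
    unfolding \<Xi>_def
  proof (rule integral_dominated_convergence[where w = "\<lambda>_. M * 1"])
    show "(\<lambda>x. g x * (x \<bullet> e)) \<in> borel_measurable \<sigma>" "(\<lambda>x. F (r n) x * (x \<bullet> e)) \<in> borel_measurable \<sigma>" for n
      by (intro borel_measurable_times gm Fm, measurable)+
    show "AE x in \<sigma>. (\<lambda>n. F (r n) x * (x \<bullet> e)) \<longlonglongrightarrow> g x * (x \<bullet> e)"
      by (rule AE_I2) (auto intro!: tendsto_mult_right pt)
    show "AE x in \<sigma>. norm (F (r n) x * (x \<bullet> e)) \<le> M * 1" for n
      by (rule AE_I2, unfold real_norm_def abs_mult)
         (use M0 abs_inner_le_1[OF _ e] O(3)[OF F(1)] in \<open>auto intro!: mult_mono simp del: mult_1_right\<close>)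
  qed simp
  moreover have "m - 1 / real (Suc n) \<le> \<Xi> (F (r n))" for n
  proof -
    have "1 / real (Suc (r n)) \<le> 1 / real (Suc n)" using seq_suble[OF g(2), of n] by (intro divide_left_mono) auto
    then show ?thesis using F(2)[of "r n"] by linarith
  qed
  moreover have "(\<lambda>n. m - 1 / real (Suc n)) \<longlonglongrightarrow> m - 0"
    by (intro tendsto_intros LIMSEQ_Suc[OF lim_1_over_n])
  ultimately have mg: "m \<le> \<Xi> g" using LIMSEQ_le[of "\<lambda>n. m - 1 / real (Suc n)" m "\<lambda>n. \<Xi> (F (r n))"] by auto
  have max: "\<Xi> f \<le> \<Xi> g" if "f \<in> \<O>" for f
    using cSUP_upper[OF that bdd] mg unfolding m_def by linarith
  have key: "g (refl_along v x) \<le> g x" if ve: "0 < v \<bullet> e" and x: "x \<in> S" and vx: "0 < v \<bullet> x" for v x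
  proof -
    \<comment> \<open>The change under polarization is odd under the reflection and has the sign of
      \<open>v \<bullet> x\<close>. Pairing mirror points writes the gain of \<open>\<Xi>\<close> as
      the integral of a nonnegative continuous function, which must vanish because \<open>g\<close>
      is maximal.\<close>
    define d where "d x = pol v g x - g x" for x
    have pc: "continuous_on S (pol v g)" by (rule O(1)[OF polO[OF gO]])
    have dr: "d (refl_along v x) = - d x" for x using pol_sum[of v g x] by (simp add: d_def)
    have dnn: "0 \<le> d x * (v \<bullet> x)" for x
      by (cases "0 \<le> v \<bullet> x") (auto simp: d_def pol_def max_def min_def mult_nonpos_nonpos)
    have w: "x \<bullet> e - refl_along v x \<bullet> e = 2 * (v \<bullet> x) * (v \<bullet> e) / (v \<bullet> v)" for x
      by (simp add: refl_along_def inner_diff_left inner_commute[of x v])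
    define q where "q x = 2 * (v \<bullet> e) / (v \<bullet> v) * (d x * (v \<bullet> x))" for x
    have di: "integrable \<sigma> (\<lambda>x. d x * (x \<bullet> e))"
      unfolding d_def by (intro integrable_continuous_on_S continuous_intros pc g)
    have "\<Xi> (pol v g) - \<Xi> g = (\<integral>x. d x * (x \<bullet> e) \<partial>\<sigma>)"
      unfolding \<Xi>_def d_def left_diff_distrib using ie[OF pc] ie[OF g(1)] by simp
    also have "\<dots> = (\<integral>x. d x * (x \<bullet> e) + d (refl_along v x) * (refl_along v x \<bullet> e) \<partial>\<sigma>) / 2"
      by (rule integral_refl_sum[OF di])
    also have "(\<lambda>x. d x * (x \<bullet> e) + d (refl_along v x) * (refl_along v x \<bullet> e)) = (\<lambda>x. d x * (x \<bullet> e - refl_along v x \<bullet> e))"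
      by (simp add: dr algebra_simps fun_eq_iff)
    also have "\<dots> = q" unfolding w q_def by (simp add: fun_eq_iff)
    finally have "(\<integral>x. q x \<partial>\<sigma>) \<le> 0" using max[OF polO[OF gO, of v]] by simp
    moreover have "continuous_on S q" unfolding q_def d_def by (intro continuous_intros pc g)
    moreover have "0 \<le> q x" for x unfolding q_def by (intro mult_nonneg_nonneg[OF divide_nonneg_nonneg dnn]) (use ve in auto)
    ultimately have "q x = 0" using continuous_nonneg_zero x by blast
    moreover have "v \<noteq> 0" using ve by auto
    ultimately have "d x = 0" using ve vx by (auto simp: q_def)
    then show ?thesis using vx by (simp add: d_def pol_def)
  qed
  have "zdec e g"
    unfolding zdec_def
  proof (intro ballI impI)
    fix x y assume x: "x \<in> S" and y: "y \<in> S" and le: "x \<bullet> e \<le> y \<bullet> e"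
    show "g x \<le> g y"
    proof (cases "x = y")
      case False
      \<comment> \<open>The bisector of \<open>x\<close> and \<open>y\<close> has normal
        \<open>y - x\<close>, which is orthogonal to \<open>e\<close> if both heights agree, whereas
        \<open>key\<close> needs a strictly positive product. The normal is tilted slightly towards
        \<open>e\<close>, and continuity of \<open>g\<close> gives the limit.\<close>
      define v where "v n = (y - x) + (1 / real (Suc n)) *\<^sub>R e" for n
      have vl: "v \<longlonglongrightarrow> y - x"
        using tendsto_add[OF tendsto_const[of "y - x"] tendsto_scaleR[OF LIMSEQ_Suc[OF lim_1_over_n] tendsto_const[of e]]]
        by (simp add: v_def[abs_def])
      have ve: "0 < v n \<bullet> e" for n
        using le e by (simp add: v_def inner_add_left inner_diff_left norm_eq_1 add_nonneg_pos)
      have "(y - x) \<bullet> y = 1 - x \<bullet> y" using y by (simp add: inner_diff_left norm_eq_1)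
      then have "0 < (y - x) \<bullet> y" using inner_less_1[OF x y False] by simp
      moreover have "(\<lambda>n. v n \<bullet> y) \<longlonglongrightarrow> (y - x) \<bullet> y" by (intro tendsto_intros vl)
      ultimately have ev: "\<forall>\<^sub>F n in sequentially. 0 < v n \<bullet> y" by (rule order_tendstoD(1)[rotated])
      have "(\<lambda>n. refl_along (v n) y) \<longlonglongrightarrow> refl_along (y - x) y"
        unfolding refl_along_def using False by (intro tendsto_intros vl) auto
      also have "refl_along (y - x) y = x" by (rule refl_along_swap) (use x y in simp)
      finally have rl: "(\<lambda>n. refl_along (v n) y) \<longlonglongrightarrow> x" .
      have "(\<lambda>n. g (refl_along (v n) y)) \<longlonglongrightarrow> g x"
        by (rule continuous_on_tendsto_compose[OF g(1) rl x]) (use y in auto)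
      then show "g x \<le> g y"
        by (rule tendsto_upperbound) (use ev key[OF ve y] in \<open>auto elim!: eventually_mono\<close>)
    qed simp
  qed
  then show thesis using that gO O(2,3,4)[OF gO] by blast
qed


subsection \<open>Comparison with the potential that is constant on a cap\<close>

lemma dominatesD1:
  fixes h :: "real \<Rightarrow> real"
  shows "dominates p f \<Longrightarrow> continuous_on UNIV h \<Longrightarrow> (\<integral>x. h (f x) \<partial>\<sigma>) = (\<integral>x. h (p x) \<partial>\<sigma>)"
  by (simp add: dominates_def)

lemma dominatesD2:
  fixes \<Phi> :: "real \<Rightarrow> real"
  shows "dominates p f \<Longrightarrow> 0 < s \<Longrightarrow> convex_on UNIV \<Phi> \<Longrightarrow> (\<integral>x. \<Phi> (R s p x) \<partial>\<sigma>) \<le> (\<integral>x. \<Phi> (R s f x) \<partial>\<sigma>)"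
  by (simp add: dominates_def)

lemma integral_nonpos_S:
  fixes f :: "real^'n \<Rightarrow> real"
  assumes "\<And>x. x \<in> S \<Longrightarrow> f x \<le> 0" shows "(\<integral>x. f x \<partial>\<sigma>) \<le> 0"
proof -
  have "AE x in \<sigma>. 0 \<le> - f x" by (rule AE_I2) (use assms in simp)
  from integral_nonneg_AE[OF this] show ?thesis by simp
qed

lemma cap_integral_continuous:
  fixes g :: "real^'n \<Rightarrow> real"
  assumes e: "e \<in> S" and g: "integrable \<sigma> g"
  shows "isCont (\<lambda>s. \<integral>x. (if s < x \<bullet> e then g x else 0) \<partial>\<sigma>) s"
  unfolding continuous_at_sequentially o_def
proof (intro allI impI)
  fix X assume X: "X \<longlonglongrightarrow> s"
  note [measurable] = borel_measurable_integrable[OF g]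
  show "(\<lambda>n. \<integral>x. (if X n < x \<bullet> e then g x else 0) \<partial>\<sigma>) \<longlonglongrightarrow> (\<integral>x. (if s < x \<bullet> e then g x else 0) \<partial>\<sigma>)"
  proof (rule integral_dominated_convergence[where w = "\<lambda>x. \<bar>g x\<bar>"])
    show "AE x in \<sigma>. (\<lambda>n. if X n < x \<bullet> e then g x else 0) \<longlonglongrightarrow> (if s < x \<bullet> e then g x else 0)"
      using AE_ring_S[OF e, of s]
    proof eventually_elim
      case (elim x)
      have "\<forall>\<^sub>F n in sequentially. (if X n < x \<bullet> e then g x else 0) = (if s < x \<bullet> e then g x else 0)"
      proof (cases "s < x \<bullet> e")
        case True
        from order_tendstoD(2)[OF X this] show ?thesis by eventually_elim (use True in simp)
      next
        case False
        then have "x \<bullet> e < s" using elim by simp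
        from order_tendstoD(1)[OF X this] show ?thesis by eventually_elim (use False in simp)
      qed
      then show ?case by (rule tendsto_eventually)
    qed
  qed (use g in auto)
qed

lemma zdec_threshold:
  assumes z: "zdec e h" and b: "\<And>x. x \<in> S \<Longrightarrow> \<bar>h x\<bar> \<le> M" and x0: "x0 \<in> S" "s < x0 \<bullet> e"
  obtains \<rho> where "\<And>x. x \<in> S \<Longrightarrow> s < x \<bullet> e \<Longrightarrow> \<rho> \<le> h x" "\<And>x. x \<in> S \<Longrightarrow> \<not> s < x \<bullet> e \<Longrightarrow> h x \<le> \<rho>"
proof
  let ?A = "{x \<in> S. s < x \<bullet> e}"
  have ne: "?A \<noteq> {}" using x0 by auto
  have bd: "bdd_below (h ` ?A)" by (rule bdd_belowI2[of _ "- M"]) (use b in \<open>auto simp: abs_le_iff minus_le_iff\<close>)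
  show "(INF x\<in>?A. h x) \<le> h x" if "x \<in> S" "s < x \<bullet> e" for x
    by (rule cINF_lower[OF bd]) (use that in auto)
  show "h x \<le> (INF x\<in>?A. h x)" if "x \<in> S" "\<not> s < x \<bullet> e" for x
    by (rule cINF_greatest[OF ne]) (use that zdecD[OF z] in auto)
qed

lemma far_mass:
  assumes m: "mass \<mu>" and w: "w \<in> borel_measurable \<sigma>" "\<And>x. x \<in> S \<Longrightarrow> 0 \<le> w x" "\<And>x. x \<in> S \<Longrightarrow> w x \<le> 1"
    and far: "AE z in \<mu>. \<forall>x\<in>S. w x \<noteq> 0 \<longrightarrow> \<eta> \<le> norm (x - z)" and \<eta>: "0 < \<eta>" and t: "0 < t" "t \<le> 1"
  shows "(\<integral>x. w x * (rpot \<mu> x - pot \<mu> t x) \<partial>\<sigma>) \<le> V * far_const (\<eta>\<^sup>2 / 2) * t\<^sup>2"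
proof -
  have "(\<integral>x. w x * (rpot \<mu> x - pot \<mu> t x) \<partial>\<sigma>) = (\<integral>z. kd t w z \<partial>\<mu>)" by (rule weighted_kd(1)[OF m t(1) w])
  also have "\<dots> \<le> (\<integral>z. V * far_const (\<eta>\<^sup>2 / 2) * t\<^sup>2 \<partial>\<mu>)"
  proof (rule integral_mono_AE[OF weighted_kd(2)[OF m t(1) w]])
    show "integrable \<mu> (\<lambda>z. V * far_const (\<eta>\<^sup>2 / 2) * t\<^sup>2)" using finite_measure.integrable_const[OF mass_finite[OF m]] .
    show "AE z in \<mu>. kd t w z \<le> V * far_const (\<eta>\<^sup>2 / 2) * t\<^sup>2"
      using far AE_space
    proof eventually_elim
      case (elim z)
      then have z: "z \<in> S" using mass_space[OF m] by simp
      show ?case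
      proof (rule kd_far[OF _ t z w])
        fix x assume x: "x \<in> S" "w x \<noteq> 0"
        then have "\<eta>\<^sup>2 \<le> (norm (x - z))\<^sup>2" using \<eta> elim by (intro power_mono) auto
        then show "x \<bullet> z \<le> 1 - \<eta>\<^sup>2 / 2" using dist_sq[OF x(1) z] by simp
      qed (use \<eta> in auto)
    qed
  qed
  also have "\<dots> = V * far_const (\<eta>\<^sup>2 / 2) * t\<^sup>2" using mass_measure[OF m] mass_space[OF m] by simp
  finally show ?thesis .
qed

lemma pot_antimono:
  assumes m: "mass \<mu>" and t: "0 < s" "s \<le> t" and x: "x \<in> S"
  shows "pot \<mu> t x \<le> pot \<mu> s x"
  unfolding pot_def
proof (rule integral_mono)
  show "integrable \<mu> (\<lambda>z. kap t (x \<bullet> z))" "integrable \<mu> (\<lambda>z. kap s (x \<bullet> z))"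
    using pot_integrable[OF m _ x] t by auto
  fix z assume "z \<in> space \<mu>"
  then have "x \<bullet> z \<le> 1" using inner_le_1[OF x] mass_space[OF m] by simp
  then show "kap t (x \<bullet> z) \<le> kap s (x \<bullet> z)" using t gap_pos[of s "x \<bullet> z"] by (intro kap_antimono) auto
qed

lemma quadratic_contradiction:
  assumes k: "\<And>t. 0 < t \<Longrightarrow> t \<le> 1 \<Longrightarrow> (\<kappa>::real) * (1 - exp (- a * t)) \<le> C * t\<^sup>2"
  shows "\<kappa> \<le> 0"
proof -
  have "((\<lambda>t. \<kappa> * ((1 - exp (- a * t)) / t)) \<longlongrightarrow> \<kappa> * a) (at_right 0)"
    by (intro tendsto_mult_left) real_asymp
  moreover have "((\<lambda>t. C * t) \<longlongrightarrow> 0) (at_right 0)"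
    by (auto intro!: tendsto_eq_intros)
  moreover have "\<forall>\<^sub>F t in at_right 0. \<kappa> * ((1 - exp (- a * t)) / t) \<le> C * t"
    using eventually_at_right_real[OF zero_less_one]
  proof eventually_elim
    case (elim t)
    then show ?case using k[of t] by (simp add: field_simps power2_eq_square)
  qed
  ultimately have "\<kappa> * a \<le> 0" using tendsto_le trivial_limit_at_right_real by blast
  then show ?thesis using a_pos by (simp add: mult_le_0_iff)
qed

text \<open>For \<open>h\<close> increasing in \<open>x \<bullet> e\<close>, the integral of \<open>h\<close> over a cap of measure \<open>c0\<close> is the minimum over
  \<open>r\<close> of \<open>r * c0\<close> plus the integral of \<open>max 0 (h - r)\<close>; here \<open>r\<close> is the minimiser for \<open>R t f\<close>.\<close>

lemma rearranged_mass_bound: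
  assumes m: "mass \<mu>" and t0: "0 < t0" and e: "e \<in> S" and t: "0 < t"
    and f: "continuous_on S f" "\<And>x. x \<in> S \<Longrightarrow> \<bar>f x\<bar> \<le> M" "zdec e f" "dominates (pot \<mu> t0) f"
    and pM: "\<And>x. x \<in> S \<Longrightarrow> pot \<mu> t0 x \<le> M"
    and x0: "x0 \<in> S" "s < x0 \<bullet> e"
  shows "(\<integral>x. (if s < x \<bullet> e then 1 else 0) * (f x - R t f x) \<partial>\<sigma>) \<le> V * (1 - exp (- a * t))"
proof -
  let ?p = "pot \<mu> t0"
  let ?c = "\<lambda>x. if s < x \<bullet> e then 1 else (0::real)"
  have pc: "continuous_on S ?p" by (rule pot_continuous[OF m t0])
  note fm = measurable_continuous_on_S[OF f(1)] and pm = measurable_continuous_on_S[OF pc]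
  note [measurable] = fm pm R_measurable[OF fm] R_measurable[OF pm]
  have pb: "\<bar>?p x\<bar> \<le> M" if "x \<in> S" for x using pM[OF that] pot_nonneg[of \<mu> t0 x] by simp
  have fi: "integrable \<sigma> f" "integrable \<sigma> ?p" using f(1) pc integrable_continuous_on_S by auto
  have Rb: "\<bar>R t f x\<bar> \<le> M" "\<bar>R t ?p x\<bar> \<le> M" if "x \<in> S" for x
    using R_abs_bound[OF t that fm f(2)] R_abs_bound[OF t that pm pb] by auto
  have Ri: "integrable \<sigma> (R t f)" "integrable \<sigma> (R t ?p)"
    using integrable_bounded[OF R_measurable[OF fm] Rb(1)] integrable_bounded[OF R_measurable[OF pm] Rb(2)] by auto
  have ci: "integrable \<sigma> (\<lambda>x. ?c x * h x)" if h: "integrable \<sigma> h" for h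
    by (rule integrable_mult_bounded[OF h, of _ 1]) auto
  have c1: "integrable \<sigma> ?c" using ci[of "\<lambda>_. 1"] by simp
  obtain r where r: "\<And>x. x \<in> S \<Longrightarrow> s < x \<bullet> e \<Longrightarrow> r \<le> R t f x" "\<And>x. x \<in> S \<Longrightarrow> \<not> s < x \<bullet> e \<Longrightarrow> R t f x \<le> r"
    using zdec_threshold[OF R_zdec[OF e t fi(1) f(3)] Rb(1) x0] by blast
  have mi: "integrable \<sigma> (\<lambda>x. max 0 (h x - r))" if "integrable \<sigma> h" for h using that by simp
  have dm: "(\<integral>x. max 0 (f x - r) \<partial>\<sigma>) = (\<integral>x. max 0 (?p x - r) \<partial>\<sigma>)"
    by (rule dominatesD1[OF f(4), where h = "\<lambda>u. max 0 (u - r)"]) (intro continuous_intros)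
  have "convex_on UNIV (\<lambda>u::real. max 0 (u - r))"
  proof (rule convex_onI)
    fix b x y :: real assume b: "0 < b" "b < 1"
    have "(1 - b) * (x - r) \<le> (1 - b) * max 0 (x - r)" "b * (y - r) \<le> b * max 0 (y - r)"
      using b by (auto intro: mult_left_mono)
    moreover have "0 \<le> (1 - b) * max 0 (x - r)" "0 \<le> b * max 0 (y - r)" using b by auto
    moreover have "(1 - b) * (x - r) + b * (y - r) = (1 - b) *\<^sub>R x + b *\<^sub>R y - r" by (simp add: algebra_simps)
    ultimately show "max 0 ((1 - b) *\<^sub>R x + b *\<^sub>R y - r) \<le> (1 - b) * max 0 (x - r) + b * max 0 (y - r)"
      by linarith
  qed simp
  note dR = dominatesD2[OF f(4) t this]
  have "(\<integral>x. ?c x * f x \<partial>\<sigma>) \<le> (\<integral>x. r * ?c x + max 0 (f x - r) \<partial>\<sigma>)"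
    by (rule integral_mono[OF ci[OF fi(1)]]) (use c1 mi[OF fi(1)] in auto)
  also have "\<dots> = (\<integral>x. r * ?c x \<partial>\<sigma>) + (\<integral>x. max 0 (?p x - r) \<partial>\<sigma>)" using c1 mi[OF fi(1)] dm by simp
  finally have 1: "(\<integral>x. ?c x * f x \<partial>\<sigma>) \<le> (\<integral>x. r * ?c x \<partial>\<sigma>) + (\<integral>x. max 0 (?p x - r) \<partial>\<sigma>)" .
  have "(\<integral>x. r * ?c x \<partial>\<sigma>) + (\<integral>x. max 0 (R t f x - r) \<partial>\<sigma>) = (\<integral>x. r * ?c x + max 0 (R t f x - r) \<partial>\<sigma>)"
    using c1 mi[OF Ri(1)] by simp
  also have "\<dots> = (\<integral>x. ?c x * R t f x \<partial>\<sigma>)"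
    by (rule Bochner_Integration.integral_cong) (use r in \<open>force simp: max_def\<close>)+
  finally have 2: "(\<integral>x. r * ?c x \<partial>\<sigma>) + (\<integral>x. max 0 (R t ?p x - r) \<partial>\<sigma>) \<le> (\<integral>x. ?c x * R t f x \<partial>\<sigma>)" using dR by linarith
  have "(\<integral>x. ?c x * (f x - R t f x) \<partial>\<sigma>) = (\<integral>x. ?c x * f x \<partial>\<sigma>) - (\<integral>x. ?c x * R t f x \<partial>\<sigma>)"
    unfolding right_diff_distrib using ci[OF fi(1)] ci[OF Ri(1)] by simp
  also have "\<dots> \<le> (\<integral>x. max 0 (?p x - r) - max 0 (R t ?p x - r) \<partial>\<sigma>)" using 1 2 mi[OF fi(2)] mi[OF Ri(2)] by simp
  also have "\<dots> \<le> (\<integral>x. ?p x - pot \<mu> (t + t0) x \<partial>\<sigma>)"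
  proof (rule integral_mono)
    show "integrable \<sigma> (\<lambda>x. max 0 (?p x - r) - max 0 (R t ?p x - r))" using mi[OF fi(2)] mi[OF Ri(2)] by simp
    show "integrable \<sigma> (\<lambda>x. ?p x - pot \<mu> (t + t0) x)"
      using fi(2) integrable_continuous_on_S[OF pot_continuous[OF m, of "t + t0"]] t t0 by simp
    fix x assume "x \<in> space \<sigma>"
    then have x: "x \<in> S" by simp
    \<comment> \<open>The positive part above \<open>r\<close> is nondecreasing and 1-Lipschitz, so
      the truncated decrease in time is at most the full one.\<close>
    have "pot \<mu> (t + t0) x \<le> ?p x" by (rule pot_antimono[OF m t0 _ x]) (use t in simp)
    then show "max 0 (?p x - r) - max 0 (R t ?p x - r) \<le> ?p x - pot \<mu> (t + t0) x"
      unfolding R_pot[OF m t t0 x] by linarith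
  qed
  also have "\<dots> = V * exp (- a * t0) - V * exp (- a * (t + t0))"
    using fi(2) integrable_continuous_on_S[OF pot_continuous[OF m, of "t + t0"]] integral_pot[OF m t0] integral_pot[OF m, of "t + t0"] t t0
    by simp
  also have "\<dots> = V * (exp (- a * t0) * (1 - exp (- a * t)))" by (simp add: algebra_simps flip: exp_add)
  also have "\<dots> \<le> V * (1 * (1 - exp (- a * t)))"
  proof -
    have "exp (- a * t0) \<le> 1" "exp (- a * t) \<le> 1" using a_pos t t0 by simp_all
    then show ?thesis using V_pos by (intro mult_left_mono mult_right_mono) auto
  qed
  finally show ?thesis by simp
qed

theorem cap_comparison:
  assumes m: "mass \<mu>" and t0: "0 < t0" and e: "e \<in> S"
    and f: "continuous_on S f" "\<And>x. x \<in> S \<Longrightarrow> \<bar>f x\<bar> \<le> M" "zdec e f" "dominates (pot \<mu> t0) f"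
    and pM: "\<And>x. x \<in> S \<Longrightarrow> pot \<mu> t0 x \<le> M"
    and m0: "mass \<mu>0" and supp: "AE z in \<mu>0. s1 \<le> z \<bullet> e"
    and P0: "\<And>x. x \<in> S \<Longrightarrow> s1 \<le> x \<bullet> e \<Longrightarrow> npot \<mu>0 x = ennreal M"
  shows "(\<integral>x. (if s < x \<bullet> e then f x - rpot \<mu>0 x else 0) \<partial>\<sigma>) \<le> 0"
proof (rule ccontr)
  assume neg: "\<not> ?thesis"
  have M0: "0 \<le> M" using f(2)[OF e] by simp
  have fi: "integrable \<sigma> f" by (rule integrable_continuous_on_S[OF f(1)])
  define g where "g x = f x - rpot \<mu>0 x" for x
  have gi: "integrable \<sigma> g" unfolding g_def using fi rpot_integrable[OF m0] by simp
  note [measurable] = borel_measurable_integrable[OF gi] borel_measurable_integrable[OF fi]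
  define \<Gamma> where "\<Gamma> s = (\<integral>x. (if s < x \<bullet> e then g x else 0) \<partial>\<sigma>)" for s
  have cont: "isCont \<Gamma> s" for s unfolding \<Gamma>_def by (rule cap_integral_continuous[OF e gi])
  have le1: "\<bar>x \<bullet> e\<bar> \<le> 1" if "x \<in> S" for x by (rule abs_inner_le_1[OF that e])
  have ig: "(\<integral>x. g x \<partial>\<sigma>) \<le> 0"
  proof -
    have "(\<integral>x. f x \<partial>\<sigma>) = (\<integral>x. pot \<mu> t0 x \<partial>\<sigma>)" using dominatesD1[OF f(4) continuous_on_id] .
    also have "\<dots> = V * exp (- a * t0)" by (rule integral_pot[OF m t0])
    also have "\<dots> \<le> V" using V_pos a_pos t0 by (simp add: mult_left_le)
    finally show ?thesis unfolding g_def using fi rpot_integrable[OF m0] integral_rpot[OF m0] by simp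
  qed
  \<comment> \<open>On these caps \<open>rpot \<mu>0\<close> equals \<open>M\<close>, which bounds
    \<open>f\<close>. A positive maximum can therefore occur only below the height
    \<open>s1\<close>, and the cap overlaps the support of \<open>\<mu>0\<close> with a
    margin.\<close>
  have hi: "\<Gamma> s \<le> 0" if "s1 \<le> s" for s
    unfolding \<Gamma>_def
  proof (rule integral_nonpos_S)
    fix x assume x: "x \<in> S"
    show "(if s < x \<bullet> e then g x else 0) \<le> 0"
      using P0[OF x] that f(2)[OF x] M0 by (auto simp: g_def rpot_def)
  qed
  have out1: "\<Gamma> s \<le> 0" if "1 \<le> s" for s
    unfolding \<Gamma>_def by (rule integral_nonpos_S) (use le1 that in \<open>force simp: abs_le_iff\<close>)
  have out2: "\<Gamma> s \<le> 0" if "s < - 1" for s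
  proof -
    have "\<Gamma> s = (\<integral>x. g x \<partial>\<sigma>)" unfolding \<Gamma>_def
      by (rule Bochner_Integration.integral_cong) (use le1 that in \<open>force simp: abs_le_iff\<close>)+
    then show ?thesis using ig by simp
  qed
  have "continuous_on {- 1..1} \<Gamma>" using cont by (intro continuous_at_imp_continuous_on) auto
  then obtain s0 where s0: "s0 \<in> {- 1..1}" "\<And>s. s \<in> {- 1..1} \<Longrightarrow> \<Gamma> s \<le> \<Gamma> s0"
    using continuous_attains_sup[of "{- 1..1}" \<Gamma>] by (auto simp del: atLeastAtMost_iff)
  have spos: "0 < \<Gamma> s" using neg unfolding \<Gamma>_def g_def by simp
  have s_in: "s \<in> {- 1..1}" using spos out1[of s] out2[of s] by fastforce
  define \<kappa> where "\<kappa> = \<Gamma> s0"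
  have \<kappa>: "0 < \<kappa>" using s0(2)[OF s_in] spos by (simp add: \<kappa>_def)
  have lev: "\<Gamma> s \<le> \<kappa>" for s
    using s0(2)[of s] out1[of s] out2[of s] \<kappa> unfolding \<kappa>_def by fastforce
  have s01: "s0 < s1" using hi[of s0] \<kappa> unfolding \<kappa>_def by linarith
  have "\<exists>x0\<in>S. s0 < x0 \<bullet> e"
  proof (rule ccontr)
    assume "\<not> ?thesis"
    then have "\<Gamma> s0 = (\<integral>x. 0 \<partial>\<sigma>)" unfolding \<Gamma>_def by (intro Bochner_Integration.integral_cong) auto
    then show False using \<kappa> by (simp add: \<kappa>_def)
  qed
  then obtain x0 where x0: "x0 \<in> S" "s0 < x0 \<bullet> e" by blast
  define c where "c x = (if s0 < x \<bullet> e then 1 else (0::real))" for x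
  have cm [measurable]: "c \<in> borel_measurable \<sigma>" unfolding c_def by measurable
  have c01: "0 \<le> c x" "c x \<le> 1" "\<bar>c x\<bar> \<le> 1" for x by (auto simp: c_def)
  have ci: "integrable \<sigma> c" by (rule integrable_bounded[OF cm c01(3)])
  have zc: "zdec e c" by (auto simp: zdec_def c_def)
  \<comment> \<open>The complement of the maximising cap and the support of \<open>\<mu>0\<close>
    differ in height by at least \<open>s1 - s0\<close>; \<open>far_mass\<close> makes the
    contribution of the complement quadratic in \<open>t\<close>.\<close>
  define C where "C = V * far_const ((s1 - s0)\<^sup>2 / 2)"
  have "AE z in \<mu>0. \<forall>x\<in>S. 1 - c x \<noteq> 0 \<longrightarrow> s1 - s0 \<le> norm (x - z)"
    using supp AE_space
  proof eventually_elim
    case (elim z)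
    show ?case
    proof (intro ballI impI)
      fix x assume x: "x \<in> S" "1 - c x \<noteq> 0"
      then have "x \<bullet> e \<le> s0" by (auto simp: c_def split: if_splits)
      then have "s1 - s0 \<le> (z - x) \<bullet> e" using elim by (simp add: inner_diff_left)
      also have "\<dots> \<le> norm (z - x)" using norm_cauchy_schwarz[of "z - x" e] e by simp
      finally show "s1 - s0 \<le> norm (x - z)" by (simp add: norm_minus_commute)
    qed
  qed
  then have C: "(\<integral>x. (1 - c x) * (rpot \<mu>0 x - pot \<mu>0 t x) \<partial>\<sigma>) \<le> C * t\<^sup>2" if "0 < t" "t \<le> 1" for t
    unfolding C_def using far_mass[OF m0, of "\<lambda>x. 1 - c x" "s1 - s0"] c01 s01 that by simp
  have "\<kappa> * (1 - exp (- a * t)) \<le> C * t\<^sup>2" if t: "0 < t" "t \<le> 1" for t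
  proof -
    have Rci: "integrable \<sigma> (\<lambda>x. R t c x * g x)" "integrable \<sigma> (\<lambda>x. c x * R t g x)" "(\<integral>x. c x * R t g x \<partial>\<sigma>) = (\<integral>x. R t c x * g x \<partial>\<sigma>)"
      using R_swap[OF t(1) gi cm c01(3)] by auto
    \<comment> \<open>\<open>R t c\<close> increases towards \<open>e\<close> and lies between 0 and
      \<open>exp (- a * t)\<close>, so it mixes indicators of caps with total weight at most
      \<open>exp (- a * t)\<close>, each worth at most \<open>\<kappa>\<close>.\<close>
    have A: "(\<integral>x. R t c x * g x \<partial>\<sigma>) \<le> exp (- a * t) * \<kappa>"
    proof (rule zdec_test[OF e gi R_zdec[OF e t(1) ci zc]])
      show "0 \<le> R t c x" if "x \<in> S" for x by (rule R_nonneg[OF t(1) that c01(1)])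
      show "R t c x \<le> exp (- a * t)" if "x \<in> S" for x using R_le_const[OF t(1) that ci c01(2)] by simp
      show "(\<integral>x. (if s < x \<bullet> e then g x else 0) \<partial>\<sigma>) \<le> \<kappa>" for s using lev[of s] by (simp add: \<Gamma>_def)
    qed simp
    have cg: "integrable \<sigma> (\<lambda>x. c x * h x)" if "integrable \<sigma> h" for h
      by (rule integrable_mult_bounded[OF that cm c01(3)])
    have "\<kappa> = (\<integral>x. c x * g x \<partial>\<sigma>)"
      unfolding \<kappa>_def \<Gamma>_def by (rule Bochner_Integration.integral_cong) (auto simp: c_def)
    then have "\<kappa> * (1 - exp (- a * t)) \<le> (\<integral>x. c x * g x \<partial>\<sigma>) - (\<integral>x. c x * R t g x \<partial>\<sigma>)"
      using A Rci(3) by (simp add: algebra_simps)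
    also have "\<dots> = (\<integral>x. c x * (f x - R t f x) - c x * (rpot \<mu>0 x - pot \<mu>0 t x) \<partial>\<sigma>)"
    proof -
      have "(\<integral>x. c x * g x \<partial>\<sigma>) - (\<integral>x. c x * R t g x \<partial>\<sigma>) = (\<integral>x. c x * g x - c x * R t g x \<partial>\<sigma>)"
        using cg[OF gi] Rci(2) by simp
      also have "\<dots> = (\<integral>x. c x * (f x - R t f x) - c x * (rpot \<mu>0 x - pot \<mu>0 t x) \<partial>\<sigma>)"
      proof (rule Bochner_Integration.integral_cong[OF refl])
        fix x assume "x \<in> space \<sigma>"
        then have x: "x \<in> S" by simp
        have "R t g x = R t f x - pot \<mu>0 t x"
          unfolding g_def R_diff[OF t(1) x fi rpot_integrable[OF m0]] R_rpot[OF m0 t(1) x] ..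
        then show "c x * g x - c x * R t g x = c x * (f x - R t f x) - c x * (rpot \<mu>0 x - pot \<mu>0 t x)"
          by (simp only: g_def) (simp add: algebra_simps)
      qed
      finally show ?thesis .
    qed
    also have "\<dots> = (\<integral>x. c x * (f x - R t f x) \<partial>\<sigma>) - (\<integral>x. c x * (rpot \<mu>0 x - pot \<mu>0 t x) \<partial>\<sigma>)"
    proof (rule Bochner_Integration.integral_diff)
      have "integrable \<sigma> (R t f)"
        by (rule integrable_bounded[OF R_measurable R_abs_bound[OF t(1) _ _ f(2)]]) (use fi in auto)
      then show "integrable \<sigma> (\<lambda>x. c x * (f x - R t f x))" using fi by (intro cg) simp
      show "integrable \<sigma> (\<lambda>x. c x * (rpot \<mu>0 x - pot \<mu>0 t x))"
        by (rule cg[OF integrable_rpot_pot[OF m0 t(1)]])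
    qed
    \<comment> \<open>The total decrease of \<open>rpot \<mu>0\<close> over the sphere is known
      exactly, so the cap receives all of it except the quadratic share of the complement. The same
      total bounds the decrease of \<open>f\<close> from above by
      \<open>rearranged_mass_bound\<close>, and the first-order terms cancel.\<close>
    also have "(\<integral>x. c x * (rpot \<mu>0 x - pot \<mu>0 t x) \<partial>\<sigma>) = V * (1 - exp (- a * t)) - (\<integral>x. (1 - c x) * (rpot \<mu>0 x - pot \<mu>0 t x) \<partial>\<sigma>)"
    proof -
      note di = integrable_rpot_pot[OF m0 t(1)]
      have "(\<integral>x. (1 - c x) * (rpot \<mu>0 x - pot \<mu>0 t x) \<partial>\<sigma>) = (\<integral>x. rpot \<mu>0 x - pot \<mu>0 t x \<partial>\<sigma>) - (\<integral>x. c x * (rpot \<mu>0 x - pot \<mu>0 t x) \<partial>\<sigma>)"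
        unfolding left_diff_distrib[of 1 "c _"] mult_1 by (rule Bochner_Integration.integral_diff[OF di cg[OF di]])
      also have "(\<integral>x. rpot \<mu>0 x - pot \<mu>0 t x \<partial>\<sigma>) = V * (1 - exp (- a * t))"
        using rpot_integrable[OF m0] integrable_continuous_on_S[OF pot_continuous[OF m0 t(1)]] integral_rpot[OF m0] integral_pot[OF m0 t(1)]
        by (simp add: algebra_simps)
      finally show ?thesis by simp
    qed
    finally show ?thesis
      using rearranged_mass_bound[OF m t0 e t(1) f pM x0] C[OF t] unfolding c_def[symmetric] by linarith
  qed
  then have "\<kappa> \<le> 0" by (rule quadratic_contradiction)
  then show False using \<kappa> by simp
qed


subsection \<open>The extremal potentials are zonal\<close>

text \<open>On \<open>A\<close>, \<open>u\<close> is at most \<open>\<eta>\<close> plus its excess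
  \<open>v\<close> over \<open>\<eta>\<close>. \<open>R s\<close> contracts constants and integrals
  of nonnegative functions by the same factor \<open>exp (- a * s)\<close>, so the part from
  \<open>A\<close> loses this factor when tested against \<open>w\<close>. What flows in from
  outside \<open>A\<close> is kept as a separate term.\<close>

lemma max_principle:
  fixes u :: "real^'n \<Rightarrow> real"
  assumes u: "integrable \<sigma> u" and s: "0 < s" and \<eta>: "0 \<le> \<eta>"
    and A [measurable]: "Measurable.pred \<sigma> A"
  defines "w \<equiv> \<lambda>x. if A x \<and> \<eta> < u x then 1 else (0::real)"
  shows "(1 - exp (- a * s)) * (\<integral>x. w x * u x \<partial>\<sigma>) \<le> (\<integral>x. w x * (u x - R s u x) \<partial>\<sigma>) + (\<integral>x. w x * R s (\<lambda>y. if A y then 0 else u y) x \<partial>\<sigma>)"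
proof -
  note [measurable] = borel_measurable_integrable[OF u]
  have w [measurable]: "w \<in> borel_measurable \<sigma>" unfolding w_def by measurable
  have w1: "\<bar>w x\<bar> \<le> 1" for x by (simp add: w_def)
  have wi: "integrable \<sigma> w" by (rule integrable_bounded[OF w w1])
  have ii: "integrable \<sigma> (\<lambda>x. if A x then 0 else u x)" "integrable \<sigma> (\<lambda>x. if A x then u x else 0)"
    by (rule Bochner_Integration.integrable_bound[OF u], auto)+
  have wu: "integrable \<sigma> (\<lambda>x. w x * u x)" by (rule integrable_mult_bounded[OF u w w1])
  define v where "v x = w x * (u x - \<eta>)" for x
  have v0: "0 \<le> v x" for x by (simp add: v_def w_def)
  have vi: "integrable \<sigma> v" unfolding v_def right_diff_distrib using wu wi by simp
  have Rw: "R s w x \<le> exp (- a * s)" if "x \<in> S" for x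
    using R_le_const[OF s that wi, of 1] by (simp add: w_def)
  have pt: "R s u x \<le> R s (\<lambda>y. if A y then 0 else u y) x + (R s v x + \<eta> * exp (- a * s))" if x: "x \<in> S" for x
  proof -
    have "R s u x = R s (\<lambda>y. (if A y then 0 else u y) + (if A y then u y else 0)) x"
      by (rule arg_cong2[where f = "R s"]) auto
    also have "\<dots> = R s (\<lambda>y. if A y then 0 else u y) x + R s (\<lambda>y. if A y then u y else 0) x"
      by (rule R_add[OF s x ii])
    also have "R s (\<lambda>y. if A y then u y else 0) x \<le> R s (\<lambda>y. v y + \<eta>) x"
    proof (rule R_mono[OF s x ii(2)])
      show "AE y in \<sigma>. (if A y then u y else 0) \<le> v y + \<eta>"
        by (rule AE_I2) (use \<eta> in \<open>auto simp: v_def w_def\<close>)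
    qed (use vi in simp)
    also have "R s (\<lambda>y. v y + \<eta>) x = R s v x + \<eta> * exp (- a * s)"
      using R_add[OF s x vi, of "\<lambda>_. \<eta>"] R_const[OF s x] by simp
    finally show ?thesis by simp
  qed
  note sw = R_swap[OF s u w w1] and sv = R_swap[OF s vi w w1] and sc = R_swap[OF s ii(1) w w1]
  have "(\<integral>x. w x * R s u x \<partial>\<sigma>) \<le> (\<integral>x. w x * R s (\<lambda>y. if A y then 0 else u y) x + (w x * R s v x + \<eta> * exp (- a * s) * w x) \<partial>\<sigma>)"
  proof (rule integral_mono[OF sw(2)])
    show "integrable \<sigma> (\<lambda>x. w x * R s (\<lambda>y. if A y then 0 else u y) x + (w x * R s v x + \<eta> * exp (- a * s) * w x))"
      using sc(2) sv(2) wi by simp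
    fix x assume "x \<in> space \<sigma>"
    then have "x \<in> S" by simp
    from mult_left_mono[OF pt[OF this], of "w x"]
    show "w x * R s u x \<le> w x * R s (\<lambda>y. if A y then 0 else u y) x + (w x * R s v x + \<eta> * exp (- a * s) * w x)"
      by (simp add: w_def algebra_simps split: if_splits)
  qed
  also have "\<dots> = (\<integral>x. w x * R s (\<lambda>y. if A y then 0 else u y) x \<partial>\<sigma>) + ((\<integral>x. w x * R s v x \<partial>\<sigma>) + \<eta> * exp (- a * s) * (\<integral>x. w x \<partial>\<sigma>))"
    using sc(2) sv(2) wi by simp
  also have "(\<integral>x. w x * R s v x \<partial>\<sigma>) \<le> exp (- a * s) * (\<integral>x. v x \<partial>\<sigma>)"
  proof -
    have "(\<integral>x. R s w x * v x \<partial>\<sigma>) \<le> (\<integral>x. exp (- a * s) * v x \<partial>\<sigma>)"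
      by (rule integral_mono[OF sv(3)]) (use vi Rw v0 in \<open>auto intro!: mult_right_mono\<close>)
    then show ?thesis using sv(1) by simp
  qed
  also have "(\<integral>x. v x \<partial>\<sigma>) = (\<integral>x. w x * u x \<partial>\<sigma>) - \<eta> * (\<integral>x. w x \<partial>\<sigma>)"
    unfolding v_def right_diff_distrib using wu wi by simp
  finally have "(\<integral>x. w x * R s u x \<partial>\<sigma>) \<le> (\<integral>x. w x * R s (\<lambda>y. if A y then 0 else u y) x \<partial>\<sigma>) + exp (- a * s) * (\<integral>x. w x * u x \<partial>\<sigma>)"
    by (simp add: algebra_simps)
  moreover have "(\<integral>x. w x * (u x - R s u x) \<partial>\<sigma>) = (\<integral>x. w x * u x \<partial>\<sigma>) - (\<integral>x. w x * R s u x \<partial>\<sigma>)"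
    unfolding right_diff_distrib using wu sw(2) by simp
  ultimately show ?thesis by (simp add: algebra_simps)
qed

text \<open>At a point where the potential attains its minimum \<open>d\<close> on the sphere, the mean of the
  potential with weight \<open>kap 0 - kap s\<close> exceeds \<open>d\<close> by a quadratic term in \<open>s\<close> only. Hence a
  set on which the potential is at least \<open>d + \<eta>\<close> is seen from there with weight \<open>O(s\<^sup>2)\<close>.\<close>

lemma contact_estimate:
  assumes m: "mass \<mu>" and z: "z \<in> S" and d: "npot \<mu> z = ennreal d" "0 \<le> d"
    and s: "0 < s" and \<eta>: "0 < \<eta>"
    and low: "AE x in \<sigma>. d \<le> rpot \<mu> x"
    and w: "w \<in> borel_measurable \<sigma>" "\<And>x. x \<in> S \<Longrightarrow> 0 \<le> w x" "\<And>x. x \<in> S \<Longrightarrow> w x \<le> 1"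
    and wF: "AE x in \<sigma>. w x \<noteq> 0 \<longrightarrow> d + \<eta> \<le> rpot \<mu> x"
  shows "kd s w z \<le> V * d * a\<^sup>2 / \<eta> * s\<^sup>2"
proof -
  let ?k = "\<lambda>x. kap 0 (x \<bullet> z) - kap s (x \<bullet> z)"
  note [measurable] = rpot_measurable[OF m]
  have kn: "AE x in \<sigma>. 0 \<le> ?k x"
    using AE_neq_S[OF z] AE_space by eventually_elim (use z s kap_le_kap_0[of s _ z] in auto)
  have nn: "AE x in \<sigma>. 0 \<le> ?k x * rpot \<mu> x"
    using kn by eventually_elim (simp add: rpot_nonneg)
  have mk: "(\<lambda>x. ?k x * rpot \<mu> x) \<in> borel_measurable \<sigma>" by measurable
  have "(\<integral>\<^sup>+x. ennreal (?k x * rpot \<mu> x) \<partial>\<sigma>) = (\<integral>\<^sup>+x. ennreal (kap 0 (z \<bullet> x) - kap s (z \<bullet> x)) * npot \<mu> x \<partial>\<sigma>)"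
  proof (rule nn_integral_cong_AE)
    show "AE x in \<sigma>. ennreal (?k x * rpot \<mu> x) = ennreal (kap 0 (z \<bullet> x) - kap s (z \<bullet> x)) * npot \<mu> x"
      using kn npot_finite_AE[OF m] by eventually_elim (simp add: ennreal_mult rpot_nonneg rpot_ennreal inner_commute)
  qed
  also have "\<dots> \<le> ennreal (a * V * s) * npot \<mu> z" by (rule kap_diff_npot_bound[OF m s z])
  also have "\<dots> = ennreal (a * V * s * d)" using d a_pos V_pos s by (simp add: ennreal_mult)
  finally have le: "(\<integral>\<^sup>+x. ennreal (?k x * rpot \<mu> x) \<partial>\<sigma>) \<le> ennreal (a * V * s * d)" .
  have ki: "integrable \<sigma> (\<lambda>x. ?k x * rpot \<mu> x)"
    by (rule integrableI_nonneg[OF mk nn]) (use le_less_trans[OF le ennreal_less_top] in simp)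
  have "ennreal (\<integral>x. ?k x * rpot \<mu> x \<partial>\<sigma>) \<le> ennreal (a * V * s * d)"
    using nn_integral_eq_integral[OF ki nn] le by simp
  then have kle: "(\<integral>x. ?k x * rpot \<mu> x \<partial>\<sigma>) \<le> a * V * s * d"
    using a_pos V_pos s d by (simp add: ennreal_le_iff)
  have k1: "integrable \<sigma> ?k" using kd_integrable(3)[OF s z, of "\<lambda>_. 1" 1] by simp
  have "\<eta> * kd s w z = (\<integral>x. \<eta> * (w x * ?k x) \<partial>\<sigma>)" by (simp add: kd_def)
  also have "\<dots> \<le> (\<integral>x. ?k x * rpot \<mu> x - d * ?k x \<partial>\<sigma>)"
  proof (rule integral_mono_AE)
    show "integrable \<sigma> (\<lambda>x. \<eta> * (w x * ?k x))" using kd_integrable(3)[OF s z w] by simp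
    show "integrable \<sigma> (\<lambda>x. ?k x * rpot \<mu> x - d * ?k x)" using ki k1 by simp
    show "AE x in \<sigma>. \<eta> * (w x * ?k x) \<le> ?k x * rpot \<mu> x - d * ?k x"
      using kn low wF AE_space
    proof eventually_elim
      case (elim x)
      have "\<eta> * w x \<le> rpot \<mu> x - d"
      proof (cases "w x = 0")
        case False
        have "\<eta> * w x \<le> \<eta> * 1" using \<eta> w(3)[of x] elim by (intro mult_left_mono) auto
        then show ?thesis using False elim by auto
      qed (use elim in simp)
      then have "(\<eta> * w x) * ?k x \<le> (rpot \<mu> x - d) * ?k x" using elim by (intro mult_right_mono)
      then show ?case by (simp add: algebra_simps)
    qed
  qed
  also have "\<dots> = (\<integral>x. ?k x * rpot \<mu> x \<partial>\<sigma>) - d * kd s (\<lambda>_. 1) z"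
    unfolding kd_def using ki k1 by simp
  \<comment> \<open>The upper bound \<open>a * V * s * d\<close> and the mean of the constant
    \<open>d\<close>, which is \<open>d * V * (1 - exp (- a * s))\<close>, agree to first order;
    only their quadratic difference is left.\<close>
  also have "\<dots> \<le> V * d * (a * s - 1 + exp (- (a * s)))"
    unfolding kd_one[OF s z] using kle by (simp add: algebra_simps)
  also have "\<dots> \<le> V * d * (a * s)\<^sup>2"
    using exp_minus_quadratic[of "a * s"] a_pos s V_pos d by (intro mult_left_mono) auto
  finally show ?thesis using \<eta> by (simp add: field_simps power2_eq_square)
qed

lemma kd_refl:
  assumes w: "w \<in> borel_measurable \<sigma>"
  shows "kd s (\<lambda>x. w (refl_along v x)) z = kd s w (refl_along v z)"
proof -
  note [measurable] = w
  have "(\<lambda>x. w x * (kap 0 (x \<bullet> refl_along v z) - kap s (x \<bullet> refl_along v z))) \<in> borel_measurable \<sigma>" by measurable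
  from integral_orth[OF orthogonal_refl_along this, of v]
  show ?thesis by (simp add: kd_def)
qed

lemma R_refl:
  assumes f: "f \<in> borel_measurable \<sigma>"
  shows "R s (\<lambda>x. f (refl_along v x)) x = R s f (refl_along v x)"
proof -
  note [measurable] = f
  have "(\<lambda>y. poi s (refl_along v x \<bullet> y) * f y) \<in> borel_measurable \<sigma>" by measurable
  from integral_orth[OF orthogonal_refl_along this, of v]
  show ?thesis by (simp add: R_def)
qed

text \<open>The reflections allowed are those that fix \<open>e\<close>; they act transitively on
  the points of each height. Equality is asked almost everywhere because \<open>rpot\<close> carries
  no information where the potential is infinite.\<close>

definition zonal :: "real^'n \<Rightarrow> (real^'n \<Rightarrow> real) \<Rightarrow> bool" where
  "zonal e f \<longleftrightarrow> (\<forall>v. v \<bullet> e = 0 \<longrightarrow> (AE x in \<sigma>. f (refl_along v x) = f x))"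

definition contact_mass :: "real^'n \<Rightarrow> real \<Rightarrow> (real^'n) measure \<Rightarrow> bool" where
  "contact_mass e d \<mu> \<longleftrightarrow> mass \<mu> \<and> 0 \<le> d \<and> (AE z in \<mu>. z = e \<or> npot \<mu> z = ennreal d) \<and>
     (\<forall>x\<in>S. ennreal d \<le> npot \<mu> x)"

lemma npot_ge_AE:
  assumes "mass \<mu>" "0 \<le> d" "\<And>x. x \<in> S \<Longrightarrow> ennreal d \<le> npot \<mu> x"
  shows "AE x in \<sigma>. d \<le> rpot \<mu> x"
  using npot_finite_AE[OF assms(1)] AE_space
proof eventually_elim
  case (elim x)
  then show ?case using assms(3)[of x] rpot_ennreal[of \<mu> x] by (simp add: rpot_nonneg flip: ennreal_le_iff)
qed

text \<open>Let \<open>u\<close> be the potential minus its reflection. Where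
  \<open>u > \<eta>\<close> the potential is at least \<open>d + \<eta>\<close>, so contact points
  see this set with weight of order \<open>s\<^sup>2\<close>. The pole is fixed by the reflection,
  so the contributions of mass there cancel. By the maximum principle the integral of
  \<open>u\<close> over this set is of second order after multiplication by
  \<open>1 - exp (- a * s)\<close>, hence not positive.\<close>

lemma contact_zonal:
  assumes c: "contact_mass e d \<mu>"
  shows "zonal e (rpot \<mu>)"
proof -
  have m: "mass \<mu>" and d: "0 \<le> d" and supp: "AE z in \<mu>. z = e \<or> npot \<mu> z = ennreal d"
    and low: "\<And>x. x \<in> S \<Longrightarrow> ennreal d \<le> npot \<mu> x"
    using c by (auto simp: contact_mass_def)
  note lowAE = npot_ge_AE[OF m d low]
  note [measurable] = rpot_measurable[OF m]
  have half: "AE x in \<sigma>. rpot \<mu> x \<le> rpot \<mu> (refl_along v x)" if ve: "v \<bullet> e = 0" for v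
  proof -
    have re: "refl_along v e = e" using ve by (simp add: refl_along_def inner_commute)
    define u where "u x = rpot \<mu> x - rpot \<mu> (refl_along v x)" for x
    have rT: "integrable \<sigma> (\<lambda>x. rpot \<mu> (refl_along v x))" by (rule integrable_orth[OF orthogonal_refl_along rpot_integrable[OF m]])
    have ui: "integrable \<sigma> u" unfolding u_def using rpot_integrable[OF m] rT by simp
    note [measurable] = borel_measurable_integrable[OF ui]
    have lowT: "AE x in \<sigma>. d \<le> rpot \<mu> (refl_along v x)" by (rule AE_orth[OF orthogonal_refl_along lowAE])
    have null: "AE x in \<sigma>. u x \<le> \<eta>" if \<eta>: "0 < \<eta>" for \<eta>
    proof -
      define w where "w = (\<lambda>x. if True \<and> \<eta> < u x then 1 else (0::real))"
      have w: "w \<in> borel_measurable \<sigma>" "\<And>x. 0 \<le> w x" "\<And>x. w x \<le> 1" unfolding w_def by auto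
      have wT: "(\<lambda>x. w (refl_along v x)) \<in> borel_measurable \<sigma>"
        using measurable_compose[OF measurable_orth[OF orthogonal_refl_along] w(1)] .
      have wF: "AE x in \<sigma>. w x \<noteq> 0 \<longrightarrow> d + \<eta> \<le> rpot \<mu> x"
        using lowT by eventually_elim (auto simp: w_def u_def)
      have "(\<integral>x. w x * u x \<partial>\<sigma>) * (1 - exp (- a * s)) \<le> V * d * a\<^sup>2 / \<eta> * s\<^sup>2" if s: "0 < s" for s
      proof -
        have "(1 - exp (- a * s)) * (\<integral>x. w x * u x \<partial>\<sigma>) \<le> (\<integral>x. w x * (u x - R s u x) \<partial>\<sigma>) + (\<integral>x. w x * R s (\<lambda>y. if True then 0 else u y) x \<partial>\<sigma>)"
          unfolding w_def by (rule max_principle[OF ui s]) (use \<eta> in auto)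
        also have "(\<integral>x. w x * R s (\<lambda>y. if True then 0 else u y) x \<partial>\<sigma>) = 0" by (simp add: R_def)
        also have "(\<integral>x. w x * (u x - R s u x) \<partial>\<sigma>) = (\<integral>x. w x * (rpot \<mu> x - pot \<mu> s x) - w x * (rpot \<mu> (refl_along v x) - pot \<mu> s (refl_along v x)) \<partial>\<sigma>)"
        proof (rule Bochner_Integration.integral_cong[OF refl])
          fix x assume "x \<in> space \<sigma>"
          then have x: "x \<in> S" and x': "refl_along v x \<in> S" by auto
          have "R s u x = pot \<mu> s x - pot \<mu> s (refl_along v x)"
            unfolding u_def R_diff[OF s x rpot_integrable[OF m] rT] R_refl[OF rpot_measurable[OF m]] R_rpot[OF m s x] R_rpot[OF m s x'] ..
          then show "w x * (u x - R s u x) = w x * (rpot \<mu> x - pot \<mu> s x) - w x * (rpot \<mu> (refl_along v x) - pot \<mu> s (refl_along v x))"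
            by (simp only: u_def) (simp add: algebra_simps)
        qed
        also have "\<dots> = (\<integral>x. w x * (rpot \<mu> x - pot \<mu> s x) \<partial>\<sigma>) - (\<integral>x. w (refl_along v x) * (rpot \<mu> x - pot \<mu> s x) \<partial>\<sigma>)"
        proof -
          have wdi: "integrable \<sigma> (\<lambda>x. q x * (rpot \<mu> x - pot \<mu> s x))" if "q \<in> borel_measurable \<sigma>" and "\<And>x. 0 \<le> q x" "\<And>x. q x \<le> 1" for q
            using that by (intro integrable_mult_bounded[OF integrable_rpot_pot[OF m s], of _ 1]) auto
          have wT1: "integrable \<sigma> (\<lambda>x. w (refl_along v x) * (rpot \<mu> x - pot \<mu> s x))" by (rule wdi[OF wT w(2,3)])
          have e: "(\<integral>x. w x * (rpot \<mu> (refl_along v x) - pot \<mu> s (refl_along v x)) \<partial>\<sigma>) = (\<integral>x. w (refl_along v x) * (rpot \<mu> x - pot \<mu> s x) \<partial>\<sigma>)"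
            using integral_orth[OF orthogonal_refl_along borel_measurable_integrable[OF wT1], of v] by simp
          have i2: "integrable \<sigma> (\<lambda>x. w x * (rpot \<mu> (refl_along v x) - pot \<mu> s (refl_along v x)))"
            using integrable_orth[OF orthogonal_refl_along wT1, of v] by simp
          show ?thesis using Bochner_Integration.integral_diff[OF wdi[OF w] i2] e by simp
        qed
        also have "\<dots> = (\<integral>z. kd s w z - kd s (\<lambda>x. w (refl_along v x)) z \<partial>\<mu>)"
          using weighted_kd[OF m s w(1)] weighted_kd[OF m s wT] w by simp
        also have "\<dots> \<le> (\<integral>z. V * d * a\<^sup>2 / \<eta> * s\<^sup>2 \<partial>\<mu>)"
        proof (rule integral_mono_AE)
          show "AE z in \<mu>. kd s w z - kd s (\<lambda>x. w (refl_along v x)) z \<le> V * d * a\<^sup>2 / \<eta> * s\<^sup>2"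
            using supp AE_space
          proof eventually_elim
            case (elim z)
            then have z: "z \<in> S" using mass_space[OF m] by simp
            show ?case
            proof (cases "z = e")
              case True
              then show ?thesis using kd_refl[OF w(1), of s v e] re V_pos d \<eta> by simp
            next
              case False
              then have "kd s w z \<le> V * d * a\<^sup>2 / \<eta> * s\<^sup>2"
                using elim by (intro contact_estimate[OF m z _ d s \<eta> lowAE w(1)] wF) (use w in auto)
              moreover have "0 \<le> kd s (\<lambda>x. w (refl_along v x)) z" by (rule kd_nonneg[OF s z w(2)])
              ultimately show ?thesis by linarith
            qed
          qed
          show "integrable \<mu> (\<lambda>z. kd s w z - kd s (\<lambda>x. w (refl_along v x)) z)"
            using weighted_kd(2)[OF m s w(1)] weighted_kd(2)[OF m s wT] w by simp
          show "integrable \<mu> (\<lambda>z. V * d * a\<^sup>2 / \<eta> * s\<^sup>2)" using finite_measure.integrable_const[OF mass_finite[OF m]] .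
        qed
        also have "\<dots> = V * d * a\<^sup>2 / \<eta> * s\<^sup>2" using mass_measure[OF m] mass_space[OF m] by simp
        finally show ?thesis by (simp add: mult.commute)
      qed
      then have le0: "(\<integral>x. w x * u x \<partial>\<sigma>) \<le> 0" by (intro quadratic_contradiction)
      have nn: "AE x in \<sigma>. 0 \<le> w x * u x" by (rule AE_I2) (use \<eta> in \<open>auto simp: w_def\<close>)
      have wu: "integrable \<sigma> (\<lambda>x. w x * u x)"
        by (rule integrable_mult_bounded[OF ui w(1), of 1]) (simp add: w_def)
      have "(\<integral>x. w x * u x \<partial>\<sigma>) = 0" using le0 integral_nonneg_AE[OF nn] by linarith
      then have "AE x in \<sigma>. w x * u x = 0" using integral_nonneg_eq_0_iff_AE[OF wu nn] by simp
      then show ?thesis by eventually_elim (use \<eta> in \<open>auto simp: w_def split: if_splits\<close>)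
    qed
    have "AE x in \<sigma>. \<forall>n. u x \<le> tau n" using null[OF tau_pos] by (simp add: AE_all_countable)
    then show ?thesis
    proof eventually_elim
      case (elim x)
      have "u x \<le> 0" by (rule LIMSEQ_le_const[OF tau_lim]) (use elim in auto)
      then show ?case by (simp add: u_def)
    qed
  qed
  show ?thesis
    unfolding zonal_def
  proof (intro allI impI)
    fix v assume ve: "v \<bullet> e = 0"
    have "AE x in \<sigma>. rpot \<mu> (refl_along v x) \<le> rpot \<mu> (refl_along v (refl_along v x))"
      by (rule AE_orth[OF orthogonal_refl_along half[OF ve]])
    with half[OF ve] show "AE x in \<sigma>. rpot \<mu> (refl_along v x) = rpot \<mu> x"
      by eventually_elim simp
  qed
qed

text \<open>The cap comparison is applied to the potential itself: \<open>f\<close> rearranges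
  \<open>pot \<mu>0 t\<close>, and testing \<open>f - rpot \<mu>0\<close> against \<open>f\<close>
  bounds their squared distance, because \<open>f\<close> has the same square integral as
  \<open>pot \<mu>0 t\<close>. The distance vanishes as \<open>t\<close> tends to 0, and every
  \<open>f\<close> depends on the height alone.\<close>

lemma extremal_zonal:
  assumes e: "e \<in> S" and m0: "mass \<mu>0" and supp: "AE z in \<mu>0. s1 \<le> z \<bullet> e"
    and P0: "\<And>x. x \<in> S \<Longrightarrow> s1 \<le> x \<bullet> e \<Longrightarrow> npot \<mu>0 x = ennreal M"
    and le: "\<And>x. x \<in> S \<Longrightarrow> npot \<mu>0 x \<le> ennreal M" and M: "0 \<le> M"
  shows "zonal e (rpot \<mu>0)"
  unfolding zonal_def
proof (intro allI impI)
  fix v assume ve: "v \<bullet> e = 0"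
  let ?p = "rpot \<mu>0"
  note [measurable] = rpot_measurable[OF m0]
  have pb: "\<bar>?p x\<bar> \<le> M" if "x \<in> S" for x
  proof -
    have "npot \<mu>0 x < \<infinity>" using le_less_trans[OF le[OF that] ennreal_less_top] by simp
    then have "ennreal (?p x) \<le> ennreal M" using le[OF that] by (simp add: rpot_ennreal)
    then show ?thesis using M by (simp add: ennreal_le_iff rpot_nonneg)
  qed
  have tb: "pot \<mu>0 t x \<le> M" if "x \<in> S" "0 < t" for x t
  proof -
    have "ennreal (pot \<mu>0 t x) \<le> ennreal M" using pot_le_npot[OF m0 that] le[OF that(1)] by simp
    then show ?thesis using M by (simp add: ennreal_le_iff)
  qed
  have prod: "integrable \<sigma> (\<lambda>x. f x * g x)" if [measurable]: "f \<in> borel_measurable \<sigma>" "g \<in> borel_measurable \<sigma>"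
    and "\<And>x. x \<in> S \<Longrightarrow> \<bar>f x\<bar> \<le> B" "\<And>x. x \<in> S \<Longrightarrow> \<bar>g x\<bar> \<le> B" for f g :: "real^'n \<Rightarrow> real" and B
  proof (rule integrable_bounded[where B = "B * B"])
    fix x assume "x \<in> S"
    then show "\<bar>f x * g x\<bar> \<le> B * B" unfolding abs_mult using that(3,4)[of x] by (intro mult_mono) auto
  qed measurable
  have pT: "integrable \<sigma> (\<lambda>x. (?p (refl_along v x) - ?p x)\<^sup>2)"
  proof -
    have "?p (refl_along v x) \<in> {0..M}" "?p x \<in> {0..M}" if "x \<in> S" for x
      using pb[of x] pb[of "refl_along v x"] that rpot_nonneg by auto
    then have "\<bar>(?p (refl_along v x) - ?p x)\<^sup>2\<bar> \<le> M\<^sup>2" if "x \<in> S" for x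
      using that by (simp, intro power2_le_iff_abs_le[THEN iffD2]) (fastforce simp: abs_le_iff M)+
    moreover have "(\<lambda>x. ?p (refl_along v x)) \<in> borel_measurable \<sigma>"
      using measurable_compose[OF measurable_orth[OF orthogonal_refl_along] rpot_measurable[OF m0]] .
    ultimately show ?thesis by (intro integrable_bounded[where B = "M\<^sup>2"]) auto
  qed
  define D where "D = (\<integral>x. (?p (refl_along v x) - ?p x)\<^sup>2 \<partial>\<sigma>)"
  \<comment> \<open>The squared distance of \<open>f\<close> and \<open>?p\<close> is twice the
    integral of \<open>f * (f - ?p)\<close> plus the difference of their square integrals. The
    tested inequality bounds the former integral by
    \<open>M * V * (1 - exp (- a * t))\<close>.\<close>
  define Q where "Q t = (\<integral>x. ?p x * ?p x \<partial>\<sigma>) - (\<integral>x. pot \<mu>0 t x * pot \<mu>0 t x \<partial>\<sigma>) + 2 * M * V * (1 - exp (- a * t))" for t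
  have bound: "D \<le> 4 * Q t" if t: "0 < t" for t
  proof -
    obtain L where L: "0 \<le> L" "\<And>x y. x \<in> S \<Longrightarrow> y \<in> S \<Longrightarrow> \<bar>pot \<mu>0 t x - pot \<mu>0 t y\<bar> \<le> L * norm (x - y)"
      using pot_lipschitz[OF m0 t] by blast
    have lp: "lips L (pot \<mu>0 t)" using L by (simp add: lips_def)
    have tb': "\<bar>pot \<mu>0 t x\<bar> \<le> M" if "x \<in> S" for x using tb[OF that t] pot_nonneg[of \<mu>0 t x] by simp
    obtain f where f: "lips L f" "\<And>x. x \<in> S \<Longrightarrow> \<bar>f x\<bar> \<le> M" "zdec e f" "dominates (pot \<mu>0 t) f"
      using rearrangement_exists[OF e lp L(1) tb'] by blast
    have fc: "continuous_on S f" by (rule lips_continuous[OF f(1)])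
    note fm [measurable] = measurable_continuous_on_S[OF fc]
    have fi: "integrable \<sigma> f" by (rule integrable_continuous_on_S[OF fc])
    have cap: "(\<integral>x. (if s < x \<bullet> e then f x - ?p x else 0) \<partial>\<sigma>) \<le> 0" for s
      by (rule cap_comparison[OF m0 t e fc f(2-4) tb[OF _ t] m0 supp P0])
    \<comment> \<open>Adding \<open>M\<close> makes the test function nonnegative; the
      \<open>+ 1\<close> in the bound keeps it positive even if \<open>M = 0\<close>.\<close>
    have "(\<integral>x. (f x + M) * (f x - ?p x) \<partial>\<sigma>) \<le> (2 * M + 1) * 0"
    proof (rule zdec_test[OF e _ _ _ _ _ cap])
      show "integrable \<sigma> (\<lambda>x. f x - ?p x)" using fi rpot_integrable[OF m0] by simp
      show "zdec e (\<lambda>x. f x + M)" using f(3) by (simp add: zdec_def)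
      show "0 \<le> f x + M" "f x + M \<le> 2 * M + 1" if "x \<in> S" for x using f(2)[OF that] by (auto simp: abs_le_iff)
    qed (use M in simp)
    moreover have ifp: "integrable \<sigma> (\<lambda>x. f x * f x)" "integrable \<sigma> (\<lambda>x. f x * ?p x)" "integrable \<sigma> (\<lambda>x. ?p x * ?p x)"
      by (rule prod[where B = M]; use f(2) pb in measurable)+
    have "(\<integral>x. (f x + M) * (f x - ?p x) \<partial>\<sigma>) = (\<integral>x. f x * f x \<partial>\<sigma>) - (\<integral>x. f x * ?p x \<partial>\<sigma>) + M * (\<integral>x. f x - ?p x \<partial>\<sigma>)"
      unfolding distrib_right right_diff_distrib using ifp fi rpot_integrable[OF m0] by (simp add: algebra_simps)
    moreover have "(\<integral>x. f x - ?p x \<partial>\<sigma>) = V * exp (- a * t) - V"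
      using dominatesD1[OF f(4) continuous_on_id] integral_pot[OF m0 t] integral_rpot[OF m0] fi rpot_integrable[OF m0] by simp
    moreover have "(\<integral>x. f x * f x \<partial>\<sigma>) = (\<integral>x. pot \<mu>0 t x * pot \<mu>0 t x \<partial>\<sigma>)"
      by (rule dominatesD1[OF f(4), where h = "\<lambda>u. u * u"]) (intro continuous_intros)
    moreover have "(\<integral>x. (f x - ?p x)\<^sup>2 \<partial>\<sigma>) = (\<integral>x. f x * f x \<partial>\<sigma>) - 2 * (\<integral>x. f x * ?p x \<partial>\<sigma>) + (\<integral>x. ?p x * ?p x \<partial>\<sigma>)"
    proof -
      have "(\<lambda>x. (f x - ?p x)\<^sup>2) = (\<lambda>x. f x * f x - 2 * (f x * ?p x) + ?p x * ?p x)"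
        by (simp add: power2_eq_square algebra_simps)
      then show ?thesis using ifp by simp
    qed
    ultimately have q: "(\<integral>x. (f x - ?p x)\<^sup>2 \<partial>\<sigma>) \<le> Q t" by (simp add: Q_def algebra_simps)
    define h where "h x = (f x - ?p x)\<^sup>2" for x
    have hi: "integrable \<sigma> h"
    proof -
      have "h = (\<lambda>x. f x * f x - 2 * (f x * ?p x) + ?p x * ?p x)"
        by (simp add: fun_eq_iff h_def power2_eq_square algebra_simps)
      then show ?thesis using ifp by simp
    qed
    note hT = integrable_orth[OF orthogonal_refl_along hi, of v] integral_orth[OF orthogonal_refl_along borel_measurable_integrable[OF hi], of v]
    have "D \<le> (\<integral>x. 2 * h (refl_along v x) + 2 * h x \<partial>\<sigma>)"
      unfolding D_def
    proof (rule integral_mono)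
      fix x assume "x \<in> space \<sigma>"
      then have x: "x \<in> S" and x': "refl_along v x \<in> S" by auto
      have "refl_along v x \<bullet> e = x \<bullet> e" using ve by (simp add: refl_along_def inner_diff_left)
      then have ff: "f (refl_along v x) = f x" using zdecD[OF f(3) x x'] zdecD[OF f(3) x' x] by simp
      have "0 \<le> ((f x - ?p (refl_along v x)) + (f x - ?p x))\<^sup>2" by simp
      then show "(?p (refl_along v x) - ?p x)\<^sup>2 \<le> 2 * h (refl_along v x) + 2 * h x"
        unfolding h_def ff by (simp add: power2_eq_square algebra_simps)
    qed (use hT hi pT in auto)
    also have "\<dots> = 4 * (\<integral>x. h x \<partial>\<sigma>)" using hT hi by simp
    also have "\<dots> \<le> 4 * Q t" using q by (simp add: h_def)
    finally show ?thesis .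
  qed
  have Q0: "(\<lambda>n. Q (tau n)) \<longlonglongrightarrow> 0"
  proof -
    have "(\<lambda>n. \<integral>x. pot \<mu>0 (tau n) x * pot \<mu>0 (tau n) x \<partial>\<sigma>) \<longlonglongrightarrow> (\<integral>x. ?p x * ?p x \<partial>\<sigma>)"
    proof (rule integral_dominated_convergence[where w = "\<lambda>_. M * M"])
      show "(\<lambda>x. pot \<mu>0 (tau n) x * pot \<mu>0 (tau n) x) \<in> borel_measurable \<sigma>" for n
        using measurable_continuous_on_S[OF pot_continuous[OF m0 tau_pos]] by simp
      show "AE x in \<sigma>. (\<lambda>n. pot \<mu>0 (tau n) x * pot \<mu>0 (tau n) x) \<longlonglongrightarrow> ?p x * ?p x"
      proof (rule AE_I2)
        fix x assume "x \<in> space \<sigma>"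
        then have x: "x \<in> S" by simp
        have "npot \<mu>0 x \<noteq> \<infinity>" using le_less_trans[OF le[OF x] ennreal_less_top] by auto
        then have "npot \<mu>0 x = ennreal (?p x)" by (simp add: rpot_def less_top)
        then have "(\<lambda>n. pot \<mu>0 (tau n) x) \<longlonglongrightarrow> ?p x"
          using tendsto_enn2real[of "\<lambda>n. ennreal (pot \<mu>0 (tau n) x)" "?p x"] npot_lim(1)[OF m0 x] by (simp add: rpot_nonneg pot_nonneg)
        then show "(\<lambda>n. pot \<mu>0 (tau n) x * pot \<mu>0 (tau n) x) \<longlonglongrightarrow> ?p x * ?p x" by (intro tendsto_mult)
      qed
      show "AE x in \<sigma>. norm (pot \<mu>0 (tau n) x * pot \<mu>0 (tau n) x) \<le> M * M" for n
        by (rule AE_I2) (use tb[OF _ tau_pos] pot_nonneg[of \<mu>0] M in \<open>auto intro!: mult_mono\<close>)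
    qed auto
    then have "(\<lambda>n. Q (tau n)) \<longlonglongrightarrow> (\<integral>x. ?p x * ?p x \<partial>\<sigma>) - (\<integral>x. ?p x * ?p x \<partial>\<sigma>) + 2 * M * V * (1 - exp (- a * 0))"
      unfolding Q_def by (intro tendsto_intros tau_lim)
    then show ?thesis by simp
  qed
  have "D \<le> 4 * 0"
    by (rule LIMSEQ_le_const[OF tendsto_mult_left[OF Q0]]) (use bound[OF tau_pos] in auto)
  moreover have nn: "AE x in \<sigma>. 0 \<le> (?p (refl_along v x) - ?p x)\<^sup>2" by simp
  ultimately have "D = 0" using integral_nonneg_AE[OF nn] by (simp add: D_def)
  then have "AE x in \<sigma>. (?p (refl_along v x) - ?p x)\<^sup>2 = 0"
    using integral_nonneg_eq_0_iff_AE[OF pT nn] by (simp add: D_def)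
  then show "AE x in \<sigma>. ?p (refl_along v x) = ?p x" by eventually_elim simp
qed


subsection \<open>Comparison of the two extremal potentials\<close>

text \<open>At fixed \<open>u\<close> the Laplacian of the kernel with gap \<open>x\<close> is
  \<open>F x\<close>. Passing from time 0 to \<open>t\<close> raises the gap from \<open>D\<close>
  to \<open>D + q\<close>, and \<open>F (D + q) < F D\<close> reduces to an inequality for
  \<open>\<rho>\<close>. Since \<open>a + 2 \<ge> 2\<close>, \<open>\<rho>\<close> is at least the
  square of \<open>1 + q / D\<close>, and the linear part of this square suffices.\<close>

lemma lap_pos:
  assumes t: "0 < t" and u: "- 1 \<le> u" "u < 1"
  shows "0 < lap (\<lambda>u. kap_u 0 u - kap_u t u) (\<lambda>u. kap_uu 0 u - kap_uu t u) u"
proof -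
  define q where "q = 2 * cosh t - 2"
  define D where "D = 2 - 2 * u"
  define \<rho> where "\<rho> = ((D + q) / D) powr (a + 2)"
  define F where "F x = 2 * a * x powr (- a - 2) * (2 * (a + 1) * (1 - u\<^sup>2) - (2 * a + 1) * u * x)" for x
  have q: "0 < q" using gap_pos[of t 1] t by (simp add: q_def)
  have D: "0 < D" using u by (simp add: D_def)
  have F: "(1 - u\<^sup>2) * (4 * a * (a + 1) * x powr (- a - 2)) - (2 * a + 1) * u * (2 * a * x powr (- a - 1)) = F x" if "0 < x" for x
  proof -
    have "1 + (- a - 2) = - a - 1" by simp
    then have "x powr (- a - 1) = x * x powr (- a - 2)" using powr_mult_base[of x "- a - 2"] that by (simp only: less_imp_le)
    then show ?thesis by (simp add: F_def algebra_simps)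
  qed
  have "lap (\<lambda>u. kap_u 0 u - kap_u t u) (\<lambda>u. kap_uu 0 u - kap_uu t u) u = F D - F (D + q)"
    unfolding F[OF D, symmetric] F[OF add_pos_pos[OF D q], symmetric]
    by (simp add: lap_def kap_u_def kap_uu_def D_def q_def algebra_simps)
  moreover have "F (D + q) < F D"
  proof -
    define B where "B = (1 - u) * (2 * a + 2 - 2 * a * u)"
    have "2 * a * u < 2 * a * 1" using u a_pos by (intro mult_strict_left_mono) auto
    then have "0 < 2 * a + 2 - 2 * a * u" by linarith
    then have B: "0 < B" unfolding B_def using u by simp
    have eqB: "2 * (a + 1) * (1 - u\<^sup>2) - (2 * a + 1) * u * D = B"
      by (simp add: B_def D_def power2_eq_square algebra_simps)
    have "1 + 2 * (q / D) \<le> (1 + q / D)\<^sup>2" by (simp add: power2_eq_square algebra_simps)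
    also have "\<dots> = ((D + q) / D) powr 2" using D q by (simp add: add_divide_distrib)
    also have "\<dots> \<le> \<rho>" unfolding \<rho>_def using D q a_pos by (intro powr_mono) auto
    finally have "(1 + 2 * (q / D)) * B \<le> \<rho> * B" using B by (simp add: mult_right_mono)
    then have h1: "B + 2 * (q / D * B) \<le> \<rho> * B" by (simp only: distrib_right mult_1 mult.assoc)
    have h2: "q / D * B = q * (a + 1 - a * u)"
      using u unfolding B_def D_def by (simp add: field_simps)
    have "- ((2 * a + 1) * u * q) < 2 * (q * (a + 1 - a * u))"
    proof -
      have "0 < q * (2 * a + 2 + u)" using q a_pos u by simp
      then show ?thesis by (simp add: algebra_simps)
    qed
    with h1 have "B - (2 * a + 1) * u * q < \<rho> * B" unfolding h2 by linarith
    then have "(D + q) powr (- a - 2) * (B - (2 * a + 1) * u * q) < (D + q) powr (- a - 2) * (\<rho> * B)"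
      using D q by (intro mult_strict_left_mono) auto
    also have "(D + q) powr (- a - 2) * (\<rho> * B) = D powr (- a - 2) * B"
    proof -
      have "(D + q) powr (- a - 2) * \<rho> = D powr (- a - 2)"
        unfolding \<rho>_def using D q by (simp add: powr_divide powr_minus powr_diff powr_add field_simps)
      then show ?thesis by (simp flip: mult.assoc)
    qed
    finally have "2 * a * ((D + q) powr (- a - 2) * (B - (2 * a + 1) * u * q)) < 2 * a * (D powr (- a - 2) * B)"
      using a_pos by simp
    then show ?thesis unfolding F_def eqB[symmetric] by (simp add: algebra_simps)
  qed
  ultimately show ?thesis by simp
qed

lemma cap_separation:
  assumes "x \<in> S" "y \<in> S" "e \<in> S" "x \<bullet> e \<le> s" "c \<le> y \<bullet> e" "s \<le> c"
  shows "x \<bullet> y \<le> 1 - (c - s)\<^sup>2 / 2"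
proof -
  have "c - s \<le> (y - x) \<bullet> e" using assms by (simp add: inner_diff_left)
  also have "\<dots> \<le> norm (x - y)" using norm_cauchy_schwarz[of "y - x" e] assms by (simp add: norm_minus_commute)
  finally have "(c - s)\<^sup>2 \<le> (norm (x - y))\<^sup>2" using assms by (intro power_mono) auto
  then show ?thesis using dist_sq[OF assms(1,2)] by linarith
qed

text \<open>The kernel \<open>kap 0 - kap t\<close> is strictly subharmonic on the sphere away from the diagonal, so
  \<open>kd t w\<close> attains its maximum over a cap disjoint from the support of \<open>w\<close> on the boundary.\<close>

lemma kd_cap_antimono:
  assumes e: "e \<in> S" and t: "0 < t"
    and w: "w \<in> borel_measurable \<sigma>" "\<And>x. x \<in> S \<Longrightarrow> 0 \<le> w x" "\<And>x. x \<in> S \<Longrightarrow> w x \<le> 1"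
    and ws: "\<And>x. x \<in> S \<Longrightarrow> w x \<noteq> 0 \<Longrightarrow> x \<bullet> e \<le> s"
    and zon: "\<And>x y. x \<in> S \<Longrightarrow> y \<in> S \<Longrightarrow> x \<bullet> e = y \<bullet> e \<Longrightarrow> kd t w x = kd t w y"
    and y: "y1 \<in> S" "y2 \<in> S" "s < y1 \<bullet> e" "y1 \<bullet> e \<le> y2 \<bullet> e"
  shows "kd t w y2 \<le> kd t w y1"
proof -
  define c where "c = y1 \<bullet> e"
  define \<eta> where "\<eta> = (c - s)\<^sup>2 / 2"
  have \<eta>: "0 < \<eta>" using y by (simp add: \<eta>_def c_def)
  \<comment> \<open>The range of \<open>x \<bullet> y\<close> for \<open>x\<close> in the support of
    \<open>w\<close> and \<open>y\<close> in the closed cap \<open>K\<close>. It stays away from 1,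
    so all derivatives of the kernel at time 0 are bounded on it.\<close>
  define U where "U = {- 1..1 - \<eta>}"
  define K where "K = {y \<in> S. c \<le> y \<bullet> e}"
  define \<phi> where "\<phi> u = kap 0 u - kap t u" for u
  define \<phi>' where "\<phi>' u = kap_u 0 u - kap_u t u" for u
  define \<phi>'' where "\<phi>'' u = kap_uu 0 u - kap_uu t u" for u
  note [measurable] = w(1)
  have U1: "u < 1" if "u \<in> U" for u using that \<eta> by (simp add: U_def)
  have gap: "0 < 2 * cosh 0 - 2 * u" "0 < 2 * cosh t - 2 * u" if "u \<in> U" for u
    using U1[OF that] gap_pos[of t u] t by auto
  have d1: "(\<phi> has_real_derivative \<phi>' u) (at u)" if "u \<in> U" for u
    unfolding \<phi>_def \<phi>'_def by (intro DERIV_diff kap_deriv_u gap that)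
  have d2: "(\<phi>' has_real_derivative \<phi>'' u) (at u)" if "u \<in> U" for u
    unfolding \<phi>'_def \<phi>''_def by (intro DERIV_diff kap_deriv_uu gap that)
  have d3: "isCont \<phi>'' u" if "u \<in> U" for u
    unfolding \<phi>''_def kap_uu_def using gap[OF that] by (intro continuous_intros) auto
  have cont: "continuous_on U \<phi>" "continuous_on U \<phi>'" "continuous_on U \<phi>''"
    using d1 d2 d3 DERIV_isCont by (blast intro: continuous_at_imp_continuous_on)+
  have bd: "\<exists>B. \<forall>u\<in>U. \<bar>q u\<bar> \<le> B" if "continuous_on U q" for q :: "real \<Rightarrow> real"
  proof -
    have "bounded (q ` U)" unfolding U_def by (intro compact_imp_bounded compact_continuous_image) (use that in \<open>auto simp: U_def\<close>)
    then show ?thesis unfolding bounded_iff by auto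
  qed
  obtain B0 B1 B2 where B: "\<And>u. u \<in> U \<Longrightarrow> \<bar>\<phi> u\<bar> \<le> B0" "\<And>u. u \<in> U \<Longrightarrow> \<bar>\<phi>' u\<bar> \<le> B1" "\<And>u. u \<in> U \<Longrightarrow> \<bar>\<phi>'' u\<bar> \<le> B2"
    using bd[OF cont(1)] bd[OF cont(2)] bd[OF cont(3)] by metis
  have inU: "x \<bullet> y \<in> U" if "x \<in> S" "w x \<noteq> 0" "y \<in> K" for x y
    using cap_separation[of x y e s c] abs_inner_le_1[of x y] ws[of x] that e y by (auto simp: U_def K_def \<eta>_def c_def abs_le_iff)
  have wb: "\<bar>w x * q\<bar> \<le> \<bar>B\<bar>" if "x \<in> S" "w x \<noteq> 0 \<Longrightarrow> \<bar>q\<bar> \<le> B" for x q B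
    using that w(2,3)[of x] mult_mono[of "w x" 1 "\<bar>q\<bar>" "\<bar>B\<bar>"] by (cases "w x = 0") (auto simp: abs_mult)
  have kd: "kd t w z = (\<integral>x. w x * \<phi> (x \<bullet> z) \<partial>\<sigma>)" for z by (simp add: kd_def \<phi>_def)
  have phim [measurable]: "\<phi> \<in> borel_measurable borel" unfolding \<phi>_def by measurable
  have Wc: "continuous_on K (kd t w)"
    unfolding continuous_on_sequentially comp_def kd
  proof (intro allI ballI impI)
    fix X z assume *: "z \<in> K" "(\<forall>n. X n \<in> K) \<and> X \<longlonglongrightarrow> z"
    show "(\<lambda>n. \<integral>x. w x * \<phi> (x \<bullet> X n) \<partial>\<sigma>) \<longlonglongrightarrow> (\<integral>x. w x * \<phi> (x \<bullet> z) \<partial>\<sigma>)"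
    proof (rule integral_dominated_convergence[where w = "\<lambda>_. \<bar>B0\<bar>"])
      show "AE x in \<sigma>. (\<lambda>n. w x * \<phi> (x \<bullet> X n)) \<longlonglongrightarrow> w x * \<phi> (x \<bullet> z)"
      proof (rule AE_I2)
        fix x assume "x \<in> space \<sigma>"
        then have x: "x \<in> S" by simp
        show "(\<lambda>n. w x * \<phi> (x \<bullet> X n)) \<longlonglongrightarrow> w x * \<phi> (x \<bullet> z)"
        proof (cases "w x = 0")
          case False
          have "isCont \<phi> (x \<bullet> z)" by (rule DERIV_isCont[OF d1[OF inU[OF x False *(1)]]])
          moreover have "(\<lambda>n. x \<bullet> X n) \<longlonglongrightarrow> x \<bullet> z" using * by (intro tendsto_intros) auto
          ultimately show ?thesis by (intro tendsto_mult tendsto_const) (rule isCont_tendsto_compose)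
        qed simp
      qed
      show "AE x in \<sigma>. norm (w x * \<phi> (x \<bullet> X n)) \<le> \<bar>B0\<bar>" for n
        unfolding real_norm_def by (rule AE_I2, rule wb) (use B(1) inU * in auto)
    qed auto
  qed
  have "compact K"
  proof -
    have "K = S \<inter> {y. c \<le> y \<bullet> e}" by (auto simp: K_def)
    moreover have "closed {y. c \<le> y \<bullet> e}" by (intro closed_Collect_le continuous_intros)
    ultimately show ?thesis by (simp add: compact_Int_closed)
  qed
  moreover have y1K: "y1 \<in> K" "y2 \<in> K" using y by (auto simp: K_def c_def)
  ultimately obtain z where z: "z \<in> K" "\<And>y. y \<in> K \<Longrightarrow> kd t w y \<le> kd t w z"
    using continuous_attains_sup[OF _ _ Wc] by blast
  have zS: "z \<in> S" using z by (simp add: K_def)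
  show ?thesis
  proof (cases "z \<bullet> e = c")
    case True
    \<comment> \<open>A maximum on the boundary ring has the value taken at \<open>y1\<close>, since
      \<open>kd t w\<close> is constant on rings.\<close>
    then show ?thesis using zon[OF zS y(1)] z(2)[OF y1K(2)] by (simp add: c_def)
  next
    case False
    then have zc: "c < z \<bullet> e" using z by (simp add: K_def)
    \<comment> \<open>A small rotation in any coordinate plane keeps the interior maximum point
      \<open>z\<close> inside the cap, so second differences of \<open>kd t w\<close> at
      \<open>z\<close> are not positive; the bounds on \<open>U\<close> allow passing to the limit
      under the integral.\<close>
    have pair: "(\<integral>x. w x * (\<phi>'' (x \<bullet> z) * (rot_B x z i j)\<^sup>2 - \<phi>' (x \<bullet> z) * rot_A x z i j) \<partial>\<sigma>) \<le> 0" (is ?L)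
      "integrable \<sigma> (\<lambda>x. w x * (\<phi>'' (x \<bullet> z) * (rot_B x z i j)\<^sup>2 - \<phi>' (x \<bullet> z) * rot_A x z i j))" (is ?I)
      if ij: "i \<noteq> j" for i j
    proof -
      have "isCont (\<lambda>\<theta>. rot i j \<theta> z \<bullet> e) 0" unfolding rot_def by (intro continuous_intros)
      then have "((\<lambda>\<theta>. rot i j \<theta> z \<bullet> e) \<longlongrightarrow> z \<bullet> e) (nhds 0)"
        unfolding isCont_def using tendsto_at_iff_tendsto_nhds[of "\<lambda>\<theta>. rot i j \<theta> z \<bullet> e" 0] by (simp add: rot_zero)
      from order_tendstoD(1)[OF this zc] have "\<forall>\<^sub>F \<theta> in nhds 0. c < rot i j \<theta> z \<bullet> e" .
      then obtain \<delta> where \<delta>: "0 < \<delta>" "\<And>\<theta>. \<bar>\<theta>\<bar> < \<delta> \<Longrightarrow> c < rot i j \<theta> z \<bullet> e"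
        unfolding eventually_nhds_metric by auto
      have rK: "rot i j \<theta> z \<in> K" if "\<bar>\<theta>\<bar> < \<delta>" for \<theta>
        using \<delta>(2)[OF that] rot_in_S[OF ij zS] by (simp add: K_def)
      define X where "X n = \<delta> / 2 * tau n" for n
      have X: "0 < X n" "X n \<le> \<delta> / 2" for n using \<delta> tau_pos[of n] by (auto simp: X_def tau_def field_simps)
      have X0: "X \<longlonglongrightarrow> 0" using tendsto_mult_left[OF tau_lim, of "\<delta> / 2"] by (simp add: X_def[abs_def])
      have mem: "x \<bullet> rot i j \<theta> z \<in> U" if "\<bar>\<theta>\<bar> \<le> \<delta> / 2" "x \<in> S" "w x \<noteq> 0" for \<theta> x
        using inU[OF that(2,3) rK[of \<theta>]] that \<delta>(1) by simp
      define G where "G x = w x * (\<phi>'' (x \<bullet> z) * (rot_B x z i j)\<^sup>2 - \<phi>' (x \<bullet> z) * rot_A x z i j)" for x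
      define Q where "Q n x = w x * sdiff i j \<phi> (X n) x z" for n x
      have Qm [measurable]: "Q n \<in> borel_measurable \<sigma>" for n unfolding Q_def sdiff_def by measurable
      have Gl: "AE x in \<sigma>. (\<lambda>n. Q n x) \<longlonglongrightarrow> G x"
      proof (rule AE_I2)
        fix x assume "x \<in> space \<sigma>"
        then have x: "x \<in> S" by simp
        show "(\<lambda>n. Q n x) \<longlonglongrightarrow> G x"
        proof (cases "w x = 0")
          case False
          have "(\<lambda>n. sdiff i j \<phi> (X n) x z) \<longlonglongrightarrow> \<phi>'' (x \<bullet> z) * (rot_B x z i j)\<^sup>2 - \<phi>' (x \<bullet> z) * rot_A x z i j"
            by (rule sdiff_limit[where \<delta> = "\<delta> / 2" and U = U]) (use mem[OF _ x False] x zS d1 d2 d3 X X0 \<delta> in auto)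
          then show ?thesis unfolding Q_def G_def by (intro tendsto_mult tendsto_const)
        qed (simp add: Q_def G_def)
      qed
      have [measurable]: "\<phi>' \<in> borel_measurable borel" "\<phi>'' \<in> borel_measurable borel"
        unfolding \<phi>'_def \<phi>''_def kap_u_def kap_uu_def by measurable
      have [measurable]: "(\<lambda>x. x $ l) \<in> borel_measurable \<sigma>" for l
        by (intro measurable_continuous_on_S continuous_intros)
      have Gm: "G \<in> borel_measurable \<sigma>" unfolding G_def rot_A_def rot_B_def by measurable
      have dom: "AE x in \<sigma>. norm (Q n x) \<le> \<bar>20 * max B1 B2\<bar>" for n
      proof (rule AE_I2)
        fix x assume "x \<in> space \<sigma>"
        then have x: "x \<in> S" by simp
        show "norm (Q n x) \<le> \<bar>20 * max B1 B2\<bar>"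
          unfolding Q_def real_norm_def
        proof (rule wb[OF x])
          assume wx: "w x \<noteq> 0"
          show "\<bar>sdiff i j \<phi> (X n) x z\<bar> \<le> 20 * max B1 B2"
          proof (rule sdiff_bound[where U = U and \<phi>' = \<phi>' and \<phi>'' = \<phi>''])
            show "x \<bullet> rot i j \<theta> z \<in> U" if "\<bar>\<theta>\<bar> \<le> X n" for \<theta> using mem[OF _ x wx] that X(2)[of n] by simp
          qed (use x zS d1 d2 X B in \<open>auto simp: le_max_iff_disj\<close>)
        qed
      qed
      show ?I unfolding G_def[symmetric]
        by (rule integrable_dominated_convergence[OF Gm Qm _ Gl dom]) simp
      have lim: "(\<lambda>n. \<integral>x. Q n x \<partial>\<sigma>) \<longlonglongrightarrow> (\<integral>x. G x \<partial>\<sigma>)"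
        by (rule integral_dominated_convergence[OF Gm Qm _ Gl dom]) simp
      have "(\<integral>x. Q n x \<partial>\<sigma>) \<le> 0" for n
      proof -
        have i: "integrable \<sigma> (\<lambda>x. w x * \<phi> (x \<bullet> y))" if "y \<in> S" for y
          using kd_integrable(3)[OF t that w] by (simp add: \<phi>_def)
        have rS: "rot i j \<theta> z \<in> S" for \<theta> by (rule rot_in_S[OF ij zS])
        have "(\<integral>x. Q n x \<partial>\<sigma>) = (\<integral>x. (w x * \<phi> (x \<bullet> rot i j (X n) z) + w x * \<phi> (x \<bullet> rot i j (- X n) z) - 2 * (w x * \<phi> (x \<bullet> z))) / (X n)\<^sup>2 \<partial>\<sigma>)"
          by (rule Bochner_Integration.integral_cong) (simp_all add: Q_def sdiff_def algebra_simps)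
        also have "\<dots> = (kd t w (rot i j (X n) z) + kd t w (rot i j (- X n) z) - 2 * kd t w z) / (X n)\<^sup>2"
          unfolding kd using i[OF rS] i[OF zS] by simp
        also have "\<dots> \<le> 0"
          using z(2)[OF rK[of "X n"]] z(2)[OF rK[of "- X n"]] X[of n] \<delta>(1) by (intro divide_nonpos_nonneg) auto
        finally show ?thesis .
      qed
      then show ?L unfolding G_def[symmetric] by (intro LIMSEQ_le_const2[OF lim]) auto
    qed
    let ?P = "{(i :: 'n, j). i \<noteq> j}"
    let ?g = "\<lambda>x i j. w x * (\<phi>'' (x \<bullet> z) * (rot_B x z i j)\<^sup>2 - \<phi>' (x \<bullet> z) * rot_A x z i j)"
    have sum: "(\<Sum>(i, j)\<in>?P. ?g x i j) = w x * (2 * lap \<phi>' \<phi>'' (x \<bullet> z))" if "x \<in> S" for x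
      unfolding sum_sdiff_limit[OF that zS, symmetric] by (simp add: sum_distrib_left case_prod_beta)
    have ie: "integrable \<sigma> (\<lambda>x. \<Sum>(i, j)\<in>?P. ?g x i j)"
      by (rule Bochner_Integration.integrable_sum) (use pair(2) in auto)
    have "(\<integral>x. (\<Sum>(i, j)\<in>?P. ?g x i j) \<partial>\<sigma>) = (\<Sum>p\<in>?P. \<integral>x. (case p of (i, j) \<Rightarrow> ?g x i j) \<partial>\<sigma>)"
      by (rule Bochner_Integration.integral_sum) (use pair(2) in auto)
    also have "\<dots> \<le> 0" by (rule sum_nonpos) (use pair(1) in auto)
    finally have I: "(\<integral>x. (\<Sum>(i, j)\<in>?P. ?g x i j) \<partial>\<sigma>) \<le> 0" .
    have lp: "0 < lap \<phi>' \<phi>'' (x \<bullet> z)" if "x \<in> S" "w x \<noteq> 0" for x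
      using lap_pos[OF t, of "x \<bullet> z"] inU[OF that z(1)] U1[OF inU[OF that z(1)]]
      unfolding \<phi>'_def[abs_def] \<phi>''_def[abs_def] by (simp add: U_def)
    have nn: "AE x in \<sigma>. 0 \<le> (\<Sum>(i, j)\<in>?P. ?g x i j)"
    proof (rule AE_I2)
      fix x assume "x \<in> space \<sigma>"
      then have x: "x \<in> S" by simp
      show "0 \<le> (\<Sum>(i, j)\<in>?P. ?g x i j)"
        unfolding sum[OF x] using w(2)[OF x] lp[OF x] by (cases "w x = 0") auto
    qed
    have "(\<integral>x. (\<Sum>(i, j)\<in>?P. ?g x i j) \<partial>\<sigma>) = 0" using I integral_nonneg_AE[OF nn] by simp
    then have "AE x in \<sigma>. (\<Sum>(i, j)\<in>?P. ?g x i j) = 0" using integral_nonneg_eq_0_iff_AE[OF ie nn] by simp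
    \<comment> \<open>The spherical Laplacian at \<open>z\<close>, an integral of \<open>w\<close>
      against a strictly positive function, is not positive. Hence \<open>w\<close> vanishes almost
      everywhere and \<open>kd t w\<close> is identically zero.\<close>
    then have w0: "AE x in \<sigma>. w x = 0"
      using AE_space
    proof eventually_elim
      case (elim x)
      then have x: "x \<in> S" by simp
      show ?case using elim(1) lp[OF x] unfolding sum[OF x] by fastforce
    qed
    have "kd t w y = 0" for y
      unfolding kd by (rule integral_eq_zero_AE) (use w0 in eventually_elim, simp)
    then show ?thesis by simp
  qed
qed

end

section \<open>The maximum principle integrated over \<open>s\<close>\<close>

lemma exp_second_order: "((\<lambda>t. (t + exp (- c * t) / c - 1 / c) / t\<^sup>2) \<longlongrightarrow> c / 2) (at_right 0)" if "0 < c" for c :: real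
proof -
  have "((\<lambda>x. (x + exp (- x) - 1) / x\<^sup>2) \<longlongrightarrow> 1 / 2) (at_right (0::real))" by real_asymp
  moreover have "filterlim (\<lambda>t. c * t) (at_right 0) (at_right 0)" using that by real_asymp
  ultimately have "((\<lambda>t. c * ((c * t + exp (- (c * t)) - 1) / (c * t)\<^sup>2)) \<longlongrightarrow> c * (1 / 2)) (at_right 0)"
    by (intro tendsto_mult_left) (rule filterlim_compose)
  moreover have "c * ((c * t + exp (- (c * t)) - 1) / (c * t)\<^sup>2) = (t + exp (- c * t) / c - 1 / c) / t\<^sup>2" for t
    using that by (cases "t = 0") (simp_all add: field_simps power2_eq_square)
  ultimately show ?thesis by simp
qed

context sphere_space
begin

lemma weighted_kap_deriv:
  assumes s: "0 < s" and y: "y \<in> S" and w: "w \<in> borel_measurable \<sigma>" "\<And>x. x \<in> S \<Longrightarrow> 0 \<le> w x" "\<And>x. x \<in> S \<Longrightarrow> w x \<le> 1"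
  shows "((\<lambda>s. \<integral>x. w x * kap s (x \<bullet> y) \<partial>\<sigma>) has_real_derivative - a * V * R s w y) (at s)"
proof -
  note [measurable] = w(1)
  have wa: "\<bar>w x\<bar> \<le> 1" if "x \<in> S" for x using w(2,3)[OF that] by simp
  have sub: "{s / 2..2 * s} \<times> {- 1..1} \<subseteq> {s / 2..} \<times> {..1}" by auto
  have "0 < s / 2" using s by simp
  note c = continuous_on_subset[OF poi_cont[OF this] sub]
  have "compact ({s / 2..2 * s} \<times> {- 1..1::real})" by (rule compact_Times) auto
  from compact_imp_bounded[OF compact_continuous_image[OF c this]]
  obtain C where C: "\<And>p. p \<in> (\<lambda>(t, u). poi t u) ` ({s / 2..2 * s} \<times> {- 1..1}) \<Longrightarrow> norm p \<le> C"
    unfolding bounded_iff by blast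
  have bd: "\<bar>poi t u\<bar> \<le> C" if "t \<in> {s / 2..2 * s}" "\<bar>u\<bar> \<le> 1" for t u
    using C[of "poi t u"] that by (force simp: abs_le_iff)
  have "((\<lambda>s. \<integral>x. w x * kap s (x \<bullet> y) \<partial>\<sigma>) has_real_derivative (\<integral>x. w x * (- a * poi s (x \<bullet> y)) \<partial>\<sigma>)) (at s)"
  proof (rule deriv_integral_dominated[where c = "s / 2" and d = "2 * s" and f' = "\<lambda>t x. w x * (- a * poi t (x \<bullet> y))" and w = "\<lambda>_. a * C"])
    show "integrable \<sigma> (\<lambda>x. w x * kap t (x \<bullet> y))" if "t \<in> {s / 2..2 * s}" for t
      by (rule kd_integrable(2)[OF _ y w]) (use that s in auto)
    show "((\<lambda>t. w x * kap t (x \<bullet> y)) has_real_derivative w x * (- a * poi t (x \<bullet> y))) (at t)" if "t \<in> {s / 2..2 * s}" "x \<in> space \<sigma>" for t x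
      by (intro DERIV_cmult kap_deriv_t) (use that s inner_le_1[of x y] y in auto)
    show "\<bar>w x * (- a * poi t (x \<bullet> y))\<bar> \<le> a * C" if "t \<in> {s / 2..2 * s}" "x \<in> space \<sigma>" for t x
    proof -
      have "\<bar>w x\<bar> * \<bar>a * poi t (x \<bullet> y)\<bar> \<le> 1 * (a * C)"
        using wa[of x] bd[OF that(1), of "x \<bullet> y"] abs_inner_le_1[of x y] a_pos that(2) y
        by (intro mult_mono) (auto simp: abs_mult)
      then show ?thesis by (simp add: abs_mult)
    qed
  qed (use s in auto)
  moreover have "(\<integral>x. w x * (- a * poi s (x \<bullet> y)) \<partial>\<sigma>) = - a * V * R s w y"
  proof -
    have "(\<lambda>x. w x * (- a * poi s (x \<bullet> y))) = (\<lambda>x. - a * (poi s (y \<bullet> x) * w x))"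
      by (simp add: fun_eq_iff inner_commute mult_ac)
    then show ?thesis using V_pos by (simp add: R_def)
  qed
  ultimately show ?thesis by simp
qed

text \<open>The weighted kernel \<open>q s\<close> has the derivative
  \<open>- a * V * R s w\<close>, so integrating the hypothesis from 0 to \<open>t\<close> replaces
  \<open>R s w\<close> by a multiple of \<open>kd t w\<close>, whose contribution is not positive.
  What remains is \<open>U\<close> times a quantity of order \<open>t\<^sup>2\<close> on the left
  against \<open>B * t ^ 3 / 3\<close> on the right.\<close>

lemma integrated_inequality:
  assumes g: "integrable \<sigma> g" and w: "w \<in> borel_measurable \<sigma>" "\<And>x. x \<in> S \<Longrightarrow> 0 \<le> w x" "\<And>x. x \<in> S \<Longrightarrow> w x \<le> 1"
    and ineq: "\<And>s. 0 < s \<Longrightarrow> s \<le> 1 \<Longrightarrow> (1 - exp (- a * s)) * U \<le> B * s\<^sup>2 + (\<integral>x. R s w x * g x \<partial>\<sigma>)"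
    and kd: "\<And>t. 0 < t \<Longrightarrow> t \<le> 1 \<Longrightarrow> (\<integral>x. kd t w x * g x \<partial>\<sigma>) \<le> 0"
  shows "U \<le> 0"
proof -
  note [measurable] = w(1) borel_measurable_integrable[OF g]
  define q where "q s y = (\<integral>x. w x * kap s (x \<bullet> y) \<partial>\<sigma>)" for s y
  define \<Psi> where "\<Psi> s = (\<integral>y. q s y * g y \<partial>\<sigma>)" for s
  have qm [measurable]: "q s \<in> borel_measurable \<sigma>" for s unfolding q_def by measurable
  have wa: "\<bar>w x\<bar> \<le> 1" if "x \<in> S" for x using w(2,3)[OF that] by simp
  have q0: "0 \<le> q s y" for s y unfolding q_def by (intro integral_nonneg_AE AE_I2) (use w kap_nonneg in auto)
  have qd: "kd s w y = q 0 y - q s y" if "0 < s" "y \<in> S" for s y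
    unfolding q_def by (rule kd_integrable(4)[OF that w])
  have qV: "q 0 y \<le> V" if "y \<in> S" for y
  proof -
    have "q 0 y \<le> (\<integral>x. kap 0 (x \<bullet> y) \<partial>\<sigma>)" unfolding q_def
      by (rule integral_mono[OF kd_integrable(1)[OF zero_less_one that w] kap_0_integrable(1)[OF that]])
         (use w kap_nonneg in \<open>auto intro: mult_left_le_one_le\<close>)
    then show ?thesis using kap_0_integrable(2)[OF that] by simp
  qed
  have qb: "\<bar>q s y\<bar> \<le> V" if "0 \<le> s" "y \<in> S" for s y
    using qd[of s y] kd_nonneg[of s y w] q0[of s y] qV[OF that(2)] that w(2) by (cases "s = 0") auto
  have qi: "integrable \<sigma> (\<lambda>y. q s y * g y)" if "0 \<le> s" for s
    by (rule integrable_mult_bounded[OF g qm qb[OF that]])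
  have dif: "\<Psi> 0 - \<Psi> s = (\<integral>y. kd s w y * g y \<partial>\<sigma>)" if s: "0 < s" for s
  proof -
    have "\<Psi> 0 - \<Psi> s = (\<integral>y. q 0 y * g y - q s y * g y \<partial>\<sigma>)"
      unfolding \<Psi>_def using qi[of 0] qi[of s] s by simp
    also have "\<dots> = (\<integral>y. kd s w y * g y \<partial>\<sigma>)"
      by (rule Bochner_Integration.integral_cong) (simp_all add: qd[OF s] left_diff_distrib)
    finally show ?thesis .
  qed
  have Rb: "\<bar>R s w y\<bar> \<le> 1" if "0 < s" "y \<in> S" for s y by (rule R_abs_bound[OF that w(1) wa])
  have d\<Psi>: "(\<Psi> has_real_derivative - a * V * (\<integral>x. R s w x * g x \<partial>\<sigma>)) (at s)" if s: "0 < s" for s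
  proof -
    have "(\<Psi> has_real_derivative (\<integral>y. (- a * V * R s w y) * g y \<partial>\<sigma>)) (at s)"
      unfolding \<Psi>_def[abs_def]
    proof (rule deriv_integral_dominated[where c = "s / 2" and d = "2 * s" and f' = "\<lambda>t y. (- a * V * R t w y) * g y" and w = "\<lambda>y. a * V * \<bar>g y\<bar>"])
      show "integrable \<sigma> (\<lambda>y. q t y * g y)" if "t \<in> {s / 2..2 * s}" for t by (rule qi) (use that s in auto)
      show "((\<lambda>t. q t y * g y) has_real_derivative - a * V * R t w y * g y) (at t)" if "t \<in> {s / 2..2 * s}" "y \<in> space \<sigma>" for t y
        unfolding q_def by (intro DERIV_cmult_right weighted_kap_deriv w) (use that s in auto)
      show "\<bar>- a * V * R t w y * g y\<bar> \<le> a * V * \<bar>g y\<bar>" if "t \<in> {s / 2..2 * s}" "y \<in> space \<sigma>" for t y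
      proof -
        have "\<bar>R t w y\<bar> * (a * V * \<bar>g y\<bar>) \<le> 1 * (a * V * \<bar>g y\<bar>)"
          using Rb[of t y] that s a_pos V_pos by (intro mult_right_mono) auto
        then show ?thesis using a_pos V_pos by (simp add: abs_mult mult_ac)
      qed
    qed (use s g in auto)
    then show ?thesis by (simp add: mult.assoc)
  qed
  \<comment> \<open>An antiderivative of the left side minus the right side of \<open>ineq\<close>;
    the hypothesis says that it does not increase.\<close>
  define \<Theta> where "\<Theta> s = U * (s + exp (- a * s) / a) + \<Psi> s / (a * V) - B * s ^ 3 / 3" for s
  have d\<Theta>: "(\<Theta> has_real_derivative U * (1 - exp (- a * s)) - (\<integral>x. R s w x * g x \<partial>\<sigma>) - B * s\<^sup>2) (at s)" if s: "0 < s" for s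
  proof -
    have p1: "((\<lambda>s. U * (s + exp (- a * s) / a)) has_real_derivative U * (1 - exp (- a * s))) (at s)"
      using a_pos by (auto intro!: derivative_eq_intros)
    have p3: "((\<lambda>s. B * s ^ 3 / 3) has_real_derivative B * s\<^sup>2) (at s)"
      by (auto intro!: derivative_eq_intros)
    show ?thesis
      unfolding \<Theta>_def[abs_def]
      using DERIV_diff[OF DERIV_add[OF p1 DERIV_cdivide[OF d\<Psi>[OF s], of "a * V"]] p3] a_pos V_pos by simp
  qed
  have mon: "\<Theta> t \<le> \<Theta> s" if "0 < s" "s \<le> t" "t \<le> 1" for s t
  proof (rule DERIV_nonpos_imp_nonincreasing[OF that(2)])
    fix x assume "s \<le> x" "x \<le> t"
    then show "\<exists>y. (\<Theta> has_real_derivative y) (at x) \<and> y \<le> 0"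
      using d\<Theta>[of x] ineq[of x] that by (intro exI conjI) (auto simp: algebra_simps)
  qed
  \<comment> \<open>\<open>\<Psi>\<close> is differentiated for \<open>s > 0\<close> only. Its value
    at 0 is reached as a limit, because \<open>kd s w\<close> is at most
    \<open>V * (1 - exp (- a * s))\<close>.\<close>
  have t0: "(\<lambda>n. \<Psi> (t * tau n)) \<longlonglongrightarrow> \<Psi> 0" if t: "0 < t" for t
  proof -
    have b: "\<bar>\<Psi> s - \<Psi> 0\<bar> \<le> V * (1 - exp (- a * s)) * (\<integral>y. \<bar>g y\<bar> \<partial>\<sigma>)" if s: "0 < s" for s
    proof -
      have kb: "\<bar>kd s w y\<bar> \<le> V * (1 - exp (- a * s))" if y: "y \<in> S" for y
      proof -
        have "kd s w y \<le> kd s (\<lambda>_. 1) y"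
          by (rule kd_mono[OF s y kd_integrable(3)[OF s y w] kd_integrable(3)[OF s y, of _ 1]]) (use w in auto)
        then show ?thesis using kd_nonneg[OF s y w(2)] kd_one[OF s y] by simp
      qed
      have "\<bar>\<Psi> 0 - \<Psi> s\<bar> \<le> (\<integral>y. \<bar>kd s w y * g y\<bar> \<partial>\<sigma>)" unfolding dif[OF s] by (rule integral_abs_bound)
      also have "\<dots> \<le> (\<integral>y. V * (1 - exp (- a * s)) * \<bar>g y\<bar> \<partial>\<sigma>)"
      proof (rule integral_mono')
        show "integrable \<sigma> (\<lambda>y. V * (1 - exp (- a * s)) * \<bar>g y\<bar>)" using g by simp
        show "\<bar>kd s w y * g y\<bar> \<le> V * (1 - exp (- a * s)) * \<bar>g y\<bar>" if "y \<in> space \<sigma>" for y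
          using kb[of y] that by (auto simp: abs_mult intro!: mult_right_mono)
      qed (use V_pos a_pos s in auto)
      finally show ?thesis by (simp add: abs_minus_commute)
    qed
    have "(\<lambda>n. V * (1 - exp (- a * (t * tau n))) * (\<integral>y. \<bar>g y\<bar> \<partial>\<sigma>)) \<longlonglongrightarrow> V * (1 - exp (- a * (t * 0))) * (\<integral>y. \<bar>g y\<bar> \<partial>\<sigma>)"
      by (intro tendsto_intros tau_lim)
    then have z: "(\<lambda>n. V * (1 - exp (- a * (t * tau n))) * (\<integral>y. \<bar>g y\<bar> \<partial>\<sigma>)) \<longlonglongrightarrow> 0" by simp
    have "norm (\<Psi> (t * tau n) - \<Psi> 0) \<le> V * (1 - exp (- a * (t * tau n))) * (\<integral>y. \<bar>g y\<bar> \<partial>\<sigma>)" for n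
      using b[of "t * tau n"] t tau_pos[of n] by simp
    then have "(\<lambda>n. \<Psi> (t * tau n) - \<Psi> 0) \<longlonglongrightarrow> 0"
      by (intro Lim_null_comparison[OF _ z] always_eventually allI)
    then show ?thesis by (simp add: LIM_zero_iff)
  qed
  have key: "U * (t + exp (- a * t) / a - 1 / a) \<le> B * t ^ 3 / 3" if t: "0 < t" "t \<le> 1" for t
  proof -
    have "(\<lambda>n. \<Theta> (t * tau n)) \<longlonglongrightarrow> U * (t * 0 + exp (- a * (t * 0)) / a) + \<Psi> 0 / (a * V) - B * (t * 0) ^ 3 / 3"
      unfolding \<Theta>_def by (intro tendsto_intros t0[OF t(1)] tau_lim) (use a_pos V_pos in auto)
    then have "\<Theta> t \<le> U * (t * 0 + exp (- a * (t * 0)) / a) + \<Psi> 0 / (a * V) - B * (t * 0) ^ 3 / 3"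
    proof (rule LIMSEQ_le_const)
      have "t * tau n \<le> t" for n using t tau_pos[of n] by (simp add: tau_def field_simps)
      then show "\<exists>N. \<forall>n\<ge>N. \<Theta> t \<le> \<Theta> (t * tau n)" using mon t tau_pos by auto
    qed
    then have "\<Theta> t \<le> U * (1 / a) + \<Psi> 0 / (a * V)" by simp
    moreover have "\<Psi> 0 / (a * V) \<le> \<Psi> t / (a * V)"
      using dif[OF t(1)] kd[OF t] a_pos V_pos by (intro divide_right_mono) auto
    ultimately show ?thesis unfolding \<Theta>_def distrib_left right_diff_distrib by linarith
  qed
  have "U * (a / 2) \<le> B * 0 / 3"
  proof (rule tendsto_le[OF _ _ tendsto_mult_left[OF exp_second_order[OF a_pos]]])
    show "((\<lambda>t. B * t / 3) \<longlongrightarrow> B * 0 / 3) (at_right 0)" by (intro tendsto_intros) simp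
    show "\<forall>\<^sub>F t in at_right 0. U * ((t + exp (- a * t) / a - 1 / a) / t\<^sup>2) \<le> B * t / 3"
      using eventually_at_right_real[OF zero_less_one]
    proof eventually_elim
      case (elim t)
      then have "U * (t + exp (- a * t) / a - 1 / a) / t\<^sup>2 \<le> B * t ^ 3 / 3 / t\<^sup>2"
        using key[of t] by (intro divide_right_mono) auto
      also have "\<dots> = B * t / 3" using elim by (simp add: power2_eq_square power3_eq_cube)
      finally show ?case by simp
    qed
  qed simp
  then show ?thesis using a_pos by (simp add: mult_le_0_iff)
qed

text \<open>Integrating the maximum principle over \<open>s\<close> replaces \<open>R s w\<close> by \<open>kd t w\<close>, whose monotonicity
  in the cap makes the boundary term nonpositive by the minimality of \<open>s0\<close>.\<close>

theorem contact_cap_comparison: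
  assumes e: "e \<in> S" and c: "contact_mass e d \<mu>1" and m0: "mass \<mu>0"
    and z0: "zonal e (rpot \<mu>0)" and low0: "AE x in \<sigma>. d \<le> rpot \<mu>0 x"
  shows "0 \<le> (\<integral>x. (if s < x \<bullet> e then rpot \<mu>1 x - rpot \<mu>0 x else 0) \<partial>\<sigma>)"
proof (rule ccontr)
  assume neg: "\<not> ?thesis"
  have m1: "mass \<mu>1" and d0: "0 \<le> d" and supp: "AE z in \<mu>1. z = e \<or> npot \<mu>1 z = ennreal d"
    and low: "\<And>x. x \<in> S \<Longrightarrow> ennreal d \<le> npot \<mu>1 x"
    using c by (auto simp: contact_mass_def)
  note low1 = npot_ge_AE[OF m1 d0 low]
  define u where "u x = rpot \<mu>1 x - rpot \<mu>0 x" for x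
  have ui: "integrable \<sigma> u" unfolding u_def using rpot_integrable[OF m0] rpot_integrable[OF m1] by simp
  have u0: "(\<integral>x. u x \<partial>\<sigma>) = 0"
    unfolding u_def using rpot_integrable[OF m0] rpot_integrable[OF m1] integral_rpot[OF m0] integral_rpot[OF m1] by simp
  note [measurable] = borel_measurable_integrable[OF ui]
  define \<Gamma> where "\<Gamma> s = (\<integral>x. (if s < x \<bullet> e then u x else 0) \<partial>\<sigma>)" for s
  have cont: "isCont \<Gamma> s" for s unfolding \<Gamma>_def by (rule cap_integral_continuous[OF e ui])
  have le1: "\<bar>x \<bullet> e\<bar> \<le> 1" if "x \<in> S" for x by (rule abs_inner_le_1[OF that e])
  have out1: "\<Gamma> s = 0" if "1 \<le> s" for s
    unfolding \<Gamma>_def by (rule integral_eq_zero_AE, rule AE_I2) (use le1 that in \<open>force simp: abs_le_iff\<close>)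
  have out2: "\<Gamma> s = 0" if "s < - 1" for s
  proof -
    have "\<Gamma> s = (\<integral>x. u x \<partial>\<sigma>)" unfolding \<Gamma>_def
      by (rule Bochner_Integration.integral_cong) (use le1 that in \<open>force simp: abs_le_iff\<close>)+
    then show ?thesis using u0 by simp
  qed
  have "continuous_on {- 1..1} \<Gamma>" using cont by (intro continuous_at_imp_continuous_on) auto
  then obtain s0 where s0: "s0 \<in> {- 1..1}" "\<And>s. s \<in> {- 1..1} \<Longrightarrow> \<Gamma> s0 \<le> \<Gamma> s"
    using continuous_attains_inf[of "{- 1..1}" \<Gamma>] by (auto simp del: atLeastAtMost_iff)
  have sneg: "\<Gamma> s < 0" using neg unfolding \<Gamma>_def u_def by simp
  have "s \<in> {- 1..1}" using sneg out1[of s] out2[of s] by fastforce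
  then have \<kappa>: "\<Gamma> s0 < 0" using s0(2)[of s] sneg by simp
  have lev: "\<Gamma> s0 \<le> \<Gamma> s" for s
    using s0(2)[of s] out1[of s] out2[of s] \<kappa> by fastforce
  have s01: "s0 < 1" using out1[of s0] \<kappa> by linarith
  \<comment> \<open>The part of \<open>u\<close> inside the minimising cap; it is the inflow term
    when the maximum principle is applied on the complement.\<close>
  define g where "g y = (if \<not> s0 < y \<bullet> e then 0 else u y)" for y
  have gi: "integrable \<sigma> g" unfolding g_def by (rule Bochner_Integration.integrable_bound[OF ui]) auto
  have bound: "AE x in \<sigma>. \<not> s0 < x \<bullet> e \<longrightarrow> u x \<le> \<eta>" if \<eta>: "0 < \<eta>" for \<eta>
  proof -
    define w where "w = (\<lambda>x. if \<not> s0 < x \<bullet> e \<and> \<eta> < u x then 1 else (0::real))"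
    have w: "w \<in> borel_measurable \<sigma>" "\<And>x. 0 \<le> w x" "\<And>x. w x \<le> 1" unfolding w_def by auto
    note [measurable] = w(1)
    have wa: "\<bar>w x\<bar> \<le> 1" for x using w(2,3)[of x] by simp
    have wF: "AE x in \<sigma>. w x \<noteq> 0 \<longrightarrow> d + \<eta> \<le> rpot \<mu>1 x"
      using low0 by eventually_elim (auto simp: w_def u_def)
    have ws: "x \<bullet> e \<le> s0" if "w x \<noteq> 0" for x using that by (auto simp: w_def split: if_splits)
    define C where "C = V * far_const (1 - s0)"
    \<comment> \<open>Two ways for the measure to be seen with quadratic weight: a contact point by
      \<open>contact_estimate\<close>, the pole because \<open>w\<close> lives at heights at most
      \<open>s0 < 1\<close>.\<close>
    define B where "B = max (V * d * a\<^sup>2 / \<eta>) C"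
    define U where "U = (\<integral>x. w x * u x \<partial>\<sigma>)"
    have main: "(1 - exp (- a * s)) * U \<le> B * s\<^sup>2 + (\<integral>x. R s w x * g x \<partial>\<sigma>)" if s: "0 < s" "s \<le> 1" for s
    proof -
      have kdB: "kd s w z \<le> B * s\<^sup>2" if z: "z \<in> S" "z = e \<or> npot \<mu>1 z = ennreal d" for z
      proof (cases "z = e")
        case True
        have "kd s w z \<le> C * s\<^sup>2"
          unfolding C_def by (rule kd_far[OF _ s z(1) w]) (use s01 ws True in auto)
        also have "\<dots> \<le> B * s\<^sup>2" by (intro mult_right_mono) (auto simp: B_def)
        finally show ?thesis .
      next
        case False
        then have "kd s w z \<le> V * d * a\<^sup>2 / \<eta> * s\<^sup>2"
          using z by (intro contact_estimate[OF m1 z(1) _ d0 s(1) \<eta> low1 w(1)] wF) (use w in auto)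
        also have "\<dots> \<le> B * s\<^sup>2" by (intro mult_right_mono) (auto simp: B_def)
        finally show ?thesis .
      qed
      note k1 = weighted_kd[OF m1 s(1) w]
      have di: "integrable \<sigma> (\<lambda>x. w x * (rpot \<mu> x - pot \<mu> s x))" if "mass \<mu>" for \<mu>
        by (rule integrable_mult_bounded[OF integrable_rpot_pot[OF that s(1)] w(1) wa])
      have "(1 - exp (- a * s)) * U \<le> (\<integral>x. w x * (u x - R s u x) \<partial>\<sigma>) + (\<integral>x. w x * R s (\<lambda>y. if \<not> s0 < y \<bullet> e then 0 else u y) x \<partial>\<sigma>)"
        unfolding U_def w_def by (rule max_principle[OF ui s(1)]) (use \<eta> in auto)
      also have "(\<integral>x. w x * R s (\<lambda>y. if \<not> s0 < y \<bullet> e then 0 else u y) x \<partial>\<sigma>) = (\<integral>x. R s w x * g x \<partial>\<sigma>)"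
        using R_swap(1)[OF s(1) gi w(1) wa] unfolding g_def .
      \<comment> \<open>The terms of \<open>\<mu>0\<close> may be dropped:
        \<open>rpot \<mu>0\<close> exceeds its Poisson shift and enters with a minus sign.\<close>
      also have "(\<integral>x. w x * (u x - R s u x) \<partial>\<sigma>) \<le> (\<integral>x. w x * (rpot \<mu>1 x - pot \<mu>1 s x) \<partial>\<sigma>)"
      proof (rule integral_mono_AE[OF _ di[OF m1]])
        have eq: "w x * (u x - R s u x) = w x * (rpot \<mu>1 x - pot \<mu>1 s x) - w x * (rpot \<mu>0 x - pot \<mu>0 s x)" if x: "x \<in> S" for x
          unfolding u_def R_diff[OF s(1) x rpot_integrable[OF m1] rpot_integrable[OF m0]] R_rpot[OF m1 s(1) x] R_rpot[OF m0 s(1) x]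
          by (simp add: algebra_simps)
        show "integrable \<sigma> (\<lambda>x. w x * (u x - R s u x))"
          by (rule Bochner_Integration.integrable_cong[THEN iffD2, OF refl _ Bochner_Integration.integrable_diff[OF di[OF m1] di[OF m0]]])
             (use eq in auto)
        show "AE x in \<sigma>. w x * (u x - R s u x) \<le> w x * (rpot \<mu>1 x - pot \<mu>1 s x)"
          using pot_le_rpot_AE[OF m0 s(1)] AE_space
        proof eventually_elim
          case (elim x)
          have "0 \<le> w x * (rpot \<mu>0 x - pot \<mu>0 s x)" using elim w(2)[of x] by simp
          then show ?case using eq[of x] elim by simp
        qed
      qed
      also have "(\<integral>x. w x * (rpot \<mu>1 x - pot \<mu>1 s x) \<partial>\<sigma>) = (\<integral>z. kd s w z \<partial>\<mu>1)" by (rule k1(1))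
      also have "\<dots> \<le> (\<integral>z. B * s\<^sup>2 \<partial>\<mu>1)"
      proof (rule integral_mono_AE[OF k1(2)])
        show "integrable \<mu>1 (\<lambda>z. B * s\<^sup>2)" using finite_measure.integrable_const[OF mass_finite[OF m1]] .
        show "AE z in \<mu>1. kd s w z \<le> B * s\<^sup>2"
          using supp AE_space by eventually_elim (use kdB mass_space[OF m1] in auto)
      qed
      also have "\<dots> = B * s\<^sup>2" using mass_measure[OF m1] mass_space[OF m1] by simp
      finally show ?thesis by simp
    qed
    have kdn: "(\<integral>x. kd t w x * g x \<partial>\<sigma>) \<le> 0" if t: "0 < t" for t
    proof -
      have zu: "AE x in \<sigma>. u (refl_along v x) = u x" if "v \<bullet> e = 0" for v
      proof -
        have "AE x in \<sigma>. rpot \<mu>0 (refl_along v x) = rpot \<mu>0 x" "AE x in \<sigma>. rpot \<mu>1 (refl_along v x) = rpot \<mu>1 x"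
          using z0 contact_zonal[OF c] that by (auto simp: zonal_def)
        then show ?thesis by eventually_elim (simp add: u_def)
      qed
      \<comment> \<open>\<open>u\<close> is symmetric only almost everywhere, but \<open>kd\<close>
        integrates the weight and is therefore constant on rings without exception, as
        \<open>kd_cap_antimono\<close> requires.\<close>
      have zon: "kd t w x = kd t w y" if x: "x \<in> S" and y: "y \<in> S" and xy: "x \<bullet> e = y \<bullet> e" for x y
      proof -
        define v where "v = x - y"
        have ve: "v \<bullet> e = 0" using xy by (simp add: v_def inner_diff_left)
        have r: "refl_along v x = y" unfolding v_def by (rule refl_along_swap) (use x y in simp)
        have re: "refl_along v z \<bullet> e = z \<bullet> e" for z using ve by (simp add: refl_along_def inner_diff_left)
        have wT: "(\<lambda>x. w (refl_along v x)) \<in> borel_measurable \<sigma>"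
          using measurable_compose[OF measurable_orth[OF orthogonal_refl_along] w(1)] .
        note [measurable] = measurable_orth[OF orthogonal_refl_along]
        have aw: "AE z in \<sigma>. w (refl_along v z) = w z"
          using zu[OF ve] by eventually_elim (simp add: w_def re)
        have "kd t (\<lambda>z. w (refl_along v z)) x = kd t w x"
          unfolding kd_def using wT by (intro integral_cong_AE) (measurable, use aw in \<open>auto elim: eventually_mono\<close>)
        then show ?thesis using kd_refl[OF w(1), of t v x] r by simp
      qed
      define W where "W x = (if s0 < x \<bullet> e then kd t w x else 0)" for x
      have kdm [measurable]: "kd t w \<in> borel_measurable \<sigma>" unfolding kd_def by measurable
      have Wm [measurable]: "W \<in> borel_measurable \<sigma>" unfolding W_def by measurable
      have mono: "kd t w y \<le> kd t w x" if "x \<in> S" "y \<in> S" "s0 < x \<bullet> e" "x \<bullet> e \<le> y \<bullet> e" for x y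
        by (rule kd_cap_antimono[OF e t w(1) w(2) w(3) ws zon that])
      have "(\<integral>x. W x * u x \<partial>\<sigma>) \<le> V * 0"
      proof (rule layer_cake_le[OF ui Wm V_pos])
        show "0 \<le> W x" "W x \<le> V" if "x \<in> S" for x
          using kd_nonneg[OF t that w(2)] kd_le_V[OF t that w] V_pos by (auto simp: W_def)
        fix \<tau> :: real assume \<tau>: "0 \<le> \<tau>"
        \<comment> \<open>Inside the cap \<open>kd t w\<close> decreases with the height, so the
          points of the cap outside a level set of \<open>W\<close> form a smaller cap. The level
          set is the zone between the heights \<open>s0\<close> and \<open>h\<close>, and the
          integral of \<open>u\<close> over it is \<open>\<Gamma> s0 - \<Gamma> h\<close>.\<close>
        have "zdec e (\<lambda>x. if \<tau> < W x \<or> x \<bullet> e \<le> s0 then 0 else (1::real))"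
          unfolding zdec_def
        proof (intro ballI impI)
          fix x y assume "x \<in> S" "y \<in> S" "x \<bullet> e \<le> y \<bullet> e"
          then show "(if \<tau> < W x \<or> x \<bullet> e \<le> s0 then 0 else (1::real)) \<le> (if \<tau> < W y \<or> y \<bullet> e \<le> s0 then 0 else 1)"
            using mono[of x y] by (auto simp: W_def)
        qed
        from zdec_level[OF e this, of 0] obtain h where h: "AE x in \<sigma>. (0 < (if \<tau> < W x \<or> x \<bullet> e \<le> s0 then 0 else (1::real))) = (h < x \<bullet> e)" .
        have "(\<integral>x. (if \<tau> < W x then u x else 0) \<partial>\<sigma>) = (\<integral>x. (if s0 < x \<bullet> e then u x else 0) - (if h < x \<bullet> e then u x else 0) \<partial>\<sigma>)"
        proof (rule integral_cong_AE)
          show "AE x in \<sigma>. (if \<tau> < W x then u x else 0) = (if s0 < x \<bullet> e then u x else 0) - (if h < x \<bullet> e then u x else 0)"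
            using h by eventually_elim (use \<tau> in \<open>auto simp: W_def split: if_splits\<close>)
        qed measurable
        also have "\<dots> = \<Gamma> s0 - \<Gamma> h"
          unfolding \<Gamma>_def by (intro Bochner_Integration.integral_diff integrable_if[OF ui]) measurable
        also have "\<dots> \<le> 0" using lev[of h] by simp
        finally show "(\<integral>x. (if \<tau> < W x then u x else 0) \<partial>\<sigma>) \<le> 0" .
      qed
      moreover have "(\<lambda>x. W x * u x) = (\<lambda>x. kd t w x * g x)" by (auto simp: W_def g_def)
      ultimately show ?thesis by simp
    qed
    have U0: "U \<le> 0" by (rule integrated_inequality[OF gi w(1) w(2) w(3) main kdn])
    have nn: "AE x in \<sigma>. 0 \<le> w x * u x" by (rule AE_I2) (use \<eta> in \<open>auto simp: w_def\<close>)
    have wu: "integrable \<sigma> (\<lambda>x. w x * u x)"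
      by (rule integrable_mult_bounded[OF ui w(1) wa])
    have "(\<integral>x. w x * u x \<partial>\<sigma>) = 0" using U0 integral_nonneg_AE[OF nn] unfolding U_def by linarith
    then have "AE x in \<sigma>. w x * u x = 0" using integral_nonneg_eq_0_iff_AE[OF wu nn] by simp
    then show ?thesis by eventually_elim (use \<eta> in \<open>auto simp: w_def split: if_splits\<close>)
  qed
  have "AE x in \<sigma>. \<forall>n. \<not> s0 < x \<bullet> e \<longrightarrow> u x \<le> tau n" unfolding AE_all_countable using bound[OF tau_pos] by blast
  then have off: "AE x in \<sigma>. \<not> s0 < x \<bullet> e \<longrightarrow> u x \<le> 0"
  proof eventually_elim
    case (elim x)
    then show ?case by (auto intro: LIMSEQ_le_const[OF tau_lim])
  qed
  \<comment> \<open>Outside the cap \<open>u\<close> is not positive although its total integral is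
    0, so its integral over the cap cannot be negative.\<close>
  have "0 \<le> (\<integral>x. g x - u x \<partial>\<sigma>)"
    by (rule integral_nonneg_AE) (use off in eventually_elim, simp add: g_def)
  also have "\<dots> = \<Gamma> s0"
  proof -
    have "(\<integral>x. g x \<partial>\<sigma>) = \<Gamma> s0" unfolding \<Gamma>_def by (rule Bochner_Integration.integral_cong) (auto simp: g_def)
    then show ?thesis using gi ui u0 by simp
  qed
  finally show False using \<kappa> by simp
qed


subsection \<open>The support of the measures\<close>

definition radial :: "(real^'n) measure \<Rightarrow> real^'n \<Rightarrow> real \<Rightarrow> real" where
  "radial \<mu> x t = exp (a * t) * rpot \<mu> (exp t *\<^sub>R x)"

lemma radial_eq:
  assumes m: "mass \<mu>" and x: "x \<in> S" and t: "t \<noteq> 0"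
  shows "radial \<mu> x t = pot \<mu> \<bar>t\<bar> x"
proof -
  have "npot \<mu> (exp t *\<^sub>R x) = ennreal (exp t powr (- a) * pot \<mu> \<bar>t\<bar> x)"
    using npot_scaled[OF m x, of "exp t"] t by simp
  then have "rpot \<mu> (exp t *\<^sub>R x) = exp t powr (- a) * pot \<mu> \<bar>t\<bar> x"
    by (simp add: rpot_def pot_nonneg)
  then show ?thesis by (simp add: radial_def powr_def exp_minus field_simps)
qed

lemma radial_deriv:
  assumes "(rpot \<mu> has_derivative (\<lambda>v. G \<bullet> v)) (at (exp t *\<^sub>R x))"
  shows "(radial \<mu> x has_real_derivative exp (a * t) * (a * rpot \<mu> (exp t *\<^sub>R x) + exp t * (G \<bullet> x))) (at t)"
proof -
  have "((\<lambda>t. exp t *\<^sub>R x) has_derivative (\<lambda>h. (h * exp t) *\<^sub>R x)) (at t)"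
    by (auto intro!: derivative_eq_intros)
  from has_derivative_compose[OF this assms]
  have "((\<lambda>t. rpot \<mu> (exp t *\<^sub>R x)) has_real_derivative exp t * (G \<bullet> x)) (at t)"
    by (rule has_derivative_imp_has_field_derivative) simp
  moreover have "((\<lambda>t. exp (a * t)) has_real_derivative exp (a * t) * a) (at t)"
    by (auto intro!: derivative_eq_intros)
  ultimately show ?thesis
    unfolding radial_def[abs_def] using DERIV_mult by (fastforce simp: algebra_simps)
qed

text \<open>By inversion in the sphere, \<open>radial \<mu> x\<close> is even, so it has derivative \<open>0\<close> at \<open>0\<close> wherever
  the potential is differentiable; the jump of the normal derivative across the sphere, which is
  the density of \<open>\<mu>\<close>, thus vanishes there.\<close>

lemma harmonic_off_support:
  assumes m: "mass \<mu>" and E: "closed E" "E \<noteq> {}" and h: "harmonic_on (- E) (rpot \<mu>)"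
  shows "AE z in \<mu>. z \<in> E"
proof -
  obtain g :: "real^'n \<Rightarrow> real^'n" and H :: "real^'n \<Rightarrow> real^'n^'n"
    where g: "\<And>x. x \<in> - E \<Longrightarrow> (rpot \<mu> has_derivative (\<lambda>v. g x \<bullet> v)) (at x)"
      "\<And>x. x \<in> - E \<Longrightarrow> (g has_derivative (\<lambda>v. H x *v v)) (at x)"
    using h unfolding harmonic_on_def by blast
  interpret M: finite_measure \<mu> by (rule mass_finite[OF m])
  note [measurable] = mass_ident[OF m]
  have small: "AE z in \<mu>. \<not> \<delta> \<le> infdist z E" if \<delta>: "0 < \<delta>" for \<delta>
  proof -
    \<comment> \<open>Three nested distances from \<open>E\<close>: mass at distance
      \<open>\<delta>\<close> is detected by a weight on the set at distance
      \<open>\<delta> / 2\<close>, and from there the short radial segments of logarithmic length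
      \<open>T\<close> stay at distance \<open>\<delta> / 4\<close>, where the potential and its
      gradient are bounded by compactness.\<close>
    define K where "K = {y. \<delta> / 4 \<le> infdist y E} \<inter> cball 0 2"
    have "closed {y. \<delta> / 4 \<le> infdist y E}" by (intro closed_Collect_le continuous_intros)
    then have K: "compact K" unfolding K_def by (intro closed_Int_compact compact_cball)
    have KE: "y \<in> - E" if "y \<in> K" for y using that \<delta> by (auto simp: K_def)
    have cf: "continuous_on K (rpot \<mu>)" "continuous_on K g"
      using g KE has_derivative_continuous by (blast intro: continuous_at_imp_continuous_on)+
    from compact_imp_bounded[OF compact_continuous_image[OF cf(1) K]]
    obtain C1 where C1: "\<And>y. y \<in> K \<Longrightarrow> \<bar>rpot \<mu> y\<bar> \<le> C1" unfolding bounded_iff by auto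
    from compact_imp_bounded[OF compact_continuous_image[OF cf(2) K]]
    obtain C2 where C2: "\<And>y. y \<in> K \<Longrightarrow> norm (g y) \<le> C2" unfolding bounded_iff by auto
    define T where "T = ln (1 + min (\<delta> / 4) 1)"
    have T: "0 < T" using \<delta> by (simp add: T_def)
    have eT: "exp t - 1 \<le> \<delta> / 4" "exp t \<le> 2" if "t \<le> T" for t
    proof -
      have "exp t \<le> exp T" using that by simp
      also have "\<dots> = 1 + min (\<delta> / 4) 1" unfolding T_def using \<delta> by (intro exp_ln) auto
      finally show "exp t - 1 \<le> \<delta> / 4" "exp t \<le> 2" by auto
    qed
    define w where "w x = (if \<delta> / 2 \<le> infdist x E then 1 else (0::real))" for x
    have idm: "(\<lambda>x. infdist x E) \<in> borel_measurable \<sigma>"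
      by (intro measurable_continuous_on_S continuous_intros)
    note [measurable] = idm mass_measurable[OF m idm]
    have w: "w \<in> borel_measurable \<sigma>" "\<And>x. 0 \<le> w x" "\<And>x. w x \<le> 1" unfolding w_def by auto
    note [measurable] = w(1)
    have inK: "exp t *\<^sub>R x \<in> K" if x: "x \<in> S" "w x \<noteq> 0" and t: "0 \<le> t" "t \<le> T" for x t
    proof -
      have "dist x (exp t *\<^sub>R x) = norm ((exp t - 1) *\<^sub>R x)"
        by (simp add: dist_norm norm_minus_commute scaleR_diff_left)
      also have "\<dots> \<le> \<delta> / 4" unfolding norm_scaleR using x t eT(1)[OF t(2)] by simp
      finally have "infdist x E \<le> infdist (exp t *\<^sub>R x) E + \<delta> / 4"
        using infdist_triangle[of x E "exp t *\<^sub>R x"] by linarith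
      then show ?thesis using x eT(2)[OF t(2)] by (auto simp: K_def w_def split: if_splits)
    qed
    define C where "C = exp (a * T) * (a * C1 + 2 * C2)"
    have d: "(radial \<mu> x has_real_derivative exp (a * t) * (a * rpot \<mu> (exp t *\<^sub>R x) + exp t * (g (exp t *\<^sub>R x) \<bullet> x))) (at t)"
      (is "(_ has_real_derivative ?d x t) _") if "x \<in> S" "w x \<noteq> 0" "0 \<le> t" "t \<le> T" for x t
      by (rule radial_deriv[OF g(1)[OF KE[OF inK[OF that]]]])
    have db: "\<bar>?d x t\<bar> \<le> C" if x: "x \<in> S" "w x \<noteq> 0" and t: "0 \<le> t" "t \<le> T" for x t
    proof -
      have k: "exp t *\<^sub>R x \<in> K" by (rule inK[OF that])
      have "\<bar>g (exp t *\<^sub>R x) \<bullet> x\<bar> \<le> C2"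
        using Cauchy_Schwarz_ineq2[of "g (exp t *\<^sub>R x)" x] C2[OF k] x by simp
      then have "\<bar>exp t * (g (exp t *\<^sub>R x) \<bullet> x)\<bar> \<le> 2 * C2"
        unfolding abs_mult using eT(2)[OF t(2)] by (intro mult_mono) auto
      moreover have "\<bar>a * rpot \<mu> (exp t *\<^sub>R x)\<bar> \<le> a * C1" unfolding abs_mult using C1[OF k] a_pos by simp
      ultimately have "\<bar>a * rpot \<mu> (exp t *\<^sub>R x) + exp t * (g (exp t *\<^sub>R x) \<bullet> x)\<bar> \<le> a * C1 + 2 * C2" by linarith
      then show ?thesis unfolding C_def abs_mult using t a_pos by (intro mult_mono) auto
    qed
    define X where "X n = T * tau n" for n
    have X: "0 < X n" "X n \<le> T" for n using T tau_pos[of n] by (auto simp: X_def tau_def field_simps)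
    have X0: "X \<longlonglongrightarrow> 0" using tendsto_mult_left[OF tau_lim, of T] by (simp add: X_def[abs_def])
    \<comment> \<open>A weighted difference quotient of \<open>- radial \<mu> x\<close> at 0. It
      tends to 0 because \<open>radial \<mu> x\<close> is even and differentiable there, and the
      derivative bound dominates it. By \<open>weighted_kd\<close> its integral is that of
      \<open>kd (X n) w / X n\<close> against \<open>\<mu>\<close>.\<close>
    define F where "F n x = w x * (rpot \<mu> x - pot \<mu> (X n) x) / X n" for n x
    have Fr: "F n x = w x * (radial \<mu> x 0 - radial \<mu> x (X n)) / X n" if "x \<in> S" for n x
      unfolding F_def using radial_eq[OF m that, of "X n"] X(1)[of n] by (simp add: radial_def)
    have "(\<lambda>n. \<integral>x. F n x \<partial>\<sigma>) \<longlonglongrightarrow> (\<integral>x. 0 \<partial>\<sigma>)"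
    proof (rule integral_dominated_convergence[where w = "\<lambda>_. \<bar>C\<bar>"])
      show "F n \<in> borel_measurable \<sigma>" for n
        unfolding F_def using rpot_measurable[OF m] measurable_continuous_on_S[OF pot_continuous[OF m X(1)]] w(1) by measurable
      show "AE x in \<sigma>. (\<lambda>n. F n x) \<longlonglongrightarrow> 0"
      proof (rule AE_I2)
        fix x assume "x \<in> space \<sigma>"
        then have x: "x \<in> S" by simp
        show "(\<lambda>n. F n x) \<longlonglongrightarrow> 0"
        proof (cases "w x = 0")
          case False
          have d0: "(radial \<mu> x has_real_derivative ?d x 0) (at 0)" by (rule d[OF x False]) (use T in auto)
          have ev: "radial \<mu> x (- t) = radial \<mu> x t" for t
            using radial_eq[OF m x, of t] radial_eq[OF m x, of "- t"] by (cases "t = 0") auto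
          have "(radial \<mu> x has_real_derivative - ?d x 0) (at 0)"
            using DERIV_mirror[of "radial \<mu> x" "?d x 0" 0] d0 by (simp add: ev)
          then have "?d x 0 = 0" using DERIV_unique[OF d0] by fastforce
          then have "((\<lambda>h. (radial \<mu> x h - radial \<mu> x 0) / h) \<longlongrightarrow> 0) (at 0)"
            using d0 unfolding DERIV_def by simp
          then have "(\<lambda>n. (radial \<mu> x (X n) - radial \<mu> x 0) / X n) \<longlonglongrightarrow> 0"
            by (rule filterlim_compose) (use X X0 in \<open>auto simp: filterlim_at less_imp_neq[OF X(1), symmetric]\<close>)
          then have "(\<lambda>n. - w x * ((radial \<mu> x (X n) - radial \<mu> x 0) / X n)) \<longlonglongrightarrow> - w x * 0" by (intro tendsto_mult tendsto_const)
          then show ?thesis unfolding Fr[OF x] by (simp add: algebra_simps minus_divide_left)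
        qed (simp add: F_def)
      qed
      show "AE x in \<sigma>. norm (F n x) \<le> \<bar>C\<bar>" for n
      proof (rule AE_I2)
        fix x assume "x \<in> space \<sigma>"
        then have x: "x \<in> S" by simp
        show "norm (F n x) \<le> \<bar>C\<bar>"
        proof (cases "w x = 0")
          case False
          have "norm (radial \<mu> x (X n) - radial \<mu> x 0) \<le> C * norm (X n - 0)"
          proof (rule field_differentiable_bound[of "{0..T}" "radial \<mu> x" "?d x"])
            fix t assume t: "t \<in> {0..T}"
            then show "(radial \<mu> x has_field_derivative ?d x t) (at t within {0..T})"
              by (intro has_field_derivative_at_within[OF d[OF x False]]) auto
            show "norm (?d x t) \<le> C" using db[OF x False, of t] t by simp
          qed (use X[of n] in auto)
          then have "\<bar>radial \<mu> x 0 - radial \<mu> x (X n)\<bar> \<le> C * X n" using X(1)[of n] by (simp add: abs_minus_commute)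
          also have "\<dots> \<le> \<bar>C\<bar> * X n" using X(1)[of n] by (intro mult_right_mono) auto
          finally show ?thesis
            using X(1)[of n] False unfolding Fr[OF x]
            by (simp add: w_def abs_minus_commute field_simps split: if_splits)
        qed (simp add: F_def)
      qed
    qed auto
    then have lim: "(\<lambda>n. \<integral>x. F n x \<partial>\<sigma>) \<longlonglongrightarrow> 0" by simp
    define B where "B = {z \<in> space \<mu>. \<delta> \<le> infdist z E}"
    have Bm [measurable]: "B \<in> sets \<mu>" unfolding B_def by measurable
    define D where "D = far_const (\<delta>\<^sup>2 / 8)"
    \<comment> \<open>For \<open>z\<close> at distance \<open>\<delta>\<close> from \<open>E\<close>
      the weight \<open>1 - w\<close> lives far from \<open>z\<close>, so \<open>kd s w z\<close> is
      the full value \<open>V * (1 - exp (- a * s))\<close> up to order \<open>s\<^sup>2\<close>.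
      Dividing by \<open>s\<close> leaves the positive limit \<open>V * a\<close> for each unit of
      mass in \<open>B\<close>, against a limit 0 of the integrals.\<close>
    have kdB: "V * (a * s - (a\<^sup>2 + D) * s\<^sup>2) \<le> kd s w z" if z: "z \<in> B" and s: "0 < s" "s \<le> 1" for z s
    proof -
      have zS: "z \<in> S" using z mass_space[OF m] by (simp add: B_def)
      have w': "(\<lambda>x. 1 - w x) \<in> borel_measurable \<sigma>" by simp
      have i1: "integrable \<sigma> (\<lambda>x. (1 - w x) * (kap 0 (x \<bullet> z) - kap s (x \<bullet> z)))"
        by (rule kd_integrable(3)[OF s(1) zS w', of 1]) (use w in auto)
      have "kd s (\<lambda>x. 1 - w x) z \<le> V * far_const (\<delta>\<^sup>2 / 8) * s\<^sup>2"
      proof (rule kd_far[OF _ s zS w'])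
        fix x assume x: "x \<in> S" "1 - w x \<noteq> 0"
        then have "infdist x E < \<delta> / 2" by (auto simp: w_def split: if_splits)
        then have "\<delta> / 2 \<le> norm (x - z)"
          using infdist_triangle[of z E x] z by (simp add: B_def dist_norm norm_minus_commute)
        then have "(\<delta> / 2)\<^sup>2 \<le> (norm (x - z))\<^sup>2" using \<delta> by (intro power_mono) auto
        then show "x \<bullet> z \<le> 1 - \<delta>\<^sup>2 / 8" using dist_sq[OF x(1) zS] by (simp add: power_divide)
      qed (use \<delta> w in auto)
      then have 1: "kd s (\<lambda>x. 1 - w x) z \<le> V * (D * s\<^sup>2)" by (simp add: D_def mult.assoc)
      have i2: "integrable \<sigma> (\<lambda>x. w x * (kap 0 (x \<bullet> z) - kap s (x \<bullet> z)))"
        by (rule kd_integrable(3)[OF s(1) zS w(1), of 1]) (use w in auto)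
      have "kd s (\<lambda>_. 1) z = (\<integral>x. w x * (kap 0 (x \<bullet> z) - kap s (x \<bullet> z)) + (1 - w x) * (kap 0 (x \<bullet> z) - kap s (x \<bullet> z)) \<partial>\<sigma>)"
        unfolding kd_def by (rule Bochner_Integration.integral_cong) (simp_all add: algebra_simps)
      also have "\<dots> = kd s w z + kd s (\<lambda>x. 1 - w x) z" unfolding kd_def by (rule Bochner_Integration.integral_add[OF i2 i1])
      finally have "V * (1 - exp (- a * s)) - V * (D * s\<^sup>2) \<le> kd s w z" using 1 unfolding kd_one[OF s(1) zS] by linarith
      moreover have "V * (a * s - a\<^sup>2 * s\<^sup>2) \<le> V * (1 - exp (- a * s))"
        using exp_minus_quadratic[of "a * s"] a_pos s V_pos by (intro mult_left_mono) (auto simp: power_mult_distrib)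
      ultimately show ?thesis by (simp add: algebra_simps)
    qed
    have low: "measure \<mu> B * (V * (a - (a\<^sup>2 + D) * X n)) \<le> (\<integral>x. F n x \<partial>\<sigma>)" if n: "X n \<le> 1" for n
    proof -
      note k = weighted_kd[OF m X(1)[of n] w]
      have "measure \<mu> B * (V * (a * X n - (a\<^sup>2 + D) * (X n)\<^sup>2)) = (\<integral>z. indicator B z * (V * (a * X n - (a\<^sup>2 + D) * (X n)\<^sup>2)) \<partial>\<mu>)"
        by simp
      also have "\<dots> \<le> (\<integral>z. kd (X n) w z \<partial>\<mu>)"
      proof (rule integral_mono[OF _ k(2)])
        fix z assume "z \<in> space \<mu>"
        then show "indicator B z * (V * (a * X n - (a\<^sup>2 + D) * (X n)\<^sup>2)) \<le> kd (X n) w z"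
          using kdB[of z "X n"] X(1)[of n] n kd_nonneg[of "X n" z w] w(2) mass_space[OF m]
          by (auto simp: indicator_def)
      qed (use M.emeasure_finite in \<open>auto simp: less_top[symmetric]\<close>)
      also have "\<dots> = X n * (\<integral>x. F n x \<partial>\<sigma>)" unfolding k(1)[symmetric] F_def using X(1)[of n] by simp
      also have "measure \<mu> B * (V * (a * X n - (a\<^sup>2 + D) * (X n)\<^sup>2)) = X n * (measure \<mu> B * (V * (a - (a\<^sup>2 + D) * X n)))"
        by (simp add: algebra_simps power2_eq_square)
      finally show ?thesis using X(1)[of n] by simp
    qed
    have "(\<lambda>n. measure \<mu> B * (V * (a - (a\<^sup>2 + D) * X n))) \<longlonglongrightarrow> measure \<mu> B * (V * (a - (a\<^sup>2 + D) * 0))"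
      by (intro tendsto_intros X0)
    moreover have "\<forall>\<^sub>F n in sequentially. X n < 1" by (rule order_tendstoD(2)[OF X0]) simp
    then have "\<forall>\<^sub>F n in sequentially. measure \<mu> B * (V * (a - (a\<^sup>2 + D) * X n)) \<le> (\<integral>x. F n x \<partial>\<sigma>)"
      by eventually_elim (use low in simp)
    ultimately have "measure \<mu> B * (V * (a - (a\<^sup>2 + D) * 0)) \<le> 0" by (intro tendsto_le[OF _ lim]) auto
    then have "measure \<mu> B \<le> 0" using V_pos a_pos by (simp add: mult_le_0_iff)
    then have "emeasure \<mu> B = 0" using measure_nonneg[of \<mu> B] by (simp add: M.emeasure_eq_measure)
    then show ?thesis by (intro AE_I[where N = B]) (auto simp: B_def)
  qed
  have "AE z in \<mu>. \<forall>n. \<not> tau n \<le> infdist z E" unfolding AE_all_countable using small[OF tau_pos] by blast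
  then show ?thesis
  proof eventually_elim
    case (elim z)
    then have "infdist z E \<le> 0" by (intro LIMSEQ_le_const[OF tau_lim] exI[of _ 0]) (simp add: not_le less_imp_le)
    then have "infdist z E = 0" using infdist_nonneg[of z E] by simp
    then show ?case using in_closed_iff_infdist_zero[OF E] by simp
  qed
qed

lemma potentials_mass: "P \<in> potentials \<Longrightarrow> \<exists>\<mu>. mass \<mu> \<and> P = npot \<mu>" for P :: "real^'n \<Rightarrow> ennreal"
  unfolding potentials_def mass_def npot_def[abs_def] by blast

lemma no_atom:
  assumes m: "mass \<mu>" and z: "z \<in> S" "npot \<mu> z < \<infinity>"
  shows "AE y in \<mu>. y \<noteq> z"
proof -
  have "AE y in \<mu>. riesz_kernel z y \<noteq> \<infinity>"
    using nn_integral_PInf_AE[OF riesz_measurable[OF m]] z(2) by (simp add: npot_def)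
  then show ?thesis by eventually_elim (auto simp: riesz_kernel_diag)
qed

lemma cap_pos_eq: "cap_pos k \<xi> = {x \<in> S. cos \<xi> \<le> x \<bullet> axis k 1}" for k :: 'n
  using abs_inner_le_1[of _ "axis k 1"] by (force simp: cap_pos_def inner_axis abs_le_iff)

lemma cap_neg_eq: "cap_neg k \<xi> = {x \<in> S. x \<bullet> axis k 1 \<le> cos \<xi>}" for k :: 'n
  using abs_inner_le_1[of _ "axis k 1"] by (force simp: cap_neg_def inner_axis abs_le_iff)

lemma inner_eq_1: "x \<in> S \<Longrightarrow> y \<in> S \<Longrightarrow> 1 \<le> x \<bullet> y \<Longrightarrow> x = y"
  using inner_less_1[of x y] by force

lemma axis_S: "axis k 1 \<in> S" for k :: 'n
  by simp

lemma extremal_support: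
  assumes P: "extremal_potential k \<xi>1 \<xi>2 d M P" and m: "mass \<mu>" and eq: "P = npot \<mu>"
  shows "AE z in \<mu>. z \<in> cap_pos k \<xi>1 \<union> cap_neg k \<xi>2"
proof (rule harmonic_off_support[OF m])
  have "closed {x :: real^'n. cos \<xi>1 \<le> x \<bullet> axis k 1}" "closed {x :: real^'n. x \<bullet> axis k 1 \<le> cos \<xi>2}"
    by (intro closed_Collect_le continuous_intros)+
  then show "closed (cap_pos k \<xi>1 \<union> cap_neg k \<xi>2)"
    unfolding cap_pos_eq cap_neg_eq Collect_conj_eq Collect_mem_eq by (intro closed_Int closed_Un closed_sphere)
  have "axis k 1 \<in> cap_pos k \<xi>1" unfolding cap_pos_eq by (simp add: inner_axis_axis)
  then show "cap_pos k \<xi>1 \<union> cap_neg k \<xi>2 \<noteq> {}" by auto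
  show "harmonic_on (- (cap_pos k \<xi>1 \<union> cap_neg k \<xi>2)) (rpot \<mu>)"
    using P unfolding extremal_potential_def eq rpot_def[abs_def] by blast
qed

text \<open>Two points need an argument. \<open>M\<close> is finite because the cap for
  \<open>0 < \<xi>\<close> contains a neighbourhood of the pole in the sphere, while the potential
  is finite almost everywhere. The lower cap for the angle \<open>pi\<close> is a single point at
  which the potential is the finite number \<open>d\<close>, so the measure has no atom there and
  lives in the upper cap.\<close>

lemma extremal_pi:
  assumes P: "extremal_potential k \<xi> pi d M P" and \<xi>: "0 < \<xi>" "\<xi> < pi"
  obtains \<mu> c where "mass \<mu>" "0 \<le> c" "M = ennreal c" "AE z in \<mu>. cos \<xi> \<le> z \<bullet> axis k 1"
    "\<And>x. x \<in> S \<Longrightarrow> cos \<xi> \<le> x \<bullet> axis k 1 \<Longrightarrow> npot \<mu> x = ennreal c"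
    "\<And>x. x \<in> S \<Longrightarrow> npot \<mu> x \<le> ennreal c" "\<And>x. x \<in> S \<Longrightarrow> ennreal d \<le> npot \<mu> x"
proof -
  let ?e = "axis k 1 :: real^'n"
  obtain \<mu> where m: "mass \<mu>" and eq: "P = npot \<mu>" using potentials_mass P unfolding extremal_potential_def by blast
  have cap: "npot \<mu> x = M" if "x \<in> S" "cos \<xi> \<le> x \<bullet> ?e" for x
    using P that unfolding extremal_potential_def eq cap_pos_eq by blast
  have top: "npot \<mu> x \<le> M" for x using P unfolding extremal_potential_def eq by blast
  have low: "ennreal d \<le> npot \<mu> x" if "x \<in> S" for x using P that unfolding extremal_potential_def eq by auto
  have "cos \<xi> < ?e \<bullet> ?e" using cos_monotone_0_pi[of 0 \<xi>] \<xi> by (simp add: inner_axis_axis)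
  then have "?e \<in> {x. cos \<xi> < x \<bullet> ?e}" by simp
  moreover have "open {x. cos \<xi> < x \<bullet> ?e}" by (intro open_Collect_less continuous_intros)
  ultimately obtain r where r: "0 < r" "ball ?e r \<subseteq> {x. cos \<xi> < x \<bullet> ?e}" using open_contains_ball by blast
  obtain y where y: "y \<in> S" "dist ?e y < r" "npot \<mu> y < \<infinity>"
    by (rule AE_open_nonempty[OF npot_finite_AE[OF m] axis_S r(1)])
  have "cos \<xi> \<le> y \<bullet> ?e" using r(2) y(2) by force
  then have "M < \<infinity>" using cap[OF y(1)] y(3) by simp
  then obtain c where c: "0 \<le> c" "M = ennreal c" by (cases M) auto
  have meS: "- ?e \<in> S" by simp
  have "- ?e \<in> cap_neg k pi" unfolding cap_neg_eq by (simp add: inner_axis_axis)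
  then have "npot \<mu> (- ?e) = ennreal d" using P unfolding extremal_potential_def eq by blast
  then have "npot \<mu> (- ?e) < \<infinity>" by simp
  from no_atom[OF m meS this] extremal_support[OF P m eq]
  have "AE z in \<mu>. cos \<xi> \<le> z \<bullet> ?e"
  proof eventually_elim
    case (elim z)
    show ?case
    proof (cases "z \<in> cap_neg k pi")
      case True
      then have "z = - ?e" using inner_eq_1[of z "- ?e"] unfolding cap_neg_eq by simp
      then show ?thesis using elim by simp
    next
      case False
      then show ?thesis using elim unfolding cap_pos_eq by simp
    qed
  qed
  then show thesis using that m c cap top low by blast
qed

lemma extremal_inf_contact:
  assumes P: "extremal_potential_inf k d P" and d: "0 \<le> d"
  obtains \<mu> where "P = npot \<mu>" "contact_mass (axis k 1) d \<mu>"
proof -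
  obtain \<xi> where P: "extremal_potential k 0 \<xi> d \<infinity> P" using P unfolding extremal_potential_inf_def by blast
  obtain \<mu> where m: "mass \<mu>" and eq: "P = npot \<mu>" using potentials_mass P unfolding extremal_potential_def by blast
  have "AE z in \<mu>. z = axis k 1 \<or> npot \<mu> z = ennreal d"
    using extremal_support[OF P m eq]
  proof eventually_elim
    case (elim z)
    then show ?case
    proof
      assume "z \<in> cap_pos k 0"
      then show ?thesis using inner_eq_1[of z "axis k 1"] unfolding cap_pos_eq by simp
    next
      assume "z \<in> cap_neg k \<xi>"
      then show ?thesis using P unfolding extremal_potential_def eq by blast
    qed
  qed
  moreover have "ennreal d \<le> npot \<mu> x" if "x \<in> S" for x using P that unfolding extremal_potential_def eq by auto
  ultimately have "contact_mass (axis k 1) d \<mu>" using m d unfolding contact_mass_def by blast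
  then show thesis using that eq by blast
qed

end

subsection \<open>Integral means\<close>

text \<open>Any choice of subgradients is monotone, by adding the subgradient inequalities at two
  points; monotonicity of \<open>\<Phi>\<close> makes it nonnegative. Both properties are needed for
  the test functions of \<open>convex_mean_comparison\<close>.\<close>

lemma convex_subgradient:
  fixes \<Phi> :: "real \<Rightarrow> real"
  assumes c: "convex_on UNIV \<Phi>" and m: "mono \<Phi>"
  obtains \<psi> where "\<And>v y. \<Phi> v + \<psi> v * (y - v) \<le> \<Phi> y" "mono \<psi>" "\<And>v. 0 \<le> \<psi> v"
proof -
  define \<psi> where "\<psi> v = Inf ((\<lambda>t. (\<Phi> v - \<Phi> t) / (v - t)) ` ({v<..} \<inter> UNIV))" for v
  have s: "\<Phi> v + \<psi> v * (y - v) \<le> \<Phi> y" for v y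
    unfolding \<psi>_def by (rule convex_le_Inf_differential[OF c]) auto
  have "mono \<psi>"
  proof (rule monoI)
    fix v w :: real assume vw: "v \<le> w"
    have "\<psi> v * (w - v) \<le> \<psi> w * (w - v)" using s[of v w] s[of w v] by (simp add: algebra_simps)
    then show "\<psi> v \<le> \<psi> w" using vw by (cases "v = w") auto
  qed
  moreover have "0 \<le> \<psi> v" for v using s[of v "v - 1"] monoD[OF m, of "v - 1" v] by simp
  ultimately show thesis using that s by blast
qed

text \<open>Adding the lower bound \<open>L\<close> on a space of finite measure changes the
  integral by a finite amount, so comparisons can be made between integrals of nonnegative
  functions, where the value infinity is harmless.\<close>

lemma ext_integral_shift:
  assumes fin: "emeasure N (space N) < \<infinity>" and F: "F \<in> borel_measurable N" "\<And>x. x \<in> space N \<Longrightarrow> - L \<le> F x" and L: "0 \<le> L"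
    and f: "AE x in N. f x = ereal (F x)"
  shows "ext_integral N f + enn2ereal (ennreal L * emeasure N (space N)) = enn2ereal (\<integral>\<^sup>+x. ennreal (F x + L) \<partial>N)"
proof -
  note [measurable] = F(1)
  let ?P = "\<integral>\<^sup>+x. ennreal (F x) \<partial>N" and ?Q = "\<integral>\<^sup>+x. ennreal (- F x) \<partial>N" and ?A = "\<integral>\<^sup>+x. ennreal (F x + L) \<partial>N"
  have e: "e2ennreal (ereal u) = ennreal u" for u by (simp add: e2ennreal_ereal)
  have i: "ext_integral N f = enn2ereal ?P - enn2ereal ?Q"
  proof -
    have "(\<integral>\<^sup>+x. e2ennreal (f x) \<partial>N) = ?P" by (rule nn_integral_cong_AE) (use f in eventually_elim, simp add: e)
    moreover have "(\<integral>\<^sup>+x. e2ennreal (- f x) \<partial>N) = ?Q" by (rule nn_integral_cong_AE) (use f in eventually_elim, simp add: e)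
    ultimately show ?thesis by (simp add: ext_integral_def)
  qed
  have "?Q \<le> (\<integral>\<^sup>+x. ennreal L \<partial>N)" by (rule nn_integral_mono) (use F(2) in \<open>auto intro!: ennreal_leI simp: minus_le_iff\<close>)
  also have "\<dots> < \<infinity>" using fin by (simp add: ennreal_mult_less_top)
  finally have Q: "?Q < \<infinity>" .
  have "?A + ?Q = (\<integral>\<^sup>+x. ennreal (F x + L) + ennreal (- F x) \<partial>N)" by (simp add: nn_integral_add)
  also have "\<dots> = (\<integral>\<^sup>+x. ennreal (F x) + ennreal L \<partial>N)"
  proof (rule nn_integral_cong)
    fix x assume x: "x \<in> space N"
    show "ennreal (F x + L) + ennreal (- F x) = ennreal (F x) + ennreal L"
      using F(2)[OF x] L by (cases "0 \<le> F x") (simp_all add: ennreal_neg flip: ennreal_plus)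
  qed
  also have "\<dots> = ?P + ennreal L * emeasure N (space N)" by (simp add: nn_integral_add)
  finally have eq: "enn2ereal ?A + enn2ereal ?Q = enn2ereal ?P + enn2ereal (ennreal L * emeasure N (space N))"
    by (metis plus_ennreal.rep_eq)
  obtain q where q: "enn2ereal ?Q = ereal q" using Q by (cases ?Q) auto
  obtain l where l: "enn2ereal (ennreal L * emeasure N (space N)) = ereal l"
    using fin by (cases "ennreal L * emeasure N (space N)") (auto simp: ennreal_mult_eq_top_iff)
  show ?thesis
    using eq unfolding i q l by (cases "enn2ereal ?P"; cases "enn2ereal ?A") (auto simp: algebra_simps)
qed

lemma ext_integral_mono_shift:
  assumes fin: "emeasure N (space N) < \<infinity>" and L: "0 \<le> L"
    and F: "F \<in> borel_measurable N" "\<And>x. x \<in> space N \<Longrightarrow> - L \<le> F x" "AE x in N. f x = ereal (F x)"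
    and G: "G \<in> borel_measurable N" "\<And>x. x \<in> space N \<Longrightarrow> - L \<le> G x" "AE x in N. g x = ereal (G x)"
    and le: "(\<integral>\<^sup>+x. ennreal (F x + L) \<partial>N) \<le> (\<integral>\<^sup>+x. ennreal (G x + L) \<partial>N)"
  shows "ext_integral N f \<le> ext_integral N g"
proof -
  obtain l where l: "enn2ereal (ennreal L * emeasure N (space N)) = ereal l"
    using fin by (cases "ennreal L * emeasure N (space N)") (auto simp: ennreal_mult_eq_top_iff)
  have "ext_integral N f + ereal l \<le> ext_integral N g + ereal l"
    using ext_integral_shift[OF fin F(1,2) L F(3)] ext_integral_shift[OF fin G(1,2) L G(3)] le
    unfolding l by (simp add: less_eq_ennreal.rep_eq)
  then show ?thesis by (simp add: ereal_add_le_add_iff2)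
qed

context sphere_space
begin

text \<open>The subgradient inequality at \<open>c * F x\<close>, where \<open>F = f\<close> or \<open>F = R T f\<close>, reduces the comparison of
  the means to testing \<open>rpot \<mu>1 - f\<close> against a bounded nonnegative function increasing in \<open>x \<bullet> e\<close>.\<close>

lemma convex_mean_comparison:
  assumes e: "e \<in> S" and \<Phi>: "convex_on UNIV \<Phi>" "mono \<Phi>" and c: "0 < c" and L: "0 \<le> L" "- L \<le> \<Phi> 0"
    and f: "f \<in> borel_measurable \<sigma>" "\<And>x. x \<in> S \<Longrightarrow> \<bar>f x\<bar> \<le> M" "zdec e f"
    and h: "integrable \<sigma> h" "\<And>x. x \<in> S \<Longrightarrow> 0 \<le> h x"
    and cap: "\<And>s. (\<integral>x. (if s < x \<bullet> e then f x - h x else 0) \<partial>\<sigma>) \<le> 0"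
    and T: "0 \<le> T"
  defines "K \<equiv> \<lambda>g. if T = 0 then g else R T g"
  shows "ennreal (\<integral>x. \<Phi> (c * K f x) + L \<partial>\<sigma>) \<le> (\<integral>\<^sup>+x. ennreal (\<Phi> (c * K h x) + L) \<partial>\<sigma>)"
proof -
  obtain \<psi> where \<psi>: "\<And>v y. \<Phi> v + \<psi> v * (y - v) \<le> \<Phi> y" "mono \<psi>" "\<And>v. 0 \<le> \<psi> v" using convex_subgradient[OF \<Phi>] by blast
  have fi: "integrable \<sigma> f" by (rule integrable_bounded[OF f(1,2)])
  have Km [measurable]: "K g \<in> borel_measurable \<sigma>" if "g \<in> borel_measurable \<sigma>" for g
    using that R_measurable[OF that] by (simp add: K_def)
  have Kb: "\<bar>K f x\<bar> \<le> M" if "x \<in> S" for x using f(2)[OF that] R_abs_bound[OF _ that f(1,2), of T] T by (auto simp: K_def)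
  have Kz: "zdec e (K f)" using f(3) R_zdec[OF e _ fi f(3), of T] T by (auto simp: K_def)
  have K0: "0 \<le> K h x" if "x \<in> S" for x using h(2)[OF that] R_nonneg[OF _ that h(2), of T] T by (auto simp: K_def)
  define w where "w x = \<psi> (c * K f x)" for x
  define B where "B = \<psi> (c * M) + 1"
  have w: "0 \<le> w x" for x by (simp add: w_def \<psi>(3))
  have wB: "w x \<le> B" if "x \<in> S" for x
  proof -
    have "c * K f x \<le> c * M" using Kb[OF that] c by (intro mult_left_mono) auto
    then show ?thesis using monoD[OF \<psi>(2)] unfolding w_def B_def by fastforce
  qed
  have B: "0 < B" using \<psi>(3)[of "c * M"] by (simp add: B_def)
  have wa: "\<bar>w x\<bar> \<le> B" if "x \<in> S" for x using w wB[OF that] by simp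
  have wz: "zdec e w" unfolding zdec_def w_def
    using c by (auto intro!: monoD[OF \<psi>(2)] mult_left_mono zdecD[OF Kz])
  have wm: "w \<in> borel_measurable \<sigma>" by (rule zdec_measurable[OF e wz])
  have wi: "integrable \<sigma> w" by (rule integrable_bounded[OF wm wa])
  have gi: "integrable \<sigma> (\<lambda>x. f x - h x)" using fi h(1) by simp
  note prod = integrable_mult_bounded[OF _ wm wa]
  have wK: "integrable \<sigma> (\<lambda>x. w x * (K h x - K f x))" and test: "0 \<le> (\<integral>x. w x * (K h x - K f x) \<partial>\<sigma>)"
  proof -
    have "integrable \<sigma> (\<lambda>x. w x * (K h x - K f x)) \<and> (\<integral>x. w x * (f x - h x) \<partial>\<sigma>) \<le> B * 0 \<and> 0 \<le> (\<integral>x. w x * (K h x - K f x) \<partial>\<sigma>)" if "T = 0"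
    proof -
      have t: "(\<integral>x. w x * (f x - h x) \<partial>\<sigma>) \<le> B * 0" by (rule zdec_test[OF e gi wz B w wB cap])
      have "(\<integral>x. w x * (h x - f x) \<partial>\<sigma>) = - (\<integral>x. w x * (f x - h x) \<partial>\<sigma>)"
        by (subst integral_minus[symmetric]) (simp add: algebra_simps)
      then show ?thesis using t prod[of "\<lambda>x. h x - f x"] h(1) fi that by (simp add: K_def)
    qed
    moreover have "integrable \<sigma> (\<lambda>x. w x * (K h x - K f x)) \<and> 0 \<le> (\<integral>x. w x * (K h x - K f x) \<partial>\<sigma>)" if "T \<noteq> 0"
    proof -
      have T: "0 < T" using T that by simp
      note s1 = R_swap[OF T fi wm wa] and s2 = R_swap[OF T h(1) wm wa]
      have t: "(\<integral>x. R T w x * (f x - h x) \<partial>\<sigma>) \<le> B * 0"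
      proof (rule zdec_test[OF e gi R_zdec[OF e T wi wz] B _ _ cap])
        show "0 \<le> R T w x" "R T w x \<le> B" if "x \<in> S" for x
          using R_nonneg[OF T that, of w] w R_abs_bound[OF T that wm wa] by auto
      qed
      have "(\<integral>x. w x * (R T h x - R T f x) \<partial>\<sigma>) = (\<integral>x. R T w x * h x \<partial>\<sigma>) - (\<integral>x. R T w x * f x \<partial>\<sigma>)"
        unfolding right_diff_distrib using s1 s2 by simp
      also have "\<dots> = - (\<integral>x. R T w x * (f x - h x) \<partial>\<sigma>)"
        unfolding right_diff_distrib using s1 s2 by simp
      finally have "0 \<le> (\<integral>x. w x * (R T h x - R T f x) \<partial>\<sigma>)" using t by simp
      moreover have "integrable \<sigma> (\<lambda>x. w x * (R T h x - R T f x))" unfolding right_diff_distrib using s1 s2 by simp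
      ultimately show ?thesis using that by (simp add: K_def)
    qed
    ultimately show "integrable \<sigma> (\<lambda>x. w x * (K h x - K f x))" "0 \<le> (\<integral>x. w x * (K h x - K f x) \<partial>\<sigma>)" by blast+
  qed
  have \<Phi>c: "continuous_on UNIV \<Phi>" by (rule convex_isCont[OF \<Phi>(1)])
  have cb: "\<bar>c * K f x\<bar> \<le> c * M" if "x \<in> S" for x using Kb[OF that] c by (simp add: abs_mult)
  have i1: "integrable \<sigma> (\<lambda>x. \<Phi> (c * K f x))"
    by (rule integrable_cont_comp[OF \<Phi>c _ cb]) (use Km[OF f(1)] in measurable)
  \<comment> \<open>The integrable lower bound from the subgradient inequality. The mean of
    \<open>\<Phi> (c * K h x)\<close> may be infinite, so the comparison ends with a nonnegative
    integral, reached through the positive part of \<open>G\<close>.\<close>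
  define G where "G x = \<Phi> (c * K f x) + L + c * (w x * (K h x - K f x))" for x
  have Gi: "integrable \<sigma> G" unfolding G_def using i1 wK by simp
  have "(\<integral>x. \<Phi> (c * K f x) + L \<partial>\<sigma>) \<le> (\<integral>x. \<Phi> (c * K f x) + L \<partial>\<sigma>) + c * (\<integral>x. w x * (K h x - K f x) \<partial>\<sigma>)"
    using c test by simp
  also have "\<dots> = (\<integral>x. G x \<partial>\<sigma>)" unfolding G_def using i1 wK by simp
  also have "\<dots> \<le> (\<integral>x. max 0 (G x) \<partial>\<sigma>)" using Gi by (intro integral_mono) auto
  finally have "ennreal (\<integral>x. \<Phi> (c * K f x) + L \<partial>\<sigma>) \<le> ennreal (\<integral>x. max 0 (G x) \<partial>\<sigma>)" by (rule ennreal_leI)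
  also have "\<dots> = (\<integral>\<^sup>+x. ennreal (max 0 (G x)) \<partial>\<sigma>)"
    by (rule nn_integral_eq_integral[symmetric]) (use Gi in auto)
  also have "\<dots> \<le> (\<integral>\<^sup>+x. ennreal (\<Phi> (c * K h x) + L) \<partial>\<sigma>)"
  proof (rule nn_integral_mono, rule ennreal_leI)
    fix x assume "x \<in> space \<sigma>"
    then have x: "x \<in> S" by simp
    have "\<Phi> 0 \<le> \<Phi> (c * K h x)" by (rule monoD[OF \<Phi>(2)]) (use c K0[OF x] in simp)
    moreover have "\<Phi> (c * K f x) + c * (w x * (K h x - K f x)) \<le> \<Phi> (c * K h x)"
      using \<psi>(1)[of "c * K f x" "c * K h x"] by (simp add: w_def algebra_simps)
    ultimately show "max 0 (G x) \<le> \<Phi> (c * K h x) + L" using L by (simp add: G_def)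
  qed
  finally show ?thesis .
qed

theorem mean_comparison:
  fixes k :: 'n and p P_inf :: "real^'n \<Rightarrow> ennreal"
  assumes \<xi>: "0 < \<xi>" "\<xi> < pi" and cp: "corresponding_pair k \<xi> pi d M" and Pi: "extremal_potential_inf k d P_inf"
    and \<Phi>: "mono \<Phi>" "convex_on UNIV \<Phi>" and p: "p \<in> bounded_potentials d M" and r: "0 < r"
  shows "ext_integral \<sigma> (\<lambda>y. extend_top \<Phi> (p (r *\<^sub>R y))) \<le> ext_integral \<sigma> (\<lambda>y. extend_top \<Phi> (P_inf (r *\<^sub>R y)))"
proof -
  let ?e = "axis k 1 :: real^'n"
  have d0: "0 \<le> d" using cp order_trans[OF powr_ge_zero] unfolding corresponding_pair_def by blast
  obtain P where P: "extremal_potential k \<xi> pi d M P" using cp unfolding corresponding_pair_def by blast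
  obtain \<mu>0 C where m0: "mass \<mu>0" and C: "0 \<le> C" "M = ennreal C" and supp: "AE z in \<mu>0. cos \<xi> \<le> z \<bullet> ?e"
    and P0: "\<And>x. x \<in> S \<Longrightarrow> cos \<xi> \<le> x \<bullet> ?e \<Longrightarrow> npot \<mu>0 x = ennreal C"
    and top0: "\<And>x. x \<in> S \<Longrightarrow> npot \<mu>0 x \<le> ennreal C" and low0: "\<And>x. x \<in> S \<Longrightarrow> ennreal d \<le> npot \<mu>0 x"
    using extremal_pi[OF P \<xi>] by blast
  obtain \<mu>1 where Pi: "P_inf = npot \<mu>1" and c1: "contact_mass ?e d \<mu>1" using extremal_inf_contact[OF Pi d0] by blast
  have m1: "mass \<mu>1" using c1 by (simp add: contact_mass_def)
  obtain \<mu> where m: "mass \<mu>" and pe: "p = npot \<mu>" using potentials_mass p unfolding bounded_potentials_def by blast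
  have top: "npot \<mu> x \<le> ennreal C" for x using p unfolding bounded_potentials_def pe C by blast
  have e: "?e \<in> S" by (rule axis_S)
  have z0: "zonal ?e (rpot \<mu>0)" by (rule extremal_zonal[OF e m0 supp P0 top0 C(1)])
  note step2 = contact_cap_comparison[OF e c1 m0 z0 npot_ge_AE[OF m0 d0 low0]]
  \<comment> \<open>By \<open>npot_scaled\<close> the potential at \<open>r *\<^sub>R x\<close> is
    \<open>c * pot \<nu> T x\<close> for \<open>r \<noteq> 1\<close>; radii inside and outside the
    sphere are treated alike. The case \<open>T = 0\<close> is the sphere itself.\<close>
  define c where "c = r powr - a"
  define T where "T = \<bar>ln r\<bar>"
  define L where "L = \<bar>\<Phi> 0\<bar>"
  have c: "0 < c" and T: "0 \<le> T" and L: "0 \<le> L" "- L \<le> \<Phi> 0" using r by (auto simp: c_def T_def L_def)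
  have T0: "T = 0 \<longleftrightarrow> r = 1" using r by (simp add: T_def)
  define G where "G \<nu> x = (if T = 0 then rpot \<nu> x else pot \<nu> T x)" for \<nu> x
  have Gm [measurable]: "G \<nu> \<in> borel_measurable \<sigma>" if "mass \<nu>" for \<nu>
    using rpot_measurable[OF that] measurable_continuous_on_S[OF pot_continuous[OF that, of T]] T
    by (cases "T = 0") (auto simp: G_def[abs_def])
  have G0: "0 \<le> G \<nu> x" for \<nu> x by (simp add: G_def rpot_nonneg pot_nonneg)
  have ext: "AE x in \<sigma>. extend_top \<Phi> (npot \<nu> (r *\<^sub>R x)) = ereal (\<Phi> (c * G \<nu> x))" if n: "mass \<nu>" for \<nu>
    using npot_finite_AE[OF n] AE_space
  proof eventually_elim
    case (elim x)
    show ?case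
    proof (cases "r = 1")
      case True
      then have "c = 1" by (simp add: c_def)
      then show ?thesis using elim True T0 by (auto simp: extend_top_def G_def rpot_def)
    next
      case False
      have "npot \<nu> (r *\<^sub>R x) = ennreal (c * pot \<nu> T x)"
        using npot_scaled[OF n _ r False, of x] elim by (simp add: c_def T_def)
      then show ?thesis using False T0 c by (simp add: extend_top_def G_def pot_nonneg)
    qed
  qed
  have \<Phi>c: "continuous_on UNIV \<Phi>" by (rule convex_isCont[OF \<Phi>(2)])
  then have \<Phi>m [measurable]: "\<Phi> \<in> borel_measurable borel" by (rule borel_measurable_continuous_onI)
  have lo: "- L \<le> \<Phi> (c * v)" if "0 \<le> v" for v
    using monoD[OF \<Phi>(1), of 0 "c * v"] that c L by simp
  \<comment> \<open>A positive \<open>t\<close> makes the potential Lipschitz, so it has a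
    rearrangement \<open>f\<close>. The two cap comparisons add up to one between \<open>f\<close>
    and \<open>rpot \<mu>1\<close>, and \<open>R T\<close> carries the result to the radius in
    question.\<close>
  have approx: "(\<integral>\<^sup>+x. ennreal (\<Phi> (c * pot \<mu> (T + t) x) + L) \<partial>\<sigma>) \<le> (\<integral>\<^sup>+x. ennreal (\<Phi> (c * G \<mu>1 x) + L) \<partial>\<sigma>)" if t: "0 < t" for t
  proof -
    have tb: "pot \<mu> t x \<le> C" if "x \<in> S" for x
      using order_trans[OF pot_le_npot[OF m that t] top] C by (simp add: ennreal_le_iff)
    obtain N where N: "0 \<le> N" "\<And>x y. x \<in> S \<Longrightarrow> y \<in> S \<Longrightarrow> \<bar>pot \<mu> t x - pot \<mu> t y\<bar> \<le> N * norm (x - y)"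
      using pot_lipschitz[OF m t] by blast
    have lp: "lips N (pot \<mu> t)" using N by (simp add: lips_def)
    have tb': "\<bar>pot \<mu> t x\<bar> \<le> C" if "x \<in> S" for x using tb[OF that] pot_nonneg[of \<mu> t x] by simp
    obtain f where f: "lips N f" "\<And>x. x \<in> S \<Longrightarrow> \<bar>f x\<bar> \<le> C" "zdec ?e f" "dominates (pot \<mu> t) f"
      using rearrangement_exists[OF e lp N(1) tb'] by blast
    have fc: "continuous_on S f" by (rule lips_continuous[OF f(1)])
    note fm = measurable_continuous_on_S[OF fc]
    have fi: "integrable \<sigma> f" by (rule integrable_continuous_on_S[OF fc])
    have cap: "(\<integral>x. (if s < x \<bullet> ?e then f x - rpot \<mu>1 x else 0) \<partial>\<sigma>) \<le> 0" for s
    proof -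
      have i1: "integrable \<sigma> (\<lambda>x. if s < x \<bullet> ?e then f x - rpot \<mu>0 x else 0)"
        using fi rpot_integrable[OF m0] by (intro integrable_if) simp_all
      have i2: "integrable \<sigma> (\<lambda>x. if s < x \<bullet> ?e then rpot \<mu>1 x - rpot \<mu>0 x else 0)"
        using rpot_integrable[OF m1] rpot_integrable[OF m0] by (intro integrable_if) simp_all
      have "(\<integral>x. (if s < x \<bullet> ?e then f x - rpot \<mu>1 x else 0) \<partial>\<sigma>)
        = (\<integral>x. (if s < x \<bullet> ?e then f x - rpot \<mu>0 x else 0) - (if s < x \<bullet> ?e then rpot \<mu>1 x - rpot \<mu>0 x else 0) \<partial>\<sigma>)"
        by (rule Bochner_Integration.integral_cong) auto
      also have "\<dots> = (\<integral>x. (if s < x \<bullet> ?e then f x - rpot \<mu>0 x else 0) \<partial>\<sigma>) - (\<integral>x. (if s < x \<bullet> ?e then rpot \<mu>1 x - rpot \<mu>0 x else 0) \<partial>\<sigma>)"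
        by (rule Bochner_Integration.integral_diff[OF i1 i2])
      also have "\<dots> \<le> 0" using cap_comparison[OF m t e fc f(2-4) tb m0 supp P0, of s] step2[of s] by simp
      finally show ?thesis .
    qed
    define K where "K g = (if T = 0 then g else R T g)" for g
    have Kp: "K (pot \<mu> t) x = pot \<mu> (T + t) x" if "x \<in> S" for x
      using R_pot[OF m _ t that, of T] T by (auto simp: K_def)
    have Kh: "K (rpot \<mu>1) x = G \<mu>1 x" if "x \<in> S" for x
      using R_rpot[OF m1 _ that, of T] T by (auto simp: K_def G_def)
    \<comment> \<open>\<open>dominates\<close> compares convex means of \<open>R T f\<close> itself;
      the factor \<open>c\<close> is absorbed into the convex function.\<close>
    have \<Phi>c': "convex_on UNIV (\<lambda>v. \<Phi> (c * v))"
    proof (rule convex_onI)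
      fix s x y :: real assume "0 < s" "s < 1"
      then show "\<Phi> (c * ((1 - s) *\<^sub>R x + s *\<^sub>R y)) \<le> (1 - s) * \<Phi> (c * x) + s * \<Phi> (c * y)"
        using convex_onD[OF \<Phi>(2), of s "c * x" "c * y"] by (simp add: algebra_simps)
    qed simp
    have dom: "(\<integral>x. \<Phi> (c * pot \<mu> (T + t) x) \<partial>\<sigma>) \<le> (\<integral>x. \<Phi> (c * K f x) \<partial>\<sigma>)"
    proof (cases "T = 0")
      case True
      have "(\<integral>x. \<Phi> (c * f x) \<partial>\<sigma>) = (\<integral>x. \<Phi> (c * pot \<mu> t x) \<partial>\<sigma>)"
        by (rule dominatesD1[OF f(4), where h = "\<lambda>v. \<Phi> (c * v)"])
           (intro continuous_on_compose2[OF \<Phi>c] continuous_intros, auto)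
      then show ?thesis using True by (simp add: K_def)
    next
      case False
      then have "(\<integral>x. \<Phi> (c * R T (pot \<mu> t) x) \<partial>\<sigma>) \<le> (\<integral>x. \<Phi> (c * R T f x) \<partial>\<sigma>)"
        using dominatesD2[OF f(4) _ \<Phi>c', of T] T by simp
      moreover have "(\<integral>x. \<Phi> (c * R T (pot \<mu> t) x) \<partial>\<sigma>) = (\<integral>x. \<Phi> (c * pot \<mu> (T + t) x) \<partial>\<sigma>)"
        by (rule Bochner_Integration.integral_cong) (use Kp False in \<open>auto simp: K_def\<close>)
      ultimately show ?thesis using False by (simp add: K_def)
    qed
    have pm: "pot \<mu> (T + t) \<in> borel_measurable \<sigma>"
      using measurable_continuous_on_S[OF pot_continuous[OF m, of "T + t"]] T t by simp
    have pb: "\<bar>pot \<mu> (T + t) x\<bar> \<le> C" if "x \<in> S" for x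
      using pot_antimono[OF m t, of "T + t" x] tb[OF that] pot_nonneg[of \<mu> "T + t" x] T that by simp
    have Kfb: "\<bar>K f x\<bar> \<le> C" if "x \<in> S" for x using f(2)[OF that] R_abs_bound[OF _ that fm f(2), of T] T by (auto simp: K_def)
    have Kfm: "K f \<in> borel_measurable \<sigma>" using fm R_measurable[OF fm] by (simp add: K_def)
    have ic: "integrable \<sigma> (\<lambda>x. \<Phi> (c * g x))" if g: "g \<in> borel_measurable \<sigma>" "\<And>x. x \<in> S \<Longrightarrow> \<bar>g x\<bar> \<le> C" for g
      by (rule integrable_cont_comp[OF _ g]) (intro continuous_on_compose2[OF \<Phi>c] continuous_intros, auto)
    have nn: "AE x in \<sigma>. 0 \<le> \<Phi> (c * pot \<mu> (T + t) x) + L"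
    proof (rule AE_I2)
      show "0 \<le> \<Phi> (c * pot \<mu> (T + t) x) + L" for x using lo[OF pot_nonneg[of \<mu> "T + t" x]] by simp
    qed
    have "(\<integral>\<^sup>+x. ennreal (\<Phi> (c * pot \<mu> (T + t) x) + L) \<partial>\<sigma>) = ennreal (\<integral>x. \<Phi> (c * pot \<mu> (T + t) x) + L \<partial>\<sigma>)"
      by (rule nn_integral_eq_integral[OF _ nn]) (use ic[OF pm pb] in simp)
    also have "\<dots> \<le> ennreal (\<integral>x. \<Phi> (c * K f x) + L \<partial>\<sigma>)"
      using dom ic[OF pm pb] ic[OF Kfm Kfb] by (intro ennreal_leI) simp
    also have "\<dots> \<le> (\<integral>\<^sup>+x. ennreal (\<Phi> (c * K (rpot \<mu>1) x) + L) \<partial>\<sigma>)"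
      unfolding K_def
      by (rule convex_mean_comparison[OF e \<Phi>(2,1) c L fm f(2,3) rpot_integrable[OF m1] rpot_nonneg cap T])
    also have "\<dots> = (\<integral>\<^sup>+x. ennreal (\<Phi> (c * G \<mu>1 x) + L) \<partial>\<sigma>)"
      by (rule nn_integral_cong) (use Kh in simp)
    finally show ?thesis .
  qed
  \<comment> \<open>The right side of \<open>approx\<close> does not depend on \<open>t\<close>, so
    Fatou's lemma along \<open>tau n\<close> completes the limit; at \<open>r = 1\<close> the bound
    by \<open>M\<close> ensures convergence to a finite value at every point.\<close>
  have le: "(\<integral>\<^sup>+x. ennreal (\<Phi> (c * G \<mu> x) + L) \<partial>\<sigma>) \<le> (\<integral>\<^sup>+x. ennreal (\<Phi> (c * G \<mu>1 x) + L) \<partial>\<sigma>)"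
  proof -
    have lim: "(\<lambda>n. pot \<mu> (T + tau n) x) \<longlonglongrightarrow> G \<mu> x" if x: "x \<in> S" for x
    proof (cases "T = 0")
      case True
      have "npot \<mu> x = ennreal (rpot \<mu> x)"
        using le_less_trans[OF top ennreal_less_top, of x] by (simp add: rpot_ennreal)
      then show ?thesis
        using tendsto_enn2real[of "\<lambda>n. ennreal (pot \<mu> (tau n) x)" "rpot \<mu> x"] npot_lim(1)[OF m x] True
        by (simp add: G_def rpot_nonneg pot_nonneg)
    next
      case False
      then show ?thesis using pot_tau_lim[OF m x, of T] T by (simp add: G_def)
    qed
    have "(\<integral>\<^sup>+x. ennreal (\<Phi> (c * G \<mu> x) + L) \<partial>\<sigma>) = (\<integral>\<^sup>+x. liminf (\<lambda>n. ennreal (\<Phi> (c * pot \<mu> (T + tau n) x) + L)) \<partial>\<sigma>)"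
    proof (rule nn_integral_cong)
      fix x assume "x \<in> space \<sigma>"
      then have x: "x \<in> S" by simp
      have "isCont \<Phi> (c * G \<mu> x)" using \<Phi>c by (simp add: continuous_on_eq_continuous_at)
      then have "(\<lambda>n. \<Phi> (c * pot \<mu> (T + tau n) x)) \<longlonglongrightarrow> \<Phi> (c * G \<mu> x)"
        by (rule isCont_tendsto_compose) (intro tendsto_intros lim x)
      then have "(\<lambda>n. ennreal (\<Phi> (c * pot \<mu> (T + tau n) x) + L)) \<longlonglongrightarrow> ennreal (\<Phi> (c * G \<mu> x) + L)"
        by (intro tendsto_intros tendsto_ennrealI)
      then show "ennreal (\<Phi> (c * G \<mu> x) + L) = liminf (\<lambda>n. ennreal (\<Phi> (c * pot \<mu> (T + tau n) x) + L))"
        by (intro lim_imp_Liminf[symmetric]) auto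
    qed
    also have "\<dots> \<le> liminf (\<lambda>n. \<integral>\<^sup>+x. ennreal (\<Phi> (c * pot \<mu> (T + tau n) x) + L) \<partial>\<sigma>)"
    proof (rule nn_integral_liminf)
      fix n
      have "pot \<mu> (T + tau n) \<in> borel_measurable \<sigma>"
        using measurable_continuous_on_S[OF pot_continuous[OF m, of "T + tau n"]] T tau_pos[of n] by simp
      then show "(\<lambda>x. ennreal (\<Phi> (c * pot \<mu> (T + tau n) x) + L)) \<in> borel_measurable \<sigma>" by measurable
    qed
    also have "\<dots> \<le> liminf (\<lambda>n. \<integral>\<^sup>+x. ennreal (\<Phi> (c * G \<mu>1 x) + L) \<partial>\<sigma>)"
      by (intro Liminf_mono always_eventually allI approx tau_pos)
    also have "\<dots> = (\<integral>\<^sup>+x. ennreal (\<Phi> (c * G \<mu>1 x) + L) \<partial>\<sigma>)" by (simp add: Liminf_const)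
    finally show ?thesis .
  qed
  show ?thesis
    unfolding pe Pi
  proof (rule ext_integral_mono_shift[OF _ L(1) _ _ ext[OF m] _ _ ext[OF m1] le])
    show "emeasure \<sigma> (space \<sigma>) < \<infinity>" using fin_\<sigma> by simp
    show "(\<lambda>x. \<Phi> (c * G \<mu> x)) \<in> borel_measurable \<sigma>" using Gm[OF m] by measurable
    show "(\<lambda>x. \<Phi> (c * G \<mu>1 x)) \<in> borel_measurable \<sigma>" using Gm[OF m1] by measurable
  qed (rule lo[OF G0])+
qed

end

theorem theorem1p2:
  fixes k :: "'n::finite"
    and \<xi>\<^sub>1 d r :: real
    and M :: ennreal
    and \<Phi> :: "real \<Rightarrow> real"
    and p P_inf :: "real^'n \<Rightarrow> ennreal"
  assumes "CARD('n) \<ge> 3"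
    and "0 < \<xi>\<^sub>1" and "\<xi>\<^sub>1 < pi"
    and "corresponding_pair k \<xi>\<^sub>1 pi d M"
    and "extremal_potential_inf k d P_inf"
    and "mono \<Phi>" and "convex_on UNIV \<Phi>"
    and "p \<in> bounded_potentials d M"
    and "0 < r"
  shows "ext_integral sphere_measure (\<lambda>y. extend_top \<Phi> (p (r *\<^sub>R y)))
       \<le> ext_integral sphere_measure (\<lambda>y. extend_top \<Phi> (P_inf (r *\<^sub>R y)))"
proof -
  let ?\<sigma> = "sphere_measure :: (real^'n) measure"
  have "2 \<le> CARD('n)" using assms(1) by simp
  then consider "emeasure ?\<sigma> (sphere 0 1) = 0" | "emeasure ?\<sigma> (sphere 0 1) \<noteq> 0" "emeasure ?\<sigma> (sphere 0 1) < \<infinity>"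
      "\<And>T :: real^'n \<Rightarrow> real^'n. orthogonal_transformation T \<Longrightarrow> distr ?\<sigma> ?\<sigma> T = ?\<sigma>"
    using sphere_measure_cases[where 'n = 'n] by blast
  then show ?thesis
  proof cases
    \<comment> \<open>With a null measure all four integrals in the two sides are 0.\<close>
    case 1
    have "(\<integral>\<^sup>+x. f x \<partial>?\<sigma>) = 0" for f
    proof -
      have "sphere 0 1 \<in> null_sets ?\<sigma>"
        using 1 sets.top[of ?\<sigma>] by (intro null_setsI) simp_all
      then have "AE x in ?\<sigma>. f x = 0" by (rule AE_I') (metis (lifting) mem_Collect_eq space_sphere_measure subsetI)
      then have "(\<integral>\<^sup>+x. f x \<partial>?\<sigma>) = (\<integral>\<^sup>+x. 0 \<partial>?\<sigma>)" by (rule nn_integral_cong_AE)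
      then show ?thesis by simp
    qed
    then show ?thesis by (simp add: ext_integral_def)
  next
    case 2
    interpret sphere_space ?\<sigma> by (rule sphere_space.intro[OF assms(1) sets_sphere_measure 2(2,1,3)])
    show ?thesis by (rule mean_comparison[OF assms(2-9)])
  qed
qed

end
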